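(* Suppose that $d_N\log N\to 0$ as $N\to\infty$. Then, for all $x\in S_\star$: (i) The average time to move the condensate from $x$ to another site of $S_\star$ satisfies $$\mathbb{E}_{\mathcal{E}_N^x}\big(\tau_{\mathcal{E}_N(S_\star\setminus\{x\})}\big)=\frac{1}{\sum_{y\in S_\star,\,y\neq x} r(x,y)}\,\frac{1}{d_N}\,(1+o(1))\qquad (N\to\infty),$$ that is, $\lim_{N\to\infty} d_N\,\mathbb{E}_{\mathcal{E}_N^x}\big(\tau_{\mathcal{E}_N(S_\star\setminus\{x\})}\big)=\big(\sum_{y\in S_\star,\,y\neq x} r(x,y)\big)^{-1}$, with the convention $1/0=+\infty$. (ii) Assume that $X_N(0)=x$. Then the speeded-up process $\{X_N(t/d_N),\ t\ge 0\}$ converges weakly, as $N\to\infty$, on the path space $D(\mathbb{R}_+,S_\star)$ (with the Skorokhod topology) to the Markov process $\{X(t),\ t\ge 0\}$ on $S_\star$ with $X(0)=x$ and generator $$\mathcal{L}f(y)=\sum_{z\in S_\star} r(y,z)\,[f(z)-f(y)].$$ Furthermore, the system spends negligible time outside the metastable states, i.e. for all $T>0$, $$\lim_{N\to\infty}\mathbb{E}_{\mathcal{E}_N^x}\Big[\int_0^T \mathbf{1}_{\{\eta(s/d_N)\in\Delta\}}\,ds\Big]=0.$$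
   Context: Random walk. $S$ is a finite set, $r:S\times S\to[0,\infty)$ are the jump rates of a continuous-time irreducible random walk on $S$, with $r(x,x)=0$, reversible with respect to a probability measure $m$ on $S$: $m(x)r(x,y)=m(y)r(y,x)$ for all $x,y\in S$. Let $M_\star=\max_{x\in S}m(x)$ and $S_\star=\{x\in S: m(x)=M_\star\}$. Inclusion process. $(d_N)_{N\ge1}$ is a sequence of positive numbers. For $N\ge1$ let $E_N=\{\eta\in\mathbb{N}^S:\sum_{x\in S}\eta_x=N\}$ (with $0\in\mathbb N$). For $\eta\in E_N$ with $\eta_x>0$ and $x\neq y$, $\eta^{x,y}$ is the configuration obtained from $\eta$ by moving one particle from $x$ to $y$. The reversible inclusion process $\{\eta(t):t\ge0\}$ is the continuous-time Markov process on $E_N$ with generator $$(L_NF)(\eta)=\sum_{x,y\in S}\eta_x(d_N+\eta_y)\,r(x,y)\,[F(\eta^{x,y})-F(\eta)],\qquad F:E_N\to\mathbb{R}.$$ Metastable sets. For $x\in S_\star$, $\mathcal{E}_N^x=\{\eta\in E_N:\eta_x=N\}$ (a singleton); for $S_0\subseteq S_\star$, $\mathcal{E}_N(S_0)=\bigcup_{x\in S_0}\mathcal{E}_N^x$; $\mathcal{E}_N^\star=\mathcal{E}_N(S_\star)$ and $\Delta=E_N\setminus\mathcal{E}_N(S_\star)$. For $A\subseteq E_N$, $\tau_A=\inf\{t\ge0:\eta(t)\in A\}$ (with $\inf\emptyset=+\infty$). $\mathbb{E}_{\eta}$ is expectation for the process started at $\eta$; $\mathbb{E}_{\mathcal{E}_N^x}$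 means started at the unique configuration in $\mathcal{E}_N^x$. Trace process. Let $\ell(t)=\int_0^t\mathbf{1}_{\{\eta(s)\in\mathcal{E}_N^\star\}}ds$, $S(t)=\sup\{s\ge0:\ell(s)\le t\}$, and $\eta^{\mathcal{E}_N^\star}(t)=\eta(S(t))$. Define $\psi_N:\mathcal{E}_N^\star\to S_\star$ by $\psi_N(\eta)=x$ if $\eta\in\mathcal{E}_N^x$, and $X_N(t)=\psi_N(\eta^{\mathcal{E}_N^\star}(t))$. *)

theory Defs
  imports "HOL-Probability.Probability"
begin

text \<open>
  The finite set \<open>S\<close> of sites is a type \<open>'s\<close> of class \<^class>\<open>finite\<close>. A function of time is a
  function on \<^typ>\<open>real\<close>, only its values on \<open>{0..}\<close> matter.
\<close>

section \<open>Markov processes on a finite state space\<close>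

text \<open>Right-continuity and left limits with respect to the discrete topology on \<open>E\<close>; the first
  conjunct also says that the path stays in \<open>E\<close>.\<close>

definition cadlag :: "'a set \<Rightarrow> (real \<Rightarrow> 'a) \<Rightarrow> bool" where
  "cadlag E w \<longleftrightarrow>
     (\<forall>t\<ge>0. limitin (discrete_topology E) w (w t) (at_right t)) \<and>
     (\<forall>t>0. \<exists>l. limitin (discrete_topology E) w l (at_left t))"

text \<open>The semigroup \<open>exp (t L)\<close> of a generator \<open>L\<close> acting on functions of the state. The exponential
  series converges because the generators below only involve finitely many states.\<close>

definition semigroup_of ::
    "(('a \<Rightarrow> real) \<Rightarrow> 'a \<Rightarrow> real) \<Rightarrow> real \<Rightarrow> ('a \<Rightarrow> real) \<Rightarrow> 'a \<Rightarrow> real" where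
  "semigroup_of L t f x = (\<Sum>n. t ^ n / fact n * (L ^^ n) f x)"

text \<open>A Markov process with cadlag paths in \<open>E\<close>, generator \<open>L\<close> and arbitrary initial law. The last
  conjunct is the Markov property
  \<open>P (X (t (n+1)) = a (n+1) | X (t 0) = a 0, \<dots>, X (t n) = a n) = (exp ((t (n+1) - t n) L) 1{a (n+1)}) (a n)\<close>,
  multiplied by the probability of the conditioning event so as to cover null events.\<close>

definition markov_process ::
    "'a set \<Rightarrow> (('a \<Rightarrow> real) \<Rightarrow> 'a \<Rightarrow> real) \<Rightarrow> 'w measure \<Rightarrow> (real \<Rightarrow> 'w \<Rightarrow> 'a) \<Rightarrow> bool" where
  "markov_process E L P X \<longleftrightarrow>
     prob_space P \<and>
     (\<forall>t\<ge>0. X t \<in> measurable P (count_space E)) \<and>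
     (\<forall>\<omega>\<in>space P. cadlag E (\<lambda>t. X t \<omega>)) \<and>
     (\<forall>n t a. 0 \<le> t 0 \<and> mono_on {..Suc n} t \<and> (\<forall>k\<le>Suc n. a k \<in> E) \<longrightarrow>
        measure P {\<omega>\<in>space P. \<forall>k\<le>Suc n. X (t k) \<omega> = a k} =
        measure P {\<omega>\<in>space P. \<forall>k\<le>n. X (t k) \<omega> = a k} *
          semigroup_of L (t (Suc n) - t n) (indicator {a (Suc n)}) (a n))"

definition hitting_time :: "'a set \<Rightarrow> (real \<Rightarrow> 'a) \<Rightarrow> ennreal" where
  "hitting_time A w = (INF t\<in>{t. 0 \<le> t \<and> w t \<in> A}. ennreal t)"

definition occupation_time :: "'a set \<Rightarrow> (real \<Rightarrow> 'a) \<Rightarrow> real \<Rightarrow> real" where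
  "occupation_time A w t = (LINT s:{0..t}|lborel. indicator A (w s))"

text \<open>The supremum is meaningful when the total time spent in \<open>A\<close> is infinite; otherwise the value
  is unspecified for large \<open>t\<close>.\<close>

definition trace_path :: "'a set \<Rightarrow> (real \<Rightarrow> 'a) \<Rightarrow> real \<Rightarrow> 'a" where
  "trace_path A w t = w (Sup {s. 0 \<le> s \<and> occupation_time A w s \<le> t})"


section \<open>The inclusion process\<close>

definition Mstar :: "'s::finite pmf \<Rightarrow> real" where
  "Mstar m = Max (range (pmf m))"

definition Sstar :: "'s::finite pmf \<Rightarrow> 's set" where
  "Sstar m = {x. pmf m x = Mstar m}"

definition configs :: "nat \<Rightarrow> ('s::finite \<Rightarrow> nat) set" where
  "configs N = {\<eta>. (\<Sum>x\<in>UNIV. \<eta> x) = N}"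

text \<open>Only relevant for \<open>x \<noteq> y\<close> and \<open>\<eta> x > 0\<close>: in the other cases the jump rate vanishes.\<close>

definition move :: "'s \<Rightarrow> 's \<Rightarrow> ('s \<Rightarrow> nat) \<Rightarrow> 's \<Rightarrow> nat" where
  "move x y \<eta> = \<eta>(x := \<eta> x - 1, y := \<eta> y + 1)"

definition inclusion_generator ::
    "('s::finite \<Rightarrow> 's \<Rightarrow> real) \<Rightarrow> real \<Rightarrow> (('s \<Rightarrow> nat) \<Rightarrow> real) \<Rightarrow> ('s \<Rightarrow> nat) \<Rightarrow> real" where
  "inclusion_generator r d F \<eta> =
     (\<Sum>x\<in>UNIV. \<Sum>y\<in>UNIV. real (\<eta> x) * (d + real (\<eta> y)) * r x y * (F (move x y \<eta>) - F \<eta>))"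

definition condensate :: "nat \<Rightarrow> 's::finite \<Rightarrow> ('s \<Rightarrow> nat) set" where
  "condensate N x = {\<eta> \<in> configs N. \<eta> x = N}"

definition condensates :: "nat \<Rightarrow> 's::finite set \<Rightarrow> ('s \<Rightarrow> nat) set" where
  "condensates N S0 = (\<Union>x\<in>S0. condensate N x)"

definition condensate_site :: "'s::finite pmf \<Rightarrow> nat \<Rightarrow> ('s \<Rightarrow> nat) \<Rightarrow> 's" where
  "condensate_site m N \<eta> = (THE x. x \<in> Sstar m \<and> \<eta> \<in> condensate N x)"

definition condensate_path :: "'s::finite pmf \<Rightarrow> nat \<Rightarrow> (real \<Rightarrow> 's \<Rightarrow> nat) \<Rightarrow> real \<Rightarrow> 's" where
  "condensate_path m N w t = condensate_site m N (trace_path (condensates N (Sstar m)) w t)"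

definition limit_generator ::
    "('s::finite \<Rightarrow> 's \<Rightarrow> real) \<Rightarrow> 's set \<Rightarrow> ('s \<Rightarrow> real) \<Rightarrow> 's \<Rightarrow> real" where
  "limit_generator r S0 f y = (\<Sum>z\<in>S0. r y z * (f z - f y))"


section \<open>Weak convergence on the Skorokhod space\<close>

text \<open>\<open>D(\<real>\<^sub>+, E)\<close>. Paths are functions on \<open>{0..}\<close>, hence extensional.\<close>

definition path_space :: "'a set \<Rightarrow> (real \<Rightarrow> 'a) set" where
  "path_space E = {w \<in> extensional {0..}. cadlag E w}"

definition time_changes :: "(real \<Rightarrow> real) set" where
  "time_changes = {\<phi>. bij_betw \<phi> {0..} {0..} \<and> strict_mono_on {0..} \<phi>}"

text \<open>Convergence of a sequence of paths in the Skorokhod (J1) topology. Uniform convergence on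
  \<open>{0..T}\<close> of \<open>v n \<circ> \<phi> n\<close> to \<open>w\<close> for the discrete metric on \<open>E\<close> means that the two functions
  eventually agree on \<open>{0..T}\<close>.\<close>

definition skorokhod_converges :: "(nat \<Rightarrow> real \<Rightarrow> 'a) \<Rightarrow> (real \<Rightarrow> 'a) \<Rightarrow> bool" where
  "skorokhod_converges v w \<longleftrightarrow>
     (\<exists>\<phi>. (\<forall>n. \<phi> n \<in> time_changes) \<and>
          uniform_limit {0..} \<phi> (\<lambda>t. t) sequentially \<and>
          (\<forall>T\<ge>0. \<forall>\<^sub>F n in sequentially. \<forall>t\<in>{0..T}. v n (\<phi> n t) = w t))"

text \<open>The Skorokhod topology is metrizable, so it is determined by its convergent sequences: a set is
  open iff it is sequentially open.\<close>

definition skorokhod_open :: "'a set \<Rightarrow> (real \<Rightarrow> 'a) set \<Rightarrow> bool" where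
  "skorokhod_open E U \<longleftrightarrow> U \<subseteq> path_space E \<and>
     (\<forall>v w. range v \<subseteq> path_space E \<and> w \<in> U \<and> skorokhod_converges v w \<longrightarrow>
        (\<forall>\<^sub>F n in sequentially. v n \<in> U))"

definition skorokhod_topology :: "'a set \<Rightarrow> (real \<Rightarrow> 'a) topology" where
  "skorokhod_topology E = topology (skorokhod_open E)"

lemma istopology_skorokhod: "istopology (skorokhod_open E)"
  unfolding istopology_def
proof (intro conjI allI impI)
  fix U V assume "skorokhod_open E U" "skorokhod_open E V"
  then show "skorokhod_open E (U \<inter> V)"
    unfolding skorokhod_open_def Int_iff eventually_conj_iff by blast
next
  fix K assume K: "\<forall>U\<in>K. skorokhod_open E U"
  show "skorokhod_open E (\<Union>K)"
    unfolding skorokhod_open_def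
  proof (intro conjI allI impI)
    show "\<Union>K \<subseteq> path_space E" using K by (auto simp: skorokhod_open_def)
  next
    fix v w assume h: "range v \<subseteq> path_space E \<and> w \<in> \<Union>K \<and> skorokhod_converges v w"
    then obtain U where U: "U \<in> K" "w \<in> U" by blast
    with K h have "\<forall>\<^sub>F n in sequentially. v n \<in> U"
      unfolding skorokhod_open_def by blast
    then show "\<forall>\<^sub>F n in sequentially. v n \<in> \<Union>K"
      by eventually_elim (use U in blast)
  qed
qed

lemma openin_skorokhod: "openin (skorokhod_topology E) U \<longleftrightarrow> skorokhod_open E U"
  by (simp add: skorokhod_topology_def istopology_skorokhod topology_inverse')

lemma topspace_skorokhod: "topspace (skorokhod_topology E) = path_space E"
proof -
  have "skorokhod_open E (path_space E)"
    unfolding skorokhod_open_def by (auto intro!: always_eventually)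
  then show ?thesis
    unfolding topspace_def openin_skorokhod by (auto simp: skorokhod_open_def)
qed

text \<open>Weak convergence of the laws of \<open>Y n\<close> (under \<open>P n\<close>) to the law of \<open>Z\<close> (under \<open>Q\<close>). The random
  elements need only be almost surely in the space: the completions make the integrals insensitive
  to the values on null events.\<close>

definition weakly_converges ::
    "'b topology \<Rightarrow> (nat \<Rightarrow> 'w measure) \<Rightarrow> (nat \<Rightarrow> 'w \<Rightarrow> 'b) \<Rightarrow> 'v measure \<Rightarrow> ('v \<Rightarrow> 'b) \<Rightarrow> bool" where
  "weakly_converges T P Y Q Z \<longleftrightarrow>
     (\<forall>\<^sub>F n in sequentially. AE \<omega> in P n. Y n \<omega> \<in> topspace T) \<and>
     (AE \<omega> in Q. Z \<omega> \<in> topspace T) \<and>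
     (\<forall>f. continuous_map T euclideanreal f \<and> bounded (f ` topspace T) \<longrightarrow>
        (\<lambda>n. \<integral>\<omega>. f (Y n \<omega>) \<partial>completion (P n)) \<longlonglongrightarrow> (\<integral>\<omega>. f (Z \<omega>) \<partial>completion Q))"

end

theory Submission
  imports Defs
begin

text \<open>
  Let \<open>h\<^sub>z\<close> be the function that is 1 on the condensate at \<open>z\<close>, 0 on the other condensates of
  \<open>S\<^sub>\<star>\<close> and harmonic elsewhere. The trace process jumps from \<open>y\<close> to \<open>z\<close> at rate \<open>(L h\<^sub>z)(y)\<close>, and the mean
  hitting time times the exit rate is one plus the weighted sum of \<open>h\<^sub>x\<close> outside the condensates. By
  symmetry of \<open>L\<close> the rates can be computed with an explicit function instead of \<open>h\<^sub>y\<close>, namely the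
  proportion at \<open>y\<close> of the particles on \<open>S\<^sub>\<star>\<close>: it gives exactly \<open>d r y z\<close> plus an error supported outside
  the condensates. There the reversible weights are of order \<open>d log N\<close> relative to the condensates,
  except that the generator is larger where sites outside \<open>S\<^sub>\<star>\<close> are occupied; this is compensated by the
  geometric factor \<open>m(x) / M\<^sub>\<star> < 1\<close>. Neither capacities nor a construction of the process by exponential
  clocks are needed: the process is observed on a grid of mesh tending to 0, and the law of the list of
  its visits to the condensates is compared with that of the limit chain by replacing one step at a time.
\<close>

section \<open>Cadlag paths in a discrete space\<close>

text \<open>The share is normalised by the particles on \<open>S0\<close>, not by \<open>N\<close>.
  With one particle at a site \<open>u\<close> outside \<open>S0\<close> and the others at
  \<open>x\<close> in \<open>S0\<close>, the proportion of \<open>x\<close> among all particles has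
  in general a drift of order 1, and this configuration has relative weight of order
  \<open>d\<close>: the error would be as large as the jump rates. Exchanges with \<open>u\<close>
  do not change the share there; what remains needs two displaced particles, one on
  \<open>S0\<close> and one outside, and this brings a further factor \<open>d\<close>.

  The one-step errors have constants that grow with \<open>N\<close> without control. So the mesh is
  refined separately for each \<open>N\<close>, and only the error of the trace rates survives,
  accumulated over a local time that grows slowly with \<open>N\<close>.

  A bounded continuous functional of the path is a function of finitely many visits, up to its
  oscillation over all continuations of the list. This oscillation is again a function of those
  visits, so its mean may be computed for the limit process, where it vanishes by continuity.

  For the time outside, reversibility bounds the law at every time by the weights relative to the
  initial condensate.\<close>

lemma limitin_discrete_iff:
  "limitin (discrete_topology E) f l F \<longleftrightarrow> l \<in> E \<and> (\<forall>\<^sub>F x in F. f x = l)"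
proof
  assume l: "limitin (discrete_topology E) f l F"
  then have "l \<in> E" by (auto dest: limitin_topspace)
  moreover have "\<forall>\<^sub>F x in F. f x \<in> {l}"
    by (rule limitinD[OF l]) (use \<open>l \<in> E\<close> in auto)
  ultimately show "l \<in> E \<and> (\<forall>\<^sub>F x in F. f x = l)" by simp
qed (auto intro: limitin_eventually)

lemma cadlag_iff:
  "cadlag E w \<longleftrightarrow>
     (\<forall>t\<ge>0. w t \<in> E \<and> (\<exists>e>0. \<forall>s. t \<le> s \<and> s < t + e \<longrightarrow> w s = w t)) \<and>
     (\<forall>t>0. \<exists>l\<in>E. \<exists>e>0. \<forall>s. t - e < s \<and> s < t \<longrightarrow> w s = l)"
proof -
  have r: "(\<forall>\<^sub>F s in at_right t. w s = w t) \<longleftrightarrow> (\<exists>e>0. \<forall>s. t \<le> s \<and> s < t + e \<longrightarrow> w s = w t)" for t :: real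
    unfolding eventually_at_right_field
  proof safe
    fix b assume b: "t < b" "\<forall>y>t. y < b \<longrightarrow> w y = w t"
    have "w s = w t" if "t \<le> s" "s < t + (b - t)" for s
    proof -
      have "s = t \<or> t < s" "s < b" using that by linarith+
      then show ?thesis using b(2) by blast
    qed
    moreover have "0 < b - t" using b(1) by simp
    ultimately show "\<exists>e>0. \<forall>s. t \<le> s \<and> s < t + e \<longrightarrow> w s = w t" by blast
  next
    fix e :: real assume "0 < e" "\<forall>s. t \<le> s \<and> s < t + e \<longrightarrow> w s = w t"
    then show "\<exists>b>t. \<forall>y>t. y < b \<longrightarrow> w y = w t"
      by (metis less_add_same_cancel1 less_imp_le)
  qed
  have l: "(\<forall>\<^sub>F s in at_left t. w s = l) \<longleftrightarrow> (\<exists>e>0. \<forall>s. t - e < s \<and> s < t \<longrightarrow> w s = l)" for t :: real and l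
    unfolding eventually_at_left_field
  proof safe
    fix b assume "b < t" "\<forall>y>b. y < t \<longrightarrow> w y = l"
    then show "\<exists>e>0. \<forall>s. t - e < s \<and> s < t \<longrightarrow> w s = l"
      by (intro exI[of _ "t - b"]) auto
  next
    fix e :: real assume "0 < e" "\<forall>s. t - e < s \<and> s < t \<longrightarrow> w s = l"
    then show "\<exists>b<t. \<forall>y>b. y < t \<longrightarrow> w y = l" by (intro exI[of _ "t - e"]) auto
  qed
  show ?thesis
    unfolding cadlag_def limitin_discrete_iff r l Bex_def by (rule refl)
qed

lemma cadlag_in: "cadlag E w \<Longrightarrow> 0 \<le> t \<Longrightarrow> w t \<in> E"
  by (simp add: cadlag_iff)

lemma cadlag_right:
  assumes "cadlag E w" "0 \<le> t"
  obtains e where "0 < e" "\<And>s. t \<le> s \<Longrightarrow> s < t + e \<Longrightarrow> w s = w t"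
  using assms(1)[unfolded cadlag_iff, THEN conjunct1, rule_format, OF assms(2)] that by blast

lemma cadlag_left:
  assumes "cadlag E w" "0 < t"
  obtains e l where "0 < e" "l \<in> E" "\<And>s. t - e < s \<Longrightarrow> s < t \<Longrightarrow> w s = l"
  using assms(1)[unfolded cadlag_iff, THEN conjunct2, rule_format, OF assms(2)] that by blast

lemma cadlag_cong:
  assumes "cadlag E w" "\<And>t. 0 \<le> t \<Longrightarrow> w t = w' t"
  shows "cadlag E w'"
  unfolding cadlag_iff
proof (intro conjI allI impI)
  fix t :: real assume t: "0 \<le> t"
  show "w' t \<in> E" using assms t cadlag_in by metis
  obtain e where "0 < e" "\<And>s. t \<le> s \<Longrightarrow> s < t + e \<Longrightarrow> w s = w t"
    using cadlag_right[OF assms(1) t] by blast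
  then show "\<exists>e>0. \<forall>s. t \<le> s \<and> s < t + e \<longrightarrow> w' s = w' t"
    using assms(2) t by (intro exI[of _ e]) (metis order.trans)
next
  fix t :: real assume t: "0 < t"
  obtain e l where e: "0 < e" "l \<in> E" "\<And>s. t - e < s \<Longrightarrow> s < t \<Longrightarrow> w s = l"
    using cadlag_left[OF assms(1) t] by blast
  have "w' s = l" if "t - min e t < s" "s < t" for s
    using e(3)[of s] assms(2)[of s] that by auto
  then show "\<exists>l\<in>E. \<exists>e>0. \<forall>s. t - e < s \<and> s < t \<longrightarrow> w' s = l"
    using e t by (intro bexI[of _ l] exI[of _ "min e t"]) auto
qed

text \<open>Compactness in the form of Bolzano's argument: the property glues over adjacent
  intervals and holds near every point by the one-sided limits. The half-open \<open>{s<..t}\<close>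
  reflects right-continuity: a jump located at \<open>s\<close> has already happened at time
  \<open>s\<close>.\<close>

lemma cadlag_jump_set:
  assumes w: "cadlag E w" and "0 \<le> a" "a \<le> b"
  shows "\<exists>D. finite D \<and> D \<subseteq> {a<..b} \<and>
           (\<forall>s t. a \<le> s \<and> s \<le> t \<and> t \<le> b \<and> D \<inter> {s<..t} = {} \<longrightarrow> w s = w t)"
    (is "?P a b")
proof -
  have "0 \<le> a \<longrightarrow> ?P a b" using \<open>a \<le> b\<close>
  proof (induction rule: Bolzano)
    case (trans a b c)
    show ?case
    proof
      assume "0 \<le> a"
      then have "?P a b" "?P b c" using trans by simp_all
      then obtain D1 D2 where D: "finite D1" "D1 \<subseteq> {a<..b}" "finite D2" "D2 \<subseteq> {b<..c}"
        and w1: "\<And>s t. a \<le> s \<Longrightarrow> s \<le> t \<Longrightarrow> t \<le> b \<Longrightarrow> D1 \<inter> {s<..t} = {} \<Longrightarrow> w s = w t"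
        and w2: "\<And>s t. b \<le> s \<Longrightarrow> s \<le> t \<Longrightarrow> t \<le> c \<Longrightarrow> D2 \<inter> {s<..t} = {} \<Longrightarrow> w s = w t"
        by meson
      have "w s = w t" if h: "a \<le> s" "s \<le> t" "t \<le> c" "(D1 \<union> D2) \<inter> {s<..t} = {}" for s t
      proof -
        consider "t \<le> b" | "b \<le> s" | "s \<le> b" "b \<le> t" by linarith
        then show ?thesis
        proof cases
          case 3
          have "w s = w b" by (rule w1) (use 3 h in auto)
          also have "w b = w t" by (rule w2) (use 3 h in auto)
          finally show ?thesis .
        next
          case 1
          then show ?thesis by (intro w1) (use h in auto)
        next
          case 2
          then show ?thesis by (intro w2) (use h in auto)
        qed
      qed
      then show "?P a c" using D trans by (intro exI[of _ "D1 \<union> D2"]) auto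
    qed
  next
    case (local x)
    show ?case
    proof (cases "0 \<le> x")
      case False
      then show ?thesis by (intro exI[of _ 1]) auto
    next
      case True
      obtain e1 where e1: "0 < e1" "\<And>s. x \<le> s \<Longrightarrow> s < x + e1 \<Longrightarrow> w s = w x"
        using cadlag_right[OF w True] by blast
      obtain e2 l where e2: "0 < e2" "\<And>s. 0 \<le> s \<Longrightarrow> x - e2 < s \<Longrightarrow> s < x \<Longrightarrow> w s = l"
      proof (cases "x = 0")
        case True
        then show ?thesis using that[of 1] by auto
      next
        case False
        then show ?thesis using cadlag_left[OF w, of x] True that by (metis less_le)
      qed
      have "?P a b" if ab: "a \<le> x" "x \<le> b" "b - a < min e1 e2" "0 \<le> a" for a b
      proof (intro exI[of _ "{x} \<inter> {a<..b}"] conjI allI impI)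
        fix s t assume h: "a \<le> s \<and> s \<le> t \<and> t \<le> b \<and> {x} \<inter> {a<..b} \<inter> {s<..t} = {}"
        then consider "x \<le> s" | "t < x" using ab by force
        then show "w s = w t"
        proof cases
          case 1
          then show ?thesis using e1(2)[of s] e1(2)[of t] h ab by auto
        next
          case 2
          then show ?thesis using e2(2)[of s] e2(2)[of t] h ab by auto
        qed
      qed auto
      then show ?thesis using e1(1) e2(1) by (intro exI[of _ "min e1 e2"]) auto
    qed
  qed
  then show ?thesis using \<open>0 \<le> a\<close> by simp
qed

section \<open>Convergence in the Skorokhod topology\<close>

lemma finite_separation:
  fixes D :: "real set"
  assumes "finite D"
  obtains g where "0 < g" "\<And>s t. s \<in> D \<Longrightarrow> t \<in> D \<Longrightarrow> s \<noteq> t \<Longrightarrow> g \<le> \<bar>s - t\<bar>"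
proof -
  let ?G = "insert 1 ((\<lambda>(s, t). \<bar>s - t\<bar>) ` {(s, t). s \<in> D \<and> t \<in> D \<and> s \<noteq> t})"
  have "finite {(s, t). s \<in> D \<and> t \<in> D \<and> s \<noteq> t}"
    by (rule finite_subset[of _ "D \<times> D"]) (use assms in auto)
  then have fin: "finite ?G" by blast
  show ?thesis
  proof
    show "0 < Min ?G" using fin by (subst Min_gr_iff) auto
    show "Min ?G \<le> \<bar>s - t\<bar>" if "s \<in> D" "t \<in> D" "s \<noteq> t" for s t
      by (rule Min_le[OF fin]) (use that in force)
  qed
qed

text \<open>The time change is the identity plus a sum of tents of half-width \<open>g\<close>, one
  at each point of \<open>D\<close>. The separation \<open>g\<close>, also from 0, makes every tent
  vanish at the other points and at 0, so the prescribed values are attained and 0 is fixed. The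
  perturbation has Lipschitz constant at most \<open>card D * \<epsilon> / g < 1\<close>, hence the
  sum stays strictly increasing.\<close>

lemma time_change_through_points:
  fixes D :: "real set"
  assumes D: "finite D" "\<And>s. s \<in> D \<Longrightarrow> g \<le> s"
    and sep: "\<And>s t. s \<in> D \<Longrightarrow> t \<in> D \<Longrightarrow> s \<noteq> t \<Longrightarrow> g \<le> \<bar>s - t\<bar>"
    and near: "\<And>s. s \<in> D \<Longrightarrow> \<bar>\<sigma> s - s\<bar> \<le> \<epsilon>"
    and small: "0 \<le> \<epsilon>" "real (card D) * \<epsilon> < g"
  shows "\<exists>\<phi>\<in>time_changes. (\<forall>s\<in>D. \<phi> s = \<sigma> s) \<and> (\<forall>t. \<bar>\<phi> t - t\<bar> \<le> real (card D) * \<epsilon>)"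
proof -
  have g: "0 < g" using small by (meson mult_nonneg_nonneg of_nat_0_le_iff order.strict_trans1)
  define tent where "tent u = max 0 (1 - \<bar>u\<bar> / g)" for u :: real
  define \<psi> where "\<psi> t = (\<Sum>s\<in>D. (\<sigma> s - s) * tent (t - s))" for t
  define \<phi> where "\<phi> t = t + \<psi> t" for t
  have tent_lip: "\<bar>tent u - tent v\<bar> \<le> \<bar>u - v\<bar> / g" for u v
  proof -
    have "\<bar>tent u - tent v\<bar> \<le> \<bar>\<bar>u\<bar> / g - \<bar>v\<bar> / g\<bar>" unfolding tent_def by linarith
    also have "\<dots> = \<bar>\<bar>u\<bar> - \<bar>v\<bar>\<bar> / g" using g by (simp add: diff_divide_distrib[symmetric])
    also have "\<dots> \<le> \<bar>u - v\<bar> / g" using g by (intro divide_right_mono) auto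
    finally show ?thesis .
  qed
  have tent_01: "0 \<le> tent u" "tent u \<le> 1" for u using g by (auto simp: tent_def)
  have \<psi>_bound: "\<bar>\<psi> t\<bar> \<le> real (card D) * \<epsilon>" for t
  proof -
    have "\<bar>\<psi> t\<bar> \<le> (\<Sum>s\<in>D. \<bar>(\<sigma> s - s) * tent (t - s)\<bar>)" unfolding \<psi>_def by (rule sum_abs)
    also have "\<dots> \<le> (\<Sum>s\<in>D. \<epsilon> * 1)"
      unfolding abs_mult by (intro sum_mono mult_mono) (use near small tent_01 in auto)
    finally show ?thesis by simp
  qed
  have \<psi>_lip: "\<bar>\<psi> t - \<psi> u\<bar> \<le> real (card D) * \<epsilon> / g * \<bar>t - u\<bar>" for t u
  proof -
    have "\<psi> t - \<psi> u = (\<Sum>s\<in>D. (\<sigma> s - s) * (tent (t - s) - tent (u - s)))"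
      unfolding \<psi>_def by (simp add: sum_subtractf[symmetric] right_diff_distrib)
    then have "\<bar>\<psi> t - \<psi> u\<bar> \<le> (\<Sum>s\<in>D. \<bar>(\<sigma> s - s) * (tent (t - s) - tent (u - s))\<bar>)" by simp
    also have "\<dots> \<le> (\<Sum>s\<in>D. \<epsilon> * (\<bar>t - u\<bar> / g))"
      unfolding abs_mult
      by (intro sum_mono mult_mono order.trans[OF tent_lip]) (use near small in auto)
    finally show ?thesis by simp
  qed
  have incr: "\<phi> t < \<phi> u" if "t < u" for t u
  proof -
    have "real (card D) * \<epsilon> / g * \<bar>t - u\<bar> < 1 * \<bar>t - u\<bar>"
      by (intro mult_strict_right_mono) (use small g that in auto)
    with \<psi>_lip[of t u] have "\<bar>\<psi> t - \<psi> u\<bar> < 1 * \<bar>t - u\<bar>" by (rule order.strict_trans1)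
    then have "\<bar>\<psi> t - \<psi> u\<bar> < u - t" using that by simp
    then show ?thesis using that unfolding \<phi>_def by linarith
  qed
  have cont: "continuous_on X \<phi>" for X
    unfolding \<phi>_def \<psi>_def tent_def by (intro continuous_intros) (use g in auto)
  have "tent (0 - s) = 0" if "s \<in> D" for s
    using D(2)[OF that] g unfolding tent_def by (auto simp: max_def field_simps)
  then have \<phi>0: "\<phi> 0 = 0" unfolding \<phi>_def \<psi>_def by simp
  have \<phi>D: "\<phi> s = \<sigma> s" if "s \<in> D" for s
  proof -
    have "tent (s - t) = 0" if "t \<in> D - {s}" for t
      using sep[of s t] that \<open>s \<in> D\<close> g unfolding tent_def by (auto simp: max_def field_simps)
    moreover have "tent 0 = 1" by (simp add: tent_def)
    ultimately have "\<psi> s = \<sigma> s - s"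
      unfolding \<psi>_def using that D(1) by (subst sum.remove[of _ s]) auto
    then show ?thesis by (simp add: \<phi>_def)
  qed
  have "\<phi> ` {0..} = {0..}"
  proof (intro equalityI subsetI)
    fix y assume "y \<in> \<phi> ` {0..}"
    then obtain t where t: "0 \<le> t" "y = \<phi> t" by auto
    then show "y \<in> {0..}" using incr[of 0 t] \<phi>0 by (cases "t = 0") auto
  next
    fix y :: real assume y: "y \<in> {0..}"
    let ?b = "y + real (card D) * \<epsilon>"
    have "y \<le> \<phi> ?b" using \<psi>_bound[of ?b] unfolding \<phi>_def by linarith
    then obtain t where "0 \<le> t" "\<phi> t = y"
      using IVT'[of \<phi> 0 y ?b] y \<phi>0 cont small by auto
    then show "y \<in> \<phi> ` {0..}" by auto
  qed
  then have "\<phi> \<in> time_changes"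
    unfolding time_changes_def bij_betw_def
    by (auto intro!: strict_mono_onI incr) (metis inj_onI incr linorder_neq_iff)
  then show ?thesis
    using \<phi>D \<psi>_bound by (intro bexI[of _ \<phi>]) (auto simp: \<phi>_def)
qed

text \<open>Diagonal argument: the definition asks for one time change per \<open>n\<close> that
  serves all horizons. The best precision available at \<open>n\<close> tends to infinity, and a
  time change of that precision is chosen.\<close>

lemma skorokhod_convergesI:
  assumes "\<And>K::nat. \<forall>\<^sub>F n in sequentially. \<exists>\<phi>\<in>time_changes.
             (\<forall>t\<ge>0. \<bar>\<phi> t - t\<bar> \<le> 1 / real (Suc K)) \<and> (\<forall>t\<in>{0..real K}. v n (\<phi> t) = w t)"
  shows "skorokhod_converges v w"
proof -
  define good where "good n K \<phi> \<longleftrightarrow> \<phi> \<in> time_changes \<and> (\<forall>t\<ge>0. \<bar>\<phi> t - t\<bar> \<le> 1 / real (Suc K)) \<and>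
     (\<forall>t\<in>{0..real K}. v n (\<phi> t) = w t)" for n K \<phi>
  have good_ev: "\<forall>\<^sub>F n in sequentially. \<exists>\<phi>. good n K \<phi>" for K
    using assms[of K] unfolding good_def by (rule eventually_mono) blast
  have id: "(\<lambda>t. t) \<in> time_changes"
    by (auto simp: time_changes_def bij_betw_def strict_mono_on_def)
  \<comment> \<open>The cap \<open>K \<le> n\<close> makes the greatest element exist. Where no good
    time change exists the identity is used, which concerns only finitely many
    \<open>n\<close>.\<close>
  define M where "M n = (GREATEST K. K \<le> n \<and> (\<exists>\<phi>. good n K \<phi>))" for n
  define \<phi> where "\<phi> n = (if \<exists>\<phi>. good n (M n) \<phi> then SOME \<phi>. good n (M n) \<phi> else (\<lambda>t. t))" for n
  have main: "\<forall>\<^sub>F n in sequentially. K \<le> M n \<and> good n (M n) (\<phi> n)" for K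
    using good_ev[of K] eventually_ge_at_top[of K]
  proof eventually_elim
    case (elim n)
    let ?Q = "\<lambda>K. K \<le> n \<and> (\<exists>\<phi>. good n K \<phi>)"
    have "?Q (M n)" unfolding M_def by (rule GreatestI_nat[where b = n]) (use elim in auto)
    moreover have "K \<le> M n" unfolding M_def by (rule Greatest_le_nat[where b = n]) (use elim in auto)
    ultimately show ?case using someI_ex[of "good n (M n)"] unfolding \<phi>_def by auto
  qed
  have tc: "\<phi> n \<in> time_changes" for n
  proof (cases "\<exists>\<phi>. good n (M n) \<phi>")
    case True
    then have "good n (M n) (\<phi> n)" using someI_ex[of "good n (M n)"] unfolding \<phi>_def by auto
    then show ?thesis by (simp add: good_def)
  qed (simp add: \<phi>_def id)
  have "uniform_limit {0..} \<phi> (\<lambda>t. t) sequentially"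
    unfolding uniform_limit_iff
  proof (intro allI impI)
    fix e :: real assume "0 < e"
    then obtain K where K: "1 / real (Suc K) < e" using nat_approx_posE by blast
    show "\<forall>\<^sub>F n in sequentially. \<forall>t\<in>{0..}. dist (\<phi> n t) t < e"
      using main[of K]
    proof eventually_elim
      case (elim n)
      have "1 / real (Suc (M n)) \<le> 1 / real (Suc K)" using elim by (intro divide_left_mono) auto
      then show ?case using elim K unfolding good_def dist_real_def by (auto intro: order.strict_trans1)
    qed
  qed
  moreover have "\<forall>\<^sub>F n in sequentially. \<forall>t\<in>{0..T}. v n (\<phi> n t) = w t" for T
  proof -
    obtain K :: nat where K: "T \<le> real K" using real_arch_simple by blast
    show ?thesis using main[of K]
    proof eventually_elim
      case (elim n)
      have "K \<le> M n" "good n (M n) (\<phi> n)" using elim by auto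
      then show ?case using K unfolding good_def by auto
    qed
  qed
  ultimately show ?thesis unfolding skorokhod_converges_def using tc by blast
qed

text \<open>\<open>v n\<close> is \<open>w\<close> read through a slightly distorted clock
  \<open>\<theta> n\<close> that is constant on grid cells. A jump of \<open>w\<close> at
  \<open>s\<close> is seen by \<open>v n\<close> at the first cell whose clock value has reached
  \<open>s\<close>, and the time change moves \<open>s\<close> to the start of this cell. After
  that, \<open>t\<close> and the clock value always lie between the same jumps of
  \<open>w\<close>.\<close>

lemma skorokhod_converges_discretization:
  fixes q :: "nat \<Rightarrow> real" and \<theta> :: "nat \<Rightarrow> nat \<Rightarrow> real"
  assumes w: "cadlag E w" and q: "filterlim q at_top sequentially"
    and \<theta>0: "\<And>n i. 0 \<le> \<theta> n i"
    and agree: "\<And>K::nat. \<forall>\<^sub>F n in sequentially. \<forall>t\<in>{0..real K}. v n t = w (\<theta> n (nat \<lfloor>q n * t\<rfloor>))"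
    and mono: "\<And>K::nat. \<forall>\<^sub>F n in sequentially. mono_on {i. real i \<le> q n * real K} (\<theta> n)"
    and close: "\<And>(K::nat) e. 0 < e \<Longrightarrow>
       \<forall>\<^sub>F n in sequentially. \<forall>i. real i \<le> q n * real K \<longrightarrow> \<bar>\<theta> n i - real i / q n\<bar> \<le> e"
  shows "skorokhod_converges v w"
proof (rule skorokhod_convergesI)
  fix K :: nat
  \<comment> \<open>Margins: the time change moves points by at most 1 and the clock is wrong by at
    most 1/2, so times up to \<open>K\<close> lead to clock values below \<open>K + 2\<close>. The
    grid is followed up to \<open>K + 3\<close> so that the clock passes every jump up to
    \<open>K + 2\<close>.\<close>
  have "\<exists>D. finite D \<and> D \<subseteq> {0<..real K + 2} \<and>
      (\<forall>s t. 0 \<le> s \<and> s \<le> t \<and> t \<le> real K + 2 \<and> D \<inter> {s<..t} = {} \<longrightarrow> w s = w t)"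
    by (rule cadlag_jump_set[OF w]) simp_all
  then obtain D where D0: "finite D \<and> D \<subseteq> {0<..real K + 2} \<and>
      (\<forall>s t. 0 \<le> s \<and> s \<le> t \<and> t \<le> real K + 2 \<and> D \<inter> {s<..t} = {} \<longrightarrow> w s = w t)" ..
  note D = D0[THEN conjunct1] D0[THEN conjunct2, THEN conjunct1]
  have wD: "w s = w t" if "0 \<le> s" "s \<le> t" "t \<le> real K + 2" "D \<inter> {s<..t} = {}" for s t
    by (rule D0[THEN conjunct2, THEN conjunct2, rule_format]) (intro conjI that)
  obtain g where g: "0 < g" "\<And>s t. s \<in> insert 0 D \<Longrightarrow> t \<in> insert 0 D \<Longrightarrow> s \<noteq> t \<Longrightarrow> g \<le> \<bar>s - t\<bar>"
    using finite_separation[of "insert 0 D"] D(1) by blast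
  \<comment> \<open>Small enough that \<open>card D\<close> tents of height at most \<open>m\<close>
    have total slope below 1 and total displacement at most \<open>1 / Suc K\<close>. The
    \<open>+ 1\<close> makes the first bound strict and covers an empty \<open>D\<close>.\<close>
  define m where "m = min g (1 / real (Suc K)) / (real (card D) + 1)"
  have m0: "0 < m" unfolding m_def using g by auto
  have md: "(real (card D) + 1) * m = min g (1 / real (Suc K))" unfolding m_def by simp
  have cm: "real (card D) * m < g" "real (card D) * m \<le> 1 / real (Suc K)" "m \<le> 1"
  proof -
    have "real (card D) * m < (real (card D) + 1) * m" using m0 by (simp add: algebra_simps)
    then show "real (card D) * m < g" "real (card D) * m \<le> 1 / real (Suc K)" unfolding md by auto
    have "m \<le> (real (card D) + 1) * m" using m0 by (simp add: algebra_simps)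
    also have "\<dots> \<le> 1 / real (Suc K)" unfolding md by auto
    also have "\<dots> \<le> 1" by simp
    finally show "m \<le> 1" .
  qed
  have q_ev: "\<forall>\<^sub>F n in sequentially. 2 / m \<le> q n"
    using q unfolding filterlim_at_top by blast
  show "\<forall>\<^sub>F n in sequentially. \<exists>\<phi>\<in>time_changes. (\<forall>t\<ge>0. \<bar>\<phi> t - t\<bar> \<le> 1 / real (Suc K)) \<and>
          (\<forall>t\<in>{0..real K}. v n (\<phi> t) = w t)"
    using q_ev agree[of "K+1"] mono[of "K+3"] close[OF half_gt_zero[OF m0], of "K+3"]
  proof eventually_elim
    case (elim n)
    have qpos: "0 < q n" using elim(1) m0 by (meson divide_pos_pos order.strict_trans2 zero_less_numeral)
    have cl: "\<bar>\<theta> n i - real i / q n\<bar> \<le> m / 2" if "real i \<le> q n * real (K+3)" for i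
      using elim(4) m0 that by auto
    have qinv: "1 / q n \<le> m / 2"
      using elim(1) m0 qpos by (simp add: field_simps)
    define I where "I = nat \<lfloor>q n * real (K+3)\<rfloor>"
    have I_iff: "real i \<le> q n * real (K+3) \<longleftrightarrow> i \<le> I" for i
      unfolding I_def using qpos by (simp add: le_nat_iff le_floor_iff)
    have I_big: "real K + 2 \<le> \<theta> n I"
    proof -
      have "q n * real (K+3) < real I + 1" unfolding I_def using qpos by linarith
      then have "real K + 3 < (real I + 1) / q n" using qpos by (simp add: field_simps)
      then have "real K + 3 < real I / q n + 1 / q n" by (simp add: add_divide_distrib)
      then show ?thesis using cl[of I] I_iff[of I] qinv cm(3) by (simp; linarith)
    qed
    define j where "j s = (LEAST i. s \<le> \<theta> n i)" for s
    define \<sigma> where "\<sigma> s = real (j s) / q n" for s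
    have j: "j s \<le> I" "s \<le> \<theta> n (j s)" "\<And>i. i < j s \<Longrightarrow> \<theta> n i < s" if "s \<in> D" for s
    proof -
      have "s \<le> \<theta> n I" using that D I_big by force
      then show "j s \<le> I" "s \<le> \<theta> n (j s)" unfolding j_def by (auto intro: Least_le LeastI)
      show "\<theta> n i < s" if "i < j s" for i using not_less_Least[of i] that unfolding j_def by force
    qed
    have \<theta>_iff: "s \<le> \<theta> n i \<longleftrightarrow> j s \<le> i" if "s \<in> D" "i \<le> I" for s i
    proof
      assume "s \<le> \<theta> n i"
      then show "j s \<le> i" unfolding j_def by (rule Least_le)
    next
      assume "j s \<le> i"
      then have "\<theta> n (j s) \<le> \<theta> n i"
        by (intro mono_onD[OF elim(3)]) (use that I_iff j(1)[OF that(1)] in auto)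
      then show "s \<le> \<theta> n i" using j(2)[OF that(1)] by simp
    qed
    have near: "\<bar>\<sigma> s - s\<bar> \<le> m" if s: "s \<in> D" for s
    proof -
      have 1: "s - m / 2 \<le> \<sigma> s"
        using cl[of "j s", unfolded I_iff, OF j(1)[OF s]] j(2)[OF s] unfolding \<sigma>_def by linarith
      have "\<sigma> s \<le> s + m"
      proof (cases "j s")
        case 0
        then show ?thesis using s D m0 unfolding \<sigma>_def by auto
      next
        case (Suc i)
        have "real i / q n \<le> \<theta> n i + m / 2"
          using cl[of i, unfolded I_iff] j(1)[OF s] Suc by linarith
        moreover have "\<theta> n i < s" using j(3)[OF s, of i] Suc by simp
        moreover have "\<sigma> s = real i / q n + 1 / q n" unfolding \<sigma>_def Suc by (simp add: add_divide_distrib)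
        ultimately show ?thesis using qinv by linarith
      qed
      then show ?thesis using 1 m0 by linarith
    qed
    have "\<exists>\<phi>\<in>time_changes. (\<forall>s\<in>D. \<phi> s = \<sigma> s) \<and> (\<forall>t. \<bar>\<phi> t - t\<bar> \<le> real (card D) * m)"
    proof (rule time_change_through_points[OF D(1) _ _ near])
      show "g \<le> s" if "s \<in> D" for s using g(2)[of s 0] that D by auto
      show "g \<le> \<bar>s - t\<bar>" if "s \<in> D" "t \<in> D" "s \<noteq> t" for s t using g(2) that by blast
    qed (use m0 cm in auto)
    then obtain \<phi> where \<phi>: "\<phi> \<in> time_changes" "\<And>s. s \<in> D \<Longrightarrow> \<phi> s = \<sigma> s"
      "\<And>t. \<bar>\<phi> t - t\<bar> \<le> real (card D) * m" by blast
    have \<phi>_mono: "\<phi> s \<le> \<phi> t \<longleftrightarrow> s \<le> t" if "0 \<le> s" "0 \<le> t" for s t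
      using \<phi>(1) that strict_mono_on_less_eq[of "{0..}" \<phi> s t] unfolding time_changes_def by auto
    have "v n (\<phi> t) = w t" if t: "t \<in> {0..real K}" for t
    proof -
      have \<phi>_dist: "\<bar>\<phi> t - t\<bar> \<le> 1" 
      proof -
        have "1 / real (Suc K) \<le> 1" by simp
        then show ?thesis using \<phi>(3)[of t] cm(2) by linarith
      qed
      have "bij_betw \<phi> {0..} {0..}" using \<phi>(1) by (simp add: time_changes_def)
      from bij_betw_apply[OF this, of t] have \<phi>t0: "0 \<le> \<phi> t" using t by simp
      have "t \<le> real K" using t by simp
      then have "\<phi> t \<le> real (K+1)" using \<phi>_dist by linarith
      note \<phi>t = \<phi>t0 this
      define i where "i = nat \<lfloor>q n * \<phi> t\<rfloor>"
      have i_le: "real i \<le> q n * \<phi> t" unfolding i_def using qpos \<phi>t by (simp add: of_nat_floor)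
      also have "\<dots> \<le> q n * real (K+1)" using qpos \<phi>t by (intro mult_left_mono) auto
      finally have i_le2: "real i \<le> q n * real (K+1)" .
      note i_le2
      also have "q n * real (K+1) \<le> q n * real (K+3)" using qpos by (intro mult_left_mono) auto
      finally have iI: "i \<le> I" using I_iff[of i] by simp
      have "real i / q n \<le> real (K + 1)" using i_le2 qpos by (simp add: field_simps)
      then have \<theta>_le: "\<theta> n i \<le> real K + 2" using cl[of i, unfolded I_iff, OF iI] cm(3) m0 by linarith
      \<comment> \<open>The choice of \<open>j s\<close> and of \<open>\<phi> s\<close> is made for
        this equivalence: the clock has passed the jump \<open>s\<close> exactly when
        \<open>t\<close> has.\<close>
      have key: "s \<le> \<theta> n i \<longleftrightarrow> s \<le> t" if s: "s \<in> D" for s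
      proof -
        have "s \<le> \<theta> n i \<longleftrightarrow> j s \<le> i" by (rule \<theta>_iff[OF s iI])
        also have "\<dots> \<longleftrightarrow> real (j s) \<le> q n * \<phi> t"
        proof -
          have "0 \<le> q n * \<phi> t" using qpos \<phi>t by simp
          then show ?thesis unfolding i_def by (subst le_nat_iff) (simp_all add: le_floor_iff)
        qed
        also have "\<dots> \<longleftrightarrow> \<phi> s \<le> \<phi> t" unfolding \<phi>(2)[OF s] \<sigma>_def using qpos
          by (simp add: pos_divide_le_eq mult.commute)
        also have "\<dots> \<longleftrightarrow> s \<le> t" by (rule \<phi>_mono) (use s D t in auto)
        finally show ?thesis .
      qed
      have "v n (\<phi> t) = w (\<theta> n i)" using elim(2) \<phi>t by (auto simp: i_def)
      also have "\<dots> = w t"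
      proof (cases "\<theta> n i \<le> t")
        case True
        have "D \<inter> {\<theta> n i<..t} = {}" using key by (force simp: not_le[symmetric])
        then show ?thesis using True \<theta>0 t by (intro wD) simp_all
      next
        case False
        have "D \<inter> {t<..\<theta> n i} = {}" using key by (force simp: not_le[symmetric])
        then show ?thesis using False \<theta>_le t by (intro wD[symmetric]) simp_all
      qed
      finally show ?thesis .
    qed
    then show ?case
      using \<phi>(1) order.trans[OF \<phi>(3) cm(2)] by (intro bexI[of _ \<phi>]) blast+
  qed
qed

section \<open>Occupation times and the trace of a path\<close>

lemma nat_floor_bounds:
  fixes x :: real
  assumes "0 \<le> x"
  shows "real (nat \<lfloor>x\<rfloor>) \<le> x" "x < real (nat \<lfloor>x\<rfloor>) + 1"
  using assms by linarith+

text \<open>The grid point is taken strictly to the right of \<open>u\<close>, so that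
  right-continuity alone identifies the value; the grid point just below could lie before a jump at
  \<open>u\<close>.\<close>

lemma cadlag_right_grid:
  assumes w: "cadlag E w" and q: "filterlim q at_top sequentially" and u: "0 \<le> u"
  shows "\<forall>\<^sub>F n in sequentially. w ((real (nat \<lfloor>q n * u\<rfloor>) + 1) / q n) = w u"
proof -
  obtain e where e: "0 < e" "\<And>s. u \<le> s \<Longrightarrow> s < u + e \<Longrightarrow> w s = w u"
    using cadlag_right[OF w u] by blast
  have "\<forall>\<^sub>F n in sequentially. 2 / e \<le> q n" using q unfolding filterlim_at_top by blast
  then show ?thesis
  proof eventually_elim
    case (elim n)
    have "0 < 2 / e" using e(1) by simp
    then have qn: "0 < q n" using elim by linarith
    have "2 \<le> q n * e" using elim e(1) by (simp add: pos_divide_le_eq mult.commute)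
    have b: "real (nat \<lfloor>q n * u\<rfloor>) \<le> q n * u" "q n * u < real (nat \<lfloor>q n * u\<rfloor>) + 1"
      using nat_floor_bounds[of "q n * u"] qn u by simp_all
    show ?case
    proof (rule e(2))
      show "u \<le> (real (nat \<lfloor>q n * u\<rfloor>) + 1) / q n"
        using b qn by (simp add: pos_le_divide_eq mult.commute)
      have "real (nat \<lfloor>q n * u\<rfloor>) + 1 < (u + e) * q n"
        using b(1) \<open>2 \<le> q n * e\<close> by (simp add: algebra_simps)
      then show "(real (nat \<lfloor>q n * u\<rfloor>) + 1) / q n < u + e"
        using qn by (simp add: pos_divide_less_eq)
    qed
  qed
qed

lemma grid_indicator_measurable:
  "(\<lambda>u. g (nat \<lfloor>q * u\<rfloor>)) \<in> borel_measurable (borel :: real measure)"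
  for g :: "nat \<Rightarrow> real"
proof -
  have "(\<lambda>u :: real. nat \<lfloor>q * u\<rfloor>) \<in> borel \<rightarrow>\<^sub>M count_space UNIV" by measurable
  moreover have "g \<in> count_space UNIV \<rightarrow>\<^sub>M borel" by simp
  ultimately show ?thesis by (rule measurable_compose)
qed

lemma cadlag_indicator_measurable:
  assumes w: "cadlag E w"
  shows "(\<lambda>u. indicator {0..} u * indicator A (w u) :: real) \<in> borel_measurable borel"
proof (rule borel_measurable_LIMSEQ_real)
  show "(\<lambda>u. indicator {0..} u * indicator A (w ((real (nat \<lfloor>real n * u\<rfloor>) + 1) / real n)) :: real)
          \<in> borel_measurable borel" for n
    using grid_indicator_measurable[of "\<lambda>i. indicator A (w ((real i + 1) / real n))" "real n"]
    by measurable
  fix u :: real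
  show "(\<lambda>n. indicator {0..} u * indicator A (w ((real (nat \<lfloor>real n * u\<rfloor>) + 1) / real n)) :: real)
          \<longlonglongrightarrow> indicator {0..} u * indicator A (w u)"
  proof (cases "0 \<le> u")
    case True
    have "\<forall>\<^sub>F n in sequentially. indicator {0..} u * indicator A (w ((real (nat \<lfloor>real n * u\<rfloor>) + 1) / real n)) =
        (indicator {0..} u * indicator A (w u) :: real)"
      using cadlag_right_grid[OF w filterlim_real_sequentially True] by (rule eventually_mono) simp
    then show ?thesis by (rule tendsto_eventually)
  qed simp
qed

lemma set_integrable_bounded_interval:
  fixes f :: "real \<Rightarrow> real"
  assumes "(\<lambda>u. indicator {0..} u * f u) \<in> borel_measurable borel" "\<And>u. \<bar>f u\<bar> \<le> B" "0 \<le> a"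
  shows "set_integrable lborel {a..b} f"
proof -
  have "(\<lambda>u. indicator {a..b} u * (indicator {0..} u * f u)) \<in> borel_measurable lborel"
    using assms(1) by measurable
  also have "(\<lambda>u. indicator {a..b} u * (indicator {0..} u * f u)) = (\<lambda>u. indicator {a..b} u *\<^sub>R f u)"
    using assms(3) by (auto simp: indicator_def)
  finally have m: "(\<lambda>u. indicator {a..b} u *\<^sub>R f u) \<in> borel_measurable lborel" .
  have B: "0 \<le> B" using assms(2)[of 0] by linarith
  have "integrable lborel (\<lambda>u. indicator {a..b} u *\<^sub>R B)"
    using integrable_real_indicator[of "{a..b}" lborel] by (auto simp: emeasure_lborel_Icc_eq)
  then show ?thesis
    unfolding set_integrable_def
    by (rule Bochner_Integration.integrable_bound) (use m assms(2) B in \<open>auto simp: indicator_def\<close>)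
qed

context
  fixes E :: "'a set" and w :: "real \<Rightarrow> 'a" and A :: "'a set"
  assumes w: "cadlag E w"
begin

private abbreviation I where "I u \<equiv> indicator A (w u) :: real"
private abbreviation occ where "occ \<equiv> occupation_time A w"

lemma set_integrable_visits: "0 \<le> a \<Longrightarrow> set_integrable lborel {a..b} (\<lambda>u. indicator A (w u) :: real)"
  by (rule set_integrable_bounded_interval[OF cadlag_indicator_measurable[OF w], where B = 1])
     (auto simp: indicator_def)

lemma visits_integrable_on: "0 \<le> a \<Longrightarrow> (\<lambda>u. indicator A (w u) :: real) integrable_on {a..b}"
  using set_borel_integral_eq_integral(1)[OF set_integrable_visits] by blast

lemma occupation_time_eq: "occupation_time A w t = integral {0..t} (\<lambda>u. indicator A (w u))"
  unfolding occupation_time_def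
  by (rule set_borel_integral_eq_integral(2)[OF set_integrable_visits]) simp

lemma occupation_time_diff:
  assumes "0 \<le> s" "s \<le> t"
  shows "occupation_time A w t = occupation_time A w s + integral {s..t} (\<lambda>u. indicator A (w u))"
  unfolding occupation_time_eq
  by (rule Henstock_Kurzweil_Integration.integral_combine[symmetric])
     (use assms visits_integrable_on in auto)

lemma occupation_time_bounds:
  assumes "0 \<le> s" "s \<le> t"
  shows "occupation_time A w s \<le> occupation_time A w t" "occupation_time A w t \<le> occupation_time A w s + (t - s)"
proof -
  have "0 \<le> integral {s..t} I"
    by (rule integral_nonneg) (use visits_integrable_on assms in auto)
  then show "occ s \<le> occ t" using occupation_time_diff[OF assms] by simp
  have "integral {s..t} I \<le> integral {s..t} (\<lambda>_. 1)"
    by (rule integral_le) (use visits_integrable_on assms in \<open>auto simp: indicator_def\<close>)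
  then show "occ t \<le> occ s + (t - s)" using occupation_time_diff[OF assms] assms by simp
qed

lemma occupation_time_0: "occupation_time A w 0 = 0"
  unfolding occupation_time_eq by simp

lemma occupation_time_le: "0 \<le> t \<Longrightarrow> occupation_time A w t \<le> t"
  using occupation_time_bounds(2)[of 0 t] occupation_time_0 by simp

lemma occupation_time_nonneg: "0 \<le> t \<Longrightarrow> 0 \<le> occupation_time A w t"
  using occupation_time_bounds(1)[of 0 t] occupation_time_0 by simp

lemma integral_visits_const:
  assumes "s \<le> t" "\<And>u. s \<le> u \<Longrightarrow> u < t \<Longrightarrow> w u = a"
  shows "integral {s..t} (\<lambda>u. indicator A (w u) :: real) = (t - s) * indicator A a"
proof -
  have "integral {s..t} I = integral {s..t} (\<lambda>_. indicator A a :: real)"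
    by (rule integral_spike[of "{t}"]) (use assms(2) in auto)
  then show ?thesis using assms(1) by simp
qed

lemma occupation_time_const:
  assumes "0 \<le> s" "s \<le> t" "\<And>u. s \<le> u \<Longrightarrow> u < t \<Longrightarrow> w u = a"
  shows "occupation_time A w t = occupation_time A w s + (t - s) * indicator A a"
  using occupation_time_diff[OF assms(1,2)] integral_visits_const[OF assms(2,3)] by simp

text \<open>Right-continuity keeps \<open>w\<close> in \<open>A\<close> for a while after
  \<open>s\<close>, so the occupation time grows strictly from \<open>s\<close> on and
  \<open>s\<close> is the last time at which it has this value.\<close>

lemma occupation_inverse:
  assumes s: "0 \<le> s" "w s \<in> A"
  shows "Sup {u. 0 \<le> u \<and> occupation_time A w u \<le> occupation_time A w s} = s"
proof (rule cSup_eq_maximum)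
  show "s \<in> {u. 0 \<le> u \<and> occ u \<le> occ s}" using s by simp
  fix u assume u: "u \<in> {u. 0 \<le> u \<and> occ u \<le> occ s}"
  show "u \<le> s"
  proof (rule ccontr)
    assume "\<not> u \<le> s"
    obtain e where e: "0 < e" "\<And>v. s \<le> v \<Longrightarrow> v < s + e \<Longrightarrow> w v = w s"
      using cadlag_right[OF w s(1)] by blast
    define v where "v = min u (s + e / 2)"
    have v: "s < v" "v \<le> u" "v < s + e" using \<open>\<not> u \<le> s\<close> e(1) unfolding v_def by auto
    have "occ v = occ s + (v - s) * indicator A (w s)"
    proof (rule occupation_time_const)
      show "w y = w s" if "s \<le> y" "y < v" for y by (rule e(2)) (use that v in auto)
    qed (use s v in auto)
    moreover have "occ v \<le> occ u" by (rule occupation_time_bounds) (use s v in auto)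
    ultimately show False using u v s by simp
  qed
qed

lemma trace_path_occupation:
  assumes "0 \<le> s" "w s \<in> A"
  shows "trace_path A w (occupation_time A w s) = w s"
  unfolding trace_path_def occupation_inverse[OF assms] ..

context
  assumes unbounded: "\<And>K. \<exists>s\<ge>0. K < occupation_time A w s"
begin

private abbreviation S where "S t \<equiv> Sup {s. 0 \<le> s \<and> occupation_time A w s \<le> t}"

text \<open>The occupation time is nondecreasing and 1-Lipschitz, so the level \<open>t\<close> is
  attained at the supremum. Strict growth right after \<open>S t\<close>, together with
  right-continuity, forces \<open>w (S t)\<close> into \<open>A\<close>.\<close>

lemma inverse_occupation:
  assumes t: "0 \<le> t"
  shows "0 \<le> S t" "occupation_time A w (S t) = t" "w (S t) \<in> A"
    "\<And>u. S t < u \<Longrightarrow> t < occupation_time A w u"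
proof -
  let ?X = "{s. 0 \<le> s \<and> occ s \<le> t}"
  have 0: "0 \<in> ?X" using t occupation_time_0 by simp
  obtain s0 where s0: "0 \<le> s0" "t < occ s0" using unbounded[of t] by auto
  have bdd: "bdd_above ?X"
  proof (rule bdd_aboveI[of _ s0])
    fix s assume s: "s \<in> ?X"
    show "s \<le> s0"
    proof (rule ccontr)
      assume "\<not> s \<le> s0"
      then have "occ s0 \<le> occ s" by (intro occupation_time_bounds) (use s0 in auto)
      then show False using s s0 by simp
    qed
  qed
  show S0: "0 \<le> S t" by (rule cSup_upper[OF 0 bdd])
  show gt: "t < occ u" if "S t < u" for u
  proof (rule ccontr)
    assume "\<not> t < occ u"
    then have "u \<in> ?X" using that S0 by simp
    then have "u \<le> S t" by (rule cSup_upper[OF _ bdd])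
    then show False using that by simp
  qed
  have "occ (S t) \<le> t"
  proof (rule field_le_epsilon)
    fix e :: real assume e: "0 < e"
    then have "S t - e < S t" by simp
    then obtain s where s: "s \<in> ?X" "S t - e < s" using less_cSup_iff[OF _ bdd] 0 by blast
    have "s \<le> S t" by (rule cSup_upper[OF s(1) bdd])
    then have "occ (S t) \<le> occ s + (S t - s)" by (intro occupation_time_bounds) (use s in auto)
    then show "occ (S t) \<le> t + e" using s by simp
  qed
  moreover have "t \<le> occ (S t)"
  proof (rule field_le_epsilon)
    fix e :: real assume e: "0 < e"
    have "t < occ (S t + e)" by (rule gt) (use e in simp)
    also have "\<dots> \<le> occ (S t) + (S t + e - S t)" by (rule occupation_time_bounds) (use S0 e in auto)
    finally show "t \<le> occ (S t) + e" by simp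
  qed
  ultimately show eq: "occ (S t) = t" by simp
  obtain e where e: "0 < e" "\<And>v. S t \<le> v \<Longrightarrow> v < S t + e \<Longrightarrow> w v = w (S t)"
    using cadlag_right[OF w S0] by blast
  have "occ (S t + e) = occ (S t) + (S t + e - S t) * indicator A (w (S t))"
    by (rule occupation_time_const) (use S0 e(1) in \<open>auto intro: e(2)\<close>)
  moreover have "t < occ (S t + e)" by (rule gt) (use e in simp)
  ultimately show "w (S t) \<in> A" using eq by (cases "w (S t) \<in> A") simp_all
qed

lemma inverse_occupation_less:
  assumes "0 \<le> t" "0 \<le> u" "t < occupation_time A w u"
  shows "S t < u"
proof (rule ccontr)
  assume "\<not> S t < u"
  then have "occ u \<le> occ (S t)" using assms by (intro occupation_time_bounds) auto
  then show False using inverse_occupation(2)[OF assms(1)] assms(3) by simp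
qed

lemma less_inverse_occupation:
  assumes "0 \<le> t" "0 \<le> u" "occupation_time A w u < t"
  shows "u < S t"
proof (rule ccontr)
  assume "\<not> u < S t"
  then have "occ (S t) \<le> occ u" using assms inverse_occupation(1)[of t] by (intro occupation_time_bounds) auto
  then show False using inverse_occupation(2)[OF assms(1)] assms(3) by simp
qed

lemma cadlag_trace_path: "cadlag A (trace_path A w)"
  unfolding cadlag_iff
proof (intro conjI allI impI)
  fix t :: real assume t: "0 \<le> t"
  note S = inverse_occupation[OF t]
  show "trace_path A w t \<in> A" unfolding trace_path_def by (rule S(3))
  obtain e where e: "0 < e" "\<And>v. S t \<le> v \<Longrightarrow> v < S t + e \<Longrightarrow> w v = w (S t)"
    using cadlag_right[OF w S(1)] by blast
  have "trace_path A w s = trace_path A w t" if s: "t \<le> s" "s < t + e" for s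
  proof -
    \<comment> \<open>On the interval of constancy that follows \<open>S t\<close> the local clock
      runs at unit speed.\<close>
    define v where "v = S t + (s - t)"
    have wv: "w v = w (S t)" by (rule e(2)) (use s in \<open>auto simp: v_def\<close>)
    have "occ v = occ (S t) + (v - S t) * indicator A (w (S t))"
    proof (rule occupation_time_const)
      show "w y = w (S t)" if "S t \<le> y" "y < v" for y by (rule e(2)) (use that s in \<open>auto simp: v_def\<close>)
    qed (use S s in \<open>auto simp: v_def\<close>)
    then have "occ v = s" using S by (simp add: v_def)
    moreover have "trace_path A w (occ v) = w v"
      by (rule trace_path_occupation) (use wv S s in \<open>auto simp: v_def\<close>)
    ultimately show ?thesis using wv by (simp add: trace_path_def)
  qed
  then show "\<exists>e>0. \<forall>s. t \<le> s \<and> s < t + e \<longrightarrow> trace_path A w s = trace_path A w t"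
    using e(1) by blast
next
  fix t :: real assume t: "0 < t"
  \<comment> \<open>\<open>u\<close> is the first and \<open>S t\<close> the last time at which the
    occupation time equals \<open>t\<close>; an excursion away from \<open>A\<close> may lie between
    them. The left limit of the trace at \<open>t\<close> is therefore the left limit of
    \<open>w\<close> at \<open>u\<close>, not at \<open>S t\<close>.\<close>
  define X where "X = {s. 0 \<le> s \<and> t \<le> occ s}"
  define u where "u = Inf X"
  have St: "S t \<in> X" unfolding X_def using inverse_occupation[of t] t by simp
  have bdd: "bdd_below X" unfolding X_def by (rule bdd_belowI[of _ 0]) simp
  have before: "occ s < t" if "0 \<le> s" "s < u" for s
  proof (rule ccontr)
    assume "\<not> occ s < t"
    then have "s \<in> X" using that unfolding X_def by simp
    then have "u \<le> s" unfolding u_def by (rule cInf_lower[OF _ bdd])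
    then show False using that by simp
  qed
  have ge: "t \<le> s" if "s \<in> X" for s using that occupation_time_le[of s] unfolding X_def by auto
  have u0: "t \<le> u" unfolding u_def by (rule cInf_greatest) (use St ge in auto)
  have occ_u: "t \<le> occ u"
  proof (rule field_le_epsilon)
    fix e :: real assume "0 < e"
    then have "u < u + e" by simp
    then obtain s where s: "s \<in> X" "s < u + e"
      using cInf_less_iff[of X "u + e"] St bdd unfolding u_def by blast
    have "u \<le> s" unfolding u_def by (rule cInf_lower[OF s(1) bdd])
    then have "occ s \<le> occ u + (s - u)" by (intro occupation_time_bounds) (use u0 t in auto)
    then show "t \<le> occ u + e" using s unfolding X_def by simp
  qed
  have "0 < u" using u0 t by linarith
  then obtain e l where e: "0 < e" "l \<in> E" "\<And>s. u - e < s \<Longrightarrow> s < u \<Longrightarrow> w s = l"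
    using cadlag_left[OF w] by metis
  define v where "v = max 0 (u - e / 2)"
  have v: "0 \<le> v" "v < u" "u - e < v" using e \<open>0 < u\<close> by (auto simp: v_def)
  define b where "b = t - occ v"
  have b: "0 < b" using before[OF v(1,2)] by (simp add: b_def)
  have tr: "trace_path A w s = l \<and> l \<in> A" if s: "t - b < s" "s < t" for s
  proof -
    have "occ v < s" using s by (simp add: b_def)
    moreover have "0 \<le> occ v" by (rule occupation_time_nonneg[OF v(1)])
    ultimately have s0: "0 \<le> s" by simp
    have "v < S s" by (rule less_inverse_occupation[OF s0 v(1) \<open>occ v < s\<close>])
    moreover have "S s < u" by (rule inverse_occupation_less[OF s0]) (use \<open>0 < u\<close> occ_u s in auto)
    ultimately have "w (S s) = l" using v by (intro e(3)) auto
    then show ?thesis unfolding trace_path_def using inverse_occupation(3)[OF s0] by simp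
  qed
  have "l \<in> A" using tr[of "t - b / 2"] b by simp
  then show "\<exists>l\<in>A. \<exists>e>0. \<forall>s. t - e < s \<and> s < t \<longrightarrow> trace_path A w s = l"
    using tr b by blast
qed

end

lemma grid_sum_integral:
  assumes "0 < q"
  shows "((\<lambda>u. indicator A (w ((real (nat \<lfloor>q * u\<rfloor>) + 1) / q)) :: real) has_integral
           (\<Sum>i<j. indicator A (w (real (Suc i) / q))) / q) {0..real j / q}"
proof (induction j)
  case 0
  then show ?case using has_integral_refl(2)[of _ "0::real"] by simp
next
  case (Suc j)
  let ?c = "indicator A (w (real (Suc j) / q)) :: real"
  have le: "real j / q \<le> real (Suc j) / q" using assms by (intro divide_right_mono) auto
  have "((\<lambda>_. ?c) has_integral (real (Suc j) / q - real j / q) *\<^sub>R ?c) {real j / q..real (Suc j) / q}"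
    using has_integral_const_real[of ?c "real j / q" "real (Suc j) / q"] le by simp
  moreover have "real (Suc j) / q - real j / q = 1 / q" by (simp add: diff_divide_distrib[symmetric])
  ultimately have "((\<lambda>_. ?c) has_integral ?c / q) {real j / q..real (Suc j) / q}" by simp
  then have 2: "((\<lambda>u. indicator A (w ((real (nat \<lfloor>q * u\<rfloor>) + 1) / q))) has_integral ?c / q)
      {real j / q..real (Suc j) / q}"
  proof (rule has_integral_spike[of "{real (Suc j) / q}", rotated 2])
    fix u assume "u \<in> {real j / q..real (Suc j) / q} - {real (Suc j) / q}"
    then have "real j / q \<le> u" "u < real (Suc j) / q" by auto
    then have "real j \<le> q * u" "q * u < real (Suc j)" using assms
      by (simp_all add: pos_divide_le_eq pos_less_divide_eq mult.commute)
    then have "nat \<lfloor>q * u\<rfloor> = j" by linarith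
    then show "indicator A (w ((real (nat \<lfloor>q * u\<rfloor>) + 1) / q)) = ?c" by (simp add: add.commute)
  qed simp
  have 3: "(\<Sum>i<Suc j. indicator A (w (real (Suc i) / q)) :: real) / q =
      (\<Sum>i<j. indicator A (w (real (Suc i) / q))) / q + ?c / q"
    by (simp add: add_divide_distrib)
  show ?case unfolding 3
    by (rule has_integral_combine[OF _ le Suc 2]) (use assms in auto)
qed

end

text \<open>Grid version of the trace: grid times spent outside \<open>A\<close> are deleted, so
  that entry \<open>i\<close> is close to the trace at local time \<open>i / q\<close>. A finite
  list keeps measurability and the comparison of laws elementary.\<close>

definition visits :: "'a set \<Rightarrow> (real \<Rightarrow> 'a) \<Rightarrow> real \<Rightarrow> nat \<Rightarrow> 'a list" where
  "visits A w q n = filter (\<lambda>a. a \<in> A) (map (\<lambda>i. w (real i / q)) [0..<n])"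

lemma visits_0: "visits A w q 0 = []"
  by (simp add: visits_def)

lemma visits_Suc:
  "visits A w q (Suc n) = visits A w q n @ (if w (real n / q) \<in> A then [w (real n / q)] else [])"
  by (simp add: visits_def)

lemma length_visits: "real (length (visits A w q n)) = (\<Sum>i<n. indicator A (w (real i / q)))"
  by (induction n) (auto simp: visits_0 visits_Suc)

lemma length_visits_mono: "i \<le> j \<Longrightarrow> length (visits A w q i) \<le> length (visits A w q j)"
  by (rule lift_Suc_mono_le[of "\<lambda>i. length (visits A w q i)"]) (auto simp: visits_Suc)

lemma visits_nth:
  assumes "i < length (visits A w q n)"
  shows "\<exists>j<n. w (real j / q) \<in> A \<and> visits A w q n ! i = w (real j / q) \<and> length (visits A w q j) = i"
  using assms
proof (induction n)
  case (Suc n)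
  show ?case
  proof (cases "i < length (visits A w q n)")
    case True
    then show ?thesis using Suc.IH by (auto simp: visits_Suc nth_append intro: less_SucI)
  next
    case False
    then have "w (real n / q) \<in> A" "i = length (visits A w q n)"
      using Suc.prems by (auto simp: visits_Suc split: if_splits)
    then show ?thesis by (intro exI[of _ n]) (auto simp: visits_Suc)
  qed
qed (simp add: visits_0)

lemma set_visits: "set (visits A w q n) \<subseteq> A"
  by (auto simp: visits_def)

text \<open>The Riemann sum over right grid points differs from the occupation time by at most the
  distance in mean of the two integrands on the whole of \<open>{0..M}\<close>, which tends to 0 by
  dominated convergence. That bound is common to all \<open>j\<close>, whence the
  uniformity.\<close>

lemma occupation_time_visits:
  assumes w: "cadlag E w" and q: "filterlim q at_top sequentially" and "0 \<le> M" "0 < e"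
  shows "\<forall>\<^sub>F n in sequentially. \<forall>j. real j \<le> q n * M \<longrightarrow>
           \<bar>occupation_time A w (real j / q n) - real (length (visits A w (q n) j)) / q n\<bar> \<le> e"
proof -
  let ?I = "\<lambda>u. indicator A (w u) :: real"
  let ?J = "\<lambda>n u. indicator A (w ((real (nat \<lfloor>q n * u\<rfloor>) + 1) / q n)) :: real"
  let ?d = "\<lambda>n u. \<bar>?J n u - ?I u\<bar>"
  have mJ: "?J n \<in> borel_measurable borel" for n
    by (rule grid_indicator_measurable[of "\<lambda>i. indicator A (w ((real i + 1) / q n))"])
  have mI: "(\<lambda>u. indicator {0..} u * ?I u) \<in> borel_measurable borel"
    by (rule cadlag_indicator_measurable[OF w])
  have "(\<lambda>u. \<bar>indicator {0..} u * ?J n u - indicator {0..} u * ?I u\<bar>) \<in> borel_measurable borel" for n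
    using mI mJ[of n] by measurable
  moreover have "(\<lambda>u. \<bar>indicator {0..} u * ?J n u - indicator {0..} u * ?I u\<bar>) =
      (\<lambda>u. indicator {0..} u * ?d n u)" for n
    by (auto simp: indicator_def)
  ultimately have md: "(\<lambda>u. indicator {0..} u * ?d n u) \<in> borel_measurable borel" for n by (simp only:)
  have "set_integrable lborel {0..M} (?d n)" for n
    by (rule set_integrable_bounded_interval[OF md, where B = 1]) (auto simp: indicator_def)
  then have di: "?d n integrable_on {0..M}" for n
    using set_borel_integral_eq_integral(1) by blast
  have "(\<lambda>n. integral {0..M} (?d n)) \<longlonglongrightarrow> integral {0..M} (\<lambda>_. 0)"
  proof (rule dominated_convergence(2)[OF di, of "\<lambda>_. 1"])
    show "(\<lambda>n. ?d n u) \<longlonglongrightarrow> 0" if "u \<in> {0..M}" for u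
    proof (rule tendsto_eventually)
      have "0 \<le> u" using that by simp
      from cadlag_right_grid[OF w q this] show "\<forall>\<^sub>F n in sequentially. ?d n u = 0"
        by (rule eventually_mono) simp
    qed
  qed (auto simp: indicator_def)
  then have "(\<lambda>n. integral {0..M} (?d n)) \<longlonglongrightarrow> 0" by simp
  then have 1: "\<forall>\<^sub>F n in sequentially. integral {0..M} (?d n) < e / 2"
    by (rule order_tendstoD) (use \<open>0 < e\<close> in simp)
  have 2: "\<forall>\<^sub>F n in sequentially. 2 / e \<le> q n" using q unfolding filterlim_at_top by blast
  from 1 2 show ?thesis
  proof eventually_elim
    case (elim n)
    have "0 < 2 / e" using \<open>0 < e\<close> by simp
    then have qn: "0 < q n" using elim by linarith
    have qe: "1 / q n \<le> e / 2" using elim(2) \<open>0 < e\<close> qn by (simp add: field_simps)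
    show ?case
    proof (intro allI impI)
      fix j assume j: "real j \<le> q n * M"
      let ?t = "real j / q n"
      have t: "0 \<le> ?t" "?t \<le> M" using j qn by (auto simp: pos_divide_le_eq mult.commute)
      have sub: "{0..?t} \<subseteq> {0..M}" using t by auto
      note gi = grid_sum_integral[OF w qn, of A j]
      have Iint: "?I integrable_on {0..?t}" by (rule visits_integrable_on[OF w]) simp
      have dint: "?d n integrable_on {0..?t}" by (rule integrable_on_subinterval[OF di sub])
      have "occupation_time A w ?t - (\<Sum>i<j. ?I (real (Suc i) / q n)) / q n = integral {0..?t} (\<lambda>u. ?I u - ?J n u)"
        unfolding occupation_time_eq[OF w] integral_unique[OF gi, symmetric]
        by (rule Henstock_Kurzweil_Integration.integral_diff[symmetric, OF Iint has_integral_integrable[OF gi]])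
      also have "\<bar>\<dots>\<bar> \<le> integral {0..?t} (?d n)"
        using integral_norm_bound_integral[OF integrable_diff[OF Iint has_integral_integrable[OF gi]] dint]
        by (simp add: abs_minus_commute)
      also have "\<dots> \<le> integral {0..M} (?d n)"
        by (rule integral_subset_le[OF sub dint di]) auto
      finally have 3: "\<bar>occupation_time A w ?t - (\<Sum>i<j. ?I (real (Suc i) / q n)) / q n\<bar> < e / 2"
        using elim(1) by simp
      \<comment> \<open>The integral involves the grid points 1 to \<open>j\<close>, the list of
        visits the points 0 to \<open>j - 1\<close>; the shift costs at most
        \<open>1 / q n\<close>.\<close>
      have "(\<Sum>i<j. ?I (real (Suc i) / q n)) = (\<Sum>i<Suc j. ?I (real i / q n)) - ?I 0"
        by (subst sum.lessThan_Suc_shift) simp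
      then have "(\<Sum>i<j. ?I (real (Suc i) / q n)) = real (length (visits A w (q n) j)) + (?I ?t - ?I 0)"
        by (simp add: length_visits)
      then have "(\<Sum>i<j. ?I (real (Suc i) / q n)) / q n =
          real (length (visits A w (q n) j)) / q n + (?I ?t - ?I 0) / q n"
        by (simp add: add_divide_distrib)
      moreover have "\<bar>(?I ?t - ?I 0) / q n\<bar> \<le> 1 / q n"
        using qn by (auto simp: indicator_def)
      ultimately show "\<bar>occupation_time A w ?t - real (length (visits A w (q n) j)) / q n\<bar> \<le> e"
        using 3 qe by linarith
    qed
  qed
qed

lemma cadlag_map:
  assumes w: "cadlag A w" and \<sigma>: "\<And>a. a \<in> A \<Longrightarrow> \<sigma> a \<in> S"
  shows "cadlag S (\<lambda>t. \<sigma> (w t))"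
  unfolding cadlag_iff
proof (intro conjI allI impI)
  fix t :: real assume t: "0 \<le> t"
  show "\<sigma> (w t) \<in> S" by (rule \<sigma>[OF cadlag_in[OF w t]])
  obtain e where e: "0 < e" "\<And>s. t \<le> s \<Longrightarrow> s < t + e \<Longrightarrow> w s = w t"
    using cadlag_right[OF w t] by blast
  have "\<sigma> (w s) = \<sigma> (w t)" if "t \<le> s" "s < t + e" for s using e(2)[OF that] by (rule arg_cong)
  then show "\<exists>e>0. \<forall>s. t \<le> s \<and> s < t + e \<longrightarrow> \<sigma> (w s) = \<sigma> (w t)" using e(1) by blast
next
  fix t :: real assume t: "0 < t"
  obtain e l where e: "0 < e" "l \<in> A" "\<And>s. t - e < s \<Longrightarrow> s < t \<Longrightarrow> w s = l"
    using cadlag_left[OF w t] by blast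
  have "\<sigma> (w s) = \<sigma> l" if "t - e < s" "s < t" for s using e(3)[OF that] by (rule arg_cong)
  then show "\<exists>l\<in>S. \<exists>e>0. \<forall>s. t - e < s \<and> s < t \<longrightarrow> \<sigma> (w s) = l"
    using e(1) \<sigma>[OF e(2)] by blast
qed

lemma cadlag_grid:
  assumes q: "0 < q" and g: "\<And>i. g i \<in> E"
  shows "cadlag E (\<lambda>t. g (nat \<lfloor>q * t\<rfloor>))"
  unfolding cadlag_iff
proof (intro conjI allI impI)
  fix t :: real assume t: "0 \<le> t"
  show "g (nat \<lfloor>q * t\<rfloor>) \<in> E" by (rule g)
  define i where "i = nat \<lfloor>q * t\<rfloor>"
  have i: "real i \<le> q * t" "q * t < real i + 1"
    unfolding i_def using nat_floor_bounds[of "q * t"] t q by auto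
  define e where "e = (real i + 1) / q - t"
  have "0 < e" unfolding e_def using i q by (simp add: pos_less_divide_eq mult.commute)
  moreover have "nat \<lfloor>q * s\<rfloor> = i" if "t \<le> s" "s < t + e" for s
  proof -
    have "s < (real i + 1) / q" using that unfolding e_def by simp
    then have "q * s < real i + 1" using q by (simp add: pos_less_divide_eq mult.commute)
    moreover have "q * t \<le> q * s" using that q by simp
    ultimately show ?thesis using i by linarith
  qed
  ultimately show "\<exists>e>0. \<forall>s. t \<le> s \<and> s < t + e \<longrightarrow> g (nat \<lfloor>q * s\<rfloor>) = g (nat \<lfloor>q * t\<rfloor>)"
    unfolding i_def[symmetric] by (intro exI[of _ e]) simp
next
  fix t :: real assume t: "0 < t"
  define i where "i = nat \<lceil>q * t\<rceil> - 1"
  have "0 < q * t" using q t by simp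
  then have i: "real i < q * t" "q * t \<le> real i + 1" unfolding i_def by linarith+
  define e where "e = t - real i / q"
  have "0 < e" unfolding e_def using i q by (simp add: pos_divide_less_eq mult.commute)
  moreover have "nat \<lfloor>q * s\<rfloor> = i" if "t - e < s" "s < t" for s
  proof -
    have "real i / q < s" using that unfolding e_def by simp
    then have "real i < q * s" using q by (simp add: pos_divide_less_eq mult.commute)
    moreover have "q * s < q * t" using that q by simp
    ultimately show ?thesis using i by linarith
  qed
  ultimately show "\<exists>l\<in>E. \<exists>e>0. \<forall>s. t - e < s \<and> s < t \<longrightarrow> g (nat \<lfloor>q * s\<rfloor>) = l"
    using g[of i] by (intro bexI[of _ "g i"] exI[of _ e]) simp_all
qed

text \<open>Beyond the end of the list the last entry is kept, and \<open>x\<close> stands in for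
  the empty list. So every list over the state space gives an element of the path space, to which a
  functional can be applied whatever the length.\<close>

definition step_path :: "'a \<Rightarrow> real \<Rightarrow> 'a list \<Rightarrow> real \<Rightarrow> 'a" where
  "step_path x q h = (\<lambda>t\<in>{0..}. if h = [] then x else h ! min (nat \<lfloor>q * t\<rfloor>) (length h - 1))"

lemma step_path_in_path_space:
  assumes "0 < q" "x \<in> E" "set h \<subseteq> E"
  shows "step_path x q h \<in> path_space E"
proof -
  let ?g = "\<lambda>i. if h = [] then x else h ! min i (length h - 1)"
  have "?g i \<in> E" for i
    using assms(2) by (cases h) (auto intro!: subsetD[OF assms(3)] nth_mem simp: min_less_iff_disj)
  from cadlag_grid[of q ?g, OF assms(1) this] have "cadlag E (step_path x q h)"
    by (rule cadlag_cong) (simp add: step_path_def)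
  then show ?thesis by (simp add: path_space_def step_path_def)
qed

text \<open>Let \<open>J n i\<close> be the grid index of visit number \<open>i\<close>. The trace
  at the occupation time of that instant is the visited state, and this occupation time is close to
  \<open>i / q n\<close>, so the step path is a discretization of the trace with this clock.
  Agreement of \<open>v n\<close> with the step path is required on compact intervals only, so that
  lists with an altered tail are covered too.\<close>

lemma step_path_visits_converges:
  assumes w: "cadlag E w" and unb: "\<And>K. \<exists>s\<ge>0. K < occupation_time A w s"
    and \<sigma>: "\<And>a. a \<in> A \<Longrightarrow> \<sigma> a \<in> S"
    and q: "filterlim q at_top sequentially"
    and N: "filterlim (\<lambda>n. real (N n) / q n) at_top sequentially"
    and v: "\<And>K::nat. \<forall>\<^sub>F n in sequentially. \<forall>t\<in>{0..real K}.
              v n t = step_path x (q n) (map \<sigma> (visits A w (q n) (N n))) t"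
  shows "skorokhod_converges v (\<lambda>t. \<sigma> (trace_path A w t))"
proof -
  define len where "len n = length (visits A w (q n) (N n))" for n
  have "\<exists>j. \<forall>i<len n. j i < N n \<and> w (real (j i) / q n) \<in> A \<and>
      visits A w (q n) (N n) ! i = w (real (j i) / q n) \<and> length (visits A w (q n) (j i)) = i" for n
    using visits_nth[of _ A w "q n" "N n"] unfolding len_def by (intro choice allI) blast
  then obtain J where J: "\<And>n i. i < len n \<Longrightarrow> J n i < N n"
      "\<And>n i. i < len n \<Longrightarrow> w (real (J n i) / q n) \<in> A"
      "\<And>n i. i < len n \<Longrightarrow> visits A w (q n) (N n) ! i = w (real (J n i) / q n)"
      "\<And>n i. i < len n \<Longrightarrow> length (visits A w (q n) (J n i)) = i"
    by metis
  \<comment> \<open>The absolute value keeps the clock nonnegative also for the finitely many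
    \<open>n\<close> for which \<open>q n\<close> may be negative.\<close>
  define \<theta> where "\<theta> n i = occupation_time A w \<bar>real (J n i) / q n\<bar>" for n i
  have q1: "\<forall>\<^sub>F n in sequentially. 1 \<le> q n" using q unfolding filterlim_at_top by blast
  have J_mono: "J n i \<le> J n i'" if "i \<le> i'" "i' < len n" for n i i'
  proof (rule ccontr)
    assume "\<not> J n i \<le> J n i'"
    then have "Suc (J n i') \<le> J n i" by simp
    then have "length (visits A w (q n) (Suc (J n i'))) \<le> length (visits A w (q n) (J n i))"
      by (rule length_visits_mono)
    moreover have "length (visits A w (q n) (Suc (J n i'))) = Suc i'"
      using J(2,4)[OF that(2)] by (simp add: visits_Suc)
    ultimately show False using J(4)[of i n] that by simp
  qed
  have "\<exists>M\<ge>0. \<forall>\<^sub>F n in sequentially. \<forall>i. real i \<le> q n * real K \<longrightarrow> i < len n \<and> real (J n i) \<le> q n * M"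
    for K :: nat
  proof -
    \<comment> \<open>One unit of local time is lost by rounding \<open>M\<close> down to the grid,
      another one in the approximation of the occupation time by the number of visits.\<close>
    obtain M where M: "0 \<le> M" "real K + 3 < occupation_time A w M" using unb[of "real K + 3"] by auto
    have M1: "\<forall>\<^sub>F n in sequentially. M \<le> real (N n) / q n" using N unfolding filterlim_at_top by blast
    have "\<forall>\<^sub>F n in sequentially. \<forall>i. real i \<le> q n * real K \<longrightarrow> i < len n \<and> real (J n i) \<le> q n * M"
      using q1 M1 occupation_time_visits[OF w q M(1) zero_less_one, of A]
    proof eventually_elim
      case (elim n)
      define j0 where "j0 = nat \<lfloor>q n * M\<rfloor>"
      have j0: "real j0 \<le> q n * M" "q n * M < real j0 + 1"
        unfolding j0_def using nat_floor_bounds[of "q n * M"] elim(1) M(1) by auto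
      have t: "0 \<le> real j0 / q n" "real j0 / q n \<le> M" "M \<le> real j0 / q n + 1"
      proof -
        show "0 \<le> real j0 / q n" using elim(1) by simp
        show "real j0 / q n \<le> M" using elim(1) j0(1) by (simp add: pos_divide_le_eq mult.commute)
        have "M < (real j0 + 1) / q n" using elim(1) j0(2) by (simp add: pos_less_divide_eq mult.commute)
        also have "\<dots> = real j0 / q n + 1 / q n" by (simp add: add_divide_distrib)
        also have "1 / q n \<le> 1" using elim(1) by simp
        finally show "M \<le> real j0 / q n + 1" by simp
      qed
      have "real K + 2 < occupation_time A w (real j0 / q n)"
        using occupation_time_bounds(2)[OF w t(1,2), of A] M(2) t(3) by linarith
      moreover have "\<bar>occupation_time A w (real j0 / q n) - real (length (visits A w (q n) j0)) / q n\<bar> \<le> 1"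
        using elim(3) j0(1) by blast
      ultimately have "real K < real (length (visits A w (q n) j0)) / q n" by linarith
      then have big: "q n * real K < real (length (visits A w (q n) j0))"
        using elim(1) by (simp add: pos_less_divide_eq mult.commute)
      have "real j0 \<le> real (N n)" using j0(1) elim(1,2) by (simp add: pos_le_divide_eq mult.commute)
      then have lenle: "length (visits A w (q n) j0) \<le> len n"
        unfolding len_def by (intro length_visits_mono) simp
      show ?case
      proof (intro allI impI)
        fix i assume i: "real i \<le> q n * real K"
        then have il: "i < length (visits A w (q n) j0)" using big by linarith
        then have i_len: "i < len n" using lenle by simp
        have "J n i < j0"
        proof (rule ccontr)
          assume "\<not> J n i < j0"
          then have "length (visits A w (q n) j0) \<le> length (visits A w (q n) (J n i))"
            by (intro length_visits_mono) simp
          then show False using J(4)[OF i_len] il by simp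
        qed
        then have "real (J n i) \<le> real j0" by simp
        then show "i < len n \<and> real (J n i) \<le> q n * M" using i_len j0(1) by simp
      qed
    qed
    then show ?thesis using M(1) by blast
  qed
  then have "\<exists>M. \<forall>K::nat. 0 \<le> M K \<and>
      (\<forall>\<^sub>F n in sequentially. \<forall>i. real i \<le> q n * real K \<longrightarrow> i < len n \<and> real (J n i) \<le> q n * M K)"
    by (intro choice allI)
  then obtain M where M': "\<forall>K::nat. 0 \<le> M K \<and>
      (\<forall>\<^sub>F n in sequentially. \<forall>i. real i \<le> q n * real K \<longrightarrow> i < len n \<and> real (J n i) \<le> q n * M K)" ..
  note M = M'[rule_format, THEN conjunct1] and early = M'[rule_format, THEN conjunct2]
  have cad: "cadlag S (\<lambda>t. \<sigma> (trace_path A w t))"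
    by (rule cadlag_map[OF cadlag_trace_path[OF w unb] \<sigma>])
  show ?thesis
  proof (rule skorokhod_converges_discretization[OF cad q, of \<theta>])
    show "0 \<le> \<theta> n i" for n i unfolding \<theta>_def by (rule occupation_time_nonneg[OF w]) simp
  next
    fix K :: nat
    show "\<forall>\<^sub>F n in sequentially. \<forall>t\<in>{0..real K}. v n t = \<sigma> (trace_path A w (\<theta> n (nat \<lfloor>q n * t\<rfloor>)))"
      using v[of K] early[of K] q1
    proof eventually_elim
      case (elim n)
      show ?case
      proof
        fix t assume t: "t \<in> {0..real K}"
        define i where "i = nat \<lfloor>q n * t\<rfloor>"
        have "real i \<le> q n * t" unfolding i_def using nat_floor_bounds(1)[of "q n * t"] t elim(3) by simp
        also have "\<dots> \<le> q n * real K" using t elim(3) by (intro mult_left_mono) auto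
        finally have i: "i < len n" using elim(2) by blast
        then have ne: "visits A w (q n) (N n) \<noteq> []" "i < length (visits A w (q n) (N n))"
          unfolding len_def by auto
        have "v n t = map \<sigma> (visits A w (q n) (N n)) ! i"
          using elim(1) t ne unfolding step_path_def i_def[symmetric] by (auto simp: i_def[symmetric] min_def)
        also have "\<dots> = \<sigma> (w (real (J n i) / q n))" using ne J(3)[OF i] by simp
        also have "w (real (J n i) / q n) = trace_path A w (\<theta> n i)"
          unfolding \<theta>_def using elim(3) J(2)[OF i] by (subst trace_path_occupation[OF w]) auto
        finally show "v n t = \<sigma> (trace_path A w (\<theta> n (nat \<lfloor>q n * t\<rfloor>)))" by (simp add: i_def)
      qed
    qed
    show "\<forall>\<^sub>F n in sequentially. mono_on {i. real i \<le> q n * real K} (\<theta> n)"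
      using early[of K] q1
    proof eventually_elim
      case (elim n)
      show ?case
      proof (rule mono_onI)
        fix i i' assume "i \<in> {i. real i \<le> q n * real K}" "i' \<in> {i. real i \<le> q n * real K}" "i \<le> i'"
        then have "J n i \<le> J n i'" using elim(1) by (intro J_mono) auto
        then have "real (J n i) / q n \<le> real (J n i') / q n" using elim(2) by (intro divide_right_mono) auto
        then show "\<theta> n i \<le> \<theta> n i'"
          unfolding \<theta>_def using elim(2) by (intro occupation_time_bounds[OF w]) auto
      qed
    qed
  next
    fix K :: nat and e :: real assume e: "0 < e"
    show "\<forall>\<^sub>F n in sequentially. \<forall>i. real i \<le> q n * real K \<longrightarrow> \<bar>\<theta> n i - real i / q n\<bar> \<le> e"
      using early[of K] q1 occupation_time_visits[OF w q M[of K] e, of A]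
    proof eventually_elim
      case (elim n)
      show ?case
      proof (intro allI impI)
        fix i assume "real i \<le> q n * real K"
        then have i: "i < len n" "real (J n i) \<le> q n * M K" using elim(1) by auto
        then have "\<bar>occupation_time A w (real (J n i) / q n) - real i / q n\<bar> \<le> e"
          using elim(3) J(4)[OF i(1)] by metis
        then show "\<bar>\<theta> n i - real i / q n\<bar> \<le> e" unfolding \<theta>_def using elim(2) by simp
      qed
    qed
  qed
qed

section \<open>Jump processes observed on a grid\<close>

text \<open>Conditional expectation of \<open>F\<close> of the history of a chain with kernel \<open>R\<close> that has \<open>j\<close> more steps
  to go, given the history \<open>h\<close> so far.\<close>

primrec backward :: "('s \<Rightarrow> 's \<Rightarrow> real) \<Rightarrow> 's set \<Rightarrow> ('s list \<Rightarrow> real) \<Rightarrow> nat \<Rightarrow> 's list \<Rightarrow> real" where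
  "backward R S F 0 h = F h"
| "backward R S F (Suc j) h = (\<Sum>b\<in>S. R (last h) b * backward R S F j (h @ [b]))"

lemma backward_bound:
  assumes "\<And>h. \<bar>F h\<bar> \<le> M" "\<And>a b. a \<in> S \<Longrightarrow> b \<in> S \<Longrightarrow> 0 \<le> R a b" "\<And>a. a \<in> S \<Longrightarrow> (\<Sum>b\<in>S. R a b) = 1"
    and "h \<noteq> []" "set h \<subseteq> S"
  shows "\<bar>backward R S F j h\<bar> \<le> M"
  using assms(4,5)
proof (induction j arbitrary: h)
  case 0
  then show ?case using assms(1) by simp
next
  case (Suc j)
  have l: "last h \<in> S" using Suc.prems by (meson last_in_set subsetD)
  have "\<bar>backward R S F (Suc j) h\<bar> \<le> (\<Sum>b\<in>S. \<bar>R (last h) b * backward R S F j (h @ [b])\<bar>)"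
    by simp
  also have "\<dots> \<le> (\<Sum>b\<in>S. R (last h) b * M)"
    unfolding abs_mult
    by (intro sum_mono mult_mono) (use Suc assms(2)[OF l] in auto)
  also have "\<dots> = M" using assms(3)[OF l] by (simp add: sum_distrib_right[symmetric])
  finally show ?case .
qed

text \<open>\<open>p m\<close> is the transition matrix over the time \<open>1 / m\<close>, and \<open>q\<close> is the matrix of the jump rates.\<close>

locale jump_process = prob_space P
  for P :: "'w measure" +
  fixes E :: "'a set" and Y :: "real \<Rightarrow> 'w \<Rightarrow> 'a"
    and p :: "real \<Rightarrow> 'a \<Rightarrow> 'a \<Rightarrow> real" and q :: "'a \<Rightarrow> 'a \<Rightarrow> real" and C :: real
  assumes finite_E: "finite E"
    and measurable_Y: "0 \<le> t \<Longrightarrow> Y t \<in> measurable P (count_space E)"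
    and cadlag_Y: "\<omega> \<in> space P \<Longrightarrow> cadlag E (\<lambda>t. Y t \<omega>)"
    and markov: "1 \<le> m \<Longrightarrow> (\<And>k. k \<le> Suc n \<Longrightarrow> c k \<in> E) \<Longrightarrow>
      measure P {\<omega>\<in>space P. \<forall>k\<le>Suc n. Y (real k / m) \<omega> = c k} =
      measure P {\<omega>\<in>space P. \<forall>k\<le>n. Y (real k / m) \<omega> = c k} * p m (c n) (c (Suc n))"
    and p_expansion: "1 \<le> m \<Longrightarrow> a \<in> E \<Longrightarrow> b \<in> E \<Longrightarrow> \<bar>p m a b - of_bool (a = b) - q a b / m\<bar> \<le> C / m\<^sup>2"
    and q_row: "a \<in> E \<Longrightarrow> (\<Sum>b\<in>E. q a b) = 0"
begin

definition gen :: "('a \<Rightarrow> real) \<Rightarrow> 'a \<Rightarrow> real" where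
  "gen f a = (\<Sum>b\<in>E. q a b * f b)"

definition hist :: "real \<Rightarrow> nat \<Rightarrow> 'w \<Rightarrow> 'a list" where
  "hist m n \<omega> = map (\<lambda>i. Y (real i / m) \<omega>) [0..<Suc n]"

definition paths :: "nat \<Rightarrow> 'a list set" where
  "paths n = {as. set as \<subseteq> E \<and> length as = Suc n}"

lemma finite_paths: "finite (paths n)"
  unfolding paths_def by (rule finite_lists_length_eq[OF finite_E])

lemma Y_in: "\<omega> \<in> space P \<Longrightarrow> 0 \<le> t \<Longrightarrow> Y t \<omega> \<in> E"
  using cadlag_in[OF cadlag_Y] by blast

lemma hist_Suc: "hist m (Suc n) \<omega> = hist m n \<omega> @ [Y (real (Suc n) / m) \<omega>]"
  by (simp add: hist_def)

lemma last_hist: "last (hist m n \<omega>) = Y (real n / m) \<omega>"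
  by (simp add: hist_def)

lemma butlast_hist: "butlast (hist m n \<omega>) = map (\<lambda>i. Y (real i / m) \<omega>) [0..<n]"
  by (simp add: hist_def)

lemma visits_hist: "filter (\<lambda>a. a \<in> A) (butlast (hist m n \<omega>)) = visits A (\<lambda>t. Y t \<omega>) m n"
  by (simp add: butlast_hist visits_def)

lemma hist_paths: "1 \<le> m \<Longrightarrow> \<omega> \<in> space P \<Longrightarrow> hist m n \<omega> \<in> paths n"
  unfolding hist_def paths_def by (auto intro!: Y_in)

lemma hist_eq_iff:
  assumes "length as = Suc n"
  shows "hist m n \<omega> = as \<longleftrightarrow> (\<forall>k\<le>n. Y (real k / m) \<omega> = as ! k)"
  using assms by (auto simp: hist_def list_eq_iff_nth_eq less_Suc_eq_le simp del: upt_Suc)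

lemma Y_event: "0 \<le> t \<Longrightarrow> {\<omega>\<in>space P. Y t \<omega> = a} \<in> events"
proof -
  assume t: "0 \<le> t"
  have "{\<omega>\<in>space P. Y t \<omega> = a} = Y t -` ({a} \<inter> E) \<inter> space P" using Y_in t by auto
  then show ?thesis using measurable_sets[OF measurable_Y[OF t], of "{a} \<inter> E"] by auto
qed

lemma hist_event: "1 \<le> m \<Longrightarrow> {\<omega>\<in>space P. hist m n \<omega> = as} \<in> events"
proof (induction n arbitrary: as)
  case 0
  have "{\<omega>\<in>space P. hist m 0 \<omega> = as} = (if length as = 1 then {\<omega>\<in>space P. Y 0 \<omega> = as ! 0} else {})"
    by (cases as) (auto simp: hist_def)
  then show ?case using Y_event[of 0] by simp
next
  case (Suc n)
  have "{\<omega>\<in>space P. hist m (Suc n) \<omega> = as} =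
      (if as = [] then {} else {\<omega>\<in>space P. hist m n \<omega> = butlast as} \<inter> {\<omega>\<in>space P. Y (real (Suc n) / m) \<omega> = last as})"
    by (cases as rule: rev_cases) (auto simp: hist_Suc)
  then show ?case using Suc Y_event[of "real (Suc n) / m" "last as"] by auto
qed

definition pr :: "real \<Rightarrow> nat \<Rightarrow> 'a list \<Rightarrow> real" where
  "pr m n as = prob {\<omega>\<in>space P. hist m n \<omega> = as}"

lemma pr_nonneg: "0 \<le> pr m n as"
  by (simp add: pr_def)

lemma pr_append:
  assumes m: "1 \<le> m" and as: "as \<in> paths n" and b: "b \<in> E"
  shows "pr m (Suc n) (as @ [b]) = pr m n as * p m (last as) b"
proof -
  have len: "length as = Suc n" and sub: "set as \<subseteq> E" using as by (auto simp: paths_def)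
  let ?a = "\<lambda>k. (as @ [b]) ! k"
  have "measure P {\<omega>\<in>space P. \<forall>k\<le>Suc n. Y (real k / m) \<omega> = ?a k} =
      measure P {\<omega>\<in>space P. \<forall>k\<le>n. Y (real k / m) \<omega> = ?a k} * p m (?a n) (?a (Suc n))"
  proof (rule markov[OF m])
    fix k assume "k \<le> Suc n"
    then have "?a k \<in> set (as @ [b])" using len by (intro nth_mem) simp
    then show "?a k \<in> E" using sub b by auto
  qed
  moreover have "?a n = last as" using len by (cases as rule: rev_cases) (auto simp: nth_append)
  moreover have "?a (Suc n) = b" using len by (simp add: nth_append)
  moreover have "{\<omega>\<in>space P. \<forall>k\<le>n. Y (real k / m) \<omega> = ?a k} = {\<omega>\<in>space P. hist m n \<omega> = as}"
    unfolding hist_eq_iff[OF len] using len by (auto simp: nth_append)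
  moreover have "{\<omega>\<in>space P. \<forall>k\<le>Suc n. Y (real k / m) \<omega> = ?a k} = {\<omega>\<in>space P. hist m (Suc n) \<omega> = as @ [b]}"
    using hist_eq_iff[of "as @ [b]" "Suc n" m] len by simp
  ultimately show ?thesis by (simp add: pr_def)
qed

lemma hist_expand:
  assumes "1 \<le> m" "\<omega> \<in> space P"
  shows "G (hist m n \<omega>) = (\<Sum>as\<in>paths n. indicator {\<omega>\<in>space P. hist m n \<omega> = as} \<omega> * G as :: real)"
proof -
  have "(\<Sum>as\<in>paths n. indicator {\<omega>\<in>space P. hist m n \<omega> = as} \<omega> * G as) =
      (\<Sum>as\<in>paths n. if as = hist m n \<omega> then G as else 0)"
    by (rule sum.cong) (use assms in auto)
  then show ?thesis using finite_paths hist_paths[OF assms] by (simp add: sum.delta)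
qed

lemma hist_has_integral:
  assumes m: "1 \<le> m"
  shows "has_bochner_integral P (\<lambda>\<omega>. G (hist m n \<omega>)) (\<Sum>as\<in>paths n. pr m n as * G as :: real)"
proof -
  have "has_bochner_integral P (\<lambda>\<omega>. \<Sum>as\<in>paths n. indicator {\<omega>\<in>space P. hist m n \<omega> = as} \<omega> * G as)
      (\<Sum>as\<in>paths n. pr m n as * G as)"
    unfolding pr_def
    by (intro has_bochner_integral_sum has_bochner_integral_mult_left has_bochner_integral_real_indicator)
       (use hist_event[OF m] in \<open>auto simp: emeasure_eq_measure\<close>)
  then show ?thesis
    by (rule has_bochner_integral_cong[THEN iffD2, rotated 3]) (auto simp: hist_expand[OF m])
qed

lemma hist_integrable: "1 \<le> m \<Longrightarrow> integrable P (\<lambda>\<omega>. G (hist m n \<omega>) :: real)"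
  using hist_has_integral by (rule integrable.intros)

lemma hist_measurable: "1 \<le> m \<Longrightarrow> (\<lambda>\<omega>. G (hist m n \<omega>) :: real) \<in> borel_measurable P"
  using hist_integrable by (rule borel_measurable_integrable)

lemma hist_expectation: "1 \<le> m \<Longrightarrow> expectation (\<lambda>\<omega>. G (hist m n \<omega>)) = (\<Sum>as\<in>paths n. pr m n as * G as :: real)"
  using hist_has_integral by (rule has_bochner_integral_integral_eq)

lemma sum_paths_Suc: "(\<Sum>as\<in>paths (Suc n). f as) = (\<Sum>as\<in>paths n. \<Sum>b\<in>E. f (as @ [b]) :: real)"
proof -
  have "(\<Sum>as\<in>paths n. \<Sum>b\<in>E. f (as @ [b])) = (\<Sum>(as, b)\<in>paths n \<times> E. f (as @ [b]))"
    by (rule sum.cartesian_product)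
  also have "\<dots> = (\<Sum>as\<in>paths (Suc n). f as)"
  proof (rule sum.reindex_bij_witness[of _ "\<lambda>as. (butlast as, last as)" "\<lambda>(as, b). as @ [b]"])
    fix as assume as: "as \<in> paths (Suc n)"
    then have ne: "as \<noteq> []" by (auto simp: paths_def)
    then show "(case (butlast as, last as) of (as, b) \<Rightarrow> as @ [b]) = as" by simp
    show "(butlast as, last as) \<in> paths n \<times> E"
      using as ne by (auto simp: paths_def dest: in_set_butlastD)
  qed (auto simp: paths_def)
  finally show ?thesis by simp
qed

lemma hist_step:
  assumes m: "1 \<le> m"
  shows "expectation (\<lambda>\<omega>. G (hist m (Suc n) \<omega>)) =
    (\<Sum>as\<in>paths n. pr m n as * (\<Sum>b\<in>E. p m (last as) b * G (as @ [b])) :: real)"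
  unfolding hist_expectation[OF m] sum_paths_Suc
  by (intro sum.cong refl) (simp add: sum_distrib_left mult.assoc pr_append[OF m])

lemma hist_step_le:
  assumes m: "1 \<le> m"
    and le: "\<And>as. as \<in> paths n \<Longrightarrow> 0 < pr m n as \<Longrightarrow> (\<Sum>b\<in>E. p m (last as) b * G (as @ [b])) \<le> G' as"
  shows "expectation (\<lambda>\<omega>. G (hist m (Suc n) \<omega>)) \<le> expectation (\<lambda>\<omega>. G' (hist m n \<omega>) :: real)"
  unfolding hist_step[OF m] hist_expectation[OF m]
proof (rule sum_mono)
  fix as assume as: "as \<in> paths n"
  show "pr m n as * (\<Sum>b\<in>E. p m (last as) b * G (as @ [b])) \<le> pr m n as * G' as"
    using le[OF as] pr_nonneg[of m n as] by (cases "pr m n as = 0") (auto intro!: mult_left_mono)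
qed

text \<open>Total probability: the one-step extensions of \<open>as\<close> partition the event that
  the history is \<open>as\<close>. The kernel is constrained exactly only by the Markov property,
  hence the restriction to histories of positive probability.\<close>

lemma p_row:
  assumes m: "1 \<le> m" and as: "as \<in> paths n" "0 < pr m n as"
  shows "(\<Sum>b\<in>E. p m (last as) b) = 1"
proof -
  have "pr m n as = expectation (\<lambda>\<omega>. of_bool (butlast (hist m (Suc n) \<omega>) = as))"
    unfolding pr_def hist_Suc
    by (subst Bochner_Integration.integral_cong[OF refl, of P _ "indicator {\<omega>\<in>space P. hist m n \<omega> = as}"])
       (auto simp: indicator_def hist_event[OF m])
  also have "\<dots> = (\<Sum>as'\<in>paths n. pr m n as' * (\<Sum>b\<in>E. p m (last as') b * of_bool (as' = as)))"
    using hist_step[OF m, of "\<lambda>as'. of_bool (butlast as' = as)" n] by simp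
  also have "\<dots> = (\<Sum>as'\<in>paths n. if as' = as then pr m n as * (\<Sum>b\<in>E. p m (last as) b) else 0)"
    by (intro sum.cong) auto
  also have "\<dots> = pr m n as * (\<Sum>b\<in>E. p m (last as) b)"
    using as finite_paths by (simp add: sum.delta)
  finally show ?thesis using as by simp
qed

lemma last_paths: "as \<in> paths n \<Longrightarrow> last as \<in> E"
  unfolding paths_def by (metis (mono_tags, lifting) last_in_set length_0_conv mem_Collect_eq nat.distinct(1) subsetD)

lemma C_nonneg: "E \<noteq> {} \<Longrightarrow> 0 \<le> C"
  using p_expansion[of 1] by fastforce

lemma p_sum_expansion:
  assumes m: "1 \<le> m" and a: "a \<in> E" and f: "\<And>b. b \<in> E \<Longrightarrow> \<bar>f b\<bar> \<le> B"
  shows "\<bar>(\<Sum>b\<in>E. p m a b * f b) - f a - gen f a / m\<bar> \<le> real (card E) * C * B / m\<^sup>2"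
proof -
  have *: "f a = (\<Sum>b\<in>E. of_bool (a = b) * f b)"
    using a finite_E by (simp add: of_bool_def if_distrib[of "\<lambda>x. x * _"] sum.delta cong: if_cong)
  have C0: "0 \<le> C" using C_nonneg a by auto
  from * have "(\<Sum>b\<in>E. p m a b * f b) - f a - gen f a / m =
      (\<Sum>b\<in>E. (p m a b - of_bool (a = b) - q a b / m) * f b)"
    unfolding gen_def by (simp add: sum_divide_distrib sum_subtractf[symmetric] algebra_simps)
  also have "\<bar>\<dots>\<bar> \<le> (\<Sum>b\<in>E. \<bar>(p m a b - of_bool (a = b) - q a b / m) * f b\<bar>)" by (rule sum_abs)
  also have "\<dots> \<le> (\<Sum>b\<in>E. C / m\<^sup>2 * B)"
    unfolding abs_mult
    by (intro sum_mono mult_mono p_expansion[OF m a] f) (use C0 in auto)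
  finally show ?thesis by simp
qed

lemma gen_affine: "a \<in> E \<Longrightarrow> gen (\<lambda>b. c + e * f b) a = e * gen f a"
  unfolding gen_def using q_row[of a]
  by (simp add: distrib_left sum.distrib sum_distrib_right[symmetric] sum_distrib_left mult.left_commute)

subsection \<open>Recurrence\<close>

text \<open>Supermartingale \<open>(1 - 1/m) ^ (number of visits) * h (Y)\<close> with
  \<open>h = 1 + \<epsilon> * g\<close> between 1 and 2. Outside \<open>A\<close> the function
  \<open>h\<close> decreases on average at rate at least \<open>\<epsilon>\<close>; in
  \<open>A\<close> it may increase, but less than the factor \<open>1 - 1/m\<close> takes away. Both
  cases leave a decay by \<open>1 - \<epsilon> / 4 / m\<close> per step.\<close>

lemma visits_laplace:
  assumes A: "A \<subseteq> E" and g0: "\<And>a. a \<in> E \<Longrightarrow> 0 \<le> g a"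
    and g: "\<And>a. a \<in> E - A \<Longrightarrow> gen g a \<le> - 1"
  shows "\<exists>\<kappa>>0. \<exists>m0\<ge>1. \<forall>m\<ge>m0. \<forall>n.
    expectation (\<lambda>\<omega>. exp (- 2 * real (length (visits A (\<lambda>t. Y t \<omega>) m n)) / m)) \<le> 2 * exp (- \<kappa> * real n / m)"
proof -
  obtain \<omega>0 where "\<omega>0 \<in> space P" using not_empty by blast
  then have E_ne: "E \<noteq> {}" using Y_in[of \<omega>0 0] by auto
  define K where "K = 1 + (\<Sum>a\<in>E. \<bar>g a\<bar> + \<bar>gen g a\<bar>)"
  have Kg: "\<bar>g a\<bar> \<le> K" "\<bar>gen g a\<bar> \<le> K" if "a \<in> E" for a
    using member_le_sum[OF that, of "\<lambda>a. \<bar>g a\<bar> + \<bar>gen g a\<bar>"] finite_E unfolding K_def by auto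
  have K1: "1 \<le> K" unfolding K_def by (simp add: sum_nonneg)
  \<comment> \<open>With this choice \<open>h\<close> stays below 2 and its growth rate inside
    \<open>A\<close> is at most 1/2, half of the loss due to a visit.\<close>
  define \<epsilon> where "\<epsilon> = 1 / (2 * K)"
  have \<epsilon>: "0 < \<epsilon>" "\<epsilon> \<le> 1 / 2" "\<epsilon> * K = 1 / 2" using K1 by (auto simp: \<epsilon>_def field_simps)
  define h where "h a = 1 + \<epsilon> * g a" for a
  have h: "1 \<le> h a" "h a \<le> 2" if "a \<in> E" for a
  proof -
    show "1 \<le> h a" unfolding h_def using \<epsilon> g0[OF that] by simp
    have "\<epsilon> * g a \<le> \<epsilon> * K" using \<epsilon> Kg(1)[OF that] by (intro mult_left_mono) auto
    then show "h a \<le> 2" unfolding h_def using \<epsilon>(3) by simp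
  qed
  define D where "D = real (card E) * C * 2"
  have D: "0 \<le> D" unfolding D_def using C_nonneg[OF E_ne] by simp
  \<comment> \<open>The second term makes the quadratic error of one step at most half of the drift
    \<open>\<epsilon> / m\<close>; the bound 2 is for the comparison of \<open>1 - 1/m\<close> with
    an exponential.\<close>
  define m0 where "m0 = max 2 (2 * D / \<epsilon>)"
  have main: "expectation (\<lambda>\<omega>. exp (- 2 * real (length (visits A (\<lambda>t. Y t \<omega>) m n)) / m)) \<le> 2 * exp (- (\<epsilon> / 4) * real n / m)"
    if m: "m0 \<le> m" for m n
  proof -
    have m2: "2 \<le> m" "2 * D / \<epsilon> \<le> m" using m unfolding m0_def by auto
    then have m1: "1 \<le> m" by simp
    define G where "G as = (1 - 1 / m) ^ length (filter (\<lambda>a. a \<in> A) (butlast as)) * h (last as)" for as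
    have contr: "0 \<le> 1 - \<epsilon> / 4 / m" using m2 \<epsilon> by (simp add: field_simps)
    have small: "D / m\<^sup>2 \<le> \<epsilon> / 2 / m"
    proof -
      have "2 * D \<le> m * \<epsilon>" using m2(2) \<epsilon> by (simp add: pos_divide_le_eq)
      then show ?thesis using m2 by (simp add: field_simps power2_eq_square)
    qed
    have step: "(\<Sum>b\<in>E. p m (last as) b * G (as @ [b])) \<le> (1 - \<epsilon> / 4 / m) * G as" if as: "as \<in> paths k" for as k
    proof -
      let ?a = "last as" and ?z = "(1 - 1 / m) ^ length (filter (\<lambda>a. a \<in> A) (butlast as))"
      let ?y = "if ?a \<in> A then 1 - 1 / m else 1"
      have a: "?a \<in> E" by (rule last_paths[OF as])
      have "as \<noteq> []" using as by (auto simp: paths_def)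
      then have split: "filter (\<lambda>a. a \<in> A) as = filter (\<lambda>a. a \<in> A) (butlast as) @ (if ?a \<in> A then [?a] else [])"
        by (subst append_butlast_last_id[symmetric]) (auto simp del: append_butlast_last_id)
      have z: "0 \<le> ?z" using m2 by simp
      have y: "0 \<le> ?y" "?y \<le> 1" using m2 by (auto simp: field_simps)
      have gh: "gen h ?a = \<epsilon> * gen g ?a"
        using gen_affine[OF a, of 1 \<epsilon> g] unfolding h_def .
      have "\<bar>(\<Sum>b\<in>E. p m ?a b * h b) - h ?a - gen h ?a / m\<bar> \<le> real (card E) * C * 2 / m\<^sup>2"
        by (rule p_sum_expansion[OF m1 a]) (use h in fastforce)
      then have e: "(\<Sum>b\<in>E. p m ?a b * h b) \<le> h ?a + \<epsilon> * gen g ?a / m + \<epsilon> / 2 / m"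
        using small unfolding gh D_def by linarith
      have "?y * (\<Sum>b\<in>E. p m ?a b * h b) \<le> h ?a - \<epsilon> / 2 / m"
      proof (cases "?a \<in> A")
        case False
        then have "\<epsilon> * gen g ?a \<le> \<epsilon> * (- 1)" using g[of ?a] a \<epsilon>(1) by (intro mult_left_mono) auto
        then have "\<epsilon> * gen g ?a / m \<le> - \<epsilon> / m" using m2 by (intro divide_right_mono) auto
        then show ?thesis using e False by (simp add: field_simps)
      next
        case True
        have "\<epsilon> * gen g ?a \<le> \<epsilon> * K" using Kg(2)[OF a] \<epsilon>(1) by (intro mult_left_mono) auto
        then have "\<epsilon> * gen g ?a / m \<le> 1 / 2 / m" using m2 \<epsilon>(3) by (intro divide_right_mono) auto
        moreover have "\<epsilon> / 2 / m \<le> 1 / 4 / m" using m2 \<epsilon> by (intro divide_right_mono) auto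
        ultimately have s: "(\<Sum>b\<in>E. p m ?a b * h b) \<le> h ?a + 3 / 4 / m" using e by (simp add: field_simps)
        have "?y * (\<Sum>b\<in>E. p m ?a b * h b) \<le> ?y * (h ?a + 3 / 4 / m)" by (rule mult_left_mono[OF s y(1)])
        also have "\<dots> = h ?a + 3 / 4 / m - h ?a / m - 3 / 4 / m / m" using True m2 by (simp add: field_simps)
        also have "\<dots> \<le> h ?a + 3 / 4 / m - h ?a / m" using m2 by simp
        also have "\<dots> \<le> h ?a + 3 / 4 / m - 1 / m" using divide_right_mono[OF h(1)[OF a], of m] m2 by linarith
        also have "\<dots> = h ?a - 1 / 4 / m" using m2 by (simp add: field_simps)
        also have "\<dots> \<le> h ?a - \<epsilon> / 2 / m" using \<open>\<epsilon> / 2 / m \<le> 1 / 4 / m\<close> by simp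
        finally show ?thesis .
      qed
      also have "\<dots> \<le> (1 - \<epsilon> / 4 / m) * h ?a"
      proof -
        have "\<epsilon> / 4 / m * h ?a \<le> \<epsilon> / 4 / m * 2" using h(2)[OF a] \<epsilon> m2 by (intro mult_left_mono) auto
        then show ?thesis by (simp add: algebra_simps)
      qed
      finally have f: "?y * (\<Sum>b\<in>E. p m ?a b * h b) \<le> (1 - \<epsilon> / 4 / m) * h ?a" .
      have "(\<Sum>b\<in>E. p m ?a b * G (as @ [b])) = ?z * (?y * (\<Sum>b\<in>E. p m ?a b * h b))"
      proof -
        have "G (as @ [b]) = ?z * ?y * h b" for b
          unfolding G_def by (simp add: split)
        then have "(\<Sum>b\<in>E. p m ?a b * G (as @ [b])) = (\<Sum>b\<in>E. ?z * ?y * (p m ?a b * h b))"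
          by (simp add: algebra_simps)
        then show ?thesis by (simp only: sum_distrib_left[symmetric] mult.assoc)
      qed
      also have "\<dots> \<le> ?z * ((1 - \<epsilon> / 4 / m) * h ?a)" by (rule mult_left_mono[OF f z])
      finally show ?thesis unfolding G_def by (simp add: algebra_simps)
    qed
    have bound: "expectation (\<lambda>\<omega>. G (hist m k \<omega>)) \<le> 2 * (1 - \<epsilon> / 4 / m) ^ k" for k
    proof (induction k)
      case 0
      have "expectation (\<lambda>\<omega>. G (hist m 0 \<omega>)) \<le> expectation (\<lambda>\<omega>. 2)"
        by (rule integral_mono[OF hist_integrable[OF m1]])
           (auto simp: G_def hist_def intro!: h Y_in)
      then show ?case by (simp add: prob_space)
    next
      case (Suc k)
      have "expectation (\<lambda>\<omega>. G (hist m (Suc k) \<omega>)) \<le> expectation (\<lambda>\<omega>. (1 - \<epsilon> / 4 / m) * G (hist m k \<omega>))"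
        by (rule hist_step_le[OF m1, of k G "\<lambda>as. (1 - \<epsilon> / 4 / m) * G as"]) (rule step)
      also have "\<dots> = (1 - \<epsilon> / 4 / m) * expectation (\<lambda>\<omega>. G (hist m k \<omega>))" by simp
      also have "\<dots> \<le> (1 - \<epsilon> / 4 / m) * (2 * (1 - \<epsilon> / 4 / m) ^ k)" by (rule mult_left_mono[OF Suc contr])
      finally show ?case by simp
    qed
    \<comment> \<open>Origin of the 2 in the exponent of the statement: \<open>1 - 1/m\<close> lies
      below \<open>exp (- 1 / m)\<close> but above \<open>exp (- 2 / m)\<close> as soon as
      \<open>m \<ge> 2\<close>.\<close>
    have em: "exp (- 2 / m) \<le> 1 - 1 / m"
    proof -
      have x: "0 \<le> 1 / m" "1 / m \<le> 1 / 2" using m2 by (auto simp: field_simps)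
      have "- (1 / m) - 2 * (1 / m)\<^sup>2 \<le> ln (1 - 1 / m)" by (rule ln_one_minus_pos_lower_bound[OF x])
      moreover have "2 * (1 / m)\<^sup>2 \<le> 1 / m" using x unfolding power2_eq_square
        using mult_right_mono[OF x(2) x(1)] by simp
      ultimately have "- 2 / m \<le> ln (1 - 1 / m)" by simp
      then have "exp (- 2 / m) \<le> exp (ln (1 - 1 / m))" by simp
      then show ?thesis using x by simp
    qed
    have "expectation (\<lambda>\<omega>. exp (- 2 * real (length (visits A (\<lambda>t. Y t \<omega>) m n)) / m)) \<le> expectation (\<lambda>\<omega>. G (hist m n \<omega>))"
    proof (rule integral_mono)
      show "integrable P (\<lambda>\<omega>. exp (- 2 * real (length (visits A (\<lambda>t. Y t \<omega>) m n)) / m))"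
        using hist_integrable[OF m1, of "\<lambda>as. exp (- 2 * real (length (filter (\<lambda>a. a \<in> A) (butlast as))) / m)" n]
        by (simp only: visits_hist)
      show "integrable P (\<lambda>\<omega>. G (hist m n \<omega>))" by (rule hist_integrable[OF m1])
      fix \<omega> assume \<omega>: "\<omega> \<in> space P"
      let ?l = "length (visits A (\<lambda>t. Y t \<omega>) m n)"
      have "exp (- 2 * real ?l / m) = exp (- 2 / m) ^ ?l" by (simp add: exp_of_nat_mult[symmetric] mult.commute)
      also have "\<dots> \<le> (1 - 1 / m) ^ ?l" by (rule power_mono[OF em]) simp
      also have "\<dots> * 1 \<le> (1 - 1 / m) ^ ?l * h (Y (real n / m) \<omega>)"
        by (intro mult_left_mono h Y_in[OF \<omega>]) (use m2 in auto)
      finally show "exp (- 2 * real ?l / m) \<le> G (hist m n \<omega>)" by (simp add: G_def visits_hist last_hist)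
    qed
    also have "\<dots> \<le> 2 * (1 - \<epsilon> / 4 / m) ^ n" by (rule bound)
    also have "(1 - \<epsilon> / 4 / m) ^ n \<le> exp (- (\<epsilon> / 4 / m)) ^ n"
      using exp_ge_add_one_self[of "- (\<epsilon> / 4 / m)"] contr by (intro power_mono) auto
    also have "\<dots> = exp (- (\<epsilon> / 4) * real n / m)" by (simp add: exp_of_nat_mult[symmetric] mult.commute)
    finally show ?thesis by simp
  qed
  have "1 \<le> m0" unfolding m0_def by simp
  moreover have "0 < \<epsilon> / 4" using \<epsilon>(1) by simp
  ultimately show ?thesis using main by blast
qed

end

section \<open>Continuous functionals on the path space, completed measures, and the grid
  parameters\<close>

lemma continuous_skorokhod_sequentially:
  assumes f: "continuous_map (skorokhod_topology S) euclideanreal f"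
    and v: "\<And>n. v n \<in> path_space S" and w: "w \<in> path_space S" and c: "skorokhod_converges v w"
  shows "(\<lambda>n. f (v n)) \<longlonglongrightarrow> f w"
proof (rule topological_tendstoI)
  fix U :: "real set" assume U: "open U" "f w \<in> U"
  have "openin (skorokhod_topology S) {u \<in> topspace (skorokhod_topology S). f u \<in> U}"
    using f U(1) unfolding continuous_map_def by auto
  then have "skorokhod_open S {u \<in> path_space S. f u \<in> U}"
    by (simp add: openin_skorokhod topspace_skorokhod)
  moreover have "range v \<subseteq> path_space S" using v by auto
  ultimately have "\<forall>\<^sub>F n in sequentially. v n \<in> {u \<in> path_space S. f u \<in> U}"
    using c w U(2) unfolding skorokhod_open_def by blast
  then show "\<forall>\<^sub>F n in sequentially. f (v n) \<in> U" by (rule eventually_mono) simp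
qed

lemma skorokhod_converges_restrict:
  "skorokhod_converges v w \<Longrightarrow> skorokhod_converges v (restrict w {0..})"
  unfolding skorokhod_converges_def by simp

text \<open>A functional of the trace is only known to agree almost everywhere with a limit of
  measurable functions of grid values; this gives it a meaning under the completed measure.\<close>

lemma measurable_completion_AE_eq:
  assumes g: "g \<in> borel_measurable M" and eq: "AE x in M. f x = g x"
  shows "f \<in> borel_measurable (completion M)"
proof -
  obtain N where N: "{x \<in> space M. f x \<noteq> g x} \<subseteq> N" "N \<in> null_sets M"
    using eq by (auto simp: eventually_ae_filter)
  show ?thesis
  proof (rule measurableI)
    fix U :: "'b set" assume "U \<in> sets borel"
    then have gU: "g -` U \<inter> space M \<in> sets M" by (rule measurable_sets[OF g])
    have sub: "f -` U \<inter> space M \<inter> N \<subseteq> N" by auto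
    have "f -` U \<inter> space M \<inter> N \<in> null_sets (completion M)"
      by (rule null_sets_completion_subset[OF sub null_sets_completionI[OF N(2)]])
    then have 1: "f -` U \<inter> space M \<inter> N \<in> sets (completion M)" by blast
    have 2: "(g -` U \<inter> space M) - N \<in> sets (completion M)"
      using gU N(2) by (intro sets_completionI_sets) auto
    have 3: "f -` U \<inter> space (completion M) = ((g -` U \<inter> space M) - N) \<union> (f -` U \<inter> space M \<inter> N)"
      using N(1) by auto
    show "f -` U \<inter> space (completion M) \<in> sets (completion M)"
      unfolding 3 by (rule sets.Un[OF 2 1])
  qed simp
qed

text \<open>The observed time \<open>horizon k / mesh k = k + 1\<close> must tend to infinity, while
  the accumulated quadratic errors, of order
  \<open>horizon k / (mesh k)\<^sup>2 = 1 / (k + 1)\<close>, must tend to 0. Exponents 3 and 2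
  achieve both.\<close>

definition mesh :: "nat \<Rightarrow> real" where "mesh k = (real (Suc k))\<^sup>2"
definition horizon :: "nat \<Rightarrow> nat" where "horizon k = Suc k ^ 3"

lemma mesh_ge_1: "1 \<le> mesh k"
  unfolding mesh_def by (simp add: one_le_power)

lemma horizon_mesh: "real (horizon k) / mesh k = real (Suc k)"
proof -
  have "real (horizon k) = real (Suc k) ^ 3" by (simp only: horizon_def of_nat_power)
  then show ?thesis by (simp add: mesh_def power2_eq_square power3_eq_cube del: of_nat_Suc)
qed

lemma filterlim_mesh: "filterlim mesh at_top sequentially"
proof (rule filterlim_at_top_mono[OF filterlim_real_sequentially])
  have "real k \<le> mesh k" for k
    using self_le_power[of "real (Suc k)" 2] unfolding mesh_def by simp
  then show "\<forall>\<^sub>F k in sequentially. real k \<le> mesh k" by simp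
qed

lemma filterlim_horizon: "filterlim (\<lambda>k. real (horizon k) / mesh k) at_top sequentially"
  unfolding horizon_mesh using filterlim_real_sequentially filterlim_sequentially_Suc by blast

section \<open>Occupation times, the trace as a limit of grid lists, and its comparison with a
  chain\<close>

context jump_process
begin

lemma visits_measurable: "1 \<le> m \<Longrightarrow> (\<lambda>\<omega>. G (visits A (\<lambda>t. Y t \<omega>) m n) :: real) \<in> borel_measurable P"
  using hist_measurable[of m "\<lambda>as. G (filter (\<lambda>a. a \<in> A) (butlast as))" n] by (simp only: visits_hist)

lemma visits_integrable: "1 \<le> m \<Longrightarrow> integrable P (\<lambda>\<omega>. G (visits A (\<lambda>t. Y t \<omega>) m n) :: real)"
  using hist_integrable[of m "\<lambda>as. G (filter (\<lambda>a. a \<in> A) (butlast as))" n] by (simp only: visits_hist)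

lemma visits_lim:
  assumes "\<omega> \<in> space P"
  shows "(\<lambda>n. real (length (visits A (\<lambda>t. Y t \<omega>) (real (Suc n)) (Suc n * M))) / real (Suc n))
          \<longlonglongrightarrow> occupation_time A (\<lambda>t. Y t \<omega>) (real M)"
proof (rule LIMSEQ_I)
  fix e :: real assume e: "0 < e"
  have q: "filterlim (\<lambda>n. real (Suc n)) at_top sequentially"
    using filterlim_real_sequentially filterlim_sequentially_Suc by blast
  have "0 < e / 2" using e by simp
  from occupation_time_visits[OF cadlag_Y[OF assms] q _ this, of "real M" A]
  have "\<forall>\<^sub>F n in sequentially. \<forall>j. real j \<le> real (Suc n) * real M \<longrightarrow>
      \<bar>occupation_time A (\<lambda>t. Y t \<omega>) (real j / real (Suc n)) -
       real (length (visits A (\<lambda>t. Y t \<omega>) (real (Suc n)) j)) / real (Suc n)\<bar> \<le> e / 2" by simp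
  then have "\<forall>\<^sub>F n in sequentially. norm (real (length (visits A (\<lambda>t. Y t \<omega>) (real (Suc n)) (Suc n * M))) / real (Suc n)
      - occupation_time A (\<lambda>t. Y t \<omega>) (real M)) < e"
  proof (rule eventually_mono)
    fix n assume *: "\<forall>j. real j \<le> real (Suc n) * real M \<longrightarrow>
      \<bar>occupation_time A (\<lambda>t. Y t \<omega>) (real j / real (Suc n)) -
       real (length (visits A (\<lambda>t. Y t \<omega>) (real (Suc n)) j)) / real (Suc n)\<bar> \<le> e / 2"
    have "real (Suc n * M) / real (Suc n) = real M" by (simp del: of_nat_Suc mult_Suc)
    moreover have "real (Suc n * M) \<le> real (Suc n) * real M" by (simp only: of_nat_mult)
    ultimately have "\<bar>occupation_time A (\<lambda>t. Y t \<omega>) (real M) -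
       real (length (visits A (\<lambda>t. Y t \<omega>) (real (Suc n)) (Suc n * M))) / real (Suc n)\<bar> \<le> e / 2"
      using * by metis
    then show "norm (real (length (visits A (\<lambda>t. Y t \<omega>) (real (Suc n)) (Suc n * M))) / real (Suc n)
      - occupation_time A (\<lambda>t. Y t \<omega>) (real M)) < e" using e unfolding real_norm_def by linarith
  qed
  then show "\<exists>no. \<forall>n\<ge>no. norm (real (length (visits A (\<lambda>t. Y t \<omega>) (real (Suc n)) (Suc n * M))) / real (Suc n)
      - occupation_time A (\<lambda>t. Y t \<omega>) (real M)) < e" by (rule eventually_sequentially[THEN iffD1])
qed

lemma occupation_time_measurable:
  "(\<lambda>\<omega>. occupation_time A (\<lambda>t. Y t \<omega>) (real M)) \<in> borel_measurable P"
proof (rule borel_measurable_LIMSEQ_real)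
  show "(\<lambda>\<omega>. real (length (visits A (\<lambda>t. Y t \<omega>) (real (Suc n)) (Suc n * M))) / real (Suc n))
      \<in> borel_measurable P" for n
    by (rule visits_measurable[of _ "\<lambda>l. real (length l) / real (Suc n)"]) simp
qed (rule visits_lim)

text \<open>Exponential Chebyshev inequality applied to the Laplace bound.\<close>

lemma few_visits:
  assumes m: "1 \<le> m"
    and lap: "expectation (\<lambda>\<omega>. exp (- 2 * real (length (visits A (\<lambda>t. Y t \<omega>) m n)) / m)) \<le> 2 * exp (- \<kappa> * real n / m)"
  shows "prob {\<omega>\<in>space P. real (length (visits A (\<lambda>t. Y t \<omega>) m n)) \<le> T * m} \<le> 2 * exp (2 * T - \<kappa> * real n / m)"
proof -
  let ?l = "\<lambda>\<omega>. real (length (visits A (\<lambda>t. Y t \<omega>) m n))"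
  have ml: "?l \<in> borel_measurable P" by (rule visits_measurable[OF m])
  have ev: "{\<omega>\<in>space P. ?l \<omega> \<le> T * m} \<in> events" using ml by measurable
  have "exp (- 2 * T) * prob {\<omega>\<in>space P. ?l \<omega> \<le> T * m} = expectation (\<lambda>\<omega>. exp (- 2 * T) * indicator {\<omega>\<in>space P. ?l \<omega> \<le> T * m} \<omega>)"
    using ev by simp
  also have "\<dots> \<le> expectation (\<lambda>\<omega>. exp (- 2 * ?l \<omega> / m))"
  proof (rule integral_mono)
    show "integrable P (\<lambda>\<omega>. exp (- 2 * T) * indicator {\<omega>\<in>space P. ?l \<omega> \<le> T * m} \<omega>)"
      by (intro integrable_mult_right integrable_real_indicator ev) (simp add: emeasure_eq_measure)
    show "integrable P (\<lambda>\<omega>. exp (- 2 * ?l \<omega> / m))" by (rule visits_integrable[OF m])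
    fix \<omega> assume "\<omega> \<in> space P"
    show "exp (- 2 * T) * indicator {\<omega>\<in>space P. ?l \<omega> \<le> T * m} \<omega> \<le> exp (- 2 * ?l \<omega> / m)"
    proof (cases "?l \<omega> \<le> T * m")
      case True
      then have "?l \<omega> / m \<le> T" using m by (simp add: pos_divide_le_eq)
      then show ?thesis by (simp add: indicator_def)
    qed simp
  qed
  also note lap
  finally have X: "exp (2 * T) * (exp (- 2 * T) * prob {\<omega>\<in>space P. ?l \<omega> \<le> T * m}) \<le> exp (2 * T) * (2 * exp (- \<kappa> * real n / m))"
    by (intro mult_left_mono) auto
  have e1: "exp (2 * T) * (exp (- 2 * T) * z) = z" for z :: real
    by (simp add: mult.assoc[symmetric] exp_add[symmetric])
  have e2: "exp (2 * T) * (2 * exp (- \<kappa> * real n / m)) = 2 * exp (2 * T - \<kappa> * real n / m)"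
    using exp_add[of "2 * T" "- \<kappa> * real n / m"] by simp
  show ?thesis using X unfolding e1 e2 .
qed

text \<open>Refining the mesh at a fixed time \<open>M\<close> turns the Laplace bound for visits
  into \<open>2 * exp (- \<kappa> * M)\<close> for the occupation time itself. The event that the
  occupation time stays below \<open>K\<close> for ever then has probability at most
  \<open>2 * exp (2 * K - \<kappa> * M)\<close> for every \<open>M\<close>.\<close>

lemma AE_occupation_unbounded:
  assumes \<kappa>: "0 < \<kappa>" "1 \<le> m0"
    and lap: "\<And>m n. m0 \<le> m \<Longrightarrow> expectation (\<lambda>\<omega>. exp (- 2 * real (length (visits A (\<lambda>t. Y t \<omega>) m n)) / m)) \<le> 2 * exp (- \<kappa> * real n / m)"
  shows "AE \<omega> in P. \<forall>K. \<exists>s\<ge>0. K < occupation_time A (\<lambda>t. Y t \<omega>) s"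
proof -
  let ?o = "\<lambda>\<omega> M. occupation_time A (\<lambda>t. Y t \<omega>) (real M)"
  have bound: "expectation (\<lambda>\<omega>. exp (- 2 * ?o \<omega> M)) \<le> 2 * exp (- \<kappa> * real M)" for M
  proof (rule LIMSEQ_le_const2)
    let ?l = "\<lambda>n \<omega>. real (length (visits A (\<lambda>t. Y t \<omega>) (real (Suc n)) (Suc n * M))) / real (Suc n)"
    show "(\<lambda>n. expectation (\<lambda>\<omega>. exp (- 2 * ?l n \<omega>))) \<longlonglongrightarrow> expectation (\<lambda>\<omega>. exp (- 2 * ?o \<omega> M))"
    proof (rule integral_dominated_convergence[where w = "\<lambda>_. 1"])
      show "(\<lambda>\<omega>. exp (- 2 * ?o \<omega> M)) \<in> borel_measurable P"
        using occupation_time_measurable by measurable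
      show "(\<lambda>\<omega>. exp (- 2 * ?l n \<omega>)) \<in> borel_measurable P" for n
        by (rule visits_measurable[of _ "\<lambda>l. exp (- 2 * (real (length l) / real (Suc n)))"]) simp
      show "AE \<omega> in P. (\<lambda>n. exp (- 2 * ?l n \<omega>)) \<longlonglongrightarrow> exp (- 2 * ?o \<omega> M)"
        by (intro AE_I2 tendsto_intros visits_lim)
    qed auto
    obtain n0 where n0: "m0 \<le> real n0" using real_arch_simple by blast
    have "expectation (\<lambda>\<omega>. exp (- 2 * ?l n \<omega>)) \<le> 2 * exp (- \<kappa> * real M)" if "n0 \<le> n" for n
    proof -
      have "m0 \<le> real (Suc n)" using that n0 by (simp add: le_trans)
      from lap[OF this, of "Suc n * M"]
      have "expectation (\<lambda>\<omega>. exp (- 2 * ?l n \<omega>)) \<le> 2 * exp (- \<kappa> * real (Suc n * M) / real (Suc n))"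
        by (simp only: times_divide_eq_right)
      moreover have "- \<kappa> * real (Suc n * M) / real (Suc n) = - \<kappa> * real M" by (simp del: of_nat_Suc mult_Suc)
      ultimately show ?thesis by (simp only:)
    qed
    then show "\<exists>N. \<forall>n\<ge>N. expectation (\<lambda>\<omega>. exp (- 2 * ?l n \<omega>)) \<le> 2 * exp (- \<kappa> * real M)" by blast
  qed
  have "AE \<omega> in P. \<exists>M. real K < ?o \<omega> M" for K :: nat
  proof -
    let ?B = "{\<omega>\<in>space P. \<forall>M. ?o \<omega> M \<le> real K}"
    have ev: "?B \<in> events" using occupation_time_measurable by measurable
    have Z: "exp (- 2 * real K) * prob ?B \<le> 2 * exp (- \<kappa> * real M)" for M
    proof -
      have "exp (- 2 * real K) * prob ?B = expectation (\<lambda>\<omega>. exp (- 2 * real K) * indicator ?B \<omega>)"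
        using ev by simp
      also have "\<dots> \<le> expectation (\<lambda>\<omega>. exp (- 2 * ?o \<omega> M))"
      proof (rule integral_mono)
        show "integrable P (\<lambda>\<omega>. exp (- 2 * real K) * indicator ?B \<omega>)"
          by (intro integrable_mult_right integrable_real_indicator ev) (simp add: emeasure_eq_measure)
        show "integrable P (\<lambda>\<omega>. exp (- 2 * ?o \<omega> M))"
        proof (rule integrable_const_bound[where B = 1])
          show "AE \<omega> in P. norm (exp (- 2 * ?o \<omega> M)) \<le> 1"
            by (rule AE_I2) (simp add: occupation_time_nonneg[OF cadlag_Y])
          show "(\<lambda>\<omega>. exp (- 2 * ?o \<omega> M)) \<in> borel_measurable P"
            using occupation_time_measurable by measurable
        qed
      qed (auto simp: indicator_def)
      also note bound
      finally show ?thesis .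
    qed
    have "(\<lambda>M. 2 * exp (- \<kappa>) ^ M) \<longlonglongrightarrow> 2 * 0"
      using \<kappa>(1) by (intro tendsto_intros LIMSEQ_power_zero) simp
    then have L: "(\<lambda>M. 2 * exp (- \<kappa> * real M)) \<longlonglongrightarrow> 2 * 0"
      by (simp add: exp_of_nat_mult[symmetric] mult.commute)
    have "exp (- 2 * real K) * prob ?B \<le> 2 * 0"
      by (rule LIMSEQ_le_const[OF L]) (use Z in blast)
    then have "prob ?B \<le> 0" by (simp add: mult_le_0_iff)
    then have "prob ?B = 0" using measure_nonneg[of P ?B] by linarith
    then have "AE \<omega> in P. \<not> (\<forall>M. ?o \<omega> M \<le> real K)"
      using ev by (subst (asm) prob_eq_0) (auto elim: AE_mp)
    then show ?thesis by (simp add: not_le)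
  qed
  then have "AE \<omega> in P. \<forall>K::nat. \<exists>M. real K < ?o \<omega> M" by (simp add: AE_all_countable)
  then show ?thesis
  proof (rule AE_mp, intro AE_I2 impI allI)
    fix \<omega> and K :: real assume *: "\<forall>K::nat. \<exists>M. real K < ?o \<omega> M"
    obtain k :: nat where k: "K \<le> real k" using real_arch_simple by blast
    obtain M where "real k < ?o \<omega> M" using * by blast
    then show "\<exists>s\<ge>0. K < occupation_time A (\<lambda>t. Y t \<omega>) s" using k by (intro exI[of _ "real M"]) auto
  qed
qed

text \<open>A continuous functional of the trace is almost surely the limit of functions of finitely
  many grid values. This yields both its measurability for the completion and, by dominated
  convergence, the limit of the expectations.\<close>

lemma trace_functional_limit:
  assumes \<sigma>: "\<And>a. a \<in> A \<Longrightarrow> \<sigma> a \<in> S" and x: "x \<in> S"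
    and unb: "AE \<omega> in P. \<forall>K. \<exists>s\<ge>0. K < occupation_time A (\<lambda>t. Y t \<omega>) s"
  shows "AE \<omega> in P. (\<lambda>t\<in>{0..}. \<sigma> (trace_path A (\<lambda>s. Y s \<omega>) t)) \<in> path_space S" (is ?A)
    and "AE \<omega> in P. skorokhod_converges (\<lambda>k. step_path x (mesh k) (map \<sigma> (visits A (\<lambda>t. Y t \<omega>) (mesh k) (horizon k))))
           (\<lambda>t\<in>{0..}. \<sigma> (trace_path A (\<lambda>s. Y s \<omega>) t))" (is ?B)
    and "continuous_map (skorokhod_topology S) euclideanreal f \<Longrightarrow> (\<And>w. w \<in> path_space S \<Longrightarrow> \<bar>f w\<bar> \<le> B) \<Longrightarrow>
      (\<lambda>k. expectation (\<lambda>\<omega>. f (step_path x (mesh k) (map \<sigma> (visits A (\<lambda>t. Y t \<omega>) (mesh k) (horizon k))))))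
        \<longlonglongrightarrow> (\<integral>\<omega>. f (\<lambda>t\<in>{0..}. \<sigma> (trace_path A (\<lambda>s. Y s \<omega>) t)) \<partial>completion P)"
proof -
  let ?Z = "\<lambda>\<omega>. \<lambda>t\<in>{0..}. \<sigma> (trace_path A (\<lambda>s. Y s \<omega>) t)"
  let ?v = "\<lambda>k \<omega>. step_path x (mesh k) (map \<sigma> (visits A (\<lambda>t. Y t \<omega>) (mesh k) (horizon k)))"
  show Z: ?A
    using unb
  proof (rule AE_mp, intro AE_I2 impI)
    fix \<omega> assume \<omega>: "\<omega> \<in> space P" and u: "\<forall>K. \<exists>s\<ge>0. K < occupation_time A (\<lambda>t. Y t \<omega>) s"
    have "cadlag S (\<lambda>t. \<sigma> (trace_path A (\<lambda>s. Y s \<omega>) t))"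
      by (rule cadlag_map[OF cadlag_trace_path[OF cadlag_Y[OF \<omega>]] \<sigma>]) (use u in blast)
    then have "cadlag S (?Z \<omega>)" by (rule cadlag_cong) simp
    then show "?Z \<omega> \<in> path_space S" by (simp add: path_space_def)
  qed
  show conv: ?B
    using unb
  proof (rule AE_mp, intro AE_I2 impI)
    fix \<omega> assume \<omega>: "\<omega> \<in> space P" and u: "\<forall>K. \<exists>s\<ge>0. K < occupation_time A (\<lambda>t. Y t \<omega>) s"
    have "skorokhod_converges (\<lambda>k. ?v k \<omega>) (\<lambda>t. \<sigma> (trace_path A (\<lambda>s. Y s \<omega>) t))"
      by (rule step_path_visits_converges[where x = x, OF cadlag_Y[OF \<omega>] _ \<sigma> filterlim_mesh filterlim_horizon])
         (use u in auto)
    then show "skorokhod_converges (\<lambda>k. ?v k \<omega>) (?Z \<omega>)" by (rule skorokhod_converges_restrict)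
  qed
  have v: "?v k \<omega> \<in> path_space S" for k \<omega>
  proof (rule step_path_in_path_space[OF _ x])
    show "0 < mesh k" using mesh_ge_1[of k] by simp
    show "set (map \<sigma> (visits A (\<lambda>t. Y t \<omega>) (mesh k) (horizon k))) \<subseteq> S"
      using set_visits[of A "\<lambda>t. Y t \<omega>" "mesh k" "horizon k"] \<sigma> by auto
  qed
  assume f: "continuous_map (skorokhod_topology S) euclideanreal f"
    and B: "\<And>w. w \<in> path_space S \<Longrightarrow> \<bar>f w\<bar> \<le> B"
  have mf: "(\<lambda>\<omega>. f (?v k \<omega>)) \<in> borel_measurable P" for k
    by (rule visits_measurable[OF mesh_ge_1, of "\<lambda>h. f (step_path x (mesh k) (map \<sigma> h))"])
  have AEf: "AE \<omega> in P. (\<lambda>k. f (?v k \<omega>)) \<longlonglongrightarrow> f (?Z \<omega>)"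
    using Z conv by eventually_elim (rule continuous_skorokhod_sequentially[OF f v])
  have "(\<lambda>\<omega>. lim (\<lambda>k. f (?v k \<omega>))) \<in> borel_measurable P"
    by (rule borel_measurable_lim_metric[OF mf])
  moreover have "AE \<omega> in P. f (?Z \<omega>) = lim (\<lambda>k. f (?v k \<omega>))"
    using AEf by eventually_elim (simp add: limI)
  ultimately have mZ: "(\<lambda>\<omega>. f (?Z \<omega>)) \<in> borel_measurable (completion P)"
    by (rule measurable_completion_AE_eq)
  have "(\<lambda>k. \<integral>\<omega>. f (?v k \<omega>) \<partial>completion P) \<longlonglongrightarrow> (\<integral>\<omega>. f (?Z \<omega>) \<partial>completion P)"
  proof (rule integral_dominated_convergence[OF mZ measurable_completion[OF mf], where w = "\<lambda>_. B"])
    show "integrable (completion P) (\<lambda>_. B)" by (subst integrable_completion) auto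
    show "AE \<omega> in completion P. (\<lambda>k. f (?v k \<omega>)) \<longlonglongrightarrow> f (?Z \<omega>)" by (rule AE_completion[OF AEf])
    show "AE \<omega> in completion P. norm (f (?v k \<omega>)) \<le> B" for k using B[OF v] by simp
  qed
  then show "(\<lambda>k. expectation (\<lambda>\<omega>. f (?v k \<omega>))) \<longlonglongrightarrow> (\<integral>\<omega>. f (?Z \<omega>) \<partial>completion P)"
    by (simp only: integral_completion[OF mf])
qed

text \<open>Replacement of one step at a time. \<open>H b a\<close> acts as the probability that the
  first visit from \<open>a\<close> is at \<open>b\<close>. Keep the visits made so far, let the
  next one be drawn from \<open>H\<close> at the present state and the later ones from the chain
  \<open>R\<close>: the resulting mean \<open>U\<close> of \<open>F\<close> is almost a martingale.
  Off \<open>A\<close> it changes by the quadratic error only, since \<open>H\<close> is harmonic;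
  at a visit one step of \<open>R\<close> is exchanged for one step of the process at a cost of
  order \<open>\<epsilon> / m\<close>. At time 0 this mean involves the chain only, at time
  \<open>n\<close> the process only, unless fewer than \<open>Suc K\<close> visits were
  made.\<close>

lemma visits_compare:
  assumes m: "1 \<le> m" and S: "finite S" and A: "A \<subseteq> E" and \<sigma>: "\<And>a. a \<in> A \<Longrightarrow> \<sigma> a \<in> S"
    and H_bound: "\<And>a b. a \<in> E \<Longrightarrow> b \<in> S \<Longrightarrow> \<bar>H b a\<bar> \<le> 1"
    and H_A: "\<And>a b. a \<in> A \<Longrightarrow> b \<in> S \<Longrightarrow> H b a = of_bool (\<sigma> a = b)"
    and harmonic: "\<And>a b. a \<in> E - A \<Longrightarrow> b \<in> S \<Longrightarrow> gen (H b) a = 0"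
    and near: "\<And>a b. a \<in> A \<Longrightarrow> b \<in> S \<Longrightarrow> \<bar>gen (H b) a - \<Lambda> (\<sigma> a) b\<bar> \<le> \<epsilon>" and \<epsilon>: "0 \<le> \<epsilon>"
    and R: "\<And>a b. R a b = of_bool (a = b) + \<Lambda> a b / m"
    and R_nonneg: "\<And>a b. a \<in> S \<Longrightarrow> b \<in> S \<Longrightarrow> 0 \<le> R a b"
    and R_row: "\<And>a. a \<in> S \<Longrightarrow> (\<Sum>b\<in>S. R a b) = 1"
    and F: "\<And>h. \<bar>F h\<bar> \<le> M"
  shows "\<bar>expectation (\<lambda>\<omega>. F (take (Suc K) (map \<sigma> (visits A (\<lambda>t. Y t \<omega>) m n)))) -
           expectation (\<lambda>\<omega>. \<Sum>b\<in>S. H b (Y 0 \<omega>) * backward R S F K [b])\<bar>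
         \<le> M * real (card S) * real (Suc K) * \<epsilon> / m + real n * (M * real (card S) * real (card E) * C / m\<^sup>2) +
           (real (card S) + 1) * M * prob {\<omega>\<in>space P. length (visits A (\<lambda>t. Y t \<omega>) m n) \<le> K}"
proof -
  define \<Phi> where "\<Phi> = backward R S F"
  define hv where "hv as = map \<sigma> (filter (\<lambda>a. a \<in> A) (butlast as))" for as
  \<comment> \<open>After \<open>Suc K\<close> visits the list is complete and \<open>U\<close> no
    longer changes. Before that, \<open>K - length (hv as)\<close> further steps of the chain follow
    the pending visit drawn from \<open>H\<close>.\<close>
  define U where "U as = (if K < length (hv as) then F (take (Suc K) (hv as))
      else (\<Sum>b\<in>S. H b (last as) * \<Phi> (K - length (hv as)) (hv as @ [b])))" for as
  \<comment> \<open>Pays for the errors of order \<open>\<epsilon>\<close>: they occur at recorded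
    visits only, so at most \<open>Suc K\<close> of the \<open>n\<close> steps contribute one,
    whatever \<open>n\<close> is.\<close>
  define cnt where "cnt as = real (min (Suc K) (length (hv as)))" for as
  define e1 where "e1 = M * real (card S) * \<epsilon> / m"
  define e2 where "e2 = M * real (card S) * real (card E) * C / m\<^sup>2"
  have M0: "0 \<le> M" using F[of "[]"] by linarith
  have C0: "0 \<le> C" using C_nonneg Y_in not_empty by (metis all_not_in_conv order.refl)
  have e1: "0 \<le> e1" unfolding e1_def using M0 \<epsilon> m by simp
  have e2: "0 \<le> e2" unfolding e2_def using M0 C0 m by simp
  have hv_S: "set (hv as) \<subseteq> S" for as unfolding hv_def using \<sigma> by auto
  have \<Phi>_bound: "\<bar>\<Phi> j (hv as @ [b])\<bar> \<le> M" if "b \<in> S" for j as b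
    unfolding \<Phi>_def
    by (rule backward_bound[OF F R_nonneg R_row]) (use that hv_S in auto)
  have hv_append: "hv (as @ [b]) = hv as @ (if last as \<in> A then [\<sigma> (last as)] else [])" if "as \<noteq> []" for as b
    unfolding hv_def butlast_snoc
    by (subst append_butlast_last_id[OF that, symmetric]) (auto simp del: append_butlast_last_id)
  have step: "\<bar>(\<Sum>b\<in>E. p m (last as) b * U (as @ [b])) - U as\<bar> \<le> e2 + of_bool (last as \<in> A \<and> length (hv as) \<le> K) * e1"
    if as: "as \<in> paths i" "0 < pr m i as" for as i
  proof -
    let ?a = "last as"
    have a: "?a \<in> E" by (rule last_paths[OF as(1)])
    have ne: "as \<noteq> []" using as by (auto simp: paths_def)
    have row: "(\<Sum>b\<in>E. p m ?a b) = 1" by (rule p_row[OF m as])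
    have H_exp: "\<bar>(\<Sum>b\<in>E. p m ?a b * H c b) - H c ?a - gen (H c) ?a / m\<bar> \<le> real (card E) * C / m\<^sup>2" if "c \<in> S" for c
      using p_sum_expansion[OF m a, of "H c" 1] H_bound that by simp
    have swap: "(\<Sum>b\<in>E. p m ?a b * (\<Sum>c\<in>S. H c b * Z c)) = (\<Sum>c\<in>S. (\<Sum>b\<in>E. p m ?a b * H c b) * Z c)" for Z
      by (simp only: sum_distrib_left sum_distrib_right mult.assoc) (rule sum.swap)
    have est: "\<bar>(\<Sum>c\<in>S. (\<Sum>b\<in>E. p m ?a b * H c b) * Z c) - (\<Sum>c\<in>S. W c * Z c)\<bar> \<le> real (card S) * (D * M)"
      if "\<And>c. c \<in> S \<Longrightarrow> \<bar>Z c\<bar> \<le> M" "\<And>c. c \<in> S \<Longrightarrow> \<bar>(\<Sum>b\<in>E. p m ?a b * H c b) - W c\<bar> \<le> D" for Z W D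
    proof -
      have "(\<Sum>c\<in>S. (\<Sum>b\<in>E. p m ?a b * H c b) * Z c) - (\<Sum>c\<in>S. W c * Z c) =
          (\<Sum>c\<in>S. ((\<Sum>b\<in>E. p m ?a b * H c b) - W c) * Z c)"
        by (simp add: sum_subtractf[symmetric] left_diff_distrib)
      also have "\<bar>\<dots>\<bar> \<le> (\<Sum>c\<in>S. \<bar>((\<Sum>b\<in>E. p m ?a b * H c b) - W c) * Z c\<bar>)" by (rule sum_abs)
      also have "\<dots> \<le> (\<Sum>c\<in>S. D * M)"
        unfolding abs_mult by (intro sum_mono mult_mono that) (use that(2) in force)+
      finally show ?thesis by simp
    qed
    consider "K < length (hv as)" | "?a \<notin> A" "length (hv as) \<le> K" | "?a \<in> A" "length (hv as) < K" | "?a \<in> A" "length (hv as) = K"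
      by linarith
    then show ?thesis
    proof cases
      case 1
      then have "U (as @ [b]) = U as" for b
        unfolding U_def using hv_append[OF ne] by auto
      then have "(\<Sum>b\<in>E. p m ?a b * U (as @ [b])) = U as" by (simp add: sum_distrib_right[symmetric] row)
      then show ?thesis using e1 e2 by simp
    next
      case 2
      let ?Z = "\<lambda>c. \<Phi> (K - length (hv as)) (hv as @ [c])"
      have "U (as @ [b]) = (\<Sum>c\<in>S. H c b * ?Z c)" for b
        unfolding U_def using hv_append[OF ne] 2 by auto
      then have 3: "(\<Sum>b\<in>E. p m ?a b * U (as @ [b])) = (\<Sum>c\<in>S. (\<Sum>b\<in>E. p m ?a b * H c b) * ?Z c)"
        by (simp only: swap)
      have 4: "U as = (\<Sum>c\<in>S. H c ?a * ?Z c)" unfolding U_def using 2 by auto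
      have "\<bar>(\<Sum>c\<in>S. (\<Sum>b\<in>E. p m ?a b * H c b) * ?Z c) - (\<Sum>c\<in>S. H c ?a * ?Z c)\<bar>
          \<le> real (card S) * (real (card E) * C / m\<^sup>2 * M)"
      proof (rule est[OF \<Phi>_bound])
        fix c assume c: "c \<in> S"
        show "\<bar>(\<Sum>b\<in>E. p m ?a b * H c b) - H c ?a\<bar> \<le> real (card E) * C / m\<^sup>2"
          using H_exp[OF c] harmonic[of ?a c] a 2(1) c by simp
      qed
      then show ?thesis unfolding 3 4 using 2 by (simp add: e2_def algebra_simps)
    next
      \<comment> \<open>Here \<open>backward\<close> is unfolded by one step of \<open>R\<close>. At
        a visited state \<open>H\<close> is a unit mass, and its rate of change is
        \<open>\<Lambda>\<close> up to \<open>\<epsilon>\<close>, so one step of the process moves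
        it to the row of \<open>R\<close>.\<close>
      case 3
      let ?h = "hv as @ [\<sigma> ?a]"
      let ?Z = "\<lambda>c. \<Phi> (K - Suc (length (hv as))) (?h @ [c])"
      have "U (as @ [b]) = (\<Sum>c\<in>S. H c b * ?Z c)" for b
        unfolding U_def using hv_append[OF ne] 3 by auto
      then have 5: "(\<Sum>b\<in>E. p m ?a b * U (as @ [b])) = (\<Sum>c\<in>S. (\<Sum>b\<in>E. p m ?a b * H c b) * ?Z c)"
        by (simp only: swap)
      have "U as = (\<Sum>c\<in>S. of_bool (\<sigma> ?a = c) * \<Phi> (K - length (hv as)) (hv as @ [c]))"
        unfolding U_def using 3 H_A by auto
      also have "\<dots> = \<Phi> (K - length (hv as)) ?h"
        using \<sigma>[OF 3(1)] S by (simp add: of_bool_def if_distrib[of "\<lambda>x. x * _"] sum.delta cong: if_cong)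
      also have "K - length (hv as) = Suc (K - Suc (length (hv as)))" using 3 by simp
      finally have 6: "U as = (\<Sum>c\<in>S. R (\<sigma> ?a) c * ?Z c)" by (simp add: \<Phi>_def)
      have Z: "\<bar>?Z c\<bar> \<le> M" if "c \<in> S" for c
        using \<Phi>_bound[OF that, of _ "as @ [?a]"] hv_append[OF ne, of ?a] 3(1) by simp
      have "\<bar>(\<Sum>c\<in>S. (\<Sum>b\<in>E. p m ?a b * H c b) * ?Z c) - (\<Sum>c\<in>S. R (\<sigma> ?a) c * ?Z c)\<bar>
          \<le> real (card S) * ((real (card E) * C / m\<^sup>2 + \<epsilon> / m) * M)"
      proof (rule est[OF Z])
        fix c assume c: "c \<in> S"
        have "\<bar>gen (H c) ?a / m - \<Lambda> (\<sigma> ?a) c / m\<bar> \<le> \<epsilon> / m"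
          using near[OF 3(1) c] m by (simp add: diff_divide_distrib[symmetric] divide_right_mono)
        then show "\<bar>(\<Sum>b\<in>E. p m ?a b * H c b) - R (\<sigma> ?a) c\<bar> \<le> real (card E) * C / m\<^sup>2 + \<epsilon> / m"
          using H_exp[OF c] unfolding R H_A[OF 3(1) c] by linarith
      qed
      then show ?thesis unfolding 5 6 using 3 by (simp add: e1_def e2_def algebra_simps)
    next
      case 4
      have "U (as @ [b]) = F (hv as @ [\<sigma> ?a])" for b
        unfolding U_def using hv_append[OF ne] 4 by auto
      then have 5: "(\<Sum>b\<in>E. p m ?a b * U (as @ [b])) = F (hv as @ [\<sigma> ?a])"
        by (simp add: sum_distrib_right[symmetric] row)
      have "U as = (\<Sum>c\<in>S. of_bool (\<sigma> ?a = c) * \<Phi> 0 (hv as @ [c]))"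
        unfolding U_def using 4 H_A by auto
      also have "\<dots> = F (hv as @ [\<sigma> ?a])"
        using \<sigma>[OF 4(1)] S by (simp add: \<Phi>_def of_bool_def if_distrib[of "\<lambda>x. x * _"] sum.delta cong: if_cong)
      finally show ?thesis unfolding 5 using e1 e2 by simp
    qed
  qed
  have cnt_append: "cnt (as @ [b]) = cnt as + of_bool (last as \<in> A \<and> length (hv as) \<le> K)" if "as \<noteq> []" for as b
    unfolding cnt_def hv_append[OF that] by auto
  \<comment> \<open>The sign \<open>s\<close> is 1 or -1, so that one induction with the one-sided
    inequality gives both bounds.\<close>
  have iter: "expectation (\<lambda>\<omega>. s * U (hist m i \<omega>) - e1 * cnt (hist m i \<omega>))
      \<le> expectation (\<lambda>\<omega>. s * U (hist m 0 \<omega>)) + real i * e2" if s: "\<bar>s\<bar> = 1" for s i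
  proof (induction i)
    case 0
    have "cnt (hist m 0 \<omega>) = 0" for \<omega> by (simp add: cnt_def hv_def hist_def)
    then show ?case by simp
  next
    case (Suc i)
    have "expectation (\<lambda>\<omega>. s * U (hist m (Suc i) \<omega>) - e1 * cnt (hist m (Suc i) \<omega>))
        \<le> expectation (\<lambda>\<omega>. s * U (hist m i \<omega>) - e1 * cnt (hist m i \<omega>) + e2)"
    proof (rule hist_step_le[OF m, of i "\<lambda>as. s * U as - e1 * cnt as" "\<lambda>as. s * U as - e1 * cnt as + e2"])
      fix as assume as: "as \<in> paths i" "0 < pr m i as"
      then have ne: "as \<noteq> []" by (auto simp: paths_def)
      let ?i = "of_bool (last as \<in> A \<and> length (hv as) \<le> K) :: real"
      let ?T = "\<Sum>b\<in>E. p m (last as) b * U (as @ [b])"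
      have "(\<Sum>b\<in>E. p m (last as) b * (s * U (as @ [b]) - e1 * cnt (as @ [b]))) =
          s * ?T - e1 * (cnt as + ?i) * (\<Sum>b\<in>E. p m (last as) b)"
        by (simp only: cnt_append[OF ne] sum_distrib_left sum_subtractf[symmetric]) (simp add: algebra_simps)
      also have "\<dots> = s * ?T - e1 * cnt as - e1 * ?i" by (simp only: p_row[OF m as]) (simp add: algebra_simps)
      also have "s * ?T \<le> s * U as + (e2 + ?i * e1)"
      proof -
        have "s * ?T - s * U as = s * (?T - U as)" by (simp add: algebra_simps)
        also have "\<dots> \<le> \<bar>s * (?T - U as)\<bar>" by simp
        also have "\<dots> \<le> e2 + ?i * e1" using step[OF as] s by (simp add: abs_mult)
        finally show ?thesis by simp
      qed
      finally show "(\<Sum>b\<in>E. p m (last as) b * (s * U (as @ [b]) - e1 * cnt (as @ [b]))) \<le> s * U as - e1 * cnt as + e2"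
        by (simp add: algebra_simps)
    qed
    also have "\<dots> = expectation (\<lambda>\<omega>. s * U (hist m i \<omega>) - e1 * cnt (hist m i \<omega>)) + e2"
      using hist_integrable[OF m, of "\<lambda>as. s * U as - e1 * cnt as" i] by (simp add: prob_space)
    finally show ?case using Suc by (simp add: algebra_simps)
  qed
  let ?EU = "\<lambda>i. expectation (\<lambda>\<omega>. U (hist m i \<omega>))"
  have two: "s * ?EU n \<le> s * ?EU 0 + real n * e2 + real (Suc K) * e1" if s: "\<bar>s\<bar> = 1" for s
  proof -
    have "s * ?EU n = expectation (\<lambda>\<omega>. s * U (hist m n \<omega>))" by simp
    also have "\<dots> \<le> expectation (\<lambda>\<omega>. s * U (hist m n \<omega>) - e1 * cnt (hist m n \<omega>) + e1 * real (Suc K))"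
    proof (rule integral_mono)
      show "integrable P (\<lambda>\<omega>. s * U (hist m n \<omega>))" by (rule hist_integrable[OF m])
      show "integrable P (\<lambda>\<omega>. s * U (hist m n \<omega>) - e1 * cnt (hist m n \<omega>) + e1 * real (Suc K))"
        by (rule hist_integrable[OF m, of "\<lambda>as. s * U as - e1 * cnt as + e1 * real (Suc K)"])
      fix \<omega>
      have "e1 * cnt (hist m n \<omega>) \<le> e1 * real (Suc K)" using e1 by (intro mult_left_mono) (auto simp: cnt_def)
      then show "s * U (hist m n \<omega>) \<le> s * U (hist m n \<omega>) - e1 * cnt (hist m n \<omega>) + e1 * real (Suc K)" by simp
    qed
    also have "\<dots> = expectation (\<lambda>\<omega>. s * U (hist m n \<omega>) - e1 * cnt (hist m n \<omega>)) + e1 * real (Suc K)"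
      using hist_integrable[OF m, of "\<lambda>as. s * U as - e1 * cnt as" n] by (simp add: prob_space)
    also have "\<dots> \<le> expectation (\<lambda>\<omega>. s * U (hist m 0 \<omega>)) + real n * e2 + e1 * real (Suc K)"
      using iter[OF s, of n] by simp
    finally show ?thesis by (simp add: mult.commute)
  qed
  have EU: "\<bar>?EU n - ?EU 0\<bar> \<le> real n * e2 + real (Suc K) * e1"
    using two[of 1] two[of "-1"] by (simp add: abs_le_iff)
  have EU0: "?EU 0 = expectation (\<lambda>\<omega>. \<Sum>b\<in>S. H b (Y 0 \<omega>) * backward R S F K [b])"
    by (simp add: U_def hv_def hist_def \<Phi>_def)
  have EUn: "\<bar>expectation (\<lambda>\<omega>. F (take (Suc K) (map \<sigma> (visits A (\<lambda>t. Y t \<omega>) m n)))) - ?EU n\<bar> \<le>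
      (real (card S) + 1) * M * prob {\<omega>\<in>space P. length (visits A (\<lambda>t. Y t \<omega>) m n) \<le> K}"
  proof -
    let ?L = "{\<omega>\<in>space P. length (visits A (\<lambda>t. Y t \<omega>) m n) \<le> K}"
    have "(\<lambda>\<omega>. real (length (visits A (\<lambda>t. Y t \<omega>) m n))) \<in> borel_measurable P"
      by (rule visits_measurable[OF m])
    then have "{\<omega>\<in>space P. real (length (visits A (\<lambda>t. Y t \<omega>) m n)) \<le> real K} \<in> events" by measurable
    then have ev: "?L \<in> events" by simp
    have hv_hist: "hv (hist m n \<omega>) = map \<sigma> (visits A (\<lambda>t. Y t \<omega>) m n)" for \<omega>
      unfolding hv_def visits_hist ..
    have i1: "integrable P (\<lambda>\<omega>. F (take (Suc K) (map \<sigma> (visits A (\<lambda>t. Y t \<omega>) m n))))"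
      by (rule visits_integrable[OF m, of "\<lambda>l. F (take (Suc K) (map \<sigma> l))"])
    have i2: "integrable P (\<lambda>\<omega>. U (hist m n \<omega>))" by (rule hist_integrable[OF m])
    have "\<bar>expectation (\<lambda>\<omega>. F (take (Suc K) (map \<sigma> (visits A (\<lambda>t. Y t \<omega>) m n)))) - ?EU n\<bar> =
        \<bar>expectation (\<lambda>\<omega>. F (take (Suc K) (map \<sigma> (visits A (\<lambda>t. Y t \<omega>) m n))) - U (hist m n \<omega>))\<bar>"
      using i1 i2 by simp
    also have "\<dots> \<le> expectation (\<lambda>\<omega>. (real (card S) + 1) * M * indicator ?L \<omega>)"
    proof (rule order.trans[OF integral_abs_bound integral_mono])
      show "integrable P (\<lambda>\<omega>. \<bar>F (take (Suc K) (map \<sigma> (visits A (\<lambda>t. Y t \<omega>) m n))) - U (hist m n \<omega>)\<bar>)"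
        using i1 i2 by simp
      show "integrable P (\<lambda>\<omega>. (real (card S) + 1) * M * indicator ?L \<omega>)"
        by (intro integrable_mult_right integrable_real_indicator ev) (simp add: emeasure_eq_measure)
      fix \<omega> assume \<omega>: "\<omega> \<in> space P"
      show "\<bar>F (take (Suc K) (map \<sigma> (visits A (\<lambda>t. Y t \<omega>) m n))) - U (hist m n \<omega>)\<bar>
          \<le> (real (card S) + 1) * M * indicator ?L \<omega>"
      proof (cases "length (visits A (\<lambda>t. Y t \<omega>) m n) \<le> K")
        case False
        then show ?thesis by (simp add: U_def hv_hist)
      next
        case True
        let ?as = "hist m n \<omega>"
        have l: "last ?as \<in> E" unfolding last_hist using m by (intro Y_in[OF \<omega>]) simp
        have "\<bar>U ?as\<bar> \<le> (\<Sum>b\<in>S. \<bar>H b (last ?as) * \<Phi> (K - length (hv ?as)) (hv ?as @ [b])\<bar>)"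
          unfolding U_def using True by (auto simp: hv_hist)
        also have "\<dots> \<le> (\<Sum>b\<in>S. 1 * M)"
          unfolding abs_mult by (intro sum_mono mult_mono H_bound[OF l] \<Phi>_bound) auto
        finally have "\<bar>U ?as\<bar> \<le> real (card S) * M" by simp
        moreover have "\<bar>F (take (Suc K) (map \<sigma> (visits A (\<lambda>t. Y t \<omega>) m n)))\<bar> \<le> M" by (rule F)
        ultimately show ?thesis using True \<omega> by (simp add: algebra_simps)
      qed
    qed
    also have "\<dots> = (real (card S) + 1) * M * prob ?L" using ev by simp
    finally show ?thesis .
  qed
  have "real (Suc K) * e1 = M * real (card S) * real (Suc K) * \<epsilon> / m" by (simp add: e1_def)
  then show ?thesis using EU EUn unfolding EU0 e2_def by linarith
qed

end

section \<open>Hitting times\<close>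

text \<open>The hitting time capped at \<open>M\<close> as a real number, fit for dominated
  convergence. The case distinction keeps \<open>Inf\<close> away from the empty set.\<close>

definition hitting_cut :: "'a set \<Rightarrow> (real \<Rightarrow> 'a) \<Rightarrow> real \<Rightarrow> real" where
  "hitting_cut B w M = (if \<exists>t\<in>{0..<M}. w t \<in> B then Inf {t. 0 \<le> t \<and> w t \<in> B} else M)"

text \<open>The infimum is attained: just after it the path is constant by right-continuity, and
  there are hits arbitrarily close.\<close>

lemma first_hit:
  assumes w: "cadlag E w" and hit: "0 \<le> s" "w s \<in> B"
  shows "0 \<le> Inf {t. 0 \<le> t \<and> w t \<in> B}" "Inf {t. 0 \<le> t \<and> w t \<in> B} \<le> s"
    "w (Inf {t. 0 \<le> t \<and> w t \<in> B}) \<in> B"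
    "\<And>t. 0 \<le> t \<Longrightarrow> t < Inf {t. 0 \<le> t \<and> w t \<in> B} \<Longrightarrow> w t \<notin> B"
proof -
  let ?X = "{t. 0 \<le> t \<and> w t \<in> B}"
  have s: "s \<in> ?X" using hit by simp
  have bdd: "bdd_below ?X" by (rule bdd_belowI[of _ 0]) simp
  show 0: "0 \<le> Inf ?X" by (rule cInf_greatest) (use s in auto)
  show "Inf ?X \<le> s" by (rule cInf_lower[OF s bdd])
  show "w t \<notin> B" if "0 \<le> t" "t < Inf ?X" for t
  proof
    assume "w t \<in> B"
    then have "Inf ?X \<le> t" using that by (intro cInf_lower[OF _ bdd]) simp
    then show False using that by simp
  qed
  obtain e where e: "0 < e" "\<And>s. Inf ?X \<le> s \<Longrightarrow> s < Inf ?X + e \<Longrightarrow> w s = w (Inf ?X)"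
    using cadlag_right[OF w 0] by blast
  have "Inf ?X < Inf ?X + e" using e(1) by simp
  then obtain u where u: "u \<in> ?X" "u < Inf ?X + e" using cInf_less_iff[OF _ bdd] s by blast
  have "w u = w (Inf ?X)" by (rule e(2)[OF cInf_lower[OF u(1) bdd] u(2)])
  then show "w (Inf ?X) \<in> B" using u by simp
qed

lemma hitting_cut_bounds:
  assumes "cadlag E w" "0 \<le> M"
  shows "0 \<le> hitting_cut B w M" "hitting_cut B w M \<le> M"
proof -
  have "0 \<le> hitting_cut B w M \<and> hitting_cut B w M \<le> M"
  proof (cases "\<exists>t\<in>{0..<M}. w t \<in> B")
    case True
    then obtain t where t: "0 \<le> t" "t < M" "w t \<in> B" by auto
    from first_hit[OF assms(1) t(1,3)] True t(2) show ?thesis by (simp add: hitting_cut_def)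
  qed (use assms(2) in \<open>simp add: hitting_cut_def\<close>)
  then show "0 \<le> hitting_cut B w M" "hitting_cut B w M \<le> M" by auto
qed

lemma ennreal_hitting_cut:
  assumes w: "cadlag E w" and M: "0 \<le> M"
  shows "ennreal (hitting_cut B w M) = min (hitting_time B w) (ennreal M)"
proof (cases "\<exists>t\<in>{0..<M}. w t \<in> B")
  case True
  then obtain s where s: "0 \<le> s" "s < M" "w s \<in> B" by auto
  let ?\<tau> = "Inf {t. 0 \<le> t \<and> w t \<in> B}"
  note h = first_hit[OF w s(1,3)]
  have "hitting_time B w = ennreal ?\<tau>"
    unfolding hitting_time_def
  proof (rule antisym)
    show "(INF t\<in>{t. 0 \<le> t \<and> w t \<in> B}. ennreal t) \<le> ennreal ?\<tau>"
      by (rule INF_lower) (use h in simp)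
    show "ennreal ?\<tau> \<le> (INF t\<in>{t. 0 \<le> t \<and> w t \<in> B}. ennreal t)"
    proof (rule INF_greatest)
      fix t assume "t \<in> {t. 0 \<le> t \<and> w t \<in> B}"
      then have "?\<tau> \<le> t" by (intro first_hit(2)[OF w]) auto
      then show "ennreal ?\<tau> \<le> ennreal t" by (rule ennreal_leI)
    qed
  qed
  moreover have "?\<tau> \<le> M" using h(2) s(2) by simp
  ultimately show ?thesis using True by (simp add: hitting_cut_def min_def ennreal_leI)
next
  case False
  have "ennreal M \<le> hitting_time B w"
    unfolding hitting_time_def
    by (rule INF_greatest) (use False in \<open>force intro: ennreal_leI\<close>)
  then show ?thesis using False by (simp add: hitting_cut_def min_def antisym)
qed

lemma SUP_min_of_nat: "(SUP M. min x (ennreal (real M))) = x"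
proof (rule antisym)
  show "(SUP M. min x (ennreal (real M))) \<le> x" by (rule SUP_least) simp
  show "x \<le> (SUP M. min x (ennreal (real M)))"
  proof (cases x)
    case (real r)
    obtain M :: nat where "r \<le> real M" using real_arch_simple by blast
    then have "min x (ennreal (real M)) = x" using real by (simp add: min_def ennreal_leI)
    then show ?thesis by (metis SUP_upper UNIV_I)
  next
    case top
    then have "min x (ennreal (real M)) = of_nat M" for M by (simp add: ennreal_of_nat_eq_real_of_nat)
    then show ?thesis by (simp only: ennreal_SUP_of_nat_eq_top top_greatest)
  qed
qed

text \<open>The sum counts the grid times before the first grid point in \<open>B\<close>. Since the
  path stays in \<open>B\<close> for a while after hitting it, a fine grid notices the hit within
  one cell.\<close>

lemma hitting_cut_lim:
  assumes w: "cadlag E w"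
  shows "(\<lambda>n. (\<Sum>j<Suc n * M. of_bool (\<forall>i\<le>j. w (real i / real (Suc n)) \<notin> B)) / real (Suc n))
           \<longlonglongrightarrow> hitting_cut B w (real M)"
proof (cases "\<exists>t\<in>{0..<real M}. w t \<in> B")
  case False
  have "(\<Sum>j<Suc n * M. of_bool (\<forall>i\<le>j. w (real i / real (Suc n)) \<notin> B)) / real (Suc n) = real M" for n
  proof -
    have "(\<Sum>j<Suc n * M. of_bool (\<forall>i\<le>j. w (real i / real (Suc n)) \<notin> B)) = (\<Sum>j<Suc n * M. 1 :: real)"
    proof (rule sum.cong[OF refl])
      fix j assume j: "j \<in> {..<Suc n * M}"
      have "w (real i / real (Suc n)) \<notin> B" if "i \<le> j" for i
      proof -
        have "i < Suc n * M" using that j by simp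
        then have "real i < real (Suc n * M)" by (simp only: of_nat_less_iff)
        then have "real i < real M * real (Suc n)" by (simp only: of_nat_mult mult.commute)
        then have "real i / real (Suc n) < real M" by (simp add: pos_divide_less_eq del: of_nat_Suc)
        then show ?thesis using False by auto
      qed
      then show "of_bool (\<forall>i\<le>j. w (real i / real (Suc n)) \<notin> B) = (1 :: real)" by simp
    qed
    then show ?thesis by (simp del: of_nat_Suc mult_Suc)
  qed
  then show ?thesis using False by (simp add: hitting_cut_def)
next
  case True
  then obtain s where s: "0 \<le> s" "s < real M" "w s \<in> B" by auto
  define \<tau> where "\<tau> = Inf {t. 0 \<le> t \<and> w t \<in> B}"
  note h = first_hit[OF w s(1,3), folded \<tau>_def]
  have cut: "hitting_cut B w (real M) = \<tau>" using True by (simp add: hitting_cut_def \<tau>_def)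
  obtain e where e: "0 < e" "\<And>s. \<tau> \<le> s \<Longrightarrow> s < \<tau> + e \<Longrightarrow> w s = w \<tau>"
    using cadlag_right[OF w h(1)] by blast
  define e' where "e' = min e (real M - \<tau>)"
  have e': "0 < e'" using e(1) h(2) s(2) by (simp add: e'_def)
  have lim1: "(\<lambda>n. 1 / real (Suc n)) \<longlonglongrightarrow> 0" using LIMSEQ_inverse_real_of_nat by (simp add: inverse_eq_divide)
  have "\<forall>\<^sub>F n in sequentially. 1 / real (Suc n) < e'"
    by (rule order_tendstoD(2)[OF lim1 e'])
  then have ev: "\<forall>\<^sub>F n in sequentially. \<bar>(\<Sum>j<Suc n * M. of_bool (\<forall>i\<le>j. w (real i / real (Suc n)) \<notin> B)) / real (Suc n) - \<tau>\<bar> \<le> 1 / real (Suc n)"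
  proof (rule eventually_mono)
    fix n assume n: "1 / real (Suc n) < e'"
    define m where "m = real (Suc n)"
    have m: "0 < m" by (simp add: m_def)
    define i0 where "i0 = nat \<lceil>m * \<tau>\<rceil>"
    have "0 \<le> m * \<tau>" using m h(1) by simp
    then have i0: "m * \<tau> \<le> real i0" "real i0 < m * \<tau> + 1" unfolding i0_def by linarith+
    have t0: "\<tau> \<le> real i0 / m" "real i0 / m < \<tau> + 1 / m"
      using i0 m by (auto simp: pos_le_divide_eq pos_divide_less_eq mult.commute field_simps)
    have "w (real i0 / m) = w \<tau>" by (rule e(2)) (use t0 n in \<open>auto simp: e'_def m_def\<close>)
    then have hit: "w (real i0 / m) \<in> B" using h(3) by simp
    have "real i0 / m < real M" using t0(2) n by (simp add: e'_def m_def)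
    then have "real i0 < real M * real (Suc n)" using m by (simp add: pos_divide_less_eq m_def del: of_nat_Suc)
    then have "real i0 < real (Suc n * M)" by (simp only: of_nat_mult mult.commute)
    then have i0J: "i0 < Suc n * M" by (simp only: of_nat_less_iff)
    have before: "w (real i / m) \<notin> B" if "i < i0" for i
    proof (rule h(4))
      have "real i < m * \<tau>" using that unfolding i0_def by linarith
      then show "real i / m < \<tau>" using m by (simp add: pos_divide_less_eq mult.commute)
    qed (use m in simp)
    have "(\<Sum>j<Suc n * M. of_bool (\<forall>i\<le>j. w (real i / m) \<notin> B)) = (\<Sum>j<Suc n * M. if j \<in> {..<i0} then 1 else 0 :: real)"
    proof (rule sum.cong[OF refl])
      fix j
      show "of_bool (\<forall>i\<le>j. w (real i / m) \<notin> B) = (if j \<in> {..<i0} then 1 else 0 :: real)"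
      proof (cases "j < i0")
        case True
        then have "\<forall>i\<le>j. w (real i / m) \<notin> B" using before by auto
        then show ?thesis using True by simp
      next
        case False
        then have "\<not> (\<forall>i\<le>j. w (real i / m) \<notin> B)" using hit by (auto intro!: exI[of _ i0])
        then show ?thesis using False by simp
      qed
    qed
    also have "\<dots> = (\<Sum>j\<in>{..<Suc n * M} \<inter> {..<i0}. 1 :: real)"
      by (rule sum.inter_restrict[symmetric]) simp
    also have "{..<Suc n * M} \<inter> {..<i0} = {..<i0}" using i0J by auto
    finally have "(\<Sum>j<Suc n * M. of_bool (\<forall>i\<le>j. w (real i / m) \<notin> B)) = real i0" by simp
    then show "\<bar>(\<Sum>j<Suc n * M. of_bool (\<forall>i\<le>j. w (real i / real (Suc n)) \<notin> B)) / real (Suc n) - \<tau>\<bar> \<le> 1 / real (Suc n)"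
      using t0 unfolding m_def by simp
  qed
  show ?thesis
    unfolding cut
    by (rule Lim_null_comparison[OF _ lim1, of "\<lambda>n. _ n - \<tau>", THEN LIM_zero_cancel]) (use ev in simp)
qed

context jump_process
begin

text \<open>Dynkin's formula on the grid: among the histories that avoid \<open>B\<close>, the mean
  of \<open>V\<close> drops in each step by \<open>1 / m\<close> times the survival probability.
  Summation gives \<open>V x0\<close> as the mean hitting time capped at \<open>M\<close>, plus the
  mean of \<open>V\<close> on survival; a bounded \<open>V\<close> makes the latter of order
  \<open>1 / M\<close>.\<close>

lemma expected_hitting_time:
  assumes V0: "\<And>a. a \<in> E \<Longrightarrow> 0 \<le> V a" and VB: "\<And>a. a \<in> E \<Longrightarrow> a \<in> B \<Longrightarrow> V a = 0"
    and V: "\<And>a. a \<in> E - B \<Longrightarrow> gen V a = - 1"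
    and start: "AE \<omega> in P. Y 0 \<omega> = x0"
  shows "(\<integral>\<^sup>+\<omega>. hitting_time B (\<lambda>t. Y t \<omega>) \<partial>P) = ennreal (V x0)"
proof -
  have x0: "x0 \<in> E"
  proof -
    have "AE \<omega> in P. x0 \<in> E" using start AE_space by eventually_elim (use Y_in[of _ 0] in auto)
    then show ?thesis by (simp add: AE_const)
  qed
  define K where "K = (\<Sum>a\<in>E. V a)"
  have VK: "V a \<le> K" if "a \<in> E" for a
    unfolding K_def by (rule member_le_sum[OF that]) (use V0 finite_E in auto)
  have K0: "0 \<le> K" unfolding K_def by (rule sum_nonneg) (rule V0)
  have Vabs: "\<bar>V a\<bar> \<le> K" if "a \<in> E" for a using V0[OF that] VK[OF that] by simp
  define c where "c = real (card E) * C * K"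
  have c0: "0 \<le> c" 
  proof -
    have "0 \<le> C" using C_nonneg x0 by auto
    then show ?thesis unfolding c_def using K0 by simp
  qed
  define D where "D as = (of_bool (set as \<inter> B = {}) :: real)" for as
  define G where "G as = D as * V (last as)" for as
  let ?ED = "\<lambda>m j. expectation (\<lambda>\<omega>. D (hist m j \<omega>))"
  let ?EG = "\<lambda>m j. expectation (\<lambda>\<omega>. G (hist m j \<omega>))"
  have ED0: "0 \<le> ?ED m j" for m j by (rule integral_nonneg_AE) (simp add: D_def)
  have step: "\<bar>?EG m (Suc j) - ?EG m j + ?ED m j / m\<bar> \<le> c / m\<^sup>2 * ?ED m j" if m: "1 \<le> m" for m j
  proof -
    have "?EG m (Suc j) - ?EG m j + ?ED m j / m =
        (\<Sum>as\<in>paths j. pr m j as * ((\<Sum>b\<in>E. p m (last as) b * G (as @ [b])) - G as + D as / m))"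
      unfolding hist_step[OF m] hist_expectation[OF m]
      by (simp add: sum_subtractf[symmetric] sum.distrib[symmetric] sum_divide_distrib algebra_simps)
    also have "\<bar>\<dots>\<bar> \<le> (\<Sum>as\<in>paths j. \<bar>pr m j as * ((\<Sum>b\<in>E. p m (last as) b * G (as @ [b])) - G as + D as / m)\<bar>)"
      by (rule sum_abs)
    also have "\<dots> \<le> (\<Sum>as\<in>paths j. pr m j as * (c / m\<^sup>2 * D as))"
    proof (rule sum_mono)
      fix as assume as: "as \<in> paths j"
      have a: "last as \<in> E" by (rule last_paths[OF as])
      have ne: "as \<noteq> []" using as by (auto simp: paths_def)
      have "G (as @ [b]) = D as * V b" if "b \<in> E" for b
        unfolding G_def D_def using VB[OF that] by auto
      then have sumG: "(\<Sum>b\<in>E. p m (last as) b * G (as @ [b])) = D as * (\<Sum>b\<in>E. p m (last as) b * V b)"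
        by (simp add: sum_distrib_left mult.left_commute)
      have "\<bar>(\<Sum>b\<in>E. p m (last as) b * G (as @ [b])) - G as + D as / m\<bar> \<le> c / m\<^sup>2 * D as"
      proof (cases "set as \<inter> B = {}")
        case True
        then have "last as \<in> E - B" using a ne by (auto dest: last_in_set)
        then have "gen V (last as) = - 1" by (rule V)
        with p_sum_expansion[OF m a, of V K] Vabs
        have "\<bar>(\<Sum>b\<in>E. p m (last as) b * V b) - V (last as) + 1 / m\<bar> \<le> c / m\<^sup>2"
          by (simp add: c_def)
        then show ?thesis using True unfolding sumG by (simp add: G_def D_def)
      next
        case False
        then show ?thesis unfolding sumG by (simp add: G_def D_def)
      qed
      then show "\<bar>pr m j as * ((\<Sum>b\<in>E. p m (last as) b * G (as @ [b])) - G as + D as / m)\<bar>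
          \<le> pr m j as * (c / m\<^sup>2 * D as)"
        unfolding abs_mult abs_of_nonneg[OF pr_nonneg] by (rule mult_left_mono[OF _ pr_nonneg])
    qed
    also have "\<dots> = c / m\<^sup>2 * ?ED m j"
      unfolding hist_expectation[OF m] by (simp add: sum_distrib_left mult.left_commute)
    finally show ?thesis .
  qed
  \<comment> \<open>\<open>T m J\<close> is the mean hitting time on the grid, capped at
    \<open>J\<close> steps. The error of each step is proportional to the survival probability, so
    the total error is \<open>c / m\<close> times \<open>T m J\<close> itself.\<close>
  define T where "T m J = (\<Sum>j<J. ?ED m j) / m" for m J
  have T0: "0 \<le> T m J" if "1 \<le> m" for m J unfolding T_def using that ED0 by (simp add: sum_nonneg)
  have EG0: "?EG m 0 = V x0" for m
  proof -
    have "?EG m 0 = expectation (\<lambda>\<omega>. V x0)"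
    proof (rule integral_cong_AE)
      show "(\<lambda>\<omega>. G (hist m 0 \<omega>)) \<in> borel_measurable P"
        using hist_measurable[of 1 G 0] by (simp add: hist_def)
      show "AE \<omega> in P. G (hist m 0 \<omega>) = V x0"
        using start by eventually_elim (use VB[OF x0] in \<open>auto simp: G_def D_def hist_def\<close>)
    qed simp
    then show ?thesis by (simp add: prob_space)
  qed
  have tot: "\<bar>?EG m J - V x0 + T m J\<bar> \<le> c / m * T m J" if m: "1 \<le> m" for m J
  proof (induction J)
    case 0
    then show ?case by (simp add: T_def EG0)
  next
    case (Suc J)
    have TS: "T m (Suc J) = T m J + ?ED m J / m" by (simp add: T_def add_divide_distrib)
    have "c / m * T m (Suc J) = c / m * T m J + c / m\<^sup>2 * ?ED m J"
      unfolding TS by (simp add: distrib_left power2_eq_square)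
    then show ?case using Suc step[OF m, of J] unfolding TS by linarith
  qed
  have ED_anti: "?ED m J \<le> ?ED m j" if "j \<le> J" "1 \<le> m" for m j J
  proof (rule integral_mono[OF hist_integrable[OF that(2)] hist_integrable[OF that(2)]])
    fix \<omega>
    have "set (hist m j \<omega>) \<subseteq> set (hist m J \<omega>)" using that(1) by (auto simp: hist_def simp del: upt_Suc)
    then show "D (hist m J \<omega>) \<le> D (hist m j \<omega>)" unfolding D_def by auto
  qed
  \<comment> \<open>Survival decreases in time, so its last value is at most its average. This
    bounds the probability of survival by the capped mean, which in turn is bounded by
    \<open>V x0\<close>; almost sure hitting is thereby included.\<close>
  have T_lower: "?ED m J * real J / m \<le> T m J" if m: "1 \<le> m" for m J
  proof -
    have "(\<Sum>j<J. ?ED m J) \<le> (\<Sum>j<J. ?ED m j)" by (intro sum_mono ED_anti m) simp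
    then show ?thesis unfolding T_def using m by (simp add: divide_right_mono mult.commute)
  qed
  have EG_upper: "?EG m J \<le> K * ?ED m J" if m: "1 \<le> m" for m J
  proof -
    have "?EG m J \<le> expectation (\<lambda>\<omega>. K * D (hist m J \<omega>))"
    proof (rule integral_mono[OF hist_integrable[OF m] hist_integrable[OF m]])
      fix \<omega> assume \<omega>: "\<omega> \<in> space P"
      have "V (last (hist m J \<omega>)) \<le> K" unfolding last_hist using m by (intro VK Y_in[OF \<omega>]) simp
      then show "G (hist m J \<omega>) \<le> K * D (hist m J \<omega>)" by (simp add: G_def D_def)
    qed
    then show ?thesis by simp
  qed
  have EG_lower: "0 \<le> ?EG m J" if m: "1 \<le> m" for m J
  proof (rule integral_nonneg_AE, rule AE_I2)
    fix \<omega> assume \<omega>: "\<omega> \<in> space P"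
    have "0 \<le> V (last (hist m J \<omega>))" unfolding last_hist using m by (intro V0 Y_in[OF \<omega>]) simp
    then show "0 \<le> G (hist m J \<omega>)" by (simp add: G_def D_def)
  qed
  let ?cut = "\<lambda>M \<omega>. hitting_cut B (\<lambda>t. Y t \<omega>) (real M)"
  define h where "h M = expectation (?cut M)" for M
  let ?X = "\<lambda>M n \<omega>. (\<Sum>j<Suc n * M. of_bool (\<forall>i\<le>j. Y (real i / real (Suc n)) \<omega> \<notin> B)) / real (Suc n)"
  have X_D: "?X M n \<omega> = (\<Sum>j<Suc n * M. D (hist (real (Suc n)) j \<omega>)) / real (Suc n)" for M n \<omega>
  proof -
    have "D (hist (real (Suc n)) j \<omega>) = of_bool (\<forall>i\<le>j. Y (real i / real (Suc n)) \<omega> \<notin> B)" for j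
      unfolding D_def hist_def set_map set_upt disjoint_iff by (rule arg_cong[of _ _ of_bool]) (auto simp del: of_nat_Suc simp: less_Suc_eq_le)
    then show ?thesis by simp
  qed
  have X_meas: "?X M n \<in> borel_measurable P" for M n
    unfolding X_D by (intro borel_measurable_divide borel_measurable_sum hist_measurable) auto
  have cut_lim: "(\<lambda>n. ?X M n \<omega>) \<longlonglongrightarrow> ?cut M \<omega>" if "\<omega> \<in> space P" for M \<omega>
    by (rule hitting_cut_lim[OF cadlag_Y[OF that]])
  have cut_meas: "?cut M \<in> borel_measurable P" for M
    by (rule borel_measurable_LIMSEQ_real[OF cut_lim X_meas])
  have X_bound: "norm (?X M n \<omega>) \<le> real M" for M n \<omega>
  proof -
    have "(\<Sum>j<Suc n * M. of_bool (\<forall>i\<le>j. Y (real i / real (Suc n)) \<omega> \<notin> B) :: real) \<le> (\<Sum>j<Suc n * M. 1)"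
      by (intro sum_mono) auto
    also have "\<dots> = real M * real (Suc n)" by (simp only: sum_constant card_lessThan of_nat_mult mult_1_right mult.commute)
    finally have "?X M n \<omega> \<le> real M" by (simp add: pos_divide_le_eq del: of_nat_Suc mult_Suc)
    moreover have "0 \<le> ?X M n \<omega>" by (intro divide_nonneg_nonneg sum_nonneg) auto
    ultimately show ?thesis by simp
  qed
  have T_lim: "(\<lambda>n. T (real (Suc n)) (Suc n * M)) \<longlonglongrightarrow> h M" for M
  proof -
    have "(\<lambda>n. expectation (?X M n)) \<longlonglongrightarrow> expectation (?cut M)"
    proof (rule integral_dominated_convergence[where w = "\<lambda>_. real M"])
      show "AE \<omega> in P. (\<lambda>n. ?X M n \<omega>) \<longlonglongrightarrow> ?cut M \<omega>" by (rule AE_I2) (rule cut_lim)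
      show "AE \<omega> in P. norm (?X M n \<omega>) \<le> real M" for n by (rule AE_I2) (rule X_bound)
    qed (rule cut_meas X_meas | simp)+
    moreover have "expectation (?X M n) = T (real (Suc n)) (Suc n * M)" for n
    proof -
      have "expectation (\<lambda>\<omega>. \<Sum>j<Suc n * M. D (hist (real (Suc n)) j \<omega>)) = (\<Sum>j<Suc n * M. ?ED (real (Suc n)) j)"
        by (rule Bochner_Integration.integral_sum) (rule hist_integrable, simp)
      then show ?thesis unfolding X_D T_def by (simp del: of_nat_Suc mult_Suc)
    qed
    ultimately show ?thesis by (simp add: h_def)
  qed
  have c_lim: "(\<lambda>n. c / real (Suc n) * T (real (Suc n)) (Suc n * M)) \<longlonglongrightarrow> 0" for M
  proof -
    have "(\<lambda>n. c * inverse (real (Suc n)) * T (real (Suc n)) (Suc n * M)) \<longlonglongrightarrow> c * 0 * h M"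
      by (intro tendsto_intros T_lim LIMSEQ_inverse_real_of_nat)
    then show ?thesis by (simp add: divide_inverse)
  qed
  have h_upper: "h M \<le> V x0" for M
  proof -
    have "(\<lambda>n. T (real (Suc n)) (Suc n * M) - c / real (Suc n) * T (real (Suc n)) (Suc n * M)) \<longlonglongrightarrow> h M - 0"
      by (intro tendsto_diff T_lim c_lim)
    moreover have "T (real (Suc n)) (Suc n * M) - c / real (Suc n) * T (real (Suc n)) (Suc n * M) \<le> V x0" for n
      using tot[of "real (Suc n)" "Suc n * M"] EG_lower[of "real (Suc n)" "Suc n * M"] by (simp del: of_nat_Suc mult_Suc; linarith)
    ultimately have "h M - 0 \<le> V x0" by (intro LIMSEQ_le_const2) blast+
    then show ?thesis by simp
  qed
  have h_lower: "V x0 - K * V x0 / real M \<le> h M" if M: "0 < M" for M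
  proof -
    have "(\<lambda>n. T (real (Suc n)) (Suc n * M) + c / real (Suc n) * T (real (Suc n)) (Suc n * M)
        + K / real M * T (real (Suc n)) (Suc n * M)) \<longlonglongrightarrow> h M + 0 + K / real M * h M"
      by (intro tendsto_add tendsto_mult_left T_lim c_lim)
    moreover have "V x0 \<le> T (real (Suc n)) (Suc n * M) + c / real (Suc n) * T (real (Suc n)) (Suc n * M)
        + K / real M * T (real (Suc n)) (Suc n * M)" for n
    proof -
      let ?m = "real (Suc n)" and ?J = "Suc n * M"
      have m: "1 \<le> ?m" by simp
      have "?ED ?m ?J * real ?J / ?m = ?ED ?m ?J * real M" by (simp del: of_nat_Suc mult_Suc)
      then have "?ED ?m ?J \<le> T ?m ?J / real M"
        using T_lower[OF m, of ?J] M by (simp add: pos_le_divide_eq del: of_nat_Suc mult_Suc)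
      then have "K * ?ED ?m ?J \<le> K * (T ?m ?J / real M)" using K0 by (rule mult_left_mono)
      then have "?EG ?m ?J \<le> K / real M * T ?m ?J" using EG_upper[OF m, of ?J] by simp
      then show ?thesis using tot[OF m, of ?J] by linarith
    qed
    ultimately have "V x0 \<le> h M + 0 + K / real M * h M" by (intro LIMSEQ_le_const) blast+
    moreover have "K / real M * h M \<le> K / real M * V x0" using h_upper K0 by (intro mult_left_mono) auto
    ultimately show ?thesis by simp
  qed
  have h_lim: "h \<longlonglongrightarrow> V x0"
  proof (rule tendsto_sandwich[of "\<lambda>M. V x0 - K * V x0 / real M" h sequentially "\<lambda>_. V x0"])
    show "\<forall>\<^sub>F M in sequentially. V x0 - K * V x0 / real M \<le> h M"
      using eventually_gt_at_top[of 0] by eventually_elim (rule h_lower)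
    have "(\<lambda>M. V x0 - K * V x0 / real M) \<longlonglongrightarrow> V x0 - 0"
      by (intro tendsto_diff tendsto_const lim_const_over_n)
    then show "(\<lambda>M. V x0 - K * V x0 / real M) \<longlonglongrightarrow> V x0" by simp
  qed (use h_upper in auto)
  have cut_nn: "(\<integral>\<^sup>+\<omega>. ennreal (?cut M \<omega>) \<partial>P) = ennreal (h M)" for M
    unfolding h_def
  proof (rule nn_integral_eq_integral)
    show "integrable P (?cut M)"
    proof (rule integrable_const_bound[where B = "real M"])
      show "AE \<omega> in P. norm (?cut M \<omega>) \<le> real M"
        by (rule AE_I2) (use hitting_cut_bounds[OF cadlag_Y] in simp)
    qed (rule cut_meas)
    show "AE \<omega> in P. 0 \<le> ?cut M \<omega>"
      by (rule AE_I2) (use hitting_cut_bounds[OF cadlag_Y] in simp)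
  qed
  let ?C = "\<lambda>M \<omega>. min (hitting_time B (\<lambda>t. Y t \<omega>)) (ennreal (real M))"
  have C_eq: "ennreal (?cut M \<omega>) = ?C M \<omega>" if "\<omega> \<in> space P" for M \<omega>
    by (rule ennreal_hitting_cut[OF cadlag_Y[OF that]]) simp
  have inc: "incseq ?C"
    by (intro incseq_SucI le_funI min.mono order.refl ennreal_leI) simp
  have "(\<integral>\<^sup>+\<omega>. hitting_time B (\<lambda>t. Y t \<omega>) \<partial>P) = (\<integral>\<^sup>+\<omega>. (SUP M. ?C M \<omega>) \<partial>P)"
    by (simp only: SUP_min_of_nat)
  also have "\<dots> = (SUP M. \<integral>\<^sup>+\<omega>. ?C M \<omega> \<partial>P)"
  proof (rule nn_integral_monotone_convergence_SUP[OF inc])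
    show "?C M \<in> borel_measurable P" for M
      using measurable_compose[OF cut_meas measurable_ennreal] by (rule measurable_cong[THEN iffD1, rotated]) (rule C_eq)
  qed
  also have "\<dots> = (SUP M. ennreal (h M))"
    by (simp only: cut_nn[symmetric] nn_integral_cong[OF C_eq])
  also have "\<dots> = ennreal (V x0)"
  proof (rule LIMSEQ_unique[OF LIMSEQ_SUP])
    show "incseq (\<lambda>M. ennreal (h M))"
    proof (rule incseq_SucI)
      fix M
      have "(\<integral>\<^sup>+\<omega>. ?C M \<omega> \<partial>P) \<le> (\<integral>\<^sup>+\<omega>. ?C (Suc M) \<omega> \<partial>P)"
        using incseq_SucD[OF inc, of M] by (intro nn_integral_mono) (simp only: le_fun_def)
      then show "ennreal (h M) \<le> ennreal (h (Suc M))"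
        by (simp only: cut_nn[symmetric] nn_integral_cong[OF C_eq])
    qed
    show "(\<lambda>M. ennreal (h M)) \<longlonglongrightarrow> ennreal (V x0)"
      by (rule tendsto_ennrealI[OF h_lim])
  qed
  finally show ?thesis .
qed

end

section \<open>Weak convergence of trace processes\<close>

context jump_process
begin

text \<open>As the mesh is refined, the quadratic errors sum to order \<open>1 / (k + 1)\<close> and
  too few visits have probability of order \<open>exp (- \<kappa> * (k + 1))\<close>. Only the rate
  error \<open>\<epsilon>\<close> over the local time \<open>T\<close>, that is
  \<open>T * mesh k\<close> steps of the chain, survives. The bound is uniform in \<open>F\<close>
  because the functions to which it is applied later depend on the mesh.\<close>

lemma compare_eventually_general:
  fixes \<sigma> :: "'a \<Rightarrow> 's" and S :: "'s set"
  assumes S: "finite S" and A: "A \<subseteq> E" and \<sigma>: "\<And>a. a \<in> A \<Longrightarrow> \<sigma> a \<in> S"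
    and H_bound: "\<And>a b. a \<in> E \<Longrightarrow> b \<in> S \<Longrightarrow> \<bar>H b a\<bar> \<le> 1"
    and H_A: "\<And>a b. a \<in> A \<Longrightarrow> b \<in> S \<Longrightarrow> H b a = of_bool (\<sigma> a = b)"
    and harmonic: "\<And>a b. a \<in> E - A \<Longrightarrow> b \<in> S \<Longrightarrow> gen (H b) a = 0"
    and near: "\<And>a b. a \<in> A \<Longrightarrow> b \<in> S \<Longrightarrow> \<bar>gen (H b) a - \<Lambda> (\<sigma> a) b\<bar> \<le> \<epsilon>" and \<epsilon>: "0 \<le> \<epsilon>"
    and \<Lambda>_nonneg: "\<And>a b. a \<in> S \<Longrightarrow> b \<in> S \<Longrightarrow> a \<noteq> b \<Longrightarrow> 0 \<le> \<Lambda> a b"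
    and \<Lambda>_row: "\<And>a. a \<in> S \<Longrightarrow> (\<Sum>b\<in>S. \<Lambda> a b) = 0"
    and \<kappa>: "0 < \<kappa>" "1 \<le> m0"
    and lap: "\<And>m n. m0 \<le> m \<Longrightarrow> expectation (\<lambda>\<omega>. exp (- 2 * real (length (visits A (\<lambda>t. Y t \<omega>) m n)) / m)) \<le> 2 * exp (- \<kappa> * real n / m)"
    and M: "0 \<le> M" and \<delta>: "0 < \<delta>"
  shows "\<forall>\<^sub>F k in sequentially. \<forall>F. (\<forall>h. \<bar>F h\<bar> \<le> M) \<longrightarrow>
    \<bar>expectation (\<lambda>\<omega>. F (take (Suc (T * Suc k ^ 2)) (map \<sigma> (visits A (\<lambda>t. Y t \<omega>) (mesh k) (horizon k))))) -
       (\<Sum>b\<in>S. expectation (\<lambda>\<omega>. H b (Y 0 \<omega>)) *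
         backward (\<lambda>a b. of_bool (a = b) + \<Lambda> a b / mesh k) S F (T * Suc k ^ 2) [b])\<bar>
     \<le> M * real (card S) * (real T + 1) * \<epsilon> + \<delta>"
proof -
  let ?c = "M * real (card S) * real (card E) * C"
  let ?d = "(real (card S) + 1) * M * (2 * exp (2 * real T))"
  have "(\<lambda>k. ?c * inverse (real (Suc k)) + ?d * (exp (- \<kappa>) ^ Suc k)) \<longlonglongrightarrow> ?c * 0 + ?d * 0"
    by (intro tendsto_intros LIMSEQ_inverse_real_of_nat LIMSEQ_Suc[OF LIMSEQ_power_zero]) (use \<kappa>(1) in simp)
  then have "(\<lambda>k. ?c * inverse (real (Suc k)) + ?d * (exp (- \<kappa>) ^ Suc k)) \<longlonglongrightarrow> 0" by simp
  then have small: "\<forall>\<^sub>F k in sequentially. ?c * inverse (real (Suc k)) + ?d * (exp (- \<kappa>) ^ Suc k) < \<delta>"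
    using \<delta> by (rule order_tendstoD)
  have big: "\<forall>\<^sub>F k in sequentially. max m0 (\<Sum>a\<in>S. \<bar>\<Lambda> a a\<bar>) \<le> mesh k"
    using filterlim_mesh unfolding filterlim_at_top by blast
  from small big show ?thesis
  proof eventually_elim
    case (elim k)
    let ?m = "mesh k" and ?R = "\<lambda>a b. of_bool (a = b) + \<Lambda> a b / mesh k" and ?K = "T * Suc k ^ 2"
    have m: "1 \<le> ?m" by (rule mesh_ge_1)
    have K: "real ?K = real T * ?m" by (simp only: of_nat_mult of_nat_power mesh_def)
    have R_nonneg: "0 \<le> ?R a b" if "a \<in> S" "b \<in> S" for a b
    proof (cases "a = b")
      case True
      have "\<bar>\<Lambda> a a\<bar> \<le> (\<Sum>a\<in>S. \<bar>\<Lambda> a a\<bar>)" by (rule member_le_sum[OF that(1)]) (use S in auto)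
      then have "- \<Lambda> a a \<le> ?m" using elim(2) by linarith
      then have "0 \<le> (?m + \<Lambda> a a) / ?m" using m by simp
      then show ?thesis using True m by (simp add: add_divide_distrib)
    next
      case False
      then show ?thesis using \<Lambda>_nonneg[OF that] m by simp
    qed
    have R_row: "(\<Sum>b\<in>S. ?R a b) = 1" if "a \<in> S" for a
    proof -
      have "(\<Sum>b\<in>S. ?R a b) = (\<Sum>b\<in>S. of_bool (a = b)) + (\<Sum>b\<in>S. \<Lambda> a b) / ?m"
        by (simp add: sum.distrib sum_divide_distrib)
      then show ?thesis using \<Lambda>_row[OF that] that S by (simp add: of_bool_def sum.delta)
    qed
    show ?case
    proof (intro allI impI)
      fix F :: "'s list \<Rightarrow> real" assume F: "\<forall>h. \<bar>F h\<bar> \<le> M"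
      let ?E1 = "expectation (\<lambda>\<omega>. F (take (Suc ?K) (map \<sigma> (visits A (\<lambda>t. Y t \<omega>) ?m (horizon k)))))"
      let ?p = "prob {\<omega>\<in>space P. length (visits A (\<lambda>t. Y t \<omega>) ?m (horizon k)) \<le> ?K}"
      have 1: "\<bar>?E1 - expectation (\<lambda>\<omega>. \<Sum>b\<in>S. H b (Y 0 \<omega>) * backward ?R S F ?K [b])\<bar>
         \<le> M * real (card S) * real (Suc ?K) * \<epsilon> / ?m + real (horizon k) * (M * real (card S) * real (card E) * C / ?m\<^sup>2) +
           (real (card S) + 1) * M * ?p"
        by (rule visits_compare[OF m S A \<sigma> H_bound H_A harmonic near \<epsilon> refl R_nonneg R_row spec[OF F]])
      have "integrable P (\<lambda>\<omega>. H b (Y 0 \<omega>))" for b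
        using hist_integrable[OF m, of "\<lambda>as. H b (last as)" 0] by (simp add: last_hist)
      then have 2: "expectation (\<lambda>\<omega>. \<Sum>b\<in>S. H b (Y 0 \<omega>) * backward ?R S F ?K [b]) =
          (\<Sum>b\<in>S. expectation (\<lambda>\<omega>. H b (Y 0 \<omega>)) * backward ?R S F ?K [b])"
        by (subst Bochner_Integration.integral_sum) auto
      have 3: "M * real (card S) * real (Suc ?K) * \<epsilon> / ?m \<le> M * real (card S) * (real T + 1) * \<epsilon>"
      proof -
        have "real (Suc ?K) = real T * ?m + 1" by (simp only: of_nat_Suc K)
        also have "\<dots> \<le> (real T + 1) * ?m" using m by (simp add: algebra_simps)
        finally have "M * real (card S) * \<epsilon> * real (Suc ?K) \<le> M * real (card S) * \<epsilon> * ((real T + 1) * ?m)"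
          by (rule mult_left_mono) (use M \<epsilon> in simp)
        then show ?thesis using m by (simp add: pos_divide_le_eq mult_ac del: of_nat_Suc)
      qed
      have 4: "real (horizon k) * (M * real (card S) * real (card E) * C / ?m\<^sup>2) = ?c * inverse (real (Suc k))"
      proof -
        have "real (horizon k) * (?c / ?m\<^sup>2) = ?c * ((real (horizon k) / ?m) / ?m)"
          by (simp add: power2_eq_square)
        also have "\<dots> = ?c * (real (Suc k) / ?m)" unfolding horizon_mesh ..
        also have "real (Suc k) / ?m = inverse (real (Suc k))"
          by (simp add: mesh_def power2_eq_square inverse_eq_divide del: of_nat_Suc)
        finally show ?thesis .
      qed
      have 5: "?p \<le> 2 * exp (2 * real T) * exp (- \<kappa>) ^ Suc k"
      proof -
        have "?p = prob {\<omega>\<in>space P. real (length (visits A (\<lambda>t. Y t \<omega>) ?m (horizon k))) \<le> real T * ?m}"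
          unfolding K[symmetric] by (simp only: of_nat_le_iff)
        also have "\<dots> \<le> 2 * exp (2 * real T - \<kappa> * real (horizon k) / ?m)"
          by (rule few_visits[OF m lap]) (use elim(2) in simp)
        also have "\<kappa> * real (horizon k) / ?m = \<kappa> * real (Suc k)"
          using horizon_mesh[of k] by (simp only: times_divide_eq_right[symmetric])
        also have "exp (2 * real T - \<kappa> * real (Suc k)) = exp (2 * real T) * exp (- \<kappa>) ^ Suc k"
          by (simp only: exp_of_nat_mult[symmetric] exp_add[symmetric]) (simp add: algebra_simps)
        finally show ?thesis by (simp only: mult.assoc)
      qed
      have "(real (card S) + 1) * M * ?p \<le> (real (card S) + 1) * M * (2 * exp (2 * real T) * exp (- \<kappa>) ^ Suc k)"
        by (rule mult_left_mono[OF 5]) (use M in simp)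
      also have "\<dots> = ?d * (exp (- \<kappa>) ^ Suc k)" by (simp only: mult.assoc)
      finally have "(real (card S) + 1) * M * ?p \<le> ?d * (exp (- \<kappa>) ^ Suc k)" .
      then show "\<bar>?E1 - (\<Sum>b\<in>S. expectation (\<lambda>\<omega>. H b (Y 0 \<omega>)) * backward ?R S F ?K [b])\<bar> \<le> M * real (card S) * (real T + 1) * \<epsilon> + \<delta>"
        using 1[unfolded 2] 3 4 elim(1) by linarith
    qed
  qed
qed

lemma compare_eventually:
  fixes \<sigma> :: "'a \<Rightarrow> 's" and S :: "'s set"
  assumes S: "finite S" and A: "A \<subseteq> E" and \<sigma>: "\<And>a. a \<in> A \<Longrightarrow> \<sigma> a \<in> S"
    and H_bound: "\<And>a b. a \<in> E \<Longrightarrow> b \<in> S \<Longrightarrow> \<bar>H b a\<bar> \<le> 1"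
    and H_A: "\<And>a b. a \<in> A \<Longrightarrow> b \<in> S \<Longrightarrow> H b a = of_bool (\<sigma> a = b)"
    and harmonic: "\<And>a b. a \<in> E - A \<Longrightarrow> b \<in> S \<Longrightarrow> gen (H b) a = 0"
    and near: "\<And>a b. a \<in> A \<Longrightarrow> b \<in> S \<Longrightarrow> \<bar>gen (H b) a - \<Lambda> (\<sigma> a) b\<bar> \<le> \<epsilon>" and \<epsilon>: "0 \<le> \<epsilon>"
    and \<Lambda>_nonneg: "\<And>a b. a \<in> S \<Longrightarrow> b \<in> S \<Longrightarrow> a \<noteq> b \<Longrightarrow> 0 \<le> \<Lambda> a b"
    and \<Lambda>_row: "\<And>a. a \<in> S \<Longrightarrow> (\<Sum>b\<in>S. \<Lambda> a b) = 0"
    and \<kappa>: "0 < \<kappa>" "1 \<le> m0"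
    and lap: "\<And>m n. m0 \<le> m \<Longrightarrow> expectation (\<lambda>\<omega>. exp (- 2 * real (length (visits A (\<lambda>t. Y t \<omega>) m n)) / m)) \<le> 2 * exp (- \<kappa> * real n / m)"
    and M: "0 \<le> M" and \<delta>: "0 < \<delta>" and x: "x \<in> S"
    and start: "\<And>b. b \<in> S \<Longrightarrow> expectation (\<lambda>\<omega>. H b (Y 0 \<omega>)) = of_bool (b = x)"
  shows "\<forall>\<^sub>F k in sequentially. \<forall>F. (\<forall>h. \<bar>F h\<bar> \<le> M) \<longrightarrow>
    \<bar>expectation (\<lambda>\<omega>. F (take (Suc (T * Suc k ^ 2)) (map \<sigma> (visits A (\<lambda>t. Y t \<omega>) (mesh k) (horizon k))))) -
       backward (\<lambda>a b. of_bool (a = b) + \<Lambda> a b / mesh k) S F (T * Suc k ^ 2) [x]\<bar>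
     \<le> M * real (card S) * (real T + 1) * \<epsilon> + \<delta>"
proof -
  have "(\<Sum>b\<in>S. expectation (\<lambda>\<omega>. H b (Y 0 \<omega>)) * B b) = B x" for B
  proof -
    have "(\<Sum>b\<in>S. expectation (\<lambda>\<omega>. H b (Y 0 \<omega>)) * B b) = (\<Sum>b\<in>S. of_bool (b = x) * B b)"
      by (intro sum.cong refl) (simp only: start)
    then show ?thesis
      using S x by (simp add: of_bool_def if_distrib[of "\<lambda>x. x * _"] sum.delta cong: if_cong)
  qed
  with compare_eventually_general[OF S A \<sigma> H_bound H_A harmonic near \<epsilon> \<Lambda>_nonneg \<Lambda>_row \<kappa> lap M \<delta>, of T]
  show ?thesis by simp
qed

text \<open>The first state of the trace is read off from the harmonic functions, whatever the initial
  law: their expectation is nearly conserved until the first visit to \<open>A\<close>.\<close>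

lemma start_of_trace:
  fixes \<sigma> :: "'a \<Rightarrow> 's" and S :: "'s set"
  assumes S: "finite S" and A: "A \<subseteq> E" and \<sigma>: "\<And>a. a \<in> A \<Longrightarrow> \<sigma> a \<in> S"
    and H_bound: "\<And>a b. a \<in> E \<Longrightarrow> b \<in> S \<Longrightarrow> \<bar>H b a\<bar> \<le> 1"
    and H_A: "\<And>a b. a \<in> A \<Longrightarrow> b \<in> S \<Longrightarrow> H b a = of_bool (\<sigma> a = b)"
    and harmonic: "\<And>a b. a \<in> E - A \<Longrightarrow> b \<in> S \<Longrightarrow> gen (H b) a = 0"
    and \<kappa>: "0 < \<kappa>" "1 \<le> m0"
    and lap: "\<And>m n. m0 \<le> m \<Longrightarrow> expectation (\<lambda>\<omega>. exp (- 2 * real (length (visits A (\<lambda>t. Y t \<omega>) m n)) / m)) \<le> 2 * exp (- \<kappa> * real n / m)"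
    and x: "x \<in> S" and trace0: "AE \<omega> in P. \<sigma> (trace_path A (\<lambda>s. Y s \<omega>) 0) = x" and b: "b \<in> S"
  shows "expectation (\<lambda>\<omega>. H b (Y 0 \<omega>)) = of_bool (b = x)"
proof -
  \<comment> \<open>Only the first visit matters here, so the comparison is made with
    \<open>K = 0\<close> and vanishing rates \<open>\<Lambda>\<close>. A crude
    \<open>\<epsilon>\<close> suffices, as it enters divided by the mesh.\<close>
  define \<epsilon> where "\<epsilon> = (\<Sum>a\<in>A. \<Sum>b\<in>S. \<bar>gen (H b) a\<bar>)"
  have finA: "finite A" using A finite_E by (rule finite_subset)
  have \<epsilon>: "\<bar>gen (H b) a\<bar> \<le> \<epsilon>" if "a \<in> A" "b \<in> S" for a b
  proof -
    have "\<bar>gen (H b) a\<bar> \<le> (\<Sum>b\<in>S. \<bar>gen (H b) a\<bar>)" by (rule member_le_sum[OF that(2)]) (use S in auto)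
    also have "\<dots> \<le> \<epsilon>" unfolding \<epsilon>_def
      by (rule member_le_sum[OF that(1), of "\<lambda>a. \<Sum>b\<in>S. \<bar>gen (H b) a\<bar>"]) (use finA in \<open>auto intro: sum_nonneg\<close>)
    finally show ?thesis .
  qed
  have \<epsilon>0: "0 \<le> \<epsilon>" unfolding \<epsilon>_def by (intro sum_nonneg) auto
  let ?h = "\<lambda>h. if h = [] then x else hd h"
  let ?F = "\<lambda>h. of_bool (?h h = b) :: real"
  let ?vis = "\<lambda>k \<omega>. map \<sigma> (visits A (\<lambda>t. Y t \<omega>) (mesh k) (horizon k))"
  let ?c = "real (card S) * real (card E) * C"
  let ?d = "(real (card S) + 1) * 2"
  let ?e = "\<lambda>k. real (card S) * \<epsilon> * inverse (real (Suc k)) + ?c * inverse (real (Suc k)) + ?d * (exp (- \<kappa>) ^ Suc k)"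
  have e_lim: "?e \<longlonglongrightarrow> 0"
  proof -
    have "?e \<longlonglongrightarrow> real (card S) * \<epsilon> * 0 + ?c * 0 + ?d * 0"
      by (intro tendsto_intros LIMSEQ_inverse_real_of_nat LIMSEQ_Suc[OF LIMSEQ_power_zero]) (use \<kappa>(1) in simp)
    then show ?thesis by simp
  qed
  have bound: "\<bar>expectation (\<lambda>\<omega>. ?F (take 1 (?vis k \<omega>))) - expectation (\<lambda>\<omega>. H b (Y 0 \<omega>))\<bar> \<le> ?e k"
    if k: "m0 \<le> mesh k" for k
  proof -
    let ?p = "prob {\<omega>\<in>space P. length (visits A (\<lambda>t. Y t \<omega>) (mesh k) (horizon k)) \<le> 0}"
    have "\<bar>expectation (\<lambda>\<omega>. ?F (take (Suc 0) (?vis k \<omega>))) -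
        expectation (\<lambda>\<omega>. \<Sum>b'\<in>S. H b' (Y 0 \<omega>) * backward (\<lambda>a b. of_bool (a = b)) S ?F 0 [b'])\<bar>
      \<le> 1 * real (card S) * real (Suc 0) * \<epsilon> / mesh k + real (horizon k) * (1 * real (card S) * real (card E) * C / (mesh k)\<^sup>2) +
        (real (card S) + 1) * 1 * ?p"
      by (rule visits_compare[where \<Lambda> = "\<lambda>_ _. 0", OF mesh_ge_1 S A \<sigma> H_bound H_A harmonic _ \<epsilon>0])
         (use S \<epsilon> in \<open>auto simp: of_bool_def sum.delta\<close>)
    moreover have "(\<Sum>b'\<in>S. H b' (Y 0 \<omega>) * backward (\<lambda>a b. of_bool (a = b)) S ?F 0 [b']) = H b (Y 0 \<omega>)" for \<omega>
      using S b by (simp add: of_bool_def if_distrib[of "\<lambda>x. _ * x"] sum.delta cong: if_cong)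
    moreover have "?p \<le> 2 * exp (- \<kappa>) ^ Suc k"
    proof -
      have "?p = prob {\<omega>\<in>space P. real (length (visits A (\<lambda>t. Y t \<omega>) (mesh k) (horizon k))) \<le> 0 * mesh k}"
        by simp
      also have "\<dots> \<le> 2 * exp (2 * 0 - \<kappa> * real (horizon k) / mesh k)"
        by (rule few_visits[OF mesh_ge_1 lap[OF k]])
      also have "\<kappa> * real (horizon k) / mesh k = \<kappa> * real (Suc k)"
        using horizon_mesh[of k] by (simp only: times_divide_eq_right[symmetric])
      also have "exp (2 * 0 - \<kappa> * real (Suc k)) = exp (- \<kappa>) ^ Suc k"
        by (simp only: exp_of_nat_mult[symmetric]) (simp add: algebra_simps)
      finally show ?thesis .
    qed
    then have "(real (card S) + 1) * 1 * ?p \<le> ?d * exp (- \<kappa>) ^ Suc k"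
      by (simp only: mult_1_right mult.assoc) (rule mult_left_mono, simp_all)
    moreover have "real (horizon k) * (1 * real (card S) * real (card E) * C / (mesh k)\<^sup>2) = ?c * inverse (real (Suc k))"
    proof -
      have "real (horizon k) * (?c / (mesh k)\<^sup>2) = ?c * ((real (horizon k) / mesh k) / mesh k)"
        by (simp add: power2_eq_square)
      also have "\<dots> = ?c * (real (Suc k) / mesh k)" unfolding horizon_mesh ..
      also have "real (Suc k) / mesh k = inverse (real (Suc k))"
        by (simp add: mesh_def power2_eq_square inverse_eq_divide del: of_nat_Suc)
      finally show ?thesis by simp
    qed
    moreover have "1 * real (card S) * real (Suc 0) * \<epsilon> / mesh k \<le> real (card S) * \<epsilon> * inverse (real (Suc k))"
    proof -
      have "real (Suc k) \<le> mesh k" unfolding mesh_def by (rule self_le_power) auto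
      then have "inverse (mesh k) \<le> inverse (real (Suc k))" by (rule le_imp_inverse_le) simp
      then have "real (card S) * \<epsilon> * inverse (mesh k) \<le> real (card S) * \<epsilon> * inverse (real (Suc k))"
        by (rule mult_left_mono) (use \<epsilon>0 in simp)
      then show ?thesis by (simp add: divide_inverse del: of_nat_Suc)
    qed
    ultimately show ?thesis by (simp only: One_nat_def)
  qed
  have unb: "AE \<omega> in P. \<forall>K. \<exists>s\<ge>0. K < occupation_time A (\<lambda>t. Y t \<omega>) s"
    by (rule AE_occupation_unbounded[OF \<kappa> lap])
  have conv: "AE \<omega> in P. skorokhod_converges (\<lambda>k. step_path x (mesh k) (?vis k \<omega>))
      (\<lambda>t\<in>{0..}. \<sigma> (trace_path A (\<lambda>s. Y s \<omega>) t))"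
    by (rule trace_functional_limit(2)[OF \<sigma> x unb])
  have first: "(\<lambda>k. expectation (\<lambda>\<omega>. ?F (take 1 (?vis k \<omega>)))) \<longlonglongrightarrow> expectation (\<lambda>\<omega>. of_bool (x = b))"
  proof (rule integral_dominated_convergence[where w = "\<lambda>_. 1"])
    show "(\<lambda>\<omega>. ?F (take 1 (?vis k \<omega>))) \<in> borel_measurable P" for k
      by (rule visits_measurable[OF mesh_ge_1, of "\<lambda>l. ?F (take 1 (map \<sigma> l))"])
    show "AE \<omega> in P. (\<lambda>k. ?F (take 1 (?vis k \<omega>))) \<longlonglongrightarrow> of_bool (x = b)"
      using trace0 conv
    proof eventually_elim
      case (elim \<omega>)
      from elim(2) obtain \<phi> where \<phi>: "\<And>n. \<phi> n \<in> time_changes"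
        "\<And>T. 0 \<le> T \<Longrightarrow> \<forall>\<^sub>F k in sequentially. \<forall>t\<in>{0..T}.
            step_path x (mesh k) (?vis k \<omega>) (\<phi> k t) = (\<lambda>t\<in>{0..}. \<sigma> (trace_path A (\<lambda>s. Y s \<omega>) t)) t"
        unfolding skorokhod_converges_def by blast
      \<comment> \<open>Time changes fix 0, so convergence in the Skorokhod topology includes
        convergence of the value at time 0.\<close>
      have \<phi>0: "\<phi> n 0 = 0" for n
      proof -
        have bij: "bij_betw (\<phi> n) {0..} {0..}" and sm: "strict_mono_on {0..} (\<phi> n)"
          using \<phi>(1)[of n] by (auto simp: time_changes_def)
        have "(0::real) \<in> \<phi> n ` {0..}" using bij by (simp add: bij_betw_def)
        then obtain t where t: "0 \<le> t" "\<phi> n t = 0" by auto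
        have "0 \<le> \<phi> n 0" using bij_betw_apply[OF bij, of 0] by simp
        then show ?thesis using strict_mono_onD[OF sm, of 0 t] t by (cases "t = 0") auto
      qed
      have "\<forall>\<^sub>F k in sequentially. ?h (take 1 (?vis k \<omega>)) = x"
        using \<phi>(2)[of 0, OF order.refl]
      proof eventually_elim
        case (elim k)
        then have "step_path x (mesh k) (?vis k \<omega>) 0 = x" using \<phi>0 \<open>\<sigma> (trace_path A (\<lambda>s. Y s \<omega>) 0) = x\<close> by simp
        then show ?case by (cases "?vis k \<omega>") (auto simp: step_path_def)
      qed
      then have "\<forall>\<^sub>F k in sequentially. ?F (take 1 (?vis k \<omega>)) = of_bool (x = b)"
        by (rule eventually_mono) (simp only:)
      then show ?case by (rule tendsto_eventually)
    qed
  qed auto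
  have "\<forall>\<^sub>F k in sequentially. m0 \<le> mesh k" using filterlim_mesh unfolding filterlim_at_top by blast
  then have "\<forall>\<^sub>F k in sequentially. norm (expectation (\<lambda>\<omega>. ?F (take 1 (?vis k \<omega>))) - expectation (\<lambda>\<omega>. H b (Y 0 \<omega>))) \<le> ?e k"
    by (rule eventually_mono) (simp only: real_norm_def bound)
  then have "(\<lambda>k. expectation (\<lambda>\<omega>. ?F (take 1 (?vis k \<omega>))) - expectation (\<lambda>\<omega>. H b (Y 0 \<omega>))) \<longlonglongrightarrow> 0"
    by (rule Lim_null_comparison[OF _ e_lim])
  then have "(\<lambda>k. expectation (\<lambda>\<omega>. ?F (take 1 (?vis k \<omega>)))) \<longlonglongrightarrow> expectation (\<lambda>\<omega>. H b (Y 0 \<omega>))"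
    by (rule LIM_zero_cancel)
  from LIMSEQ_unique[OF this first] show ?thesis by (simp add: prob_space eq_commute[of b x])
qed

text \<open>The Riemann sums of the occupation time avoid a Fubini argument.\<close>

lemma expected_occupation_time_le:
  assumes rare: "\<And>t. 0 \<le> t \<Longrightarrow> prob {\<omega>\<in>space P. Y t \<omega> \<in> B} \<le> \<epsilon>"
  shows "expectation (\<lambda>\<omega>. occupation_time B (\<lambda>t. Y t \<omega>) (real M)) \<le> real M * \<epsilon>"
proof (rule LIMSEQ_le_const2)
  let ?l = "\<lambda>n \<omega>. real (length (visits B (\<lambda>t. Y t \<omega>) (real (Suc n)) (Suc n * M))) / real (Suc n)"
  have l_meas: "?l n \<in> borel_measurable P" for n
    by (rule visits_measurable[of _ "\<lambda>l. real (length l) / real (Suc n)"]) simp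
  have ev: "{\<omega>\<in>space P. Y t \<omega> \<in> B} \<in> events" if "0 \<le> t" for t
  proof -
    have "{\<omega>\<in>space P. Y t \<omega> \<in> B} = (\<Union>b\<in>B \<inter> E. {\<omega>\<in>space P. Y t \<omega> = b})" using Y_in that by auto
    moreover have "\<dots> \<in> events" by (intro sets.finite_UN) (use finite_E Y_event[OF that] in auto)
    ultimately show ?thesis by simp
  qed
  show "(\<lambda>n. expectation (?l n)) \<longlonglongrightarrow> expectation (\<lambda>\<omega>. occupation_time B (\<lambda>t. Y t \<omega>) (real M))"
  proof (rule integral_dominated_convergence[where w = "\<lambda>_. real M"])
    show "(\<lambda>\<omega>. occupation_time B (\<lambda>t. Y t \<omega>) (real M)) \<in> borel_measurable P"
      by (rule occupation_time_measurable)
    show "AE \<omega> in P. (\<lambda>n. ?l n \<omega>) \<longlonglongrightarrow> occupation_time B (\<lambda>t. Y t \<omega>) (real M)"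
      by (rule AE_I2) (rule visits_lim)
    show "AE \<omega> in P. norm (?l n \<omega>) \<le> real M" for n
    proof (rule AE_I2)
      fix \<omega>
      have "length (visits B (\<lambda>t. Y t \<omega>) (real (Suc n)) (Suc n * M)) \<le> Suc n * M"
        unfolding visits_def by (rule order.trans[OF length_filter_le]) simp
      then have "real (length (visits B (\<lambda>t. Y t \<omega>) (real (Suc n)) (Suc n * M))) \<le> real M * real (Suc n)"
        by (simp only: of_nat_mult[symmetric] of_nat_le_iff mult.commute)
      then have "?l n \<omega> \<le> real M" by (simp add: pos_divide_le_eq del: of_nat_Suc mult_Suc)
      then show "norm (?l n \<omega>) \<le> real M" by simp
    qed
  qed (use l_meas in auto)
  have "expectation (?l n) \<le> real M * \<epsilon>" for n
  proof -
    let ?m = "real (Suc n)"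
    have "expectation (?l n) = expectation (\<lambda>\<omega>. \<Sum>i<Suc n * M. indicator {\<omega>\<in>space P. Y (real i / ?m) \<omega> \<in> B} \<omega>) / ?m"
      unfolding length_visits
      by (subst integral_divide_zero[symmetric], rule Bochner_Integration.integral_cong) (auto simp: indicator_def simp del: mult_Suc of_nat_Suc)
    also have "expectation (\<lambda>\<omega>. \<Sum>i<Suc n * M. indicator {\<omega>\<in>space P. Y (real i / ?m) \<omega> \<in> B} \<omega>) =
        (\<Sum>i<Suc n * M. prob {\<omega>\<in>space P. Y (real i / ?m) \<omega> \<in> B})"
      by (subst Bochner_Integration.integral_sum)
         (use ev in \<open>auto intro!: integrable_real_indicator simp: emeasure_eq_measure simp del: mult_Suc of_nat_Suc\<close>)
    also have "\<dots> \<le> (\<Sum>i<Suc n * M. \<epsilon>)" by (intro sum_mono rare) simp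
    also have "\<dots> = real M * \<epsilon> * ?m" by (simp del: of_nat_Suc mult_Suc)
    finally show ?thesis by (simp add: pos_divide_le_eq divide_right_mono del: of_nat_Suc mult_Suc)
  qed
  then show "\<exists>N. \<forall>n\<ge>N. expectation (?l n) \<le> real M * \<epsilon>" by blast
qed

end

lemma occupation_time_all:
  assumes w: "cadlag S w" and t: "0 \<le> t"
  shows "occupation_time S w t = t"
proof -
  have "integral {0..t} (\<lambda>u. indicator S (w u) :: real) = integral {0..t} (\<lambda>u. 1)"
    by (rule integral_cong) (use cadlag_in[OF w] in simp)
  then show ?thesis using occupation_time_eq[OF w, of S t] t by simp
qed

text \<open>Lets the limit process be treated by the same lemmas, as its own trace on the full state
  space.\<close>

lemma trace_path_all:
  assumes "cadlag S w" "0 \<le> t"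
  shows "trace_path S w t = w t"
  using trace_path_occupation[OF assms(1,2), of S] occupation_time_all[OF assms] cadlag_in[OF assms] by simp

text \<open>\<open>T\<close> plays the role of \<open>\<epsilon>\<close> to the power -1/2. It will
  be the local time up to which the processes are compared: it must tend to infinity although the
  errors accumulate to \<open>(T + 1) * \<epsilon>\<close>.\<close>

lemma slow_sequence:
  fixes \<epsilon> :: "nat \<Rightarrow> real"
  assumes "\<epsilon> \<longlonglongrightarrow> 0" "\<And>N. 0 \<le> \<epsilon> N"
  obtains T :: "nat \<Rightarrow> nat" where "filterlim T at_top sequentially" "(\<lambda>N. (real (T N) + 1) * \<epsilon> N) \<longlonglongrightarrow> 0"
proof -
  \<comment> \<open>The added term keeps the square root away from 0 even where
    \<open>\<epsilon> N\<close> vanishes.\<close>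
  define e where "e N = \<epsilon> N + inverse (real (Suc N))" for N
  have e0: "0 < e N" for N using assms(2)[of N] by (simp add: e_def add_nonneg_pos)
  have elim: "e \<longlonglongrightarrow> 0"
    using tendsto_add[OF assms(1) LIMSEQ_inverse_real_of_nat] by (simp add: e_def[abs_def])
  then have s: "(\<lambda>N. sqrt (e N)) \<longlonglongrightarrow> 0" using tendsto_real_sqrt by fastforce
  define T where "T N = nat \<lfloor>inverse (sqrt (e N))\<rfloor>" for N
  have "filterlim (\<lambda>N. inverse (sqrt (e N))) at_top sequentially"
    using s e0 by (intro filterlim_inverse_at_top) auto
  then have "filterlim T at_top sequentially"
    unfolding T_def filterlim_at_top
  proof (intro allI)
    fix Z :: nat assume "\<forall>Z. \<forall>\<^sub>F N in sequentially. Z \<le> inverse (sqrt (e N))"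
    then have "\<forall>\<^sub>F N in sequentially. real Z \<le> inverse (sqrt (e N))" by blast
    then show "\<forall>\<^sub>F N in sequentially. Z \<le> nat \<lfloor>inverse (sqrt (e N))\<rfloor>"
      by (rule eventually_mono) (simp add: le_nat_floor)
  qed
  moreover have "(\<lambda>N. (real (T N) + 1) * \<epsilon> N) \<longlonglongrightarrow> 0"
  proof (rule tendsto_sandwich[of "\<lambda>_. 0" _ _ "\<lambda>N. sqrt (e N) + \<epsilon> N"])
    have "real (T N) * \<epsilon> N \<le> sqrt (e N)" for N
    proof -
      have "real (T N) \<le> inverse (sqrt (e N))" unfolding T_def using e0[of N] by simp
      moreover have "\<epsilon> N \<le> e N" by (simp add: e_def)
      ultimately have "real (T N) * \<epsilon> N \<le> inverse (sqrt (e N)) * e N"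
        using assms(2)[of N] e0[of N] by (intro mult_mono) auto
      also have "\<dots> = sqrt (e N)" using e0[of N] by (simp add: inverse_eq_divide real_div_sqrt)
      finally show ?thesis .
    qed
    then show "\<forall>\<^sub>F N in sequentially. (real (T N) + 1) * \<epsilon> N \<le> sqrt (e N) + \<epsilon> N"
      by (simp add: algebra_simps)
    show "(\<lambda>N. sqrt (e N) + \<epsilon> N) \<longlonglongrightarrow> 0" using tendsto_add[OF s assms(1)] by simp
  qed (use assms(2) in auto)
  ultimately show ?thesis by (rule that)
qed

text \<open>For each \<open>N\<close> a mesh is fixed so fine that both the process and the limit
  process are close to the same chain on their first \<open>Suc (KN N)\<close> visits. The
  functional applied to the step path depends on the whole list; \<open>Fn\<close> evaluates it on
  the truncated list and \<open>Gn\<close> is its largest change over all continuations. As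
  \<open>Gn\<close> is itself a function of the truncated list, its mean under \<open>P N\<close> is
  close to that under \<open>Q\<close>. For the limit process all continuations converge to the same
  path, since the truncation time \<open>T N\<close> tends to infinity, and continuity sends
  \<open>Gn\<close> to 0.\<close>

theorem trace_weakly_converges:
  fixes P :: "nat \<Rightarrow> 'w measure" and Q :: "'v measure" and S :: "'s set"
  assumes S: "finite S" and x: "x \<in> S"
    and proc: "\<And>N. N0 \<le> N \<Longrightarrow> jump_process (P N) (E N) (Y N) (p N) (q N) (C N)"
    and A: "\<And>N. N0 \<le> N \<Longrightarrow> A N \<subseteq> E N"
    and \<sigma>: "\<And>N a. N0 \<le> N \<Longrightarrow> a \<in> A N \<Longrightarrow> \<sigma> N a \<in> S"
    and H_bound: "\<And>N a b. N0 \<le> N \<Longrightarrow> a \<in> E N \<Longrightarrow> b \<in> S \<Longrightarrow> \<bar>H N b a\<bar> \<le> 1"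
    and H_A: "\<And>N a b. N0 \<le> N \<Longrightarrow> a \<in> A N \<Longrightarrow> b \<in> S \<Longrightarrow> H N b a = of_bool (\<sigma> N a = b)"
    and harmonic: "\<And>N a b. N0 \<le> N \<Longrightarrow> a \<in> E N - A N \<Longrightarrow> b \<in> S \<Longrightarrow> jump_process.gen (E N) (q N) (H N b) a = 0"
    and near: "\<And>N a b. N0 \<le> N \<Longrightarrow> a \<in> A N \<Longrightarrow> b \<in> S \<Longrightarrow>
        \<bar>jump_process.gen (E N) (q N) (H N b) a - \<Lambda> (\<sigma> N a) b\<bar> \<le> \<epsilon> N"
    and \<epsilon>: "\<And>N. 0 \<le> \<epsilon> N" "\<epsilon> \<longlonglongrightarrow> 0"
    and \<Lambda>_nonneg: "\<And>a b. a \<in> S \<Longrightarrow> b \<in> S \<Longrightarrow> a \<noteq> b \<Longrightarrow> 0 \<le> \<Lambda> a b"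
    and \<Lambda>_row: "\<And>a. a \<in> S \<Longrightarrow> (\<Sum>b\<in>S. \<Lambda> a b) = 0"
    and lap: "\<And>N. N0 \<le> N \<Longrightarrow> \<exists>\<kappa>>0. \<exists>m0\<ge>1. \<forall>m\<ge>m0. \<forall>n.
        (\<integral>\<omega>. exp (- 2 * real (length (visits (A N) (\<lambda>t. Y N t \<omega>) m n)) / m) \<partial>P N) \<le> 2 * exp (- \<kappa> * real n / m)"
    and start: "\<And>N b. N0 \<le> N \<Longrightarrow> b \<in> S \<Longrightarrow> (\<integral>\<omega>. H N b (Y N 0 \<omega>) \<partial>P N) = of_bool (b = x)"
    and limit: "jump_process Q S X pX \<Lambda> CX" and limit_start: "AE \<omega> in Q. X 0 \<omega> = x"
  shows "weakly_converges (skorokhod_topology S) P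
      (\<lambda>N \<omega>. \<lambda>t\<in>{0..}. \<sigma> N (trace_path (A N) (\<lambda>s. Y N s \<omega>) t)) Q (\<lambda>\<omega>. \<lambda>t\<in>{0..}. X t \<omega>)"
proof -
  interpret X: jump_process Q S X pX \<Lambda> CX by (rule limit)
  let ?Z = "\<lambda>N \<omega>. \<lambda>t\<in>{0..}. \<sigma> N (trace_path (A N) (\<lambda>s. Y N s \<omega>) t)"
  let ?ZX = "\<lambda>\<omega>. \<lambda>t\<in>{0..}. X t \<omega>"
  have unb: "AE \<omega> in P N. \<forall>K. \<exists>s\<ge>0. K < occupation_time (A N) (\<lambda>t. Y N t \<omega>) s" if N: "N0 \<le> N" for N
  proof -
    interpret Y: jump_process "P N" "E N" "Y N" "p N" "q N" "C N" by (rule proc[OF N])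
    obtain \<kappa> m0 where "0 < \<kappa>" "1 \<le> m0" "\<And>m n. m0 \<le> m \<Longrightarrow>
        (\<integral>\<omega>. exp (- 2 * real (length (visits (A N) (\<lambda>t. Y N t \<omega>) m n)) / m) \<partial>P N) \<le> 2 * exp (- \<kappa> * real n / m)"
      using lap[OF N] by blast
    then show ?thesis by (rule Y.AE_occupation_unbounded)
  qed
  \<comment> \<open>The visited set is the whole state space, so the drift condition is void and the
    zero function serves.\<close>
  have lapX: "\<exists>\<kappa>>0. \<exists>m0\<ge>1. \<forall>m\<ge>m0. \<forall>n.
        (\<integral>\<omega>. exp (- 2 * real (length (visits S (\<lambda>t. X t \<omega>) m n)) / m) \<partial>Q) \<le> 2 * exp (- \<kappa> * real n / m)"
    by (rule X.visits_laplace[of S "\<lambda>_. 0"]) auto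
  have unbX: "\<exists>s\<ge>0. K < occupation_time S (\<lambda>t. X t \<omega>) s" if "\<omega> \<in> space Q" for \<omega> K
    using occupation_time_all[OF X.cadlag_Y[OF that], of "max 0 K + 1"] by (intro exI[of _ "max 0 K + 1"]) auto
  have traceX: "(\<lambda>t\<in>{0..}. trace_path S (\<lambda>s. X s \<omega>) t) = ?ZX \<omega>" if "\<omega> \<in> space Q" for \<omega>
    using trace_path_all[OF X.cadlag_Y[OF that]] by (auto simp: restrict_def)
  have ZX: "?ZX \<omega> \<in> path_space S" if "\<omega> \<in> space Q" for \<omega>
    using cadlag_cong[OF X.cadlag_Y[OF that], of "?ZX \<omega>"] by (simp add: path_space_def)
  have start_X: "(\<integral>\<omega>. of_bool (X 0 \<omega> = b) \<partial>Q) = (of_bool (b = x) :: real)" for b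
  proof -
    have "(\<integral>\<omega>. of_bool (X 0 \<omega> = b) \<partial>Q) = (\<integral>\<omega>. of_bool (b = x) \<partial>Q :: real)"
    proof (rule integral_cong_AE)
      show "(\<lambda>\<omega>. of_bool (X 0 \<omega> = b) :: real) \<in> borel_measurable Q"
        using X.hist_measurable[of 1 "\<lambda>as. of_bool (last as = b)" 0] by (simp add: X.last_hist)
      show "AE \<omega> in Q. of_bool (X 0 \<omega> = b) = (of_bool (b = x) :: real)"
        using limit_start by eventually_elim auto
    qed simp
    then show ?thesis by (simp add: X.prob_space)
  qed
  show ?thesis
    unfolding weakly_converges_def topspace_skorokhod
  proof (intro conjI allI impI)
    have "AE \<omega> in P N. ?Z N \<omega> \<in> path_space S" if N: "N0 \<le> N" for N
    proof -
      interpret Y: jump_process "P N" "E N" "Y N" "p N" "q N" "C N" by (rule proc[OF N])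
      show ?thesis by (rule Y.trace_functional_limit(1)[OF \<sigma>[OF N] x unb[OF N]])
    qed
    then show "\<forall>\<^sub>F N in sequentially. AE \<omega> in P N. ?Z N \<omega> \<in> path_space S"
      by (rule eventually_mono[OF eventually_ge_at_top[of N0]])
    show "AE \<omega> in Q. ?ZX \<omega> \<in> path_space S" using ZX by (rule AE_I2)
  next
    fix f :: "(real \<Rightarrow> 's) \<Rightarrow> real"
    assume f: "continuous_map (skorokhod_topology S) euclideanreal f \<and> bounded (f ` path_space S)"
    then obtain B where B: "\<And>w. w \<in> path_space S \<Longrightarrow> \<bar>f w\<bar> \<le> B" "0 < B"
      unfolding bounded_pos by auto
    have cont: "continuous_map (skorokhod_topology S) euclideanreal f" using f ..
    define a where "a N = (\<integral>\<omega>. f (?Z N \<omega>) \<partial>completion (P N))" for N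
    define visY where "visY N k \<omega> = map (\<sigma> N) (visits (A N) (\<lambda>t. Y N t \<omega>) (mesh k) (horizon k))" for N k \<omega>
    define visX where "visX k \<omega> = visits S (\<lambda>t. X t \<omega>) (mesh k) (horizon k)" for k \<omega>
    define K where "K T k = T * Suc k ^ 2" for T k :: nat
    obtain T where T: "filterlim T at_top sequentially" "(\<lambda>N. (real (T N) + 1) * \<epsilon> N) \<longlonglongrightarrow> 0"
      using slow_sequence[OF \<epsilon>(2,1)] by blast
    define \<delta> where "\<delta> N = inverse (real (Suc N))" for N
    have \<delta>: "0 < \<delta> N" for N by (simp add: \<delta>_def)
    have \<delta>_lim: "\<delta> \<longlonglongrightarrow> 0" unfolding \<delta>_def by (rule LIMSEQ_inverse_real_of_nat)
    define bwd where "bwd N k F = backward (\<lambda>a b. of_bool (a = b) + \<Lambda> a b / mesh k) S F (K (T N) k) [x]" for N k F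
    \<comment> \<open>The conditions \<open>N \<le> k\<close> and \<open>T N \<le> k\<close> make
      the mesh tend to infinity with \<open>N\<close> and the truncated list shorter than the
      observed one.\<close>
    define good where "good N k \<longleftrightarrow> N \<le> k \<and> T N \<le> k \<and>
      \<bar>(\<integral>\<omega>. f (step_path x (mesh k) (visY N k \<omega>)) \<partial>P N) - a N\<bar> \<le> \<delta> N \<and>
      (\<forall>F. (\<forall>h. \<bar>F h\<bar> \<le> 2 * B) \<longrightarrow> \<bar>(\<integral>\<omega>. F (take (Suc (K (T N) k)) (visY N k \<omega>)) \<partial>P N) - bwd N k F\<bar>
          \<le> 2 * B * real (card S) * (real (T N) + 1) * \<epsilon> N + \<delta> N) \<and>
      (\<forall>F. (\<forall>h. \<bar>F h\<bar> \<le> 2 * B) \<longrightarrow> \<bar>(\<integral>\<omega>. F (take (Suc (K (T N) k)) (visX k \<omega>)) \<partial>Q) - bwd N k F\<bar> \<le> \<delta> N)" for N k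
    have "\<exists>k. good N k" if N: "N0 \<le> N" for N
    proof -
      interpret Y: jump_process "P N" "E N" "Y N" "p N" "q N" "C N" by (rule proc[OF N])
      obtain \<kappa> m0 where \<kappa>: "0 < \<kappa>" "1 \<le> m0" and l: "\<And>m n. m0 \<le> m \<Longrightarrow>
        (\<integral>\<omega>. exp (- 2 * real (length (visits (A N) (\<lambda>t. Y N t \<omega>) m n)) / m) \<partial>P N) \<le> 2 * exp (- \<kappa> * real n / m)"
        using lap[OF N] by blast
      obtain \<kappa>X m0X where \<kappa>X: "0 < \<kappa>X" "1 \<le> m0X" and lX: "\<And>m n. m0X \<le> m \<Longrightarrow>
        (\<integral>\<omega>. exp (- 2 * real (length (visits S (\<lambda>t. X t \<omega>) m n)) / m) \<partial>Q) \<le> 2 * exp (- \<kappa>X * real n / m)"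
        using lapX by blast
      have "(\<lambda>k. \<integral>\<omega>. f (step_path x (mesh k) (visY N k \<omega>)) \<partial>P N) \<longlonglongrightarrow> a N"
        unfolding a_def visY_def by (rule Y.trace_functional_limit(3)[OF \<sigma>[OF N] x unb[OF N] cont B(1)])
      then have "\<forall>\<^sub>F k in sequentially. dist (\<integral>\<omega>. f (step_path x (mesh k) (visY N k \<omega>)) \<partial>P N) (a N) < \<delta> N"
        by (rule tendstoD[OF _ \<delta>])
      moreover have "0 \<le> 2 * B" using B(2) by simp
      from Y.compare_eventually[OF S A[OF N] \<sigma>[OF N] H_bound[OF N] H_A[OF N] harmonic[OF N] near[OF N] \<epsilon>(1)
          \<Lambda>_nonneg \<Lambda>_row \<kappa> l this \<delta> x start[OF N], of "T N" N]
      have "\<forall>\<^sub>F k in sequentially. \<forall>F. (\<forall>h. \<bar>F h\<bar> \<le> 2 * B) \<longrightarrow> \<bar>(\<integral>\<omega>. F (take (Suc (K (T N) k)) (visY N k \<omega>)) \<partial>P N) - bwd N k F\<bar>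
          \<le> 2 * B * real (card S) * (real (T N) + 1) * \<epsilon> N + \<delta> N"
        unfolding K_def visY_def bwd_def .
      moreover have "\<forall>\<^sub>F k in sequentially. \<forall>F. (\<forall>h. \<bar>F h\<bar> \<le> 2 * B) \<longrightarrow>
          \<bar>(\<integral>\<omega>. F (take (Suc (K (T N) k)) (map (\<lambda>a. a) (visX k \<omega>))) \<partial>Q) - bwd N k F\<bar>
          \<le> 2 * B * real (card S) * (real (T N) + 1) * 0 + \<delta> N"
        unfolding K_def visX_def bwd_def
      proof (rule X.compare_eventually[where H = "\<lambda>b a. of_bool (a = b)", OF S _ _ _ _ _ _ _ \<Lambda>_nonneg \<Lambda>_row \<kappa>X lX _ \<delta> x start_X])
        fix a b assume ab: "a \<in> S" "b \<in> S"
        show "\<bar>X.gen (\<lambda>a. of_bool (a = b)) a - \<Lambda> a b\<bar> \<le> 0"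
          using S ab unfolding X.gen_def
          by (simp add: of_bool_def if_distrib[of "\<lambda>x. _ * x"] sum.delta cong: if_cong)
      qed (use B(2) in auto)
      moreover have "\<forall>\<^sub>F k in sequentially. N \<le> k" "\<forall>\<^sub>F k in sequentially. T N \<le> k"
        by (rule eventually_ge_at_top)+
      ultimately have "\<forall>\<^sub>F k in sequentially. good N k"
        by eventually_elim (simp add: good_def dist_real_def)
      then show ?thesis by (auto simp: eventually_sequentially)
    qed
    then have "\<exists>k. \<forall>N\<ge>N0. good N (k N)" by (intro choice allI) auto
    then obtain k where k: "\<And>N. N0 \<le> N \<Longrightarrow> good N (k N)" by blast
    define KN where "KN N = K (T N) (k N)" for N
    define m where "m N = mesh (k N)" for N
    define st where "st N h = f (step_path x (m N) h)" for N h
    define Fn where "Fn N h = (if set h \<subseteq> S then st N h else 0)" for N h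
    define ext where "ext N h = {h'. set h' \<subseteq> S \<and> take (Suc (KN N)) h' = h}" for N h
    \<comment> \<open>The first case avoids suprema over the empty set; it never occurs for a list
      that arises by truncating an observed one.\<close>
    define Gn where "Gn N h = (if ext N h = {} \<or> \<not> set h \<subseteq> S then 0 else SUP h'\<in>ext N h. \<bar>st N h' - st N h\<bar>)" for N h
    have mpos: "0 < m N" for N unfolding m_def using mesh_ge_1[of "k N"] by simp
    have st_B: "\<bar>st N h\<bar> \<le> B" if "set h \<subseteq> S" for N h
      unfolding st_def by (rule B(1)[OF step_path_in_path_space[OF mpos x that]])
    have diff_B: "\<bar>st N h' - st N h\<bar> \<le> 2 * B" if "set h \<subseteq> S" "h' \<in> ext N h" for N h h'
      using st_B[OF that(1), of N] st_B[of h' N] that(2) by (simp add: ext_def)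
    have bdd: "bdd_above ((\<lambda>h'. \<bar>st N h' - st N h\<bar>) ` ext N h)" if "set h \<subseteq> S" for N h
      by (rule bdd_aboveI2[of _ _ "2 * B"]) (rule diff_B[OF that])
    have Fn_B: "\<bar>Fn N h\<bar> \<le> 2 * B" for N h using st_B[of h N] B(2) by (auto simp: Fn_def)
    have Gn_0: "0 \<le> Gn N h" for N h
    proof (cases "ext N h = {} \<or> \<not> set h \<subseteq> S")
      case False
      then obtain h' where h': "h' \<in> ext N h" by blast
      have "0 \<le> \<bar>st N h' - st N h\<bar>" by simp
      also have "\<dots> \<le> (SUP h'\<in>ext N h. \<bar>st N h' - st N h\<bar>)"
        by (rule cSUP_upper[OF h' bdd]) (use False in simp)
      finally show ?thesis using False by (simp add: Gn_def)
    qed (auto simp: Gn_def)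
    have Gn_B: "\<bar>Gn N h\<bar> \<le> 2 * B" for N h
    proof (cases "ext N h = {} \<or> \<not> set h \<subseteq> S")
      case False
      then have "(SUP h'\<in>ext N h. \<bar>st N h' - st N h\<bar>) \<le> 2 * B"
        by (intro cSUP_least diff_B) auto
      then show ?thesis using False Gn_0[of N h] by (simp add: Gn_def)
    qed (use B(2) in \<open>auto simp: Gn_def\<close>)
    have Gn_bound: "\<bar>st N h - Fn N (take (Suc (KN N)) h)\<bar> \<le> Gn N (take (Suc (KN N)) h)" if "set h \<subseteq> S" for N h
    proof -
      let ?h = "take (Suc (KN N)) h"
      have s: "set ?h \<subseteq> S" using that set_take_subset[of "Suc (KN N)" h] by blast
      have e: "h \<in> ext N ?h" using that by (simp add: ext_def)
      have "\<bar>st N h - st N ?h\<bar> \<le> (SUP h'\<in>ext N ?h. \<bar>st N h' - st N ?h\<bar>)"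
        by (rule cSUP_upper[OF e bdd[OF s]])
      then show ?thesis using s e unfolding Fn_def Gn_def by auto
    qed
    let ?vX = "\<lambda>N \<omega>. visX (k N) \<omega>"
    let ?vY = "\<lambda>N \<omega>. visY N (k N) \<omega>"
    let ?tX = "\<lambda>N \<omega>. take (Suc (KN N)) (visX (k N) \<omega>)"
    let ?tY = "\<lambda>N \<omega>. take (Suc (KN N)) (visY N (k N) \<omega>)"
    have X_int: "integrable Q (\<lambda>\<omega>. G (?vX N \<omega>) :: real)" for G N
      unfolding visX_def by (rule X.visits_integrable[OF mesh_ge_1])
    have X_S: "set (?vX N \<omega>) \<subseteq> S" for N \<omega> unfolding visX_def by (rule set_visits)
    have k_ge: "\<forall>\<^sub>F N in sequentially. N \<le> k N \<and> T N \<le> k N"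
      using eventually_ge_at_top[of N0] by eventually_elim (use k in \<open>auto simp: good_def\<close>)
    have k_lim: "filterlim k at_top sequentially"
      by (rule filterlim_at_top_mono[OF filterlim_ident]) (use k_ge in \<open>auto elim: eventually_mono\<close>)
    have X_lim: "(\<lambda>N. \<integral>\<omega>. st N (?vX N \<omega>) \<partial>Q) \<longlonglongrightarrow> (\<integral>\<omega>. f (?ZX \<omega>) \<partial>completion Q)"
    proof -
      have "(\<lambda>k. \<integral>\<omega>. f (step_path x (mesh k) (map (\<lambda>a. a) (visits S (\<lambda>t. X t \<omega>) (mesh k) (horizon k)))) \<partial>Q)
          \<longlonglongrightarrow> (\<integral>\<omega>. f (\<lambda>t\<in>{0..}. trace_path S (\<lambda>s. X s \<omega>) t) \<partial>completion Q)"
        by (rule X.trace_functional_limit(3)[OF _ x _ cont B(1)]) (use unbX in auto)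
      moreover have "(\<integral>\<omega>. f (\<lambda>t\<in>{0..}. trace_path S (\<lambda>s. X s \<omega>) t) \<partial>completion Q) = (\<integral>\<omega>. f (?ZX \<omega>) \<partial>completion Q)"
        by (rule Bochner_Integration.integral_cong[OF refl]) (simp add: traceX)
      ultimately have "(\<lambda>k. \<integral>\<omega>. f (step_path x (mesh k) (visX k \<omega>)) \<partial>Q) \<longlonglongrightarrow> (\<integral>\<omega>. f (?ZX \<omega>) \<partial>completion Q)"
        by (simp add: visX_def)
      from filterlim_compose[OF this k_lim] show ?thesis by (simp add: st_def m_def)
    qed
    have G_lim: "(\<lambda>N. \<integral>\<omega>. Gn N (?tX N \<omega>) \<partial>Q) \<longlonglongrightarrow> (\<integral>\<omega>. 0 \<partial>Q)"
    proof (rule integral_dominated_convergence[where w = "\<lambda>_. 2 * B"])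
      show "(\<lambda>\<omega>. Gn N (?tX N \<omega>)) \<in> borel_measurable Q" for N
        by (rule borel_measurable_integrable[OF X_int[of "\<lambda>h. Gn N (take (Suc (KN N)) h)" N]])
      show "AE \<omega> in Q. norm (Gn N (?tX N \<omega>)) \<le> 2 * B" for N using Gn_B by simp
      show "AE \<omega> in Q. (\<lambda>N. Gn N (?tX N \<omega>)) \<longlonglongrightarrow> 0"
      proof (rule AE_I2)
        fix \<omega> assume \<omega>: "\<omega> \<in> space Q"
        \<comment> \<open>The supremum need not be attained, so a continuation that misses it by at
          most \<open>\<delta> N\<close> is chosen for every \<open>N\<close>. These chosen lists
          form one sequence to which the convergence of step paths applies.\<close>
        have "\<exists>h'\<in>ext N (?tX N \<omega>). Gn N (?tX N \<omega>) \<le> \<bar>st N h' - st N (?tX N \<omega>)\<bar> + \<delta> N" for N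
        proof -
          have s: "set (?tX N \<omega>) \<subseteq> S" using X_S[of N \<omega>] set_take_subset[of "Suc (KN N)" "?vX N \<omega>"] by blast
          have e: "?vX N \<omega> \<in> ext N (?tX N \<omega>)" using X_S by (simp add: ext_def)
          have "Gn N (?tX N \<omega>) - \<delta> N < (SUP h'\<in>ext N (?tX N \<omega>). \<bar>st N h' - st N (?tX N \<omega>)\<bar>)"
            using s e \<delta>[of N] unfolding Gn_def by auto
          then obtain h' where "h' \<in> ext N (?tX N \<omega>)" "Gn N (?tX N \<omega>) - \<delta> N < \<bar>st N h' - st N (?tX N \<omega>)\<bar>"
            using less_cSUP_iff[OF _ bdd[OF s], of N] e by blast
          then show ?thesis by (intro bexI[of _ h']) auto
        qed
        then have "\<exists>h'. \<forall>N. h' N \<in> ext N (?tX N \<omega>) \<and> Gn N (?tX N \<omega>) \<le> \<bar>st N (h' N) - st N (?tX N \<omega>)\<bar> + \<delta> N"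
          by (intro choice allI) blast
        then obtain h' where h': "\<And>N. h' N \<in> ext N (?tX N \<omega>)"
          "\<And>N. Gn N (?tX N \<omega>) \<le> \<bar>st N (h' N) - st N (?tX N \<omega>)\<bar> + \<delta> N" by blast
        have len: "length (visX j \<omega>) = horizon j" for j
          unfolding visX_def visits_def using X.Y_in[OF \<omega>] mesh_ge_1[of j] by (subst filter_True) auto
        have conv: "skorokhod_converges (\<lambda>N. step_path x (m N) (g N)) (\<lambda>t. (\<lambda>a. a) (trace_path S (\<lambda>s. X s \<omega>) t))"
          if g: "\<And>N. take (Suc (KN N)) (g N) = ?tX N \<omega>" for g
        proof (rule step_path_visits_converges[where x = x and N = "\<lambda>N. horizon (k N)", OF X.cadlag_Y[OF \<omega>] unbX[OF \<omega>]])
          show "filterlim m at_top sequentially"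
            unfolding m_def by (rule filterlim_compose[OF filterlim_mesh k_lim])
          show "filterlim (\<lambda>N. real (horizon (k N)) / m N) at_top sequentially"
            unfolding m_def by (rule filterlim_compose[OF filterlim_horizon k_lim])
          fix J :: nat
          have "\<forall>\<^sub>F N in sequentially. J \<le> T N" using T(1) unfolding filterlim_at_top by blast
          then show "\<forall>\<^sub>F N in sequentially. \<forall>t\<in>{0..real J}. step_path x (m N) (g N) t =
              step_path x (m N) (map (\<lambda>a. a) (visits S (\<lambda>t. X t \<omega>) (m N) (horizon (k N)))) t"
            using k_ge
          proof eventually_elim
            case (elim N)
            show ?case
            proof
              fix t assume t: "t \<in> {0..real J}"
              let ?i = "nat \<lfloor>m N * t\<rfloor>"
              have KNm: "real (KN N) = real (T N) * m N"
                by (simp only: KN_def K_def m_def mesh_def of_nat_mult of_nat_power)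
              have "real ?i \<le> m N * t" using nat_floor_bounds(1)[of "m N * t"] t mpos[of N] by simp
              also have "\<dots> \<le> m N * real (T N)" using t elim(1) mpos[of N] by (intro mult_left_mono) auto
              finally have "?i \<le> KN N" using KNm by (simp add: mult.commute)
              then have i: "?i < Suc (KN N)" by simp
              \<comment> \<open>The limit process visits \<open>S\<close> at every grid time, so its
                list has full length \<open>horizon (k N)\<close>, and this exceeds the truncation
                point because \<open>T N \<le> k N\<close>.\<close>
              have "KN N < Suc (k N) * Suc (k N) ^ 2"
                unfolding KN_def K_def using elim(2) by (intro mult_strict_right_mono) auto
              moreover have "horizon (k N) = Suc (k N) * Suc (k N) ^ 2"
                by (simp only: horizon_def power3_eq_cube power2_eq_square mult.assoc)
              ultimately have lX: "Suc (KN N) \<le> length (?vX N \<omega>)"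
                unfolding len by (simp only: Suc_le_eq)
              then have "length (take (Suc (KN N)) (g N)) = Suc (KN N)" unfolding g by simp
              then have lg: "Suc (KN N) \<le> length (g N)" by simp
              have nth: "g N ! ?i = ?vX N \<omega> ! ?i"
                using arg_cong[OF g[of N], of "\<lambda>l. l ! ?i"] i by simp
              have mins: "min ?i (length (g N) - 1) = ?i" "min ?i (length (?vX N \<omega>) - 1) = ?i"
                using i lg lX by auto
              have ne: "g N \<noteq> []" "?vX N \<omega> \<noteq> []" using lg lX by auto
              show "step_path x (m N) (g N) t =
                  step_path x (m N) (map (\<lambda>a. a) (visits S (\<lambda>t. X t \<omega>) (m N) (horizon (k N)))) t"
                using t ne nth mins unfolding step_path_def visX_def m_def by simp
            qed
          qed
        qed
        have lim: "(\<lambda>N. st N (g N)) \<longlonglongrightarrow> f (?ZX \<omega>)"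
          if g: "\<And>N. take (Suc (KN N)) (g N) = ?tX N \<omega>" "\<And>N. set (g N) \<subseteq> S" for g
          unfolding st_def
        proof (rule continuous_skorokhod_sequentially[OF cont])
          show "step_path x (m N) (g N) \<in> path_space S" for N
            by (rule step_path_in_path_space[OF mpos x g(2)])
          show "?ZX \<omega> \<in> path_space S" by (rule ZX[OF \<omega>])
          show "skorokhod_converges (\<lambda>N. step_path x (m N) (g N)) (?ZX \<omega>)"
            using skorokhod_converges_restrict[OF conv[OF g(1)]] traceX[OF \<omega>] by simp
        qed
        have "(\<lambda>N. \<bar>st N (h' N) - st N (?tX N \<omega>)\<bar> + \<delta> N) \<longlonglongrightarrow> \<bar>f (?ZX \<omega>) - f (?ZX \<omega>)\<bar> + 0"
        proof (intro tendsto_add tendsto_rabs tendsto_diff lim \<delta>_lim)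
          show "take (Suc (KN N)) (h' N) = ?tX N \<omega>" "set (h' N) \<subseteq> S" for N
            using h'(1)[of N] by (auto simp: ext_def)
          show "set (?tX N \<omega>) \<subseteq> S" for N using X_S[of N \<omega>] set_take_subset[of "Suc (KN N)" "?vX N \<omega>"] by blast
        qed simp
        then have L: "(\<lambda>N. \<bar>st N (h' N) - st N (?tX N \<omega>)\<bar> + \<delta> N) \<longlonglongrightarrow> 0" by simp
        show "(\<lambda>N. Gn N (?tX N \<omega>)) \<longlonglongrightarrow> 0"
          by (rule tendsto_sandwich[OF _ _ tendsto_const L]) (use Gn_0 h'(2) in auto)
      qed
    qed auto
    define e where "e N = 2 * B * real (card S) * ((real (T N) + 1) * \<epsilon> N) + \<delta> N + \<delta> N" for N
    have "e \<longlonglongrightarrow> 2 * B * real (card S) * 0 + 0 + 0"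
      unfolding e_def by (intro tendsto_add tendsto_mult_left T(2) \<delta>_lim)
    then have e_lim: "e \<longlonglongrightarrow> 0" by simp
    \<comment> \<open>The oscillation is counted twice, under \<open>P N\<close> and under
      \<open>Q\<close>. Transferring it from \<open>P N\<close> to \<open>Q\<close> costs
      \<open>e N\<close> once more, in addition to the comparison of \<open>Fn\<close>.\<close>
    have main: "\<bar>a N - (\<integral>\<omega>. st N (?vX N \<omega>) \<partial>Q)\<bar> \<le> \<delta> N + 2 * e N + 2 * (\<integral>\<omega>. Gn N (?tX N \<omega>) \<partial>Q)" if N: "N0 \<le> N" for N
    proof -
      interpret Y: jump_process "P N" "E N" "Y N" "p N" "q N" "C N" by (rule proc[OF N])
      note gd = k[OF N, unfolded good_def]
      have Y_int: "integrable (P N) (\<lambda>\<omega>. G (?vY N \<omega>) :: real)" for G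
        unfolding visY_def by (rule Y.visits_integrable[OF mesh_ge_1, of "\<lambda>h. G (map (\<sigma> N) h)"])
      have Y_S: "set (?vY N \<omega>) \<subseteq> S" for \<omega>
        unfolding visY_def using set_visits[of "A N" "\<lambda>t. Y N t \<omega>" "mesh (k N)" "horizon (k N)"] \<sigma>[OF N] by auto
      have close: "\<bar>(\<integral>\<omega>. F (?tY N \<omega>) \<partial>P N) - (\<integral>\<omega>. F (?tX N \<omega>) \<partial>Q)\<bar> \<le> e N" if F: "\<And>h. \<bar>F h\<bar> \<le> 2 * B" for F
      proof -
        have "\<bar>(\<integral>\<omega>. F (?tY N \<omega>) \<partial>P N) - bwd N (k N) F\<bar> \<le> 2 * B * real (card S) * (real (T N) + 1) * \<epsilon> N + \<delta> N"
          using gd F unfolding KN_def by blast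
        moreover have "\<bar>(\<integral>\<omega>. F (?tX N \<omega>) \<partial>Q) - bwd N (k N) F\<bar> \<le> \<delta> N"
          using gd F unfolding KN_def by blast
        ultimately show ?thesis unfolding e_def mult.assoc by linarith
      qed
      have 1: "\<bar>(\<integral>\<omega>. st N (?vY N \<omega>) \<partial>P N) - a N\<bar> \<le> \<delta> N"
        using gd by (simp add: st_def m_def)
      have dY: "\<bar>(\<integral>\<omega>. st N (?vY N \<omega>) \<partial>P N) - (\<integral>\<omega>. Fn N (?tY N \<omega>) \<partial>P N)\<bar> \<le> (\<integral>\<omega>. Gn N (?tY N \<omega>) \<partial>P N)"
      proof -
        have "\<bar>\<integral>\<omega>. st N (?vY N \<omega>) - Fn N (?tY N \<omega>) \<partial>P N\<bar> \<le> (\<integral>\<omega>. Gn N (?tY N \<omega>) \<partial>P N)"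
        proof (rule order.trans[OF integral_abs_bound integral_mono])
          show "integrable (P N) (\<lambda>\<omega>. \<bar>st N (?vY N \<omega>) - Fn N (?tY N \<omega>)\<bar>)"
            by (rule Y_int[of "\<lambda>h. \<bar>st N h - Fn N (take (Suc (KN N)) h)\<bar>"])
          show "integrable (P N) (\<lambda>\<omega>. Gn N (?tY N \<omega>))" by (rule Y_int[of "\<lambda>h. Gn N (take (Suc (KN N)) h)"])
        qed (rule Gn_bound[OF Y_S])
        then show ?thesis
          by (simp add: Bochner_Integration.integral_diff[OF Y_int[of "st N"] Y_int[of "\<lambda>h. Fn N (take (Suc (KN N)) h)"]])
      qed
      have dX: "\<bar>(\<integral>\<omega>. st N (?vX N \<omega>) \<partial>Q) - (\<integral>\<omega>. Fn N (?tX N \<omega>) \<partial>Q)\<bar> \<le> (\<integral>\<omega>. Gn N (?tX N \<omega>) \<partial>Q)"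
      proof -
        have "\<bar>\<integral>\<omega>. st N (?vX N \<omega>) - Fn N (?tX N \<omega>) \<partial>Q\<bar> \<le> (\<integral>\<omega>. Gn N (?tX N \<omega>) \<partial>Q)"
        proof (rule order.trans[OF integral_abs_bound integral_mono])
          show "integrable Q (\<lambda>\<omega>. \<bar>st N (?vX N \<omega>) - Fn N (?tX N \<omega>)\<bar>)"
            by (rule X_int[of "\<lambda>h. \<bar>st N h - Fn N (take (Suc (KN N)) h)\<bar>"])
          show "integrable Q (\<lambda>\<omega>. Gn N (?tX N \<omega>))" by (rule X_int[of "\<lambda>h. Gn N (take (Suc (KN N)) h)"])
        qed (rule Gn_bound[OF X_S])
        then show ?thesis
          by (simp add: Bochner_Integration.integral_diff[OF X_int[of "st N" N] X_int[of "\<lambda>h. Fn N (take (Suc (KN N)) h)" N]])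
      qed
      show ?thesis using 1 dY dX close[of "Fn N", OF Fn_B] close[of "Gn N", OF Gn_B] by linarith
    qed
    have "(\<lambda>N. a N - (\<integral>\<omega>. st N (?vX N \<omega>) \<partial>Q)) \<longlonglongrightarrow> 0"
    proof (rule Lim_null_comparison)
      show "\<forall>\<^sub>F N in sequentially. norm (a N - (\<integral>\<omega>. st N (?vX N \<omega>) \<partial>Q)) \<le> \<delta> N + 2 * e N + 2 * (\<integral>\<omega>. Gn N (?tX N \<omega>) \<partial>Q)"
        using eventually_ge_at_top[of N0] by eventually_elim (use main in simp)
      have "(\<lambda>N. \<delta> N + 2 * e N + 2 * (\<integral>\<omega>. Gn N (?tX N \<omega>) \<partial>Q)) \<longlonglongrightarrow> 0 + 2 * 0 + 2 * (\<integral>\<omega>. 0 \<partial>Q)"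
        by (intro tendsto_add tendsto_mult_left \<delta>_lim e_lim G_lim)
      then show "(\<lambda>N. \<delta> N + 2 * e N + 2 * (\<integral>\<omega>. Gn N (?tX N \<omega>) \<partial>Q)) \<longlonglongrightarrow> 0" by simp
    qed
    from tendsto_add[OF this X_lim]
    show "(\<lambda>N. \<integral>\<omega>. f (?Z N \<omega>) \<partial>completion (P N)) \<longlonglongrightarrow> (\<integral>\<omega>. f (?ZX \<omega>) \<partial>completion Q)"
      by (simp add: a_def)
  qed
qed

section \<open>Generators of jump processes on a finite set\<close>

text \<open>Jumps are indexed by finitely many maps with state dependent rates. This covers the
  moves of one particle, with pairs of sites as indices, and the limit chain, with target sites as
  indices. \<open>closed\<close> is restricted to positive rates because a forbidden particle move
  may leave the configuration space.\<close>

locale jump_generator =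
  fixes E :: "'a set" and I :: "'i set" and c :: "'i \<Rightarrow> 'a \<Rightarrow> real" and g :: "'i \<Rightarrow> 'a \<Rightarrow> 'a"
    and L :: "('a \<Rightarrow> real) \<Rightarrow> 'a \<Rightarrow> real"
  assumes finite_E: "finite E" and finite_I: "finite I"
    and rate_nonneg: "i \<in> I \<Longrightarrow> a \<in> E \<Longrightarrow> 0 \<le> c i a"
    and closed: "i \<in> I \<Longrightarrow> a \<in> E \<Longrightarrow> c i a \<noteq> 0 \<Longrightarrow> g i a \<in> E"
    and L_eq: "L f a = (\<Sum>i\<in>I. c i a * (f (g i a) - f a))"
begin

definition total :: real where
  "total = (\<Sum>a\<in>E. \<Sum>i\<in>I. c i a)"

lemma total_ge: "a \<in> E \<Longrightarrow> (\<Sum>i\<in>I. c i a) \<le> total"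
  unfolding total_def
  by (rule member_le_sum[of a E "\<lambda>a. \<Sum>i\<in>I. c i a"]) (auto simp: finite_E intro!: sum_nonneg rate_nonneg)

lemma total_nonneg: "0 \<le> total"
  unfolding total_def by (intro sum_nonneg rate_nonneg)

lemma L_bound:
  assumes f: "\<And>a. a \<in> E \<Longrightarrow> \<bar>f a\<bar> \<le> B" and a: "a \<in> E"
  shows "\<bar>L f a\<bar> \<le> 2 * total * B"
proof -
  have B: "0 \<le> B" using f[OF a] by linarith
  have "\<bar>L f a\<bar> \<le> (\<Sum>i\<in>I. \<bar>c i a * (f (g i a) - f a)\<bar>)" unfolding L_eq by (rule sum_abs)
  also have "\<dots> \<le> (\<Sum>i\<in>I. c i a * (2 * B))"
  proof (rule sum_mono)
    fix i assume i: "i \<in> I"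
    show "\<bar>c i a * (f (g i a) - f a)\<bar> \<le> c i a * (2 * B)"
    proof (cases "c i a = 0")
      case False
      have "\<bar>f (g i a) - f a\<bar> \<le> 2 * B" using f[OF closed[OF i a False]] f[OF a] by linarith
      then show ?thesis using rate_nonneg[OF i a] by (simp add: abs_mult mult_left_mono)
    qed simp
  qed
  also have "\<dots> = (\<Sum>i\<in>I. c i a) * (2 * B)" by (rule sum_distrib_right[symmetric])
  also have "\<dots> \<le> total * (2 * B)" by (rule mult_right_mono[OF total_ge[OF a]]) (use B in simp)
  finally show ?thesis by (simp add: mult_ac)
qed

lemma L_row: "a \<in> E \<Longrightarrow> (\<Sum>b\<in>E. L (indicator {b}) a) = 0"
proof -
  assume a: "a \<in> E"
  have one: "(\<Sum>b\<in>E. indicator {b} u :: real) = 1" if "u \<in> E" for u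
    using that finite_E by (simp add: indicator_def sum.delta of_bool_def eq_commute)
  have "(\<Sum>b\<in>E. L (indicator {b}) a) = (\<Sum>i\<in>I. \<Sum>b\<in>E. c i a * (indicator {b} (g i a) - indicator {b} a))"
    unfolding L_eq by (rule sum.swap)
  also have "\<dots> = (\<Sum>i\<in>I. c i a * ((\<Sum>b\<in>E. indicator {b} (g i a)) - (\<Sum>b\<in>E. indicator {b} a)))"
    by (simp only: sum_distrib_left[symmetric] sum_subtractf)
  also have "\<dots> = 0"
  proof (rule sum.neutral, rule ballI)
    fix i assume i: "i \<in> I"
    show "c i a * ((\<Sum>b\<in>E. indicator {b} (g i a)) - (\<Sum>b\<in>E. indicator {b} a)) = 0"
      using one[OF a] one[OF closed[OF i a]] by (cases "c i a = 0") auto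
  qed
  finally show ?thesis .
qed

lemma L_expand: "a \<in> E \<Longrightarrow> L f a = (\<Sum>b\<in>E. L (indicator {b}) a * f b)"
proof -
  assume a: "a \<in> E"
  have ex: "(\<Sum>b\<in>E. indicator {b} u * f b) = f u" if "u \<in> E" for u
  proof -
    have "(\<Sum>b\<in>E. indicator {b} u * f b) = (\<Sum>b\<in>E. if b = u then f b else 0)"
      by (rule sum.cong) (auto simp: indicator_def)
    then show ?thesis using that finite_E by (simp add: sum.delta)
  qed
  have "(\<Sum>b\<in>E. L (indicator {b}) a * f b) = (\<Sum>b\<in>E. \<Sum>i\<in>I. c i a * (indicator {b} (g i a) - indicator {b} a) * f b)"
    unfolding L_eq by (simp only: sum_distrib_right)
  also have "\<dots> = (\<Sum>i\<in>I. \<Sum>b\<in>E. c i a * (indicator {b} (g i a) - indicator {b} a) * f b)" by (rule sum.swap)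
  also have "\<dots> = (\<Sum>i\<in>I. c i a * ((\<Sum>b\<in>E. indicator {b} (g i a) * f b) - (\<Sum>b\<in>E. indicator {b} a * f b)))"
    by (simp only: mult.assoc sum_distrib_left[symmetric] left_diff_distrib sum_subtractf)
  also have "\<dots> = L f a"
    unfolding L_eq
  proof (rule sum.cong[OF refl])
    fix i assume i: "i \<in> I"
    show "c i a * ((\<Sum>b\<in>E. indicator {b} (g i a) * f b) - (\<Sum>b\<in>E. indicator {b} a * f b)) = c i a * (f (g i a) - f a)"
      using ex[OF a] ex[OF closed[OF i a]] by (cases "c i a = 0") auto
  qed
  finally show ?thesis by simp
qed

lemma L_power_bound:
  assumes f: "\<And>a. a \<in> E \<Longrightarrow> \<bar>f a\<bar> \<le> B" and a: "a \<in> E"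
  shows "\<bar>(L ^^ n) f a\<bar> \<le> (2 * total) ^ n * B"
  using a
proof (induction n arbitrary: a)
  case (Suc n)
  have "\<bar>L ((L ^^ n) f) a\<bar> \<le> 2 * total * ((2 * total) ^ n * B)"
    by (rule L_bound[OF Suc.IH Suc.prems])
  then show ?case by (simp add: mult.assoc)
qed (use f in simp)

lemma semigroup_summable:
  assumes f: "\<And>a. a \<in> E \<Longrightarrow> \<bar>f a\<bar> \<le> B" and a: "a \<in> E" and t: "0 \<le> t"
  shows "summable (\<lambda>n. t ^ n / fact n * (L ^^ n) f a)"
proof (rule summable_comparison_test')
  show "summable (\<lambda>n. B * (inverse (fact n) * (2 * total * t) ^ n))"
    by (intro summable_mult summable_exp)
  show "norm (t ^ n / fact n * (L ^^ n) f a) \<le> B * (inverse (fact n) * (2 * total * t) ^ n)" for n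
  proof -
    have "norm (t ^ n / fact n * (L ^^ n) f a) = t ^ n / fact n * \<bar>(L ^^ n) f a\<bar>" using t by (simp add: abs_mult)
    also have "\<dots> \<le> t ^ n / fact n * ((2 * total) ^ n * B)"
      by (rule mult_left_mono[OF L_power_bound[OF f a]]) (use t in simp_all)
    finally show ?thesis by (simp add: power_mult_distrib divide_inverse mult_ac)
  qed
qed

text \<open>The tail of the exponential series from the quadratic term on, with
  \<open>(n + 2)!\<close> replaced by \<open>n!\<close>. The bound \<open>s\<close> on the times
  makes the constant independent of \<open>t\<close>.\<close>

lemma semigroup_expansion:
  assumes f: "\<And>a. a \<in> E \<Longrightarrow> \<bar>f a\<bar> \<le> B" and a: "a \<in> E" and t: "0 \<le> t" "t \<le> s"
  shows "\<bar>semigroup_of L t f a - f a - t * L f a\<bar> \<le> B * ((2 * total)\<^sup>2 * exp (2 * total * s)) * t\<^sup>2"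
proof -
  define u where "u n = t ^ n / fact n * (L ^^ n) f a" for n
  let ?z = "2 * total * t"
  have z0: "0 \<le> ?z" using total_nonneg t by simp
  have B: "0 \<le> B" using f[OF a] by linarith
  have sm: "summable u" unfolding u_def by (rule semigroup_summable[OF f a t(1)])
  have "suminf u = (\<Sum>n. u (n + 2)) + (\<Sum>n<2. u n)" by (rule suminf_split_initial_segment[OF sm])
  also have "(\<Sum>n<2. u n) = f a + t * L f a" by (simp add: u_def numeral_2_eq_2)
  finally have "semigroup_of L t f a - f a - t * L f a = (\<Sum>n. u (n + 2))"
    unfolding semigroup_of_def u_def by simp
  also have "norm (\<Sum>n. u (n + 2)) \<le> (\<Sum>n. B * ?z\<^sup>2 * (inverse (fact n) * ?z ^ n))"
  proof (rule norm_suminf_le)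
    show "summable (\<lambda>n. B * ?z\<^sup>2 * (inverse (fact n) * ?z ^ n))" by (intro summable_mult summable_exp)
    show "norm (u (n + 2)) \<le> B * ?z\<^sup>2 * (inverse (fact n) * ?z ^ n)" for n
    proof -
      have "norm (u (n + 2)) = t ^ (n + 2) / fact (n + 2) * \<bar>(L ^^ (n + 2)) f a\<bar>"
        unfolding u_def using t by (simp add: abs_mult)
      also have "\<dots> \<le> t ^ (n + 2) / fact (n + 2) * ((2 * total) ^ (n + 2) * B)"
        by (rule mult_left_mono[OF L_power_bound[OF f a]]) (use t in simp_all)
      also have "\<dots> = B * ?z ^ (n + 2) * inverse (fact (n + 2))"
        by (simp only: power_mult_distrib divide_inverse mult_ac)
      also have "\<dots> \<le> B * ?z ^ (n + 2) * inverse (fact n)"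
      proof (rule mult_left_mono)
        show "inverse (fact (n + 2)) \<le> (inverse (fact n) :: real)"
          by (intro le_imp_inverse_le fact_mono) simp_all
        show "0 \<le> B * ?z ^ (n + 2)" by (intro mult_nonneg_nonneg zero_le_power B z0)
      qed
      also have "\<dots> = B * ?z\<^sup>2 * (inverse (fact n) * ?z ^ n)" by (simp only: power_add mult_ac)
      finally show ?thesis .
    qed
  qed
  also have "\<dots> = B * ?z\<^sup>2 * exp ?z"
    by (subst suminf_mult[OF summable_exp]) (simp add: exp_def divide_inverse scaleR_conv_of_real mult.commute)
  also have "\<dots> \<le> B * ?z\<^sup>2 * exp (2 * total * s)"
    using B t total_nonneg by (intro mult_left_mono) (auto intro: mult_left_mono)
  also have "\<dots> = B * ((2 * total)\<^sup>2 * exp (2 * total * s)) * t\<^sup>2" by (simp add: power_mult_distrib mult_ac)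
  finally show ?thesis by simp
qed

text \<open>Division of the time by \<open>s\<close> divides the rates by \<open>s\<close>;
  \<open>s = d N\<close> is the acceleration of the theorem. The constant of the expansion is huge
  in terms of the total rate, but it only ever enters with an additional negative power of the
  mesh.\<close>

lemma jump_process_of_markov_process:
  assumes X: "markov_process E L P X" and s: "0 < s"
  shows "jump_process P E (\<lambda>t. X (t / s)) (\<lambda>m a b. semigroup_of L (1 / (m * s)) (indicator {b}) a)
    (\<lambda>a b. L (indicator {b}) a / s) (((2 * total)\<^sup>2 * exp (2 * total * (1 / s))) / s\<^sup>2)"
proof -
  interpret prob_space P using X by (simp add: markov_process_def)
  show ?thesis
  proof
    show "finite E" by (rule finite_E)
    show "X (t / s) \<in> measurable P (count_space E)" if "0 \<le> t" for t
      using X that s by (simp add: markov_process_def)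
    show "cadlag E (\<lambda>t. X (t / s) \<omega>)" if "\<omega> \<in> space P" for \<omega>
    proof -
      have w: "cadlag E (\<lambda>t. X t \<omega>)" using X that by (simp add: markov_process_def)
      show ?thesis
        unfolding cadlag_iff
      proof (intro conjI allI impI)
        fix t :: real assume t: "0 \<le> t"
        then have t': "0 \<le> t / s" using s by simp
        show "X (t / s) \<omega> \<in> E" by (rule cadlag_in[OF w t'])
        obtain e where e: "0 < e" "\<And>u. t / s \<le> u \<Longrightarrow> u < t / s + e \<Longrightarrow> X u \<omega> = X (t / s) \<omega>"
          using cadlag_right[OF w t'] by blast
        have "X (u / s) \<omega> = X (t / s) \<omega>" if "t \<le> u" "u < t + e * s" for u
        proof (rule e(2))
          have "u / s < (t + e * s) / s" using that(2) s by (rule divide_strict_right_mono)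
          then show "u / s < t / s + e" using s by (simp add: add_divide_distrib)
          show "t / s \<le> u / s" using that(1) s by (simp add: divide_right_mono)
        qed
        moreover have "0 < e * s" using e(1) s by simp
        ultimately show "\<exists>e>0. \<forall>u. t \<le> u \<and> u < t + e \<longrightarrow> X (u / s) \<omega> = X (t / s) \<omega>" by blast
      next
        fix t :: real assume t: "0 < t"
        then have t': "0 < t / s" using s by simp
        obtain e l where e: "0 < e" "l \<in> E" "\<And>u. t / s - e < u \<Longrightarrow> u < t / s \<Longrightarrow> X u \<omega> = l"
          using cadlag_left[OF w t'] by blast
        have "X (u / s) \<omega> = l" if "t - e * s < u" "u < t" for u
        proof (rule e(3))
          have "(t - e * s) / s < u / s" using that(1) s by (rule divide_strict_right_mono)
          then show "t / s - e < u / s" using s by (simp add: diff_divide_distrib)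
          show "u / s < t / s" using that(2) s by (rule divide_strict_right_mono)
        qed
        moreover have "0 < e * s" using e(1) s by simp
        ultimately show "\<exists>l\<in>E. \<exists>e>0. \<forall>u. t - e < u \<and> u < t \<longrightarrow> X (u / s) \<omega> = l" using e(2) by blast
      qed
    qed
    show "measure P {\<omega>\<in>space P. \<forall>k\<le>Suc n. X (real k / m / s) \<omega> = c k} =
      measure P {\<omega>\<in>space P. \<forall>k\<le>n. X (real k / m / s) \<omega> = c k} * semigroup_of L (1 / (m * s)) (indicator {c (Suc n)}) (c n)"
      if m: "1 \<le> m" and c: "\<And>k. k \<le> Suc n \<Longrightarrow> c k \<in> E" for m n and c :: "nat \<Rightarrow> 'a"
    proof -
      have "mono_on {..Suc n} (\<lambda>k. real k / m / s)"
        by (rule mono_onI) (use m s in \<open>auto intro!: divide_right_mono\<close>)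
      moreover have "real (Suc n) / m / s - real n / m / s = 1 / (m * s)"
        using m s by (simp add: diff_divide_distrib[symmetric] divide_divide_eq_left)
      moreover have M: "\<forall>n t a. 0 \<le> t 0 \<and> mono_on {..Suc n} t \<and> (\<forall>k\<le>Suc n. a k \<in> E) \<longrightarrow>
        measure P {\<omega>\<in>space P. \<forall>k\<le>Suc n. X (t k) \<omega> = a k} =
        measure P {\<omega>\<in>space P. \<forall>k\<le>n. X (t k) \<omega> = a k} *
          semigroup_of L (t (Suc n) - t n) (indicator {a (Suc n)}) (a n)"
        using X unfolding markov_process_def by (elim conjE)
      ultimately show ?thesis
        using M[rule_format, of "\<lambda>k. real k / m / s" n c] c by simp
    qed
    show "\<bar>semigroup_of L (1 / (m * s)) (indicator {b}) a - of_bool (a = b) - L (indicator {b}) a / s / m\<bar>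
        \<le> ((2 * total)\<^sup>2 * exp (2 * total * (1 / s))) / s\<^sup>2 / m\<^sup>2"
      if m: "1 \<le> m" and ab: "a \<in> E" "b \<in> E" for m a b
    proof -
      have t: "0 \<le> 1 / (m * s)" "1 / (m * s) \<le> 1 / s" using m s by (auto simp: field_simps)
      have "\<bar>semigroup_of L (1 / (m * s)) (indicator {b}) a - indicator {b} a - 1 / (m * s) * L (indicator {b}) a\<bar>
          \<le> 1 * ((2 * total)\<^sup>2 * exp (2 * total * (1 / s))) * (1 / (m * s))\<^sup>2"
        by (rule semigroup_expansion[OF _ ab(1) t]) (simp add: indicator_def)
      then show ?thesis by (simp add: indicator_def power_divide power_mult_distrib mult.commute)
    qed
    show "(\<Sum>b\<in>E. L (indicator {b}) a / s) = 0" if "a \<in> E" for a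
      using L_row[OF that] by (simp add: sum_divide_distrib[symmetric])
  qed
qed

text \<open>The solution is the limit of an iterated order preserving map below the supersolution \<open>V\<close>.\<close>

lemma dirichlet_solution:
  assumes c0: "0 \<le> k" and h: "\<And>a. a \<in> E \<Longrightarrow> 0 \<le> h a" "\<And>a. a \<in> E \<Longrightarrow> a \<in> B \<Longrightarrow> h a \<le> V a"
    and V: "\<And>a. a \<in> E \<Longrightarrow> 0 \<le> V a" "\<And>a. a \<in> E - B \<Longrightarrow> L V a \<le> - k"
  shows "\<exists>U. (\<forall>a\<in>E. 0 \<le> U a \<and> U a \<le> V a) \<and> (\<forall>a\<in>E \<inter> B. U a = h a) \<and> (\<forall>a\<in>E - B. L U a = - k)"
proof -
  \<comment> \<open>Larger than every exit rate, so that the new value in \<open>T\<close> is an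
    increasing function of the old ones, as in uniformisation.\<close>
  define \<rho> where "\<rho> = 1 + total"
  have \<rho>: "0 < \<rho>" using total_nonneg by (simp add: \<rho>_def)
  define T where "T f a = (if a \<in> B then h a else f a + (L f a + k) / \<rho>)" for f a
  have T_mono: "T f a \<le> T f' a" if le: "\<And>a. a \<in> E \<Longrightarrow> f a \<le> f' a" and a: "a \<in> E" for f f' a
  proof (cases "a \<in> B")
    case False
    have "L f a + \<rho> * f a \<le> L f' a + \<rho> * f' a"
    proof -
      have "L f a + \<rho> * f a = (\<Sum>i\<in>I. c i a * f (g i a)) + (\<rho> - (\<Sum>i\<in>I. c i a)) * f a" for f
      proof -
        have "L f a = (\<Sum>i\<in>I. c i a * f (g i a)) - (\<Sum>i\<in>I. c i a) * f a"
          unfolding L_eq by (simp only: right_diff_distrib sum_subtractf sum_distrib_right)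
        then show ?thesis by (simp add: algebra_simps)
      qed
      moreover have "(\<Sum>i\<in>I. c i a * f (g i a)) \<le> (\<Sum>i\<in>I. c i a * f' (g i a))"
      proof (rule sum_mono)
        fix i assume i: "i \<in> I"
        show "c i a * f (g i a) \<le> c i a * f' (g i a)"
          using le[OF closed[OF i a]] rate_nonneg[OF i a] by (cases "c i a = 0") (auto intro: mult_left_mono)
      qed
      moreover have "(\<rho> - (\<Sum>i\<in>I. c i a)) * f a \<le> (\<rho> - (\<Sum>i\<in>I. c i a)) * f' a"
        by (rule mult_left_mono[OF le[OF a]]) (use total_ge[OF a] in \<open>simp add: \<rho>_def\<close>)
      ultimately show ?thesis by simp
    qed
    then have "(L f a + \<rho> * f a + k) / \<rho> \<le> (L f' a + \<rho> * f' a + k) / \<rho>"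
      using \<rho> by (intro divide_right_mono) auto
    moreover have "(L f a + \<rho> * f a + k) / \<rho> = f a + (L f a + k) / \<rho>" for f
      using \<rho> by (simp add: field_simps)
    ultimately show ?thesis using False by (simp add: T_def)
  qed (simp add: T_def)
  define u where "u n = (T ^^ n) (\<lambda>a. if a \<in> B then h a else 0)" for n
  have u_Suc: "u (Suc n) = T (u n)" for n by (simp add: u_def)
  have u0: "u 0 a \<le> u (Suc 0) a" if a: "a \<in> E" for a
  proof (cases "a \<in> B")
    case False
    have "0 \<le> L (u 0) a"
      unfolding L_eq
    proof (rule sum_nonneg)
      fix i assume i: "i \<in> I"
      show "0 \<le> c i a * (u 0 (g i a) - u 0 a)"
        using rate_nonneg[OF i a] h(1)[OF closed[OF i a]] False by (cases "c i a = 0") (auto simp: u_def)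
    qed
    then show ?thesis using False c0 \<rho> by (simp add: u_Suc T_def)
  qed (simp add: u_Suc T_def u_def)
  have inc: "u n a \<le> u (Suc n) a" if "a \<in> E" for n a
    using that
  proof (induction n arbitrary: a)
    case 0
    then show ?case by (rule u0)
  next
    case (Suc n)
    show ?case using T_mono[OF Suc.IH Suc.prems] by (simp only: u_Suc)
  qed
  have le_V: "u n a \<le> V a" if "a \<in> E" for n a
    using that
  proof (induction n arbitrary: a)
    case 0
    then show ?case using h(2) V(1) by (simp add: u_def)
  next
    case (Suc n)
    have "T (u n) a \<le> T V a" by (rule T_mono[OF Suc.IH Suc.prems])
    also have "T V a \<le> V a"
    proof (cases "a \<in> B")
      case False
      have "(L V a + k) / \<rho> \<le> 0" using V(2)[of a] False Suc.prems \<rho> by (simp add: divide_nonpos_pos)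
      then show ?thesis using False by (simp add: T_def)
    qed (use h(2) Suc.prems in \<open>simp add: T_def\<close>)
    finally show ?case by (simp add: u_Suc)
  qed
  have ge0: "0 \<le> u n a" if "a \<in> E" for n a
    using that
  proof (induction n arbitrary: a)
    case 0
    then show ?case using h(1) by (simp add: u_def)
  next
    case (Suc n)
    then show ?case using inc[OF Suc.prems, of n] Suc.IH[OF Suc.prems] by linarith
  qed
  define U where "U a = lim (\<lambda>n. u n a)" for a
  have conv: "(\<lambda>n. u n a) \<longlonglongrightarrow> U a" if a: "a \<in> E" for a
  proof -
    have "incseq (\<lambda>n. u n a)" by (rule incseq_SucI) (rule inc[OF a])
    moreover have "Bseq (\<lambda>n. u n a)" by (rule BseqI'[of _ "V a"]) (use ge0[OF a] le_V[OF a] in simp)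
    ultimately have "convergent (\<lambda>n. u n a)" by (intro Bseq_monoseq_convergent) (auto simp: monoseq_iff)
    then show ?thesis unfolding U_def by (rule convergent_LIMSEQ_iff[THEN iffD1])
  qed
  have UB: "U a = h a" if "a \<in> E" "a \<in> B" for a
  proof -
    have "u n a = h a" for n using that by (cases n) (auto simp: u_Suc T_def, simp add: u_def)
    then show ?thesis using LIMSEQ_unique[OF conv[OF that(1)], of "h a"] by simp
  qed
  have LU: "L U a = - k" if a: "a \<in> E" "a \<notin> B" for a
  proof -
    have "(\<lambda>n. L (u n) a) \<longlonglongrightarrow> L U a"
      unfolding L_eq
    proof (rule tendsto_sum)
      fix i assume i: "i \<in> I"
      show "(\<lambda>n. c i a * (u n (g i a) - u n a)) \<longlonglongrightarrow> c i a * (U (g i a) - U a)"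
      proof (cases "c i a = 0")
        case False
        show ?thesis by (intro tendsto_intros conv closed[OF i a(1) False] a(1))
      qed simp
    qed
    then have 1: "(\<lambda>n. u n a + (L (u n) a + k) / \<rho>) \<longlonglongrightarrow> U a + (L U a + k) / \<rho>"
      by (intro tendsto_intros conv[OF a(1)]) (use \<rho> in auto)
    have "(\<lambda>n. u (Suc n) a) \<longlonglongrightarrow> U a" by (rule LIMSEQ_Suc[OF conv[OF a(1)]])
    then have 2: "(\<lambda>n. u n a + (L (u n) a + k) / \<rho>) \<longlonglongrightarrow> U a" using a(2) by (simp add: u_Suc T_def)
    have "(L U a + k) / \<rho> = 0" using LIMSEQ_unique[OF 1 2] by simp
    then show ?thesis using \<rho> by simp
  qed
  have "0 \<le> U a" "U a \<le> V a" if "a \<in> E" for a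
  proof -
    show "0 \<le> U a" by (rule LIMSEQ_le_const[OF conv[OF that]]) (use ge0[OF that] in blast)
    show "U a \<le> V a" by (rule LIMSEQ_le_const2[OF conv[OF that]]) (use le_V[OF that] in blast)
  qed
  then show ?thesis using UB LU by (intro exI[of _ U]) auto
qed

text \<open>Exponential weights in the height, so steep that the single descending jump guaranteed
  by \<open>down\<close> outweighs all other jumps together. The base \<open>\<beta>\<close>
  satisfies \<open>r0 * \<beta> = r0 + total + 1\<close>: the summand \<open>total\<close> absorbs
  the possible losses and the 1 leaves a drift of at least 1.\<close>

lemma lyapunov_function:
  assumes r0: "0 < r0"
    and down: "\<And>a. a \<in> E - B \<Longrightarrow> \<exists>i\<in>I. r0 \<le> c i a \<and> D (g i a) < D a"
    and D: "\<And>a. a \<in> E \<Longrightarrow> D a \<le> (n :: nat)"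
  shows "\<exists>w. (\<forall>a\<in>E. 0 \<le> w a) \<and> (\<forall>a\<in>E - B. L w a \<le> - 1)"
proof -
  define \<beta> where "\<beta> = 1 + (total + 1) / r0"
  have \<beta>: "1 \<le> \<beta>" using r0 total_nonneg by (simp add: \<beta>_def)
  define u where "u a = \<beta> ^ (n - D a)" for a
  have u1: "1 \<le> u a" for a unfolding u_def by (rule one_le_power[OF \<beta>])
  have Lu: "1 \<le> L u a" if a: "a \<in> E - B" for a
  proof -
    obtain i where i: "i \<in> I" "r0 \<le> c i a" "D (g i a) < D a" using down[OF a] by blast
    have aE: "a \<in> E" using a by simp
    have "c i a \<noteq> 0" using i(2) r0 by simp
    then have "g i a \<in> E" by (rule closed[OF i(1) aE])
    then have "Suc (n - D a) \<le> n - D (g i a)" using D[OF aE] i(3) by simp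
    then have up: "\<beta> * u a \<le> u (g i a)" unfolding u_def using \<beta> by (metis power_Suc power_increasing)
    have "- total * u a \<le> - (\<Sum>j\<in>I. c j a) * u a"
      by (rule mult_right_mono) (use total_ge[OF aE] u1[of a] in auto)
    moreover have "(\<Sum>j\<in>I. c j a * u (g j a)) - (\<Sum>j\<in>I. c j a) * u a = L u a"
      unfolding L_eq by (simp add: right_diff_distrib sum_subtractf sum_distrib_right)
    moreover have "c i a * u (g i a) \<le> (\<Sum>j\<in>I. c j a * u (g j a))"
      by (rule member_le_sum[OF i(1)])
         (use rate_nonneg[OF _ aE] u1 finite_I in \<open>auto intro!: mult_nonneg_nonneg intro: order.trans[OF zero_le_one]\<close>)
    moreover have "r0 * (\<beta> * u a) \<le> c i a * u (g i a)"
      by (rule mult_mono[OF i(2) up]) (use i(2) r0 \<beta> u1[of a] in auto)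
    moreover have "r0 * (\<beta> * u a) = r0 * u a + (total + 1) * u a" using r0 by (simp add: \<beta>_def field_simps)
    moreover have "0 \<le> r0 * u a" using r0 u1[of a] by simp
    ultimately have "u a \<le> L u a" by (simp add: algebra_simps)
    then show ?thesis using u1[of a] by simp
  qed
  define w where "w a = \<beta> ^ n - u a" for a
  have "0 \<le> w a" for a unfolding w_def u_def using power_increasing[of "n - D a" n \<beta>] \<beta> by simp
  moreover have "L w a = - L u a" for a
    unfolding L_eq w_def by (simp add: sum_negf[symmetric] algebra_simps)
  ultimately show ?thesis using Lu by (intro exI[of _ w]) force
qed

end

section \<open>The reversible measure of the inclusion process\<close>

lemma finite_configs: "finite (configs N :: ('s::finite \<Rightarrow> nat) set)"
proof (rule finite_subset)
  show "configs N \<subseteq> (PiE UNIV (\<lambda>_. {..N}) :: ('s \<Rightarrow> nat) set)"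
  proof
    fix \<zeta> :: "'s \<Rightarrow> nat" assume "\<zeta> \<in> configs N"
    then have "\<zeta> x \<le> N" for x
      using member_le_sum[of x UNIV \<zeta>] by (simp add: configs_def)
    then show "\<zeta> \<in> PiE UNIV (\<lambda>_. {..N})" by (auto simp: PiE_def)
  qed
qed (simp add: finite_PiE)

lemma configs_le: "\<zeta> \<in> configs N \<Longrightarrow> (\<zeta> :: 's::finite \<Rightarrow> nat) x \<le> N"
  using member_le_sum[of x UNIV \<zeta>] by (simp add: configs_def)

lemma move_simps:
  "x \<noteq> y \<Longrightarrow> move x y \<zeta> x = \<zeta> x - 1"
  "move x y \<zeta> y = \<zeta> y + 1"
  "z \<noteq> x \<Longrightarrow> z \<noteq> y \<Longrightarrow> move x y \<zeta> z = \<zeta> z"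
  by (auto simp: move_def)

lemma move_move: "0 < \<zeta> x \<Longrightarrow> x \<noteq> y \<Longrightarrow> move y x (move x y \<zeta>) = \<zeta>"
  by (auto simp: move_def fun_eq_iff)

lemma sum_move:
  fixes \<zeta> :: "'s::finite \<Rightarrow> nat"
  assumes "0 < \<zeta> x" "x \<noteq> y"
  shows "int (\<Sum>z\<in>A. move x y \<zeta> z) = int (\<Sum>z\<in>A. \<zeta> z) + of_bool (y \<in> A) - of_bool (x \<in> A)"
proof -
  have "int (move x y \<zeta> z) = int (\<zeta> z) + of_bool (z = y) - of_bool (z = x)" for z
    using assms by (auto simp: move_def)
  then have "int (\<Sum>z\<in>A. move x y \<zeta> z) = (\<Sum>z\<in>A. int (\<zeta> z)) + (\<Sum>z\<in>A. of_bool (z = y)) - (\<Sum>z\<in>A. of_bool (z = x))"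
    by (simp add: sum.distrib sum_subtractf)
  then show ?thesis by (simp add: of_bool_def sum.delta)
qed

lemma move_configs:
  fixes \<zeta> :: "'s::finite \<Rightarrow> nat"
  assumes "\<zeta> \<in> configs N" "0 < \<zeta> x" "x \<noteq> y"
  shows "move x y \<zeta> \<in> configs N"
proof -
  have "int (\<Sum>z\<in>UNIV. move x y \<zeta> z) = int N" using sum_move[where \<zeta> = \<zeta> and A = UNIV, OF assms(2,3)] assms(1) by (simp add: configs_def del: of_nat_sum)
  then show ?thesis unfolding configs_def by (simp only: of_nat_eq_iff mem_Collect_eq)
qed

definition cond :: "nat \<Rightarrow> 's \<Rightarrow> 's \<Rightarrow> nat" where
  "cond N x = (\<lambda>z. if z = x then N else 0)"

lemma cond_configs: "cond N x \<in> (configs N :: ('s::finite \<Rightarrow> nat) set)"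
  by (simp add: cond_def configs_def sum.delta)

lemma configs_cond:
  fixes \<zeta> :: "'s::finite \<Rightarrow> nat"
  assumes "\<zeta> \<in> configs N" "\<And>y. y \<noteq> x \<Longrightarrow> \<zeta> y = 0"
  shows "\<zeta> = cond N x"
proof -
  have "(\<Sum>z\<in>UNIV. \<zeta> z) = (\<Sum>z\<in>UNIV. if z = x then \<zeta> x else 0)" by (rule sum.cong) (auto simp: assms(2))
  then have "\<zeta> x = N" using assms(1) by (simp add: configs_def sum.delta)
  then show ?thesis using assms(2) by (auto simp: cond_def fun_eq_iff)
qed

lemma condensate_eq: "condensate N x = {cond N (x :: 's::finite)}"
proof -
  have "\<zeta> = cond N x" if "\<zeta> \<in> configs N" "\<zeta> x = N" for \<zeta> :: "'s \<Rightarrow> nat"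
  proof (rule configs_cond[OF that(1)])
    fix y assume "y \<noteq> x"
    have "(\<Sum>z\<in>UNIV. \<zeta> z) = \<zeta> x + (\<Sum>z\<in>UNIV - {x}. \<zeta> z)" by (rule sum.remove) auto
    then have "(\<Sum>z\<in>UNIV - {x}. \<zeta> z) = 0" using that by (simp add: configs_def)
    then show "\<zeta> y = 0" using \<open>y \<noteq> x\<close> by simp
  qed
  moreover have "cond N x \<in> configs N" "cond N x x = N" by (rule cond_configs) (simp add: cond_def)
  ultimately show ?thesis unfolding condensate_def by blast
qed

lemma condensates_eq: "condensates N S0 = cond N ` (S0 :: 's::finite set)"
  by (auto simp: condensates_def condensate_eq)

lemma cond_inj: "0 < N \<Longrightarrow> cond N x = cond N y \<longleftrightarrow> x = y"
  by (auto simp: cond_def fun_eq_iff split: if_splits)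

section \<open>Single-site weights and their bounds\<close>

definition wt :: "real \<Rightarrow> nat \<Rightarrow> real" where
  "wt d k = pochhammer d k / fact k"

lemma wt_0: "wt d 0 = 1" by (simp add: wt_def)

text \<open>\<open>wt d k\<close> is the quotient of \<open>Gamma (d + k)\<close> by
  \<open>k! * Gamma d\<close>; this recursion is the form in which it enters detailed
  balance.\<close>

lemma wt_Suc: "wt d (Suc k) * real (Suc k) = wt d k * (d + real k)"
  by (simp add: wt_def pochhammer_Suc divide_simps del: of_nat_Suc)

lemma wt_pos: "0 < d \<Longrightarrow> 0 < wt d k"
  by (simp add: wt_def pochhammer_pos)

lemma wt_lower: "0 < d \<Longrightarrow> d / real (Suc k) \<le> wt d (Suc k)"
proof (induction k)
  case 0
  then show ?case using wt_Suc[of d 0] by (simp add: wt_0)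
next
  case (Suc k)
  have "d \<le> wt d (Suc k) * real (Suc k)" using Suc by (simp add: pos_divide_le_eq del: of_nat_Suc)
  also have "\<dots> \<le> wt d (Suc k) * (d + real (Suc k))"
    using Suc.prems wt_pos[of d "Suc k"] by (intro mult_left_mono) auto
  finally show ?case using wt_Suc[of d "Suc k"] by (simp add: pos_divide_le_eq del: of_nat_Suc)
qed

text \<open>By the recursion the weight is \<open>d / (k + 1)\<close> times the product of
  \<open>1 + d / i\<close> for \<open>i\<close> up to \<open>k\<close>, and the product is bounded
  by an exponential. Bounding it below by 1 gives \<open>wt_lower\<close>. Hence the weights are
  close to \<open>d / k\<close> uniformly up to \<open>N\<close> when \<open>d * ln N\<close> is
  small.\<close>

lemma wt_upper: "0 < d \<Longrightarrow> wt d (Suc k) \<le> d / real (Suc k) * exp (d * (\<Sum>i=1..k. 1 / real i))"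
proof (induction k)
  case 0
  then show ?case using wt_Suc[of d 0] by (simp add: wt_0)
next
  case (Suc k)
  let ?h = "\<Sum>i=1..k. 1 / real i"
  have "wt d (Suc (Suc k)) * real (Suc (Suc k)) = wt d (Suc k) * (d + real (Suc k))" by (rule wt_Suc)
  also have "\<dots> \<le> d / real (Suc k) * exp (d * ?h) * (d + real (Suc k))"
    using Suc by (intro mult_right_mono) auto
  also have "\<dots> = d * exp (d * ?h) * (1 + d / real (Suc k))" by (simp add: field_simps del: of_nat_Suc)
  also have "\<dots> \<le> d * exp (d * ?h) * exp (d / real (Suc k))"
    using Suc.prems exp_ge_add_one_self[of "d / real (Suc k)"] by (intro mult_left_mono) auto
  also have "\<dots> = d * exp (d * (\<Sum>i=1..Suc k. 1 / real i))"
    by (simp add: exp_add[symmetric] distrib_left del: of_nat_Suc)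
  finally show ?case by (simp add: pos_le_divide_eq del: of_nat_Suc)
qed

lemma harmonic_le: "1 \<le> N \<Longrightarrow> (\<Sum>i=1..N. 1 / real i) \<le> 1 + ln (real N)"
proof (induction N rule: dec_induct)
  case (step N)
  have N: "0 < real N" using step by simp
  have "ln (real N / real (Suc N)) \<le> real N / real (Suc N) - 1"
    by (rule ln_le_minus_one) (use N in simp)
  also have "\<dots> = - (1 / real (Suc N))" by (simp add: field_simps)
  finally have "ln (real N) - ln (real (Suc N)) \<le> - (1 / real (Suc N))" using N by (simp add: ln_div)
  then show ?case using step by simp
qed simp

text \<open>The smallness condition makes the exponential correction at most
  \<open>exp (1 / 2)\<close>, which is below 2.\<close>

lemma wt_le_double:
  assumes d: "0 < d" "2 * d * (1 + ln (real N)) \<le> 1" and k: "1 \<le> k" "k \<le> N"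
  shows "wt d k \<le> 2 * d / real k"
proof -
  obtain j where j: "k = Suc j" using k by (cases k) auto
  have "(\<Sum>i=1..j. 1 / real i) \<le> (\<Sum>i=1..N. 1 / real i)"
    by (rule sum_mono2) (use j k in auto)
  also have "\<dots> \<le> 1 + ln (real N)" by (rule harmonic_le) (use k in simp)
  finally have "d * (\<Sum>i=1..j. 1 / real i) \<le> d * (1 + ln (real N))" using d(1) by (intro mult_left_mono) auto
  then have "exp (d * (\<Sum>i=1..j. 1 / real i)) \<le> exp (1 / 2)" using d(2) by simp
  also have "exp (1 / 2 :: real) \<le> 2"
  proof (rule power2_le_imp_le)
    have "(exp (1 / 2 :: real))\<^sup>2 = exp 1" by (simp add: exp_double[symmetric])
    also have "\<dots> \<le> 3" by (rule exp_le)
    finally show "(exp (1 / 2 :: real))\<^sup>2 \<le> 2\<^sup>2" by simp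
  qed simp
  finally have "d / real k * exp (d * (\<Sum>i=1..j. 1 / real i)) \<le> d / real k * 2"
    using d(1) by (intro mult_left_mono) auto
  then show ?thesis using wt_upper[OF d(1), of j] j by (simp add: mult.commute)
qed

section \<open>The inclusion process and its reversible measure\<close>

locale reversible_walk =
  fixes r :: "'s::finite \<Rightarrow> 's \<Rightarrow> real" and m :: "'s pmf"
  assumes rates_nonneg: "0 \<le> r y z"
    and rates_diag: "r y y = 0"
    and irreducible: "(y, z) \<in> {(u, v). 0 < r u v}\<^sup>*"
    and reversible: "pmf m y * r y z = pmf m z * r z y"
begin

abbreviation S0 where "S0 \<equiv> Sstar m"

definition \<rho> :: "'s \<Rightarrow> real" where "\<rho> x = pmf m x / Mstar m"

lemma pmf_le_Mstar: "pmf m x \<le> Mstar m"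
  unfolding Mstar_def by (rule Max_ge) auto

lemma Mstar_pos: "0 < Mstar m"
proof -
  obtain x where "x \<in> set_pmf m" using set_pmf_not_empty[of m] by blast
  then have "0 < pmf m x" by (simp add: pmf_positive)
  then show ?thesis using pmf_le_Mstar[of x] by simp
qed

lemma \<rho>_bounds: "0 \<le> \<rho> x" "\<rho> x \<le> 1"
  unfolding \<rho>_def using Mstar_pos pmf_le_Mstar[of x] by auto

lemma \<rho>_star: "x \<in> S0 \<Longrightarrow> \<rho> x = 1"
  unfolding \<rho>_def Sstar_def using Mstar_pos by simp

lemma \<rho>_less: "x \<notin> S0 \<Longrightarrow> \<rho> x < 1"
  unfolding \<rho>_def Sstar_def using Mstar_pos pmf_le_Mstar[of x] by (simp add: less_le)

lemma \<rho>_reversible: "\<rho> x * r x y = \<rho> y * r y x"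
  unfolding \<rho>_def using reversible[of x y] by simp

lemma r_sym: "x \<in> S0 \<Longrightarrow> y \<in> S0 \<Longrightarrow> r x y = r y x"
  using \<rho>_reversible[of x y] by (simp add: \<rho>_star)

text \<open>The inserted 0 covers the case that every site belongs to \<open>S0\<close>.\<close>

definition q :: real where "q = Max (insert 0 (\<rho> ` (- S0)))"

lemma q_bounds: "0 \<le> q" "q < 1" "x \<notin> S0 \<Longrightarrow> \<rho> x \<le> q"
  unfolding q_def by (auto simp: \<rho>_less intro!: Max_ge)

definition rM :: real where "rM = (\<Sum>x\<in>UNIV. \<Sum>y\<in>UNIV. r x y)"

lemma r_le: "r x y \<le> rM"
proof -
  have "r x y \<le> (\<Sum>y\<in>UNIV. r x y)" by (rule member_le_sum) (auto simp: rates_nonneg)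
  also have "\<dots> \<le> rM" unfolding rM_def
    by (rule member_le_sum[of x UNIV "\<lambda>x. \<Sum>y\<in>UNIV. r x y"]) (auto simp: rates_nonneg intro: sum_nonneg)
  finally show ?thesis .
qed

lemma rM_nonneg: "0 \<le> rM"
  unfolding rM_def by (intro sum_nonneg rates_nonneg)

lemma jump_generator_inclusion:
  assumes "0 \<le> d"
  shows "jump_generator (configs N) UNIV (\<lambda>(x, y) \<zeta>. real (\<zeta> x) * (d + real (\<zeta> y)) * r x y)
    (\<lambda>(x, y). move x y) (inclusion_generator r d)"
proof
  fix i :: "'s \<times> 's" and \<zeta> :: "'s \<Rightarrow> nat" and f :: "('s \<Rightarrow> nat) \<Rightarrow> real"
  show "inclusion_generator r d f \<zeta> = (\<Sum>i\<in>UNIV. (case i of (x, y) \<Rightarrow> \<lambda>\<zeta>. real (\<zeta> x) * (d + real (\<zeta> y)) * r x y) \<zeta> *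
      (f ((case i of (x, y) \<Rightarrow> move x y) \<zeta>) - f \<zeta>))"
    unfolding inclusion_generator_def sum.cartesian_product UNIV_Times_UNIV
    by (rule sum.cong) auto
  assume "\<zeta> \<in> configs N" "(case i of (x, y) \<Rightarrow> \<lambda>\<zeta>. real (\<zeta> x) * (d + real (\<zeta> y)) * r x y) \<zeta> \<noteq> 0"
  then show "(case i of (x, y) \<Rightarrow> move x y) \<zeta> \<in> configs N"
    using rates_diag by (cases i) (auto intro!: move_configs)
qed (use assms finite_configs in \<open>auto simp: rates_nonneg split: prod.split\<close>)

text \<open>Reversible product measure without normalisation: only quotients by the weight of a
  condensate occur below. Dividing \<open>m\<close> by its maximum gives all condensates on
  \<open>S0\<close> the same weight \<open>wt d N\<close>.\<close>

definition weight :: "real \<Rightarrow> ('s \<Rightarrow> nat) \<Rightarrow> real" where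
  "weight d \<zeta> = (\<Prod>x\<in>UNIV. wt d (\<zeta> x) * \<rho> x ^ \<zeta> x)"

lemma weight_nonneg: "0 < d \<Longrightarrow> 0 \<le> weight d \<zeta>"
  unfolding weight_def by (intro prod_nonneg) (simp add: wt_pos \<rho>_bounds less_imp_le)

lemma weight_cond: "x \<in> S0 \<Longrightarrow> weight d (cond N x) = wt d N"
proof -
  assume x: "x \<in> S0"
  have "weight d (cond N x) = (\<Prod>z\<in>UNIV. if z = x then wt d N else 1)"
    unfolding weight_def by (rule prod.cong) (auto simp: cond_def wt_0 \<rho>_star[OF x])
  then show ?thesis by (simp add: prod.delta)
qed

text \<open>The recursion of \<open>wt\<close> exchanges the factors \<open>\<zeta> x\<close> and
  \<open>d + \<zeta> y\<close> of the rate for those of the reverse move, and the remaining factor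
  of \<open>\<rho>\<close> is absorbed by the reversibility of the walk.\<close>

lemma detailed_balance:
  assumes x: "0 < \<zeta> x" "x \<noteq> y"
  shows "weight d \<zeta> * (real (\<zeta> x) * (d + real (\<zeta> y)) * r x y) =
    weight d (move x y \<zeta>) * (real (move x y \<zeta> y) * (d + real (move x y \<zeta> x)) * r y x)"
proof -
  obtain k where k: "\<zeta> x = Suc k" using x by (cases "\<zeta> x") auto
  define l where "l = \<zeta> y"
  define R where "R = (\<Prod>z\<in>UNIV - {x} - {y}. wt d (\<zeta> z) * \<rho> z ^ \<zeta> z)"
  have split: "weight d \<xi> = (wt d (\<xi> x) * \<rho> x ^ \<xi> x) * ((wt d (\<xi> y) * \<rho> y ^ \<xi> y) * (\<Prod>z\<in>UNIV - {x} - {y}. wt d (\<xi> z) * \<rho> z ^ \<xi> z))" for \<xi>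
    unfolding weight_def using x(2) by (simp add: prod.remove[of UNIV x] prod.remove[of "UNIV - {x}" y])
  have R': "(\<Prod>z\<in>UNIV - {x} - {y}. wt d (move x y \<zeta> z) * \<rho> z ^ move x y \<zeta> z) = R"
    unfolding R_def by (rule prod.cong) (auto simp: move_simps)
  have w: "weight d \<zeta> = (wt d (Suc k) * \<rho> x ^ Suc k) * ((wt d l * \<rho> y ^ l) * R)"
    unfolding split[of \<zeta>] R_def k l_def ..
  have w': "weight d (move x y \<zeta>) = (wt d k * \<rho> x ^ k) * ((wt d (Suc l) * \<rho> y ^ Suc l) * R)"
    unfolding split[of "move x y \<zeta>"] R' using x(2) by (simp add: move_simps k l_def)
  have "weight d \<zeta> * (real (\<zeta> x) * (d + real (\<zeta> y)) * r x y) =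
      (wt d (Suc k) * real (Suc k)) * \<rho> x ^ k * wt d l * (d + real l) * \<rho> y ^ l * R * (\<rho> x * r x y)"
    unfolding w k l_def[symmetric] by simp
  also have "\<dots> = (wt d k * (d + real k)) * \<rho> x ^ k * (wt d l * (d + real l)) * \<rho> y ^ l * R * (\<rho> x * r x y)"
    unfolding wt_Suc by simp
  also have "\<dots> = (wt d k * (d + real k)) * \<rho> x ^ k * (wt d (Suc l) * real (Suc l)) * \<rho> y ^ l * R * (\<rho> y * r y x)"
    unfolding wt_Suc \<rho>_reversible[of x y] ..
  also have "\<dots> = weight d (move x y \<zeta>) * (real (move x y \<zeta> y) * (d + real (move x y \<zeta> x)) * r y x)"
    unfolding w' using x(2) by (simp add: move_simps k l_def)
  finally show ?thesis .
qed

text \<open>Reversing a move is an involution on the genuine moves \<open>T\<close>, and it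
  preserves the weighted rate by detailed balance. Moves from an empty site and moves to the same
  site have rate 0 and are dropped first, since \<open>move\<close> cannot be inverted
  there.\<close>

lemma generator_symmetric:
  "(\<Sum>\<zeta>\<in>configs N. weight d \<zeta> * f \<zeta> * inclusion_generator r d g \<zeta>) =
   (\<Sum>\<zeta>\<in>configs N. weight d \<zeta> * g \<zeta> * inclusion_generator r d f \<zeta>)"
proof -
  define T where "T = {(\<zeta>, x, y). \<zeta> \<in> configs N \<and> 0 < \<zeta> x \<and> x \<noteq> (y :: 's)}"
  define cc where "cc \<zeta> x y = weight d \<zeta> * (real (\<zeta> x) * (d + real (\<zeta> y)) * r x y)" for \<zeta> x y
  have finT: "finite T"
    by (rule finite_subset[of _ "configs N \<times> UNIV"]) (auto simp: T_def finite_configs)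
  have expand: "(\<Sum>\<zeta>\<in>configs N. weight d \<zeta> * f \<zeta> * inclusion_generator r d g \<zeta>) =
      (\<Sum>(\<zeta>, x, y)\<in>T. cc \<zeta> x y * f \<zeta> * g (move x y \<zeta>)) - (\<Sum>(\<zeta>, x, y)\<in>T. cc \<zeta> x y * f \<zeta> * g \<zeta>)" for f g
  proof -
    have "(\<Sum>\<zeta>\<in>configs N. weight d \<zeta> * f \<zeta> * inclusion_generator r d g \<zeta>) =
        (\<Sum>\<zeta>\<in>configs N. \<Sum>(x, y)\<in>UNIV. cc \<zeta> x y * f \<zeta> * (g (move x y \<zeta>) - g \<zeta>))"
      unfolding inclusion_generator_def cc_def sum.cartesian_product UNIV_Times_UNIV sum_distrib_left
      by (intro sum.cong refl) (auto simp: algebra_simps)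
    also have "\<dots> = (\<Sum>(\<zeta>, x, y)\<in>configs N \<times> UNIV. cc \<zeta> x y * f \<zeta> * (g (move x y \<zeta>) - g \<zeta>))"
      by (subst sum.cartesian_product) (auto simp: split_beta)
    also have "\<dots> = (\<Sum>(\<zeta>, x, y)\<in>T. cc \<zeta> x y * f \<zeta> * (g (move x y \<zeta>) - g \<zeta>))"
      by (rule sum.mono_neutral_right) (auto simp: T_def cc_def finite_configs rates_diag)
    also have "\<dots> = (\<Sum>(\<zeta>, x, y)\<in>T. cc \<zeta> x y * f \<zeta> * g (move x y \<zeta>) - cc \<zeta> x y * f \<zeta> * g \<zeta>)"
      by (rule sum.cong) (auto simp: algebra_simps)
    finally show ?thesis by (simp add: split_beta sum_subtractf)
  qed
  have "(\<Sum>(\<zeta>, x, y)\<in>T. cc \<zeta> x y * f \<zeta> * g (move x y \<zeta>)) = (\<Sum>(\<zeta>, x, y)\<in>T. cc \<zeta> x y * g \<zeta> * f (move x y \<zeta>))"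
  proof (rule sum.reindex_bij_witness[of _ "\<lambda>(\<zeta>, x, y). (move x y \<zeta>, y, x)" "\<lambda>(\<zeta>, x, y). (move x y \<zeta>, y, x)"])
    fix t assume "t \<in> T"
    then obtain \<zeta> x y where t: "t = (\<zeta>, x, y)" "\<zeta> \<in> configs N" "0 < \<zeta> x" "x \<noteq> y" by (auto simp: T_def)
    have mm: "move y x (move x y \<zeta>) = \<zeta>" by (rule move_move[of \<zeta>, OF t(3,4)])
    show "(case case t of (\<zeta>, x, y) \<Rightarrow> (move x y \<zeta>, y, x) of (\<zeta>, x, y) \<Rightarrow> (move x y \<zeta>, y, x)) = t"
      "(case case t of (\<zeta>, x, y) \<Rightarrow> (move x y \<zeta>, y, x) of (\<zeta>, x, y) \<Rightarrow> (move x y \<zeta>, y, x)) = t"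
      using t mm by auto
    show "(case t of (\<zeta>, x, y) \<Rightarrow> (move x y \<zeta>, y, x)) \<in> T" "(case t of (\<zeta>, x, y) \<Rightarrow> (move x y \<zeta>, y, x)) \<in> T"
      using t move_configs[of \<zeta> N x y] by (auto simp: T_def move_simps)
    have "cc \<zeta> x y = cc (move x y \<zeta>) y x"
      unfolding cc_def by (rule detailed_balance[where \<zeta> = \<zeta>, OF t(3,4)])
    then show "(case case t of (\<zeta>, x, y) \<Rightarrow> (move x y \<zeta>, y, x) of (\<zeta>, x, y) \<Rightarrow> cc \<zeta> x y * g \<zeta> * f (move x y \<zeta>)) =
        (case t of (\<zeta>, x, y) \<Rightarrow> cc \<zeta> x y * f \<zeta> * g (move x y \<zeta>))"
      using t mm by simp
  qed
  then show ?thesis unfolding expand by (simp add: mult.commute mult.left_commute)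
qed

lemma generator_power_symmetric:
  "(\<Sum>\<zeta>\<in>configs N. weight d \<zeta> * f \<zeta> * (inclusion_generator r d ^^ n) g \<zeta>) =
   (\<Sum>\<zeta>\<in>configs N. weight d \<zeta> * g \<zeta> * (inclusion_generator r d ^^ n) f \<zeta>)"
proof (induction n arbitrary: f g)
  case 0
  then show ?case by (simp add: mult_ac)
next
  case (Suc n)
  let ?L = "inclusion_generator r d"
  have "(\<Sum>\<zeta>\<in>configs N. weight d \<zeta> * f \<zeta> * (?L ^^ Suc n) g \<zeta>) = (\<Sum>\<zeta>\<in>configs N. weight d \<zeta> * (?L ^^ n) g \<zeta> * ?L f \<zeta>)"
    using generator_symmetric[where f = f and g = "(?L ^^ n) g"] by simp
  also have "\<dots> = (\<Sum>\<zeta>\<in>configs N. weight d \<zeta> * ?L f \<zeta> * (?L ^^ n) g \<zeta>)" by (simp add: mult_ac)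
  also have "\<dots> = (\<Sum>\<zeta>\<in>configs N. weight d \<zeta> * g \<zeta> * (?L ^^ n) (?L f) \<zeta>)" by (rule Suc)
  finally show ?case by (simp add: funpow_swap1)
qed

text \<open>Every power of the generator is symmetric, so the exponential series is symmetric term
  by term.\<close>

lemma semigroup_symmetric:
  assumes d: "0 \<le> d" and t: "0 \<le> t" and a: "a \<in> configs N" and b: "b \<in> configs N"
  shows "weight d a * semigroup_of (inclusion_generator r d) t (indicator {b}) a =
    weight d b * semigroup_of (inclusion_generator r d) t (indicator {a}) b"
proof -
  interpret jump_generator "configs N" UNIV "\<lambda>(x, y) \<zeta>. real (\<zeta> x) * (d + real (\<zeta> y)) * r x y"
    "\<lambda>(x, y). move x y" "inclusion_generator r d" by (rule jump_generator_inclusion[OF d])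
  let ?L = "inclusion_generator r d"
  have pick: "(\<Sum>\<zeta>\<in>configs N. weight d \<zeta> * indicator {c} \<zeta> * h \<zeta>) = weight d c * h c" if "c \<in> configs N" for c and h :: "('s \<Rightarrow> nat) \<Rightarrow> real"
  proof -
    have "(\<Sum>\<zeta>\<in>configs N. weight d \<zeta> * indicator {c} \<zeta> * h \<zeta>) = (\<Sum>\<zeta>\<in>configs N. if \<zeta> = c then weight d c * h c else 0)"
      by (rule sum.cong) auto
    then show ?thesis using that by (simp add: sum.delta finite_configs)
  qed
  have eq: "weight d a * (?L ^^ n) (indicator {b}) a = weight d b * (?L ^^ n) (indicator {a}) b" for n
    using generator_power_symmetric[where d = d and N = N and f = "indicator {a}" and n = n and g = "indicator {b}"] by (simp add: pick a b)
  have s: "summable (\<lambda>n. t ^ n / fact n * (?L ^^ n) (indicator {c}) c')" if "c' \<in> configs N" for c c'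
    by (rule semigroup_summable[where B = 1, OF _ that t]) (simp add: indicator_def)
  show ?thesis
    unfolding semigroup_of_def suminf_mult[OF s[OF a], symmetric] suminf_mult[OF s[OF b], symmetric]
    by (rule suminf_cong) (use eq in \<open>simp add: mult.left_commute\<close>)
qed

end

section \<open>The share of a site\<close>

text \<open>A configuration is determined by its values off \<open>x0\<close>, since the total is
  \<open>N\<close>. Enlarging the range of these values to a full box makes the sum of products a
  product of sums.\<close>

lemma sum_configs_le:
  fixes h :: "'s::finite \<Rightarrow> nat \<Rightarrow> real"
  assumes Z: "Z \<subseteq> configs N" and h: "\<And>x k. 0 \<le> h x k" and M: "0 \<le> M"
    and le: "\<And>\<zeta>. \<zeta> \<in> Z \<Longrightarrow> \<phi> \<zeta> \<le> M * (\<Prod>x\<in>UNIV - {x0}. h x (\<zeta> x))"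
  shows "(\<Sum>\<zeta>\<in>Z. \<phi> \<zeta>) \<le> M * (\<Prod>x\<in>UNIV - {x0}. \<Sum>k\<le>N. h x k)"
proof -
  let ?A = "UNIV - {x0}" and ?R = "\<lambda>\<zeta>. restrict \<zeta> (UNIV - {x0})"
  have finZ: "finite Z" using Z finite_configs by (rule finite_subset)
  have inj: "inj_on ?R Z"
  proof (rule inj_onI)
    fix \<zeta> \<xi> assume a: "\<zeta> \<in> Z" "\<xi> \<in> Z" "?R \<zeta> = ?R \<xi>"
    have eq: "\<zeta> x = \<xi> x" if "x \<noteq> x0" for x using fun_cong[OF a(3), of x] that by simp
    have s: "(\<Sum>z\<in>UNIV. \<eta> z) = \<eta> x0 + (\<Sum>z\<in>?A. \<eta> z)" for \<eta> :: "'s \<Rightarrow> nat" by (rule sum.remove) auto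
    have "(\<Sum>z\<in>?A. \<zeta> z) = (\<Sum>z\<in>?A. \<xi> z)" by (rule sum.cong) (auto simp: eq)
    then have "\<zeta> x0 = \<xi> x0" using a Z s[of \<zeta>] s[of \<xi>] by (auto simp: configs_def subset_iff)
    then show "\<zeta> = \<xi>" using eq by (metis ext)
  qed
  have "(\<Sum>\<zeta>\<in>Z. \<phi> \<zeta>) \<le> (\<Sum>\<zeta>\<in>Z. M * (\<Prod>x\<in>?A. h x (\<zeta> x)))" by (rule sum_mono) (rule le)
  also have "\<dots> = M * (\<Sum>\<zeta>\<in>Z. \<Prod>x\<in>?A. h x (?R \<zeta> x))" by (simp add: sum_distrib_left)
  also have "(\<Sum>\<zeta>\<in>Z. \<Prod>x\<in>?A. h x (?R \<zeta> x)) = (\<Sum>\<xi>\<in>?R ` Z. \<Prod>x\<in>?A. h x (\<xi> x))"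
    by (rule sum.reindex[OF inj, symmetric, unfolded o_def])
  also have "\<dots> \<le> (\<Sum>\<xi>\<in>PiE ?A (\<lambda>_. {..N}). \<Prod>x\<in>?A. h x (\<xi> x))"
  proof (rule sum_mono2)
    show "?R ` Z \<subseteq> PiE ?A (\<lambda>_. {..N})"
    proof (rule image_subsetI)
      fix \<zeta> assume "\<zeta> \<in> Z"
      then have "\<zeta> \<in> configs N" using Z by blast
      then show "?R \<zeta> \<in> PiE ?A (\<lambda>_. {..N})" by (auto simp: restrict_PiE_iff configs_le)
    qed
  qed (auto intro: finite_PiE prod_nonneg h)
  also have "\<dots> = (\<Prod>x\<in>?A. \<Sum>k\<le>N. h x k)" by (rule prod_sum_PiE[symmetric]) auto
  finally show ?thesis using M by (simp add: mult_left_mono)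
qed

text \<open>To be applied to single-site sums: a site without further requirement contributes a
  factor of at most 2, and only the marked site contributes a small factor.\<close>

lemma prod_le_one_special:
  fixes s :: "'s::finite \<Rightarrow> real"
  assumes s: "\<And>x. x \<in> A \<Longrightarrow> 0 \<le> s x" "\<And>x. x \<in> A \<Longrightarrow> x \<noteq> y \<Longrightarrow> s x \<le> 2" and y: "y \<in> A"
  shows "(\<Prod>x\<in>A. s x) \<le> s y * 2 ^ CARD('s)"
proof -
  have "(\<Prod>x\<in>A - {y}. s x) \<le> (\<Prod>x\<in>A - {y}. 2)" by (rule prod_mono) (use s in auto)
  also have "\<dots> = 2 ^ card (A - {y})" by simp
  also have "\<dots> \<le> 2 ^ CARD('s)" by (intro power_increasing card_mono) auto
  finally have "s y * (\<Prod>x\<in>A - {y}. s x) \<le> s y * 2 ^ CARD('s)" using s(1)[OF y] by (rule mult_left_mono)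
  then show ?thesis using prod.remove[of A y s] y by simp
qed

lemma prod_le_no_special:
  fixes s :: "'s::finite \<Rightarrow> real"
  assumes s: "\<And>x. x \<in> A \<Longrightarrow> 0 \<le> s x" "\<And>x. x \<in> A \<Longrightarrow> s x \<le> 2"
  shows "(\<Prod>x\<in>A. s x) \<le> 2 ^ CARD('s)"
proof -
  have "(\<Prod>x\<in>A. s x) \<le> (\<Prod>x\<in>A. 2)" by (rule prod_mono) (use s in auto)
  also have "\<dots> = 2 ^ card A" by simp
  also have "\<dots> \<le> 2 ^ CARD('s)" by (intro power_increasing card_mono) auto
  finally show ?thesis .
qed

lemma prod_le_two_special:
  fixes s :: "'s::finite \<Rightarrow> real"
  assumes s: "\<And>x. x \<in> A \<Longrightarrow> 0 \<le> s x" "\<And>x. x \<in> A \<Longrightarrow> x \<noteq> y \<Longrightarrow> x \<noteq> z \<Longrightarrow> s x \<le> 2" and yz: "y \<in> A" "z \<in> A" "y \<noteq> z"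
  shows "(\<Prod>x\<in>A. s x) \<le> s y * (s z * 2 ^ CARD('s))"
proof -
  have "(\<Prod>x\<in>A - {y}. s x) \<le> s z * 2 ^ CARD('s)" by (rule prod_le_one_special) (use s yz in auto)
  then have "s y * (\<Prod>x\<in>A - {y}. s x) \<le> s y * (s z * 2 ^ CARD('s))" using s(1)[OF yz(1)] by (rule mult_left_mono)
  then show ?thesis using prod.remove[of A y s] yz by simp
qed

context reversible_walk
begin

definition ns :: "('s \<Rightarrow> nat) \<Rightarrow> nat" where
  "ns \<zeta> = (\<Sum>x\<in>S0. \<zeta> x)"

text \<open>An explicit substitute for the harmonic function of \<open>y\<close>. When no particle is on \<open>S0\<close> it is \<open>0 / 0 = 0\<close>.\<close>

definition share :: "'s \<Rightarrow> ('s \<Rightarrow> nat) \<Rightarrow> real" where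
  "share y \<zeta> = real (\<zeta> y) / real (ns \<zeta>)"

lemma le_ns: "x \<in> S0 \<Longrightarrow> \<zeta> x \<le> ns \<zeta>"
  unfolding ns_def by (rule member_le_sum) auto

lemma add_le_ns: "x \<in> S0 \<Longrightarrow> y \<in> S0 \<Longrightarrow> x \<noteq> y \<Longrightarrow> \<zeta> x + \<zeta> y \<le> ns \<zeta>"
proof -
  assume a: "x \<in> S0" "y \<in> S0" "x \<noteq> y"
  have "ns \<zeta> = \<zeta> x + (\<Sum>z\<in>S0 - {x}. \<zeta> z)" unfolding ns_def by (rule sum.remove) (use a in auto)
  moreover have "\<zeta> y \<le> (\<Sum>z\<in>S0 - {x}. \<zeta> z)" by (rule member_le_sum) (use a in auto)
  ultimately show ?thesis by simp
qed

lemma share_bounds: "y \<in> S0 \<Longrightarrow> 0 \<le> share y \<zeta>" "y \<in> S0 \<Longrightarrow> share y \<zeta> \<le> 1"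
  using le_ns[of y \<zeta>] by (auto simp: share_def divide_le_eq_1)

lemma share_cond: "x \<in> S0 \<Longrightarrow> 0 < N \<Longrightarrow> share y (cond N x) = of_bool (x = y)"
  by (auto simp: share_def ns_def cond_def sum.delta)

lemma ns_move:
  assumes "0 < \<zeta> x" "x \<noteq> u"
  shows "real (ns (move x u \<zeta>)) = real (ns \<zeta>) + of_bool (u \<in> S0) - of_bool (x \<in> S0)"
    "real (move x u \<zeta> y) = real (\<zeta> y) + of_bool (u = y) - of_bool (x = y)"
proof -
  have "real_of_int (int (ns (move x u \<zeta>))) = real_of_int (int (ns \<zeta>) + of_bool (u \<in> S0) - of_bool (x \<in> S0))"
    unfolding ns_def using sum_move[where \<zeta> = \<zeta> and A = S0, OF assms] by (simp only:)
  then show "real (ns (move x u \<zeta>)) = real (ns \<zeta>) + of_bool (u \<in> S0) - of_bool (x \<in> S0)" by simp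
  show "real (move x u \<zeta> y) = real (\<zeta> y) + of_bool (u = y) - of_bool (x = y)"
    using assms by (auto simp: move_def)
qed

definition dshare :: "'s \<Rightarrow> ('s \<Rightarrow> nat) \<Rightarrow> 's \<Rightarrow> 's \<Rightarrow> real" where
  "dshare y \<zeta> x u = share y (move x u \<zeta>) - share y \<zeta>"

text \<open>The right-hand side counts the particles of \<open>S0\<close> away from
  \<open>x\<close>. It is what makes the share insensitive to exchanges with the outside as long as
  \<open>S0\<close> carries a single pile.\<close>

lemma deviation: "x \<in> S0 \<Longrightarrow> y \<in> S0 \<Longrightarrow> \<bar>real (\<zeta> y) - of_bool (x = y) * real (ns \<zeta>)\<bar> \<le> real (ns \<zeta>) - real (\<zeta> x)"
  using le_ns[of x \<zeta>] add_le_ns[of x y \<zeta>] by (cases "x = y") auto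

lemma dshare_le_1: "y \<in> S0 \<Longrightarrow> \<bar>dshare y \<zeta> x u\<bar> \<le> 1"
  using share_bounds[of y "move x u \<zeta>"] share_bounds[of y \<zeta>] unfolding dshare_def by linarith

lemma dshare_in_in:
  assumes "0 < \<zeta> x" "x \<noteq> u" "x \<in> S0" "u \<in> S0"
  shows "dshare y \<zeta> x u = (of_bool (u = y) - of_bool (x = y)) / real (ns \<zeta>)"
  unfolding dshare_def share_def ns_move[where \<zeta> = \<zeta>, OF assms(1,2)] using assms
  by (simp add: diff_divide_distrib[symmetric])

lemma dshare_out_out:
  assumes "0 < \<zeta> x" "x \<noteq> u" "x \<notin> S0" "u \<notin> S0" "y \<in> S0"
  shows "dshare y \<zeta> x u = 0"
  unfolding dshare_def share_def ns_move[where \<zeta> = \<zeta>, OF assms(1,2)] using assms by auto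

text \<open>The difference of the two fractions has numerator
  \<open>\<zeta> y - of_bool (x = y) * ns \<zeta>\<close>, which is controlled by the particles of
  \<open>S0\<close> away from \<open>x\<close>. This gains a factor over the trivial bound of order
  \<open>1 / ns \<zeta>\<close>. Two particles on \<open>S0\<close> ensure
  \<open>ns \<zeta> - 1 \<ge> ns \<zeta> / 2\<close>.\<close>

lemma dshare_in_out:
  assumes "0 < \<zeta> x" "x \<in> S0" "u \<notin> S0" "y \<in> S0" "2 \<le> ns \<zeta>"
  shows "\<bar>dshare y \<zeta> x u\<bar> \<le> 2 * (real (ns \<zeta>) - real (\<zeta> x)) / (real (ns \<zeta>))\<^sup>2"
proof -
  let ?n = "real (ns \<zeta>)" and ?e = "of_bool (x = y) :: real"
  have n: "2 \<le> ?n" using assms(5) by simp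
  have ne: "x \<noteq> u" "u \<noteq> y" using assms by auto
  have "dshare y \<zeta> x u = (real (\<zeta> y) - ?e) / (?n - 1) - real (\<zeta> y) / ?n"
    unfolding dshare_def share_def ns_move[where \<zeta> = \<zeta>, OF assms(1) ne(1)] using assms ne by simp
  also have "\<dots> = (real (\<zeta> y) - ?e * ?n) / (?n * (?n - 1))" using n by (simp add: field_simps)
  finally have "\<bar>dshare y \<zeta> x u\<bar> = \<bar>real (\<zeta> y) - ?e * ?n\<bar> / (?n * (?n - 1))" using n by (simp add: abs_mult)
  also have "\<dots> \<le> (?n - real (\<zeta> x)) / (?n * (?n - 1))"
    by (rule divide_right_mono[OF deviation]) (use assms n in auto)
  also have "\<dots> \<le> (?n - real (\<zeta> x)) / (?n\<^sup>2 / 2)"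
  proof (rule divide_left_mono)
    have "?n \<le> 2 * (?n - 1)" using n by simp
    then have "?n * ?n \<le> ?n * (2 * (?n - 1))" by (rule mult_left_mono) (use n in simp)
    then have "?n * ?n \<le> 2 * (?n * (?n - 1))" by (simp only: mult.left_commute)
    then show "?n\<^sup>2 / 2 \<le> ?n * (?n - 1)" by (simp add: power2_eq_square)
    show "0 \<le> ?n - real (\<zeta> x)" using le_ns[OF assms(2), of \<zeta>] by simp
    show "0 < ?n * (?n - 1) * (?n\<^sup>2 / 2)" using n by simp
  qed
  finally show ?thesis by (simp add: mult.commute)
qed

lemma dshare_out_in:
  assumes "0 < \<zeta> u" "x \<in> S0" "u \<notin> S0" "y \<in> S0" "1 \<le> ns \<zeta>"
  shows "\<bar>dshare y \<zeta> u x\<bar> \<le> (real (ns \<zeta>) - real (\<zeta> x)) / (real (ns \<zeta>))\<^sup>2"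
proof -
  let ?n = "real (ns \<zeta>)" and ?e = "of_bool (x = y) :: real"
  have n: "1 \<le> ?n" using assms(5) by simp
  have ne: "u \<noteq> x" "u \<noteq> y" using assms by auto
  have "dshare y \<zeta> u x = (real (\<zeta> y) + ?e) / (?n + 1) - real (\<zeta> y) / ?n"
    unfolding dshare_def share_def ns_move[where \<zeta> = \<zeta>, OF assms(1) ne(1)] using assms ne by simp
  also have "\<dots> = (?e * ?n - real (\<zeta> y)) / (?n * (?n + 1))"
  proof -
    have "(z + e) / (k + 1) - z / k = (e * k - z) / (k * (k + 1))" if "1 \<le> k" for z e k :: real
      using that by (simp add: field_simps)
    then show ?thesis using n .
  qed
  finally have "\<bar>dshare y \<zeta> u x\<bar> = \<bar>real (\<zeta> y) - ?e * ?n\<bar> / (?n * (?n + 1))" using n by (simp add: abs_mult abs_minus_commute)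
  also have "\<dots> \<le> (?n - real (\<zeta> x)) / (?n * (?n + 1))"
    by (rule divide_right_mono[OF deviation]) (use assms n in auto)
  also have "\<dots> \<le> (?n - real (\<zeta> x)) / ?n\<^sup>2"
  proof (rule divide_left_mono)
    show "?n\<^sup>2 \<le> ?n * (?n + 1)" using n by (simp add: power2_eq_square)
    show "0 \<le> ?n - real (\<zeta> x)" using le_ns[OF assms(2), of \<zeta>] by simp
    show "0 < ?n * (?n + 1) * ?n\<^sup>2" using n by (simp add: mult_pos_pos)
  qed
  finally show ?thesis .
qed

lemma dshare_small:
  assumes "0 < \<zeta> x" "x \<noteq> u" "y \<in> S0" "2 \<le> ns \<zeta>"
  shows "\<bar>dshare y \<zeta> x u\<bar> \<le> 2 / real (ns \<zeta>)"
proof -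
  let ?n = "real (ns \<zeta>)"
  have n: "2 \<le> ?n" using assms(4) by simp
  have sq: "c * (?n - real k) / ?n\<^sup>2 \<le> 2 / ?n" if "0 \<le> c" "c \<le> 2" for c k
  proof -
    have "c * (?n - real k) \<le> 2 * ?n" using n that by (intro order.trans[OF mult_left_mono mult_right_mono]) auto
    then have "c * (?n - real k) / ?n\<^sup>2 \<le> 2 * ?n / ?n\<^sup>2" by (intro divide_right_mono) auto
    then show ?thesis using n by (simp add: power2_eq_square)
  qed
  consider "x \<in> S0" "u \<in> S0" | "x \<in> S0" "u \<notin> S0" | "x \<notin> S0" "u \<in> S0" | "x \<notin> S0" "u \<notin> S0" by blast
  then show ?thesis
  proof cases
    case 1
    show ?thesis unfolding dshare_in_in[where \<zeta> = \<zeta>, OF assms(1,2) 1] using n by (auto simp: divide_right_mono)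
  next
    case 2
    show ?thesis using dshare_in_out[where \<zeta> = \<zeta>, OF assms(1) 2 assms(3,4)] sq[of 2 "\<zeta> x"] by simp
  next
    case 3
    show ?thesis using dshare_out_in[where \<zeta> = \<zeta>, OF assms(1) 3(2,1) assms(3)] assms(4) sq[of 1 "\<zeta> u"] by simp
  next
    case 4
    show ?thesis using dshare_out_out[where \<zeta> = \<zeta>, OF assms(1,2) 4 assms(3)] n by simp
  qed
qed

lemma sum_split_S0: "(\<Sum>x\<in>UNIV. f x) = (\<Sum>x\<in>S0. f x) + (\<Sum>x\<in>- S0. f x :: real)"
  using sum.subset_diff[of S0 UNIV f] by (simp add: Compl_eq_Diff_UNIV add.commute)

text \<open>The part of the generator that is not small with \<open>d\<close> only sees pairs of a site in \<open>S0\<close> and a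
  site outside: within \<open>S0\<close> the rates are symmetric and the contributions cancel.\<close>

lemma generator_share:
  assumes y: "y \<in> S0"
  shows "inclusion_generator r d (share y) \<zeta> =
    d * (\<Sum>x\<in>UNIV. \<Sum>u\<in>UNIV. real (\<zeta> x) * r x u * dshare y \<zeta> x u) +
    (\<Sum>x\<in>S0. \<Sum>u\<in>- S0. real (\<zeta> x) * real (\<zeta> u) * (r x u * dshare y \<zeta> x u + r u x * dshare y \<zeta> u x))"
proof -
  define B where "B x u = real (\<zeta> x) * real (\<zeta> u) * r x u * dshare y \<zeta> x u" for x u
  have "inclusion_generator r d (share y) \<zeta> =
      (\<Sum>x\<in>UNIV. \<Sum>u\<in>UNIV. d * (real (\<zeta> x) * r x u * dshare y \<zeta> x u) + B x u)"
    unfolding inclusion_generator_def B_def dshare_def by (intro sum.cong refl) (simp add: algebra_simps)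
  then have 1: "inclusion_generator r d (share y) \<zeta> =
      d * (\<Sum>x\<in>UNIV. \<Sum>u\<in>UNIV. real (\<zeta> x) * r x u * dshare y \<zeta> x u) + (\<Sum>x\<in>UNIV. \<Sum>u\<in>UNIV. B x u)"
    by (simp add: sum.distrib sum_distrib_left)
  have anti: "B x u = - B u x" if "x \<in> S0" "u \<in> S0" for x u
  proof (cases "0 < \<zeta> x \<and> 0 < \<zeta> u \<and> x \<noteq> u")
    case True
    have 1: "dshare y \<zeta> x u = (of_bool (u = y) - of_bool (x = y)) / real (ns \<zeta>)"
      by (rule dshare_in_in) (use True that in blast)+
    have 2: "dshare y \<zeta> u x = (of_bool (x = y) - of_bool (u = y)) / real (ns \<zeta>)"
      by (rule dshare_in_in) (use True that in blast)+
    have "dshare y \<zeta> x u = - dshare y \<zeta> u x"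
      unfolding 1 2 minus_divide_left minus_diff_eq ..
    then show ?thesis unfolding B_def using r_sym[OF that] by simp
  next
    case False
    then show ?thesis unfolding B_def using rates_diag by auto
  qed
  have "(\<Sum>x\<in>S0. \<Sum>u\<in>S0. B x u) = (\<Sum>x\<in>S0. \<Sum>u\<in>S0. - B u x)"
    by (intro sum.cong refl) (rule anti)
  also have "\<dots> = - (\<Sum>x\<in>S0. \<Sum>u\<in>S0. B u x)" by (simp only: sum_negf)
  also have "(\<Sum>x\<in>S0. \<Sum>u\<in>S0. B u x) = (\<Sum>x\<in>S0. \<Sum>u\<in>S0. B x u)" by (rule sum.swap)
  finally have 2: "(\<Sum>x\<in>S0. \<Sum>u\<in>S0. B x u) = 0" by simp
  have 3: "(\<Sum>x\<in>- S0. \<Sum>u\<in>- S0. B x u) = 0"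
  proof (intro sum.neutral ballI)
    fix x u assume "x \<in> - S0" "u \<in> - S0"
    then show "B x u = 0"
      unfolding B_def using dshare_out_out[of \<zeta> x u y] y rates_diag by (cases "0 < \<zeta> x \<and> x \<noteq> u") auto
  qed
  have "(\<Sum>x\<in>UNIV. \<Sum>u\<in>UNIV. B x u) = (\<Sum>x\<in>S0. \<Sum>u\<in>- S0. B x u) + (\<Sum>x\<in>- S0. \<Sum>u\<in>S0. B x u)"
    unfolding sum_split_S0 sum.distrib using 2 3 by simp
  also have "(\<Sum>x\<in>- S0. \<Sum>u\<in>S0. B x u) = (\<Sum>x\<in>S0. \<Sum>u\<in>- S0. B u x)" by (rule sum.swap)
  finally have "(\<Sum>x\<in>UNIV. \<Sum>u\<in>UNIV. B x u) = (\<Sum>x\<in>S0. \<Sum>u\<in>- S0. B x u + B u x)"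
    by (simp add: sum.distrib)
  then show ?thesis unfolding 1 B_def by (simp add: algebra_simps)
qed

text \<open>All outside sites are empty, so only the part with factor \<open>d\<close> remains. In
  it, a particle leaving for the outside does not change the share, because the rest of
  \<open>S0\<close> is still a single pile. The factor \<open>N\<close> of the rate cancels the
  \<open>1 / N\<close> of the change of the share.\<close>

lemma generator_share_cond:
  assumes y: "y \<in> S0" and x: "x \<in> S0" and N: "2 \<le> N"
  shows "inclusion_generator r d (share y) (cond N x) = d * limit_generator r S0 (indicator {y}) x"
proof -
  have cx: "cond N x x = N" "\<And>z. z \<noteq> x \<Longrightarrow> cond N x z = 0" by (auto simp: cond_def)
  have nsx: "ns (cond N x) = N" using x by (simp add: ns_def cond_def sum.delta)
  have pos: "0 < cond N x x" using N cx by simp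
  have out: "dshare y (cond N x) x u = 0" if "u \<notin> S0" for u
    using dshare_in_out[of "cond N x" x u y, OF pos x that y] N nsx cx by simp
  have inn: "r x u * dshare y (cond N x) x u = r x u * ((of_bool (u = y) - of_bool (x = y)) / real N)" if "u \<in> S0" for u
    using dshare_in_in[of "cond N x" x u y, OF pos _ x that] nsx rates_diag by (cases "x = u") auto
  have "(\<Sum>z\<in>UNIV. \<Sum>u\<in>UNIV. real (cond N x z) * r z u * dshare y (cond N x) z u) =
      (\<Sum>z\<in>UNIV. if z = x then (\<Sum>u\<in>UNIV. real N * r x u * dshare y (cond N x) x u) else 0)"
    by (rule sum.cong) (auto simp: cx)
  also have "\<dots> = (\<Sum>u\<in>UNIV. real N * r x u * dshare y (cond N x) x u)" by (simp add: sum.delta)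
  also have "\<dots> = (\<Sum>u\<in>S0. real N * (r x u * dshare y (cond N x) x u))"
    unfolding sum_split_S0 by (simp add: out mult.assoc)
  also have "\<dots> = (\<Sum>u\<in>S0. r x u * (of_bool (u = y) - of_bool (x = y)))"
    by (rule sum.cong[OF refl]) (use inn N in simp)
  also have "\<dots> = limit_generator r S0 (indicator {y}) x"
    unfolding limit_generator_def by (rule sum.cong) (auto simp: indicator_def)
  finally have 1: "(\<Sum>z\<in>UNIV. \<Sum>u\<in>UNIV. real (cond N x z) * r z u * dshare y (cond N x) z u) = limit_generator r S0 (indicator {y}) x" .
  have 2: "(\<Sum>z\<in>S0. \<Sum>u\<in>- S0. real (cond N x z) * real (cond N x u) * (r z u * dshare y (cond N x) z u + r u z * dshare y (cond N x) u z)) = 0"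
  proof (intro sum.neutral ballI)
    fix z u assume "z \<in> S0" "u \<in> - S0"
    then have "u \<noteq> x" using x by auto
    then have "cond N x u = 0" by (rule cx(2))
    then show "real (cond N x z) * real (cond N x u) * (r z u * dshare y (cond N x) z u + r u z * dshare y (cond N x) u z) = 0" by simp
  qed
  show ?thesis unfolding generator_share[OF y] 1 2 by simp
qed

lemma real_sum_configs: "\<zeta> \<in> configs N \<Longrightarrow> (\<Sum>x\<in>UNIV. real (\<zeta> x)) = real N"
  unfolding configs_def by (simp flip: of_nat_sum)

lemma small_part:
  assumes \<zeta>: "\<zeta> \<in> configs N" and D: "\<And>x u. 0 < \<zeta> x \<Longrightarrow> x \<noteq> u \<Longrightarrow> \<bar>dshare y \<zeta> x u\<bar> \<le> D" and D0: "0 \<le> D"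
  shows "\<bar>\<Sum>x\<in>UNIV. \<Sum>u\<in>UNIV. real (\<zeta> x) * r x u * dshare y \<zeta> x u\<bar> \<le> rM * real CARD('s) * real N * D"
proof -
  have "\<bar>\<Sum>x\<in>UNIV. \<Sum>u\<in>UNIV. real (\<zeta> x) * r x u * dshare y \<zeta> x u\<bar> \<le>
      (\<Sum>x\<in>UNIV. \<Sum>u\<in>UNIV. \<bar>real (\<zeta> x) * r x u * dshare y \<zeta> x u\<bar>)"
    by (intro order.trans[OF sum_abs] sum_mono sum_abs)
  also have "\<dots> \<le> (\<Sum>x\<in>UNIV. \<Sum>u\<in>(UNIV :: 's set). real (\<zeta> x) * (rM * D))"
  proof (intro sum_mono)
    fix x u :: 's
    show "\<bar>real (\<zeta> x) * r x u * dshare y \<zeta> x u\<bar> \<le> real (\<zeta> x) * (rM * D)"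
    proof (cases "0 < \<zeta> x \<and> x \<noteq> u")
      case True
      have "r x u * \<bar>dshare y \<zeta> x u\<bar> \<le> rM * D"
        by (rule mult_mono[OF r_le D]) (use True rM_nonneg in auto)
      then show ?thesis using rates_nonneg[of x u] by (simp add: abs_mult mult.assoc mult_left_mono)
    next
      case False
      then show ?thesis using rM_nonneg D0 by (auto simp: rates_diag)
    qed
  qed
  also have "\<dots> = rM * real CARD('s) * real N * D"
    using real_sum_configs[OF \<zeta>] by (simp add: sum_distrib_right[symmetric] sum_distrib_left[symmetric] mult_ac)
  finally show ?thesis .
qed

text \<open>A heavy site in \<open>S0\<close> makes \<open>ns \<zeta>\<close> comparable to
  \<open>N\<close>, which tames the part with factor \<open>d\<close>. The other part carries no
  \<open>d\<close>, but it is bounded by the number of particles of \<open>S0\<close> away from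
  \<open>x0\<close> times the number outside \<open>S0\<close>; each of these two numbers brings a
  factor \<open>d\<close> in the mean.\<close>

lemma generator_share_star:
  assumes y: "y \<in> S0" and d: "0 \<le> d" and \<zeta>: "\<zeta> \<in> configs N" and x0: "x0 \<in> S0" "real N \<le> real CARD('s) * real (\<zeta> x0)"
    and N: "2 * CARD('s) \<le> N"
  shows "\<bar>inclusion_generator r d (share y) \<zeta>\<bar> \<le> 2 * d * rM * (real CARD('s))\<^sup>2 +
    3 * rM * (real CARD('s))\<^sup>2 / real N * (\<Sum>x\<in>S0 - {x0}. \<Sum>u\<in>- S0. real (\<zeta> x) * real (\<zeta> u))"
proof -
  let ?c = "real CARD('s)" and ?n = "real (ns \<zeta>)"
  have c: "1 \<le> ?c" by (simp add: Suc_le_eq)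
  have "real (2 * CARD('s)) \<le> real N" using N by (simp only: of_nat_le_iff)
  then have cN: "2 * ?c \<le> real N" by simp
  then have N0: "0 < real N" using c by linarith
  have Nn: "real N \<le> ?c * ?n"
    by (rule order.trans[OF x0(2)]) (use le_ns[OF x0(1), of \<zeta>] in simp)
  have "2 * ?c \<le> ?c * ?n" using Nn cN by linarith
  then have n2: "2 \<le> ?n" using c by simp
  then have n2': "2 \<le> ns \<zeta>" by simp
  have inv: "1 / ?n \<le> ?c / real N" using Nn N0 n2 by (simp add: field_simps)
  have "\<bar>\<Sum>x\<in>UNIV. \<Sum>u\<in>UNIV. real (\<zeta> x) * r x u * dshare y \<zeta> x u\<bar> \<le> rM * ?c * real N * (2 / ?n)"
    by (rule small_part[OF \<zeta>]) (use dshare_small[OF _ _ y n2'] n2 in auto)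
  also have "\<dots> = 2 * rM * ?c * real N * (1 / ?n)" by simp
  also have "\<dots> \<le> 2 * rM * ?c * real N * (?c / real N)"
    by (rule mult_left_mono[OF inv]) (use rM_nonneg in simp)
  also have "\<dots> = 2 * rM * ?c\<^sup>2" using N0 by (simp add: power2_eq_square)
  finally have "\<bar>\<Sum>x\<in>UNIV. \<Sum>u\<in>UNIV. real (\<zeta> x) * r x u * dshare y \<zeta> x u\<bar> \<le> 2 * rM * ?c\<^sup>2" .
  from mult_left_mono[OF this d]
  have part1: "\<bar>d * (\<Sum>x\<in>UNIV. \<Sum>u\<in>UNIV. real (\<zeta> x) * r x u * dshare y \<zeta> x u)\<bar> \<le> 2 * d * rM * ?c\<^sup>2"
    using d by (simp add: abs_mult mult_ac)
  let ?s = "\<Sum>x\<in>S0 - {x0}. real (\<zeta> x)"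
  have s_ns: "?n = real (\<zeta> x0) + ?s"
    unfolding ns_def of_nat_sum by (rule sum.remove) (use x0 in auto)
  have key: "real (\<zeta> x) * ((?n - real (\<zeta> x)) / ?n\<^sup>2) \<le> ?s * (?c / real N)" if x: "x \<in> S0" for x
  proof -
    have le: "real (\<zeta> x) \<le> ?n" using le_ns[OF x, of \<zeta>] by simp
    have "real (\<zeta> x) * (?n - real (\<zeta> x)) \<le> ?s * ?n"
    proof (cases "x = x0")
      case True
      then have "?n - real (\<zeta> x) = ?s" using s_ns by simp
      have "real (\<zeta> x) * ?s \<le> ?n * ?s" using le by (rule mult_right_mono) (simp add: sum_nonneg)
      then show ?thesis unfolding \<open>?n - real (\<zeta> x) = ?s\<close> by (simp only: mult.commute)
    next
      case False
      have "real (\<zeta> x) \<le> ?s" by (rule member_le_sum) (use x False in auto)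
      then show ?thesis using le by (intro mult_mono) (auto simp: sum_nonneg)
    qed
    then have "real (\<zeta> x) * (?n - real (\<zeta> x)) / ?n\<^sup>2 \<le> ?s * ?n / ?n\<^sup>2" by (rule divide_right_mono) simp
    also have "\<dots> = ?s * (1 / ?n)" using n2 by (simp add: power2_eq_square)
    also have "\<dots> \<le> ?s * (?c / real N)" by (rule mult_left_mono[OF inv]) (simp add: sum_nonneg)
    finally show ?thesis by simp
  qed
  have trm: "\<bar>real (\<zeta> x) * real (\<zeta> u) * (r x u * dshare y \<zeta> x u + r u x * dshare y \<zeta> u x)\<bar> \<le>
      3 * rM * (?s * (?c / real N)) * real (\<zeta> u)" if x: "x \<in> S0" and u: "u \<in> - S0" for x u
  proof (cases "0 < \<zeta> x \<and> 0 < \<zeta> u")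
    case True
    let ?q = "(?n - real (\<zeta> x)) / ?n\<^sup>2"
    have q0: "0 \<le> ?q" using le_ns[OF x, of \<zeta>] by simp
    have "\<bar>dshare y \<zeta> x u\<bar> \<le> 2 * ?q" using dshare_in_out[of \<zeta> x u y] True x u y n2' by simp
    then have a: "r x u * \<bar>dshare y \<zeta> x u\<bar> \<le> rM * (2 * ?q)" by (intro mult_mono r_le) (use rM_nonneg in auto)
    have "\<bar>dshare y \<zeta> u x\<bar> \<le> ?q" using dshare_out_in[of \<zeta> u x y] True x u y n2' by simp
    then have b: "r u x * \<bar>dshare y \<zeta> u x\<bar> \<le> rM * ?q" by (intro mult_mono r_le) (use rM_nonneg in auto)
    have "\<bar>r x u * dshare y \<zeta> x u + r u x * dshare y \<zeta> u x\<bar> \<le> r x u * \<bar>dshare y \<zeta> x u\<bar> + r u x * \<bar>dshare y \<zeta> u x\<bar>"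
      using abs_triangle_ineq[of "r x u * dshare y \<zeta> x u" "r u x * dshare y \<zeta> u x"] rates_nonneg by (simp add: abs_mult)
    also have "\<dots> \<le> 3 * rM * ?q"
    proof -
      have "rM * (2 * z) + rM * z = 3 * rM * z" for z by (simp add: algebra_simps)
      from add_mono[OF a b, unfolded this] show ?thesis .
    qed
    finally have "\<bar>real (\<zeta> x) * real (\<zeta> u) * (r x u * dshare y \<zeta> x u + r u x * dshare y \<zeta> u x)\<bar> \<le> real (\<zeta> x) * real (\<zeta> u) * (3 * rM * ?q)"
      unfolding abs_mult by (intro mult_mono) simp_all
    also have "\<dots> = 3 * rM * real (\<zeta> u) * (real (\<zeta> x) * ?q)" by simp
    also have "\<dots> \<le> 3 * rM * real (\<zeta> u) * (?s * (?c / real N))"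
      by (rule mult_left_mono[OF key[OF x]]) (use rM_nonneg in simp)
    finally show ?thesis by (simp add: mult_ac)
  next
    case False
    have "0 \<le> 3 * rM * (?s * (?c / real N)) * real (\<zeta> u)"
      using rM_nonneg by (intro mult_nonneg_nonneg sum_nonneg divide_nonneg_nonneg) auto
    then show ?thesis using False by auto
  qed
  have "\<bar>\<Sum>x\<in>S0. \<Sum>u\<in>- S0. real (\<zeta> x) * real (\<zeta> u) * (r x u * dshare y \<zeta> x u + r u x * dshare y \<zeta> u x)\<bar>
      \<le> (\<Sum>x\<in>S0. \<Sum>u\<in>- S0. 3 * rM * (?s * (?c / real N)) * real (\<zeta> u))"
    by (intro order.trans[OF sum_abs] sum_mono trm)
  also have "\<dots> = real (card S0) * (3 * rM * (?s * (?c / real N)) * (\<Sum>u\<in>- S0. real (\<zeta> u)))"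
    by (simp add: sum_distrib_left)
  also have "\<dots> \<le> ?c * (3 * rM * (?s * (?c / real N)) * (\<Sum>u\<in>- S0. real (\<zeta> u)))"
    by (intro mult_right_mono mult_nonneg_nonneg sum_nonneg divide_nonneg_nonneg)
       (use rM_nonneg in \<open>auto intro: card_mono\<close>)
  also have "\<dots> = 3 * rM * ?c\<^sup>2 / real N * (?s * (\<Sum>u\<in>- S0. real (\<zeta> u)))"
    by (simp add: power2_eq_square)
  also have "?s * (\<Sum>u\<in>- S0. real (\<zeta> u)) = (\<Sum>x\<in>S0 - {x0}. \<Sum>u\<in>- S0. real (\<zeta> x) * real (\<zeta> u))"
    by (rule sum_product)
  finally have part2: "\<bar>\<Sum>x\<in>S0. \<Sum>u\<in>- S0. real (\<zeta> x) * real (\<zeta> u) * (r x u * dshare y \<zeta> x u + r u x * dshare y \<zeta> u x)\<bar>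
      \<le> 3 * rM * ?c\<^sup>2 / real N * (\<Sum>x\<in>S0 - {x0}. \<Sum>u\<in>- S0. real (\<zeta> x) * real (\<zeta> u))" .
  show ?thesis unfolding generator_share[OF y] using part1 part2 by linarith
qed

text \<open>Crude bound for a heavy site outside \<open>S0\<close>, where powers of \<open>N\<close>
  are harmless against the geometric factor. The indicators are kept because the error will be
  divided by \<open>d\<close>: an occupied site of \<open>S0\<close> supplies the missing
  factor.\<close>

lemma generator_share_other:
  assumes y: "y \<in> S0" and d: "0 \<le> d" and \<zeta>: "\<zeta> \<in> configs N"
  shows "\<bar>inclusion_generator r d (share y) \<zeta>\<bar> \<le> d * rM * real CARD('s) * real N +
    2 * rM * (real N)\<^sup>2 * (\<Sum>x\<in>S0. of_bool (1 \<le> \<zeta> x))"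
proof -
  have "\<bar>\<Sum>x\<in>UNIV. \<Sum>u\<in>UNIV. real (\<zeta> x) * r x u * dshare y \<zeta> x u\<bar> \<le> rM * real CARD('s) * real N * 1"
    by (rule small_part[OF \<zeta>]) (use dshare_le_1[OF y] in auto)
  then have "d * \<bar>\<Sum>x\<in>UNIV. \<Sum>u\<in>UNIV. real (\<zeta> x) * r x u * dshare y \<zeta> x u\<bar> \<le> d * (rM * real CARD('s) * real N * 1)"
    using d by (rule mult_left_mono)
  then have part1: "\<bar>d * (\<Sum>x\<in>UNIV. \<Sum>u\<in>UNIV. real (\<zeta> x) * r x u * dshare y \<zeta> x u)\<bar> \<le> d * rM * real CARD('s) * real N"
    using d by (simp add: abs_mult mult_ac)
  have trm: "\<bar>real (\<zeta> x) * real (\<zeta> u) * (r x u * dshare y \<zeta> x u + r u x * dshare y \<zeta> u x)\<bar> \<le>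
      real N * of_bool (1 \<le> \<zeta> x) * (2 * rM) * real (\<zeta> u)" for x u
  proof -
    have "r x u * \<bar>dshare y \<zeta> x u\<bar> \<le> rM * 1" "r u x * \<bar>dshare y \<zeta> u x\<bar> \<le> rM * 1"
      by (intro mult_mono r_le dshare_le_1[OF y] rM_nonneg; simp)+
    moreover have "\<bar>r x u * dshare y \<zeta> x u + r u x * dshare y \<zeta> u x\<bar> \<le> r x u * \<bar>dshare y \<zeta> x u\<bar> + r u x * \<bar>dshare y \<zeta> u x\<bar>"
      using abs_triangle_ineq[of "r x u * dshare y \<zeta> x u" "r u x * dshare y \<zeta> u x"] rates_nonneg by (simp add: abs_mult)
    ultimately have a: "\<bar>r x u * dshare y \<zeta> x u + r u x * dshare y \<zeta> u x\<bar> \<le> 2 * rM" by linarith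
    have b: "real (\<zeta> x) \<le> real N * of_bool (1 \<le> \<zeta> x)" using configs_le[OF \<zeta>, of x] by (cases "\<zeta> x") auto
    have "\<bar>real (\<zeta> x) * real (\<zeta> u) * (r x u * dshare y \<zeta> x u + r u x * dshare y \<zeta> u x)\<bar> =
        real (\<zeta> x) * \<bar>r x u * dshare y \<zeta> x u + r u x * dshare y \<zeta> u x\<bar> * real (\<zeta> u)"
      by (simp add: abs_mult)
    also have "\<dots> \<le> real N * of_bool (1 \<le> \<zeta> x) * (2 * rM) * real (\<zeta> u)"
      by (intro mult_right_mono mult_mono a b) auto
    finally show ?thesis .
  qed
  have "\<bar>\<Sum>x\<in>S0. \<Sum>u\<in>- S0. real (\<zeta> x) * real (\<zeta> u) * (r x u * dshare y \<zeta> x u + r u x * dshare y \<zeta> u x)\<bar>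
      \<le> (\<Sum>x\<in>S0. \<Sum>u\<in>- S0. real N * of_bool (1 \<le> \<zeta> x) * (2 * rM) * real (\<zeta> u))"
    by (intro order.trans[OF sum_abs] sum_mono trm)
  also have "\<dots> = (\<Sum>x\<in>S0. real N * of_bool (1 \<le> \<zeta> x) * (2 * rM) * (\<Sum>u\<in>- S0. real (\<zeta> u)))"
    by (simp only: sum_distrib_left)
  also have "\<dots> \<le> (\<Sum>x\<in>S0. real N * of_bool (1 \<le> \<zeta> x) * (2 * rM) * real N)"
  proof (intro sum_mono mult_left_mono)
    have "(\<Sum>u\<in>- S0. real (\<zeta> u)) \<le> (\<Sum>u\<in>UNIV. real (\<zeta> u))" by (rule sum_mono2) auto
    then show "(\<Sum>u\<in>- S0. real (\<zeta> u)) \<le> real N" using real_sum_configs[OF \<zeta>] by simp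
  qed (use rM_nonneg in auto)
  also have "\<dots> = 2 * rM * (real N)\<^sup>2 * (\<Sum>x\<in>S0. of_bool (1 \<le> \<zeta> x))"
    unfolding sum_distrib_left by (rule sum.cong) (simp_all only: power2_eq_square mult_ac)
  finally show ?thesis unfolding generator_share[OF y] using part1 by linarith
qed

end

section \<open>The mass outside the condensates\<close>

text \<open>With \<open>s\<close> the cube root of \<open>q\<close> and \<open>j = N div c\<close>,
  the term is at most the cube of \<open>c * (j + 1) * s ^ j\<close>, which tends to 0.\<close>

lemma cube_times_geometric:
  fixes q :: real
  assumes q: "0 \<le> q" "q < 1" and c: "0 < c"
  shows "(\<lambda>N. real N ^ 3 * q ^ (N div c)) \<longlonglongrightarrow> 0"
proof -
  define s where "s = root 3 q"
  have s: "0 \<le> s" "s < 1" "s ^ 3 = q" using q by (auto simp: s_def)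
  have "(\<lambda>j. real j * s ^ j + s ^ j) \<longlonglongrightarrow> 0 + 0"
    by (intro tendsto_add LIMSEQ_power_zero powser_times_n_limit_0) (use s in auto)
  then have lim: "(\<lambda>j. (real c * (real j * s ^ j + s ^ j)) ^ 3) \<longlonglongrightarrow> (real c * 0) ^ 3"
    by (intro tendsto_intros) simp
  have "filterlim (\<lambda>N. N div c) at_top sequentially"
    unfolding filterlim_at_top
  proof
    fix Z :: nat
    have "Z \<le> N div c" if "Z * c \<le> N" for N
      using div_le_mono[OF that, of c] c by simp
    then show "\<forall>\<^sub>F N in sequentially. Z \<le> N div c" unfolding eventually_sequentially by blast
  qed
  from filterlim_compose[OF lim this]
  have L: "(\<lambda>N. (real c * (real (N div c) * s ^ (N div c) + s ^ (N div c))) ^ 3) \<longlonglongrightarrow> 0" by simp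
  show ?thesis
  proof (rule tendsto_sandwich[OF _ _ tendsto_const L])
    have "real N ^ 3 * q ^ (N div c) \<le> (real c * (real (N div c) * s ^ (N div c) + s ^ (N div c))) ^ 3" for N
    proof -
      let ?j = "N div c"
      have "c * ?j + N mod c = N" by (rule mult_div_mod_eq)
      moreover have "N mod c < c" using c by simp
      ultimately have "N \<le> c * ?j + c" by linarith
      then have "N \<le> c * (?j + 1)" by simp
      then have "real N \<le> real (c * (?j + 1))" by (simp only: of_nat_le_iff)
      then have "real N * s ^ ?j \<le> real (c * (?j + 1)) * s ^ ?j" by (rule mult_right_mono) (use s in simp)
      then have "(real N * s ^ ?j) ^ 3 \<le> (real (c * (?j + 1)) * s ^ ?j) ^ 3" by (rule power_mono) (use s in simp)
      moreover have "(real N * s ^ ?j) ^ 3 = real N ^ 3 * q ^ ?j"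
        by (simp add: power_mult_distrib s(3)[symmetric] power_mult[symmetric] mult.commute)
      moreover have "real (c * (?j + 1)) * s ^ ?j = real c * (real ?j * s ^ ?j + s ^ ?j)" by (simp add: algebra_simps)
      ultimately show ?thesis by simp
    qed
    then show "\<forall>\<^sub>F N in sequentially. real N ^ 3 * q ^ (N div c) \<le> (real c * (real (N div c) * s ^ (N div c) + s ^ (N div c))) ^ 3" by simp
  qed (use q in simp)
qed

context reversible_walk
begin

text \<open>Upper bound for the weight of \<open>k\<close> particles at one site, in a form whose
  sums over \<open>k\<close> are explicit.\<close>

definition factor :: "real \<Rightarrow> 's \<Rightarrow> nat \<Rightarrow> real" where
  "factor d x k = (if k = 0 then 1 else 2 * d / real k * \<rho> x ^ k)"

lemma sum_atMost_0: "(\<Sum>k\<le>N. f k) = f 0 + (\<Sum>k=1..N. f k)" for f :: "nat \<Rightarrow> real" and N :: nat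
  by (induction N) simp_all

text \<open>Weight relative to a condensate on \<open>S0\<close>, each of which has weight
  \<open>wt d N\<close>.\<close>

definition ratio :: "real \<Rightarrow> nat \<Rightarrow> ('s \<Rightarrow> nat) \<Rightarrow> real" where
  "ratio d N \<zeta> = weight d \<zeta> / wt d N"

text \<open>Every configuration has a heavy site, which absorbs the normalisation of the weights.\<close>

definition heavy :: "nat \<Rightarrow> 's \<Rightarrow> ('s \<Rightarrow> nat) set" where
  "heavy N x = {\<zeta> \<in> configs N. real N \<le> real CARD('s) * real (\<zeta> x)}"

lemma finite_heavy: "finite (heavy N x)"
  unfolding heavy_def by (rule finite_subset[OF _ finite_configs]) auto

lemma heavy_exists: "\<zeta> \<in> configs N \<Longrightarrow> \<exists>x. \<zeta> \<in> heavy N x"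
proof (rule ccontr)
  assume \<zeta>: "\<zeta> \<in> configs N" and "\<nexists>x. \<zeta> \<in> heavy N x"
  then have lt: "real CARD('s) * real (\<zeta> x) < real N" for x by (auto simp: heavy_def not_le)
  have "real CARD('s) * real N = (\<Sum>x\<in>UNIV. real CARD('s) * real (\<zeta> x))"
    using real_sum_configs[OF \<zeta>] by (simp add: sum_distrib_left[symmetric])
  also have "\<dots> < (\<Sum>x\<in>(UNIV :: 's set). real N)" by (rule sum_strict_mono) (use lt in auto)
  also have "\<dots> = real CARD('s) * real N" by simp
  finally show False by simp
qed

context
  fixes d \<theta> :: real and N :: nat
  assumes d: "0 < d" and N: "2 * CARD('s) \<le> N" and \<theta>: "\<theta> = 2 * d * (1 + ln (real N))" and small: "\<theta> \<le> 1"
begin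

private abbreviation Q :: real where "Q \<equiv> q ^ (N div CARD('s))"
private abbreviation R :: "('s \<Rightarrow> nat) \<Rightarrow> real" where "R \<equiv> ratio d N"

lemma N_ge_1: "1 \<le> N"
proof -
  have "1 \<le> CARD('s)" by (simp add: Suc_le_eq)
  then show ?thesis using N by linarith
qed

lemma \<theta>_nonneg: "0 \<le> \<theta>"
  unfolding \<theta> using d N_ge_1 by (simp add: add_nonneg_nonneg)

lemma R_nonneg: "0 \<le> R \<zeta>"
  unfolding ratio_def using weight_nonneg[OF d] wt_pos[OF d] by (simp add: less_imp_le)

lemma factor_nonneg: "0 \<le> factor d x k"
  using d \<rho>_bounds by (simp add: factor_def)

text \<open>The heavy site has weight at most \<open>2 * d / \<zeta> x0\<close>, hence of order
  \<open>d / N\<close>, and \<open>wt d N\<close> is at least \<open>d / N\<close>: the powers of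
  \<open>d\<close> cancel and no power of \<open>N\<close> is left. Every other occupied site then
  costs a factor \<open>d\<close>.\<close>

lemma ratio_bound:
  assumes \<zeta>: "\<zeta> \<in> heavy N x0"
  shows "R \<zeta> \<le> 2 * real CARD('s) * \<rho> x0 ^ \<zeta> x0 * (\<Prod>x\<in>UNIV - {x0}. factor d x (\<zeta> x))"
proof -
  have \<zeta>C: "\<zeta> \<in> configs N" and big: "real N \<le> real CARD('s) * real (\<zeta> x0)" using \<zeta> by (auto simp: heavy_def)
  have pos: "1 \<le> \<zeta> x0" using big N_ge_1 by (cases "\<zeta> x0") auto
  have wN: "d / real N \<le> wt d N" using wt_lower[OF d, of "N - 1"] N_ge_1 by simp
  have wx: "wt d (\<zeta> x0) \<le> 2 * d / real (\<zeta> x0)"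
    by (rule wt_le_double[OF d small[unfolded \<theta>] pos configs_le[OF \<zeta>C]])
  have "2 * d / real (\<zeta> x0) \<le> 2 * real CARD('s) * (d / real N)"
    using big pos N_ge_1 d by (simp add: field_simps)
  also have "\<dots> \<le> 2 * real CARD('s) * wt d N" by (rule mult_left_mono[OF wN]) simp
  finally have w1: "wt d (\<zeta> x0) / wt d N \<le> 2 * real CARD('s)" using wx wt_pos[OF d, of N] by (simp add: pos_divide_le_eq)
  have rest: "(\<Prod>x\<in>UNIV - {x0}. wt d (\<zeta> x) * \<rho> x ^ \<zeta> x) \<le> (\<Prod>x\<in>UNIV - {x0}. factor d x (\<zeta> x))"
  proof (rule prod_mono)
    fix x
    have "wt d (\<zeta> x) * \<rho> x ^ \<zeta> x \<le> factor d x (\<zeta> x)"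
    proof (cases "\<zeta> x")
      case 0
      then show ?thesis by (simp add: factor_def wt_0)
    next
      case (Suc k)
      then have "wt d (\<zeta> x) \<le> 2 * d / real (\<zeta> x)" by (intro wt_le_double[OF d small[unfolded \<theta>] _ configs_le[OF \<zeta>C]]) simp
      then have "wt d (\<zeta> x) * \<rho> x ^ \<zeta> x \<le> 2 * d / real (\<zeta> x) * \<rho> x ^ \<zeta> x"
        by (rule mult_right_mono) (simp add: \<rho>_bounds)
      then show ?thesis using Suc by (simp add: factor_def)
    qed
    then show "0 \<le> wt d (\<zeta> x) * \<rho> x ^ \<zeta> x \<and> wt d (\<zeta> x) * \<rho> x ^ \<zeta> x \<le> factor d x (\<zeta> x)"
      using wt_pos[OF d, of "\<zeta> x"] \<rho>_bounds by simp
  qed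
  have "R \<zeta> = (wt d (\<zeta> x0) / wt d N * \<rho> x0 ^ \<zeta> x0) * (\<Prod>x\<in>UNIV - {x0}. wt d (\<zeta> x) * \<rho> x ^ \<zeta> x)"
    unfolding ratio_def weight_def by (simp add: prod.remove[of UNIV x0])
  also have "\<dots> \<le> (2 * real CARD('s) * \<rho> x0 ^ \<zeta> x0) * (\<Prod>x\<in>UNIV - {x0}. factor d x (\<zeta> x))"
  proof (rule mult_mono[OF mult_right_mono[OF w1] rest])
    show "0 \<le> (\<Prod>x\<in>UNIV - {x0}. wt d (\<zeta> x) * \<rho> x ^ \<zeta> x)"
      using wt_pos[OF d] \<rho>_bounds by (intro prod_nonneg mult_nonneg_nonneg zero_le_power) (auto intro: less_imp_le)
  qed (use \<rho>_bounds in auto)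
  finally show ?thesis .
qed

text \<open>The price \<open>\<theta>\<close> of one additional occupied site: the harmonic sum is
  the origin of the logarithm in the hypothesis on \<open>d\<close>.\<close>

lemma factor_sum_pos: "(\<Sum>k\<le>N. factor d x k * of_bool (1 \<le> k)) \<le> \<theta>"
proof -
  have "(\<Sum>k\<le>N. factor d x k * of_bool (1 \<le> k)) = (\<Sum>k=1..N. factor d x k)"
    unfolding sum_atMost_0 by simp
  also have "\<dots> \<le> (\<Sum>k=1..N. 2 * d * (1 / real k))"
  proof (rule sum_mono)
    fix k assume "k \<in> {1..N}"
    then have "factor d x k = 2 * d / real k * \<rho> x ^ k" by (simp add: factor_def)
    also have "\<dots> \<le> 2 * d / real k * 1"
      by (rule mult_left_mono) (use \<rho>_bounds d in \<open>auto intro: power_le_one\<close>)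
    finally show "factor d x k \<le> 2 * d * (1 / real k)" by simp
  qed
  also have "\<dots> = 2 * d * (\<Sum>k=1..N. 1 / real k)" by (simp only: sum_distrib_left)
  also have "\<dots> \<le> \<theta>" unfolding \<theta> by (rule mult_left_mono[OF harmonic_le[OF N_ge_1]]) (use d in simp)
  finally show ?thesis .
qed

lemma factor_sum: "(\<Sum>k\<le>N. factor d x k) \<le> 2"
proof -
  have "(\<Sum>k\<le>N. factor d x k) = 1 + (\<Sum>k\<le>N. factor d x k * of_bool (1 \<le> k))"
    unfolding sum_atMost_0 by (simp add: factor_def)
  then show ?thesis using factor_sum_pos[of x] small by simp
qed

lemma factor_mean: "(\<Sum>k\<le>N. factor d x k * real k) \<le> 2 * d * real N"
proof -
  have "(\<Sum>k\<le>N. factor d x k * real k) = (\<Sum>k=1..N. 2 * d * \<rho> x ^ k)"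
    unfolding sum_atMost_0 by (simp, rule sum.cong) (auto simp: factor_def)
  also have "\<dots> \<le> (\<Sum>k=1..N. 2 * d * 1)"
    by (intro sum_mono mult_left_mono power_le_one) (use \<rho>_bounds d in auto)
  finally show ?thesis by (simp add: mult_ac)
qed

text \<open>Outside \<open>S0\<close> the geometric decay keeps the mean number of particles of
  order \<open>d\<close>; on \<open>S0\<close> it is of order \<open>d * N\<close>.\<close>

lemma factor_mean_outside: "x \<notin> S0 \<Longrightarrow> (\<Sum>k\<le>N. factor d x k * real k) \<le> 2 * d / (1 - q)"
proof -
  assume x: "x \<notin> S0"
  have "(\<Sum>k\<le>N. factor d x k * real k) = (\<Sum>k=1..N. 2 * d * \<rho> x ^ k)"
    unfolding sum_atMost_0 by (simp, rule sum.cong) (auto simp: factor_def)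
  also have "\<dots> \<le> (\<Sum>k=1..N. 2 * d * q ^ k)"
    by (intro sum_mono mult_left_mono power_mono) (use q_bounds(3)[OF x] \<rho>_bounds d in auto)
  also have "\<dots> \<le> (\<Sum>k\<le>N. 2 * d * q ^ k)" by (rule sum_mono2) (use d q_bounds in auto)
  also have "\<dots> = 2 * d * (\<Sum>k\<le>N. q ^ k)" by (simp only: sum_distrib_left)
  also have "\<dots> \<le> 2 * d * (1 / (1 - q))"
  proof (rule mult_left_mono)
    have "(\<Sum>k\<le>N. q ^ k) \<le> (\<Sum>k. q ^ k)"
      using sum_le_suminf[OF summable_geometric[of q], of "{..N}"] q_bounds by simp
    also have "\<dots> = 1 / (1 - q)" by (rule suminf_geometric) (use q_bounds in simp)
    finally show "(\<Sum>k\<le>N. q ^ k) \<le> 1 / (1 - q)" .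
  qed (use d in simp)
  finally show ?thesis by simp
qed

text \<open>All sums over configurations with a heavy site \<open>x0\<close> factorize over the other sites.\<close>

lemma heavy_sum:
  assumes Z: "Z \<subseteq> heavy N x0" and g: "\<And>x k. 0 \<le> g x k" and a: "\<And>\<zeta>. \<zeta> \<in> Z \<Longrightarrow> \<rho> x0 ^ \<zeta> x0 \<le> a" "0 \<le> a"
  shows "(\<Sum>\<zeta>\<in>Z. R \<zeta> * (\<Prod>x\<in>UNIV - {x0}. g x (\<zeta> x))) \<le> 2 * real CARD('s) * a * (\<Prod>x\<in>UNIV - {x0}. \<Sum>k\<le>N. factor d x k * g x k)"
proof (rule sum_configs_le)
  show "Z \<subseteq> configs N" using Z by (auto simp: heavy_def)
  show "0 \<le> factor d x k * g x k" for x k using factor_nonneg g by simp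
  show "0 \<le> 2 * real CARD('s) * a" using a by simp
  fix \<zeta> assume \<zeta>: "\<zeta> \<in> Z"
  have "R \<zeta> \<le> 2 * real CARD('s) * \<rho> x0 ^ \<zeta> x0 * (\<Prod>x\<in>UNIV - {x0}. factor d x (\<zeta> x))"
    by (rule ratio_bound) (use Z \<zeta> in blast)
  also have "\<dots> \<le> 2 * real CARD('s) * a * (\<Prod>x\<in>UNIV - {x0}. factor d x (\<zeta> x))"
    by (intro mult_right_mono mult_left_mono a(1)[OF \<zeta>] prod_nonneg factor_nonneg) auto
  finally have "R \<zeta> * (\<Prod>x\<in>UNIV - {x0}. g x (\<zeta> x)) \<le>
      2 * real CARD('s) * a * (\<Prod>x\<in>UNIV - {x0}. factor d x (\<zeta> x)) * (\<Prod>x\<in>UNIV - {x0}. g x (\<zeta> x))"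
    by (rule mult_right_mono) (intro prod_nonneg g)
  then show "R \<zeta> * (\<Prod>x\<in>UNIV - {x0}. g x (\<zeta> x)) \<le> 2 * real CARD('s) * a * (\<Prod>x\<in>UNIV - {x0}. factor d x (\<zeta> x) * g x (\<zeta> x))"
    by (simp add: prod.distrib)
qed

lemma \<rho>_heavy_outside: "x0 \<notin> S0 \<Longrightarrow> \<zeta> \<in> heavy N x0 \<Longrightarrow> \<rho> x0 ^ \<zeta> x0 \<le> Q"
proof -
  assume x0: "x0 \<notin> S0" and \<zeta>: "\<zeta> \<in> heavy N x0"
  have "real N \<le> real (CARD('s) * \<zeta> x0)" using \<zeta> by (simp add: heavy_def)
  then have "N \<le> CARD('s) * \<zeta> x0" by (simp only: of_nat_le_iff)
  then have "N div CARD('s) \<le> \<zeta> x0" using div_le_mono[of N "CARD('s) * \<zeta> x0" "CARD('s)"] by simp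
  have "\<rho> x0 ^ \<zeta> x0 \<le> q ^ \<zeta> x0" by (rule power_mono) (use q_bounds(3)[OF x0] \<rho>_bounds in auto)
  also have "\<dots> \<le> Q" by (rule power_decreasing) (use \<open>N div CARD('s) \<le> \<zeta> x0\<close> q_bounds in auto)
  finally show ?thesis .
qed

lemma Q_nonneg: "0 \<le> Q" using q_bounds by simp

lemma heavy_sum_1:
  assumes Z: "Z \<subseteq> heavy N x0" and a: "\<And>\<zeta>. \<zeta> \<in> Z \<Longrightarrow> \<rho> x0 ^ \<zeta> x0 \<le> a" "0 \<le> a"
  shows "(\<Sum>\<zeta>\<in>Z. R \<zeta>) \<le> 2 * real CARD('s) * a * 2 ^ CARD('s)"
proof -
  have "(\<Sum>\<zeta>\<in>Z. R \<zeta> * (\<Prod>x\<in>UNIV - {x0}. 1)) \<le> 2 * real CARD('s) * a * (\<Prod>x\<in>UNIV - {x0}. \<Sum>k\<le>N. factor d x k * 1)"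
    by (rule heavy_sum[OF Z]) (use a in auto)
  also have "\<dots> \<le> 2 * real CARD('s) * a * 2 ^ CARD('s)"
    by (intro mult_left_mono prod_le_no_special sum_nonneg) (use a factor_nonneg factor_sum in auto)
  finally show ?thesis by simp
qed

lemma heavy_sum_occupied:
  assumes Z: "Z \<subseteq> heavy N x0" and a: "\<And>\<zeta>. \<zeta> \<in> Z \<Longrightarrow> \<rho> x0 ^ \<zeta> x0 \<le> a" "0 \<le> a" and y: "y \<noteq> x0"
  shows "(\<Sum>\<zeta>\<in>Z. R \<zeta> * of_bool (1 \<le> \<zeta> y)) \<le> 2 * real CARD('s) * a * (\<theta> * 2 ^ CARD('s))"
proof -
  let ?g = "\<lambda>x k. if x = y then of_bool (1 \<le> k) else 1 :: real"
  have pr: "(\<Prod>x\<in>UNIV - {x0}. ?g x (\<zeta> x)) = of_bool (1 \<le> \<zeta> y)" for \<zeta> :: "'s \<Rightarrow> nat"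
    using y by (simp add: prod.delta)
  have "(\<Sum>\<zeta>\<in>Z. R \<zeta> * (\<Prod>x\<in>UNIV - {x0}. ?g x (\<zeta> x))) \<le> 2 * real CARD('s) * a * (\<Prod>x\<in>UNIV - {x0}. \<Sum>k\<le>N. factor d x k * ?g x k)"
    by (rule heavy_sum[OF Z]) (use a in auto)
  also have "\<dots> \<le> 2 * real CARD('s) * a * ((\<Sum>k\<le>N. factor d y k * ?g y k) * 2 ^ CARD('s))"
    by (intro mult_left_mono prod_le_one_special sum_nonneg) (use a y factor_nonneg factor_sum in auto)
  also have "\<dots> \<le> 2 * real CARD('s) * a * (\<theta> * 2 ^ CARD('s))"
    by (intro mult_left_mono mult_right_mono) (use a factor_sum_pos[of y] in auto)
  finally show ?thesis unfolding pr .
qed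

text \<open>The result is of order \<open>d\<^sup>2 * N\<close>. The \<open>N\<close> is compensated
  by the factor \<open>1 / N\<close> in the bound for the generator, and one \<open>d\<close> by the
  division in the error.\<close>

lemma heavy_sum_pair:
  assumes x0: "x0 \<in> S0" and x: "x \<in> S0" "x \<noteq> x0" and u: "u \<notin> S0"
  shows "(\<Sum>\<zeta>\<in>heavy N x0. R \<zeta> * (real (\<zeta> x) * real (\<zeta> u))) \<le> 2 * real CARD('s) * (2 * d * real N * (2 * d / (1 - q) * 2 ^ CARD('s)))"
proof -
  let ?g = "\<lambda>z k. (if z = x then real k else 1) * (if z = u then real k else 1) :: real"
  have ne: "x \<noteq> u" "u \<noteq> x0" using x u x0 by auto
  have pr: "(\<Prod>z\<in>UNIV - {x0}. ?g z (\<zeta> z)) = real (\<zeta> x) * real (\<zeta> u)" for \<zeta> :: "'s \<Rightarrow> nat"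
    using x ne by (simp add: prod.distrib prod.delta)
  let ?s = "\<lambda>z. \<Sum>k\<le>N. factor d z k * ?g z k"
  have "(\<Sum>\<zeta>\<in>heavy N x0. R \<zeta> * (\<Prod>z\<in>UNIV - {x0}. ?g z (\<zeta> z))) \<le> 2 * real CARD('s) * 1 * (\<Prod>z\<in>UNIV - {x0}. ?s z)"
    by (rule heavy_sum[OF order.refl]) (use \<rho>_star[OF x0] in auto)
  also have "\<dots> \<le> 2 * real CARD('s) * 1 * (?s x * (?s u * 2 ^ CARD('s)))"
    by (intro mult_left_mono prod_le_two_special sum_nonneg) (use x u ne factor_nonneg factor_sum in auto)
  also have "\<dots> \<le> 2 * real CARD('s) * 1 * (2 * d * real N * (2 * d / (1 - q) * 2 ^ CARD('s)))"
  proof (intro mult_left_mono mult_mono mult_right_mono)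
    show "?s x \<le> 2 * d * real N" using factor_mean[of x] ne by simp
    show "?s u \<le> 2 * d / (1 - q)" using factor_mean_outside[OF u] ne by simp
    show "0 \<le> ?s u * 2 ^ CARD('s)" by (intro mult_nonneg_nonneg sum_nonneg) (use factor_nonneg in auto)
  qed (use d q_bounds in auto)
  finally show ?thesis unfolding pr by simp
qed

lemma sum_heavy_cover:
  assumes "Z \<subseteq> configs N" "\<And>\<zeta>. \<zeta> \<in> Z \<Longrightarrow> 0 \<le> \<phi> \<zeta>"
  shows "(\<Sum>\<zeta>\<in>Z. \<phi> \<zeta>) \<le> (\<Sum>x0\<in>UNIV. \<Sum>\<zeta>\<in>Z \<inter> heavy N x0. \<phi> \<zeta> :: real)"
proof -
  have fin: "finite Z" using assms(1) finite_configs by (rule finite_subset)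
  have "\<phi> \<zeta> \<le> (\<Sum>x0\<in>UNIV. if \<zeta> \<in> heavy N x0 then \<phi> \<zeta> else 0)" if \<zeta>: "\<zeta> \<in> Z" for \<zeta>
  proof -
    obtain x0 where "\<zeta> \<in> heavy N x0" using heavy_exists \<zeta> assms(1) by blast
    then have "\<phi> \<zeta> = (if \<zeta> \<in> heavy N x0 then \<phi> \<zeta> else 0)" by simp
    also have "\<dots> \<le> (\<Sum>x0\<in>UNIV. if \<zeta> \<in> heavy N x0 then \<phi> \<zeta> else 0)"
      by (rule member_le_sum[of x0 UNIV "\<lambda>x0. if \<zeta> \<in> heavy N x0 then \<phi> \<zeta> else 0"]) (use assms(2)[OF \<zeta>] in auto)
    finally show ?thesis .
  qed
  then have "(\<Sum>\<zeta>\<in>Z. \<phi> \<zeta>) \<le> (\<Sum>\<zeta>\<in>Z. \<Sum>x0\<in>UNIV. if \<zeta> \<in> heavy N x0 then \<phi> \<zeta> else 0)" by (rule sum_mono)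
  also have "\<dots> = (\<Sum>x0\<in>UNIV. \<Sum>\<zeta>\<in>Z. if \<zeta> \<in> heavy N x0 then \<phi> \<zeta> else 0)" by (rule sum.swap)
  also have "\<dots> = (\<Sum>x0\<in>UNIV. \<Sum>\<zeta>\<in>Z \<inter> heavy N x0. \<phi> \<zeta>)"
    by (rule sum.cong[OF refl]) (rule sum.inter_restrict[OF fin, symmetric])
  finally show ?thesis .
qed

private abbreviation \<Delta> :: "('s \<Rightarrow> nat) set" where "\<Delta> \<equiv> configs N - cond N ` S0"

text \<open>A configuration with heavy site \<open>x0\<close> in \<open>S0\<close> that is not a
  condensate has a second occupied site, which costs a factor \<open>\<theta>\<close>.\<close>

lemma mass_star: "x0 \<in> S0 \<Longrightarrow> (\<Sum>\<zeta>\<in>\<Delta> \<inter> heavy N x0. R \<zeta>) \<le> real CARD('s) * (2 * real CARD('s) * (\<theta> * 2 ^ CARD('s)))"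
proof -
  assume x0: "x0 \<in> S0"
  let ?Z = "\<Delta> \<inter> heavy N x0"
  have "R \<zeta> \<le> (\<Sum>y\<in>UNIV - {x0}. R \<zeta> * of_bool (1 \<le> \<zeta> y))" if \<zeta>: "\<zeta> \<in> ?Z" for \<zeta>
  proof -
    have "\<exists>y. y \<noteq> x0 \<and> \<zeta> y \<noteq> 0"
    proof (rule ccontr)
      assume "\<nexists>y. y \<noteq> x0 \<and> \<zeta> y \<noteq> 0"
      then have "\<zeta> = cond N x0" using \<zeta> by (intro configs_cond) auto
      then show False using \<zeta> x0 by auto
    qed
    then obtain y where y: "y \<noteq> x0" "1 \<le> \<zeta> y" by auto
    have "R \<zeta> = R \<zeta> * of_bool (1 \<le> \<zeta> y)" using y by simp
    also have "\<dots> \<le> (\<Sum>y\<in>UNIV - {x0}. R \<zeta> * of_bool (1 \<le> \<zeta> y))"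
      by (rule member_le_sum[of y "UNIV - {x0}" "\<lambda>y. R \<zeta> * of_bool (1 \<le> \<zeta> y)"]) (use y R_nonneg in auto)
    finally show ?thesis .
  qed
  then have "(\<Sum>\<zeta>\<in>?Z. R \<zeta>) \<le> (\<Sum>\<zeta>\<in>?Z. \<Sum>y\<in>UNIV - {x0}. R \<zeta> * of_bool (1 \<le> \<zeta> y))" by (rule sum_mono)
  also have "\<dots> = (\<Sum>y\<in>UNIV - {x0}. \<Sum>\<zeta>\<in>?Z. R \<zeta> * of_bool (1 \<le> \<zeta> y))" by (rule sum.swap)
  also have "\<dots> \<le> (\<Sum>y\<in>UNIV - {x0}. 2 * real CARD('s) * 1 * (\<theta> * 2 ^ CARD('s)))"
    by (intro sum_mono heavy_sum_occupied) (use \<rho>_star[OF x0] in auto)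
  also have "\<dots> \<le> (\<Sum>y\<in>(UNIV :: 's set). 2 * real CARD('s) * 1 * (\<theta> * 2 ^ CARD('s)))"
    by (rule sum_mono2) (use \<theta>_nonneg in auto)
  finally show ?thesis by simp
qed

lemma mass_outside_condensates:
  "(\<Sum>\<zeta>\<in>\<Delta>. R \<zeta>) \<le> real CARD('s) * (real CARD('s) * (2 * real CARD('s) * (\<theta> * 2 ^ CARD('s))) + 2 * real CARD('s) * Q * 2 ^ CARD('s))"
proof -
  have "(\<Sum>\<zeta>\<in>\<Delta>. R \<zeta>) \<le> (\<Sum>x0\<in>UNIV. \<Sum>\<zeta>\<in>\<Delta> \<inter> heavy N x0. R \<zeta>)"
    by (rule sum_heavy_cover) (use R_nonneg in auto)
  also have "\<dots> \<le> (\<Sum>x0\<in>(UNIV :: 's set). real CARD('s) * (2 * real CARD('s) * (\<theta> * 2 ^ CARD('s))) + 2 * real CARD('s) * Q * 2 ^ CARD('s))"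
  proof (rule sum_mono)
    fix x0 :: 's
    have 0: "0 \<le> real CARD('s) * (2 * real CARD('s) * (\<theta> * 2 ^ CARD('s)))" "0 \<le> 2 * real CARD('s) * Q * 2 ^ CARD('s)" using \<theta>_nonneg Q_nonneg by auto
    show "(\<Sum>\<zeta>\<in>\<Delta> \<inter> heavy N x0. R \<zeta>) \<le> real CARD('s) * (2 * real CARD('s) * (\<theta> * 2 ^ CARD('s))) + 2 * real CARD('s) * Q * 2 ^ CARD('s)"
    proof (cases "x0 \<in> S0")
      case True
      then show ?thesis using mass_star[OF True] 0 by linarith
    next
      case False
      have "(\<Sum>\<zeta>\<in>\<Delta> \<inter> heavy N x0. R \<zeta>) \<le> 2 * real CARD('s) * Q * 2 ^ CARD('s)"
        by (rule heavy_sum_1) (use \<rho>_heavy_outside[OF False] Q_nonneg in auto)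
      then show ?thesis using 0 by linarith
    qed
  qed
  also have "\<dots> = real CARD('s) * (real CARD('s) * (2 * real CARD('s) * (\<theta> * 2 ^ CARD('s))) + 2 * real CARD('s) * Q * 2 ^ CARD('s))" by simp
  finally show ?thesis .
qed

text \<open>The four summands, after division by \<open>d\<close>: with the heavy site in
  \<open>S0\<close>, the part with factor \<open>d\<close> times the mass \<open>\<theta>\<close>,
  and the pairs of displaced particles, of order \<open>d\<close>; with the heavy site outside
  \<open>S0\<close>, the same two parts of the generator with polynomial growth times the geometric
  factor.\<close>

lemma generator_outside_condensates:
  assumes y: "y \<in> S0"
  shows "(\<Sum>\<zeta>\<in>\<Delta>. R \<zeta> * \<bar>inclusion_generator r d (share y) \<zeta>\<bar>) / d \<le>
    real CARD('s) * (2 * rM * (real CARD('s))\<^sup>2 * (real CARD('s) * (2 * real CARD('s) * (\<theta> * 2 ^ CARD('s)))) + 3 * rM * (real CARD('s))\<^sup>2 * (real CARD('s) * (real CARD('s) * (2 * real CARD('s) * (4 * d / (1 - q) * 2 ^ CARD('s))))) +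
      rM * real CARD('s) * (2 * real CARD('s) * 2 ^ CARD('s)) * (real N * Q) + 2 * rM * (real CARD('s) * (2 * real CARD('s) * (4 * 2 ^ CARD('s)))) * (real N ^ 3 * Q))"
    (is "_ \<le> real CARD('s) * (?b1 + ?b2 + ?b3 + ?b4)")
proof -
  let ?L = "inclusion_generator r d (share y)"
  have N0: "0 < real N" using N_ge_1 by simp
  have b: "0 \<le> ?b1" "0 \<le> ?b2" "0 \<le> ?b3" "0 \<le> ?b4"
    using rM_nonneg \<theta>_nonneg Q_nonneg d q_bounds by auto
  have star: "(\<Sum>\<zeta>\<in>\<Delta> \<inter> heavy N x0. R \<zeta> * \<bar>?L \<zeta>\<bar>) \<le> d * (?b1 + ?b2)" if x0: "x0 \<in> S0" for x0
  proof -
    let ?Z = "\<Delta> \<inter> heavy N x0"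
    let ?k = "3 * rM * (real CARD('s))\<^sup>2 / real N"
    have k0: "0 \<le> ?k" using rM_nonneg by simp
    have "(\<Sum>\<zeta>\<in>?Z. R \<zeta> * \<bar>?L \<zeta>\<bar>) \<le>
        (\<Sum>\<zeta>\<in>?Z. R \<zeta> * (2 * d * rM * (real CARD('s))\<^sup>2 + ?k * (\<Sum>x\<in>S0 - {x0}. \<Sum>u\<in>- S0. real (\<zeta> x) * real (\<zeta> u))))"
    proof (intro sum_mono mult_left_mono R_nonneg)
      fix \<zeta> assume "\<zeta> \<in> ?Z"
      then show "\<bar>?L \<zeta>\<bar> \<le> 2 * d * rM * (real CARD('s))\<^sup>2 + ?k * (\<Sum>x\<in>S0 - {x0}. \<Sum>u\<in>- S0. real (\<zeta> x) * real (\<zeta> u))"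
        by (intro generator_share_star[OF y less_imp_le[OF d] _ x0 _ N]) (auto simp: heavy_def)
    qed
    also have "\<dots> = 2 * d * rM * (real CARD('s))\<^sup>2 * (\<Sum>\<zeta>\<in>?Z. R \<zeta>) + ?k * (\<Sum>x\<in>S0 - {x0}. \<Sum>u\<in>- S0. \<Sum>\<zeta>\<in>?Z. R \<zeta> * (real (\<zeta> x) * real (\<zeta> u)))"
    proof -
      have "(\<Sum>\<zeta>\<in>?Z. R \<zeta> * (\<Sum>x\<in>S0 - {x0}. \<Sum>u\<in>- S0. real (\<zeta> x) * real (\<zeta> u))) =
          (\<Sum>\<zeta>\<in>?Z. \<Sum>x\<in>S0 - {x0}. \<Sum>u\<in>- S0. R \<zeta> * (real (\<zeta> x) * real (\<zeta> u)))"
        by (simp only: sum_distrib_left)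
      also have "\<dots> = (\<Sum>x\<in>S0 - {x0}. \<Sum>\<zeta>\<in>?Z. \<Sum>u\<in>- S0. R \<zeta> * (real (\<zeta> x) * real (\<zeta> u)))" by (rule sum.swap)
      also have "\<dots> = (\<Sum>x\<in>S0 - {x0}. \<Sum>u\<in>- S0. \<Sum>\<zeta>\<in>?Z. R \<zeta> * (real (\<zeta> x) * real (\<zeta> u)))"
        by (rule sum.cong[OF refl]) (rule sum.swap)
      finally have sw: "(\<Sum>\<zeta>\<in>?Z. R \<zeta> * (\<Sum>x\<in>S0 - {x0}. \<Sum>u\<in>- S0. real (\<zeta> x) * real (\<zeta> u))) =
          (\<Sum>x\<in>S0 - {x0}. \<Sum>u\<in>- S0. \<Sum>\<zeta>\<in>?Z. R \<zeta> * (real (\<zeta> x) * real (\<zeta> u)))" .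
      have "(\<Sum>\<zeta>\<in>Z. w \<zeta> * (A + K * B \<zeta>)) = A * (\<Sum>\<zeta>\<in>Z. w \<zeta>) + K * (\<Sum>\<zeta>\<in>Z. w \<zeta> * B \<zeta>)" for w B :: "('s \<Rightarrow> nat) \<Rightarrow> real" and A K Z
        by (simp add: sum_distrib_left sum.distrib[symmetric] distrib_left mult_ac)
      then show ?thesis unfolding sw[symmetric] .
    qed
    also have "\<dots> \<le> 2 * d * rM * (real CARD('s))\<^sup>2 * (real CARD('s) * (2 * real CARD('s) * (\<theta> * 2 ^ CARD('s)))) +
        ?k * (\<Sum>x\<in>S0 - {x0}. \<Sum>u\<in>- S0. 2 * real CARD('s) * (2 * d * real N * (2 * d / (1 - q) * 2 ^ CARD('s))))"
    proof (intro add_mono mult_left_mono mass_star x0 sum_mono k0)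
      fix x u assume xu: "x \<in> S0 - {x0}" "u \<in> - S0"
      have "(\<Sum>\<zeta>\<in>?Z. R \<zeta> * (real (\<zeta> x) * real (\<zeta> u))) \<le> (\<Sum>\<zeta>\<in>heavy N x0. R \<zeta> * (real (\<zeta> x) * real (\<zeta> u)))"
        by (rule sum_mono2) (auto intro!: mult_nonneg_nonneg R_nonneg simp: finite_heavy)
      also have "\<dots> \<le> 2 * real CARD('s) * (2 * d * real N * (2 * d / (1 - q) * 2 ^ CARD('s)))"
        by (rule heavy_sum_pair[OF x0]) (use xu in auto)
      finally show "(\<Sum>\<zeta>\<in>?Z. R \<zeta> * (real (\<zeta> x) * real (\<zeta> u))) \<le> 2 * real CARD('s) * (2 * d * real N * (2 * d / (1 - q) * 2 ^ CARD('s)))" .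
    qed (use d rM_nonneg in auto)
    also have "\<dots> \<le> 2 * d * rM * (real CARD('s))\<^sup>2 * (real CARD('s) * (2 * real CARD('s) * (\<theta> * 2 ^ CARD('s)))) +
        ?k * (real CARD('s) * (real CARD('s) * (2 * real CARD('s) * (2 * d * real N * (2 * d / (1 - q) * 2 ^ CARD('s))))))"
    proof -
      let ?v = "2 * real CARD('s) * (2 * d * real N * (2 * d / (1 - q) * 2 ^ CARD('s)))"
      have v0: "0 \<le> ?v" using d q_bounds by simp
      have "(\<Sum>x\<in>S0 - {x0}. \<Sum>u\<in>- S0. ?v) = real (card (S0 - {x0})) * (real (card (- S0)) * ?v)" by simp
      also have "\<dots> \<le> real CARD('s) * (real CARD('s) * ?v)" by (intro mult_mono mult_right_mono mult_nonneg_nonneg v0) (auto intro: card_mono)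
      finally have "(\<Sum>x\<in>S0 - {x0}. \<Sum>u\<in>- S0. ?v) \<le> real CARD('s) * (real CARD('s) * ?v)" .
      from mult_left_mono[OF this k0] show ?thesis by (rule add_left_mono)
    qed
    also have "?k * (real CARD('s) * (real CARD('s) * (2 * real CARD('s) * (2 * d * real N * (2 * d / (1 - q) * 2 ^ CARD('s)))))) = d * ?b2"
      using N0 by (simp add: field_simps)
    finally show ?thesis by (simp add: distrib_left mult_ac)
  qed
  have other: "(\<Sum>\<zeta>\<in>\<Delta> \<inter> heavy N x0. R \<zeta> * \<bar>?L \<zeta>\<bar>) \<le> d * (?b3 + ?b4)" if x0: "x0 \<notin> S0" for x0
  proof -
    let ?Z = "\<Delta> \<inter> heavy N x0"
    let ?k = "2 * rM * (real N)\<^sup>2"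
    have "(\<Sum>\<zeta>\<in>?Z. R \<zeta> * \<bar>?L \<zeta>\<bar>) \<le> (\<Sum>\<zeta>\<in>?Z. R \<zeta> * (d * rM * real CARD('s) * real N + ?k * (\<Sum>x\<in>S0. of_bool (1 \<le> \<zeta> x))))"
    proof (intro sum_mono mult_left_mono R_nonneg)
      fix \<zeta> assume "\<zeta> \<in> ?Z"
      then show "\<bar>?L \<zeta>\<bar> \<le> d * rM * real CARD('s) * real N + ?k * (\<Sum>x\<in>S0. of_bool (1 \<le> \<zeta> x))"
        by (intro generator_share_other[OF y less_imp_le[OF d]]) auto
    qed
    also have "\<dots> = d * rM * real CARD('s) * real N * (\<Sum>\<zeta>\<in>?Z. R \<zeta>) + ?k * (\<Sum>x\<in>S0. \<Sum>\<zeta>\<in>?Z. R \<zeta> * of_bool (1 \<le> \<zeta> x))"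
    proof -
      have "(\<Sum>\<zeta>\<in>?Z. R \<zeta> * (\<Sum>x\<in>S0. of_bool (1 \<le> \<zeta> x))) = (\<Sum>\<zeta>\<in>?Z. \<Sum>x\<in>S0. R \<zeta> * of_bool (1 \<le> \<zeta> x))"
        by (simp only: sum_distrib_left)
      also have "\<dots> = (\<Sum>x\<in>S0. \<Sum>\<zeta>\<in>?Z. R \<zeta> * of_bool (1 \<le> \<zeta> x))" by (rule sum.swap)
      finally have sw: "(\<Sum>\<zeta>\<in>?Z. R \<zeta> * (\<Sum>x\<in>S0. of_bool (1 \<le> \<zeta> x))) = (\<Sum>x\<in>S0. \<Sum>\<zeta>\<in>?Z. R \<zeta> * of_bool (1 \<le> \<zeta> x))" .
      have "(\<Sum>\<zeta>\<in>Z. w \<zeta> * (A + K * B \<zeta>)) = A * (\<Sum>\<zeta>\<in>Z. w \<zeta>) + K * (\<Sum>\<zeta>\<in>Z. w \<zeta> * B \<zeta>)" for w B :: "('s \<Rightarrow> nat) \<Rightarrow> real" and A K Z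
        by (simp add: sum_distrib_left sum.distrib[symmetric] distrib_left mult_ac)
      then show ?thesis unfolding sw[symmetric] .
    qed
    also have "\<dots> \<le> d * rM * real CARD('s) * real N * (2 * real CARD('s) * Q * 2 ^ CARD('s)) + ?k * (\<Sum>x\<in>S0. 2 * real CARD('s) * Q * (\<theta> * 2 ^ CARD('s)))"
    proof (intro add_mono mult_left_mono sum_mono)
      show "(\<Sum>\<zeta>\<in>?Z. R \<zeta>) \<le> 2 * real CARD('s) * Q * 2 ^ CARD('s)"
        by (rule heavy_sum_1) (use \<rho>_heavy_outside[OF x0] Q_nonneg in auto)
      fix x assume "x \<in> S0"
      then show "(\<Sum>\<zeta>\<in>?Z. R \<zeta> * of_bool (1 \<le> \<zeta> x)) \<le> 2 * real CARD('s) * Q * (\<theta> * 2 ^ CARD('s))"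
        by (intro heavy_sum_occupied) (use x0 \<rho>_heavy_outside[OF x0] Q_nonneg in auto)
    qed (use d rM_nonneg in auto)
    also have "\<dots> \<le> d * rM * real CARD('s) * real N * (2 * real CARD('s) * Q * 2 ^ CARD('s)) + ?k * (real CARD('s) * (2 * real CARD('s) * Q * (4 * d * real N * 2 ^ CARD('s))))"
    proof -
      \<comment> \<open>The factor \<open>d\<close> needed for the division is hidden in
        \<open>\<theta>\<close>; the logarithm is bounded by a power of \<open>N\<close>, at no cost
        next to the geometric factor.\<close>
      have "ln (real N) \<le> real N - 1" by (rule ln_le_minus_one[OF N0])
      then have "\<theta> \<le> 2 * d * real N" unfolding \<theta> using d by (intro mult_left_mono) auto
      also have "\<dots> \<le> 4 * d * real N" using d by simp
      finally have "\<theta> \<le> 4 * d * real N" .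
      then have le: "2 * real CARD('s) * Q * (\<theta> * 2 ^ CARD('s)) \<le> 2 * real CARD('s) * Q * (4 * d * real N * 2 ^ CARD('s))"
        by (intro mult_left_mono mult_right_mono) (use Q_nonneg in auto)
      have v0: "0 \<le> 2 * real CARD('s) * Q * (4 * d * real N * 2 ^ CARD('s))" using d Q_nonneg by simp
      have "(\<Sum>x\<in>S0. 2 * real CARD('s) * Q * (\<theta> * 2 ^ CARD('s))) = real (card S0) * (2 * real CARD('s) * Q * (\<theta> * 2 ^ CARD('s)))" by simp
      also have "\<dots> \<le> real CARD('s) * (2 * real CARD('s) * Q * (4 * d * real N * 2 ^ CARD('s)))"
        by (rule mult_mono[OF _ le]) (use \<theta>_nonneg Q_nonneg in \<open>auto intro: card_mono\<close>)
      finally have le2: "(\<Sum>x\<in>S0. 2 * real CARD('s) * Q * (\<theta> * 2 ^ CARD('s))) \<le> real CARD('s) * (2 * real CARD('s) * Q * (4 * d * real N * 2 ^ CARD('s)))" .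
      have "0 \<le> ?k" using rM_nonneg by simp
      from mult_left_mono[OF le2 this] show ?thesis by (rule add_left_mono)
    qed
    also have "\<dots> = d * (?b3 + ?b4)" by (simp add: algebra_simps power2_eq_square power3_eq_cube)
    finally show ?thesis .
  qed
  have "(\<Sum>\<zeta>\<in>\<Delta>. R \<zeta> * \<bar>?L \<zeta>\<bar>) \<le> (\<Sum>x0\<in>UNIV. \<Sum>\<zeta>\<in>\<Delta> \<inter> heavy N x0. R \<zeta> * \<bar>?L \<zeta>\<bar>)"
    by (rule sum_heavy_cover) (auto intro!: mult_nonneg_nonneg R_nonneg)
  also have "\<dots> \<le> (\<Sum>x0\<in>(UNIV :: 's set). d * (?b1 + ?b2 + ?b3 + ?b4))"
  proof (rule sum_mono)
    fix x0 :: 's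
    have "d * (?b1 + ?b2) \<le> d * (?b1 + ?b2 + ?b3 + ?b4)" "d * (?b3 + ?b4) \<le> d * (?b1 + ?b2 + ?b3 + ?b4)"
      using b d by (intro mult_left_mono; linarith)+
    then show "(\<Sum>\<zeta>\<in>\<Delta> \<inter> heavy N x0. R \<zeta> * \<bar>?L \<zeta>\<bar>) \<le> d * (?b1 + ?b2 + ?b3 + ?b4)"
      using star[of x0] other[of x0] by (cases "x0 \<in> S0") (meson order.trans)+
  qed
  also have "\<dots> = real CARD('s) * (?b1 + ?b2 + ?b3 + ?b4) * d" by simp
  finally show ?thesis using d by (simp only: pos_divide_le_eq)
qed

end

end

section \<open>Harmonic functions and mean hitting times\<close>

context reversible_walk
begin

text \<open>Dirichlet problem with right-hand side 0 and the constant 1 as supersolution.\<close>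

lemma harmonic_exists:
  assumes d: "0 < d"
  shows "\<exists>h. (\<forall>\<zeta>\<in>configs N. 0 \<le> h \<zeta> \<and> h \<zeta> \<le> 1) \<and> (\<forall>u\<in>S0. h (cond N u) = of_bool (cond N u = cond N z)) \<and>
    (\<forall>\<zeta>\<in>configs N - cond N ` S0. inclusion_generator r d h \<zeta> = 0)"
proof -
  interpret jump_generator "configs N" UNIV "\<lambda>(x, y) \<zeta>. real (\<zeta> x) * (d + real (\<zeta> y)) * r x y"
    "\<lambda>(x, y). move x y" "inclusion_generator r d" by (rule jump_generator_inclusion[OF less_imp_le[OF d]])
  have one: "inclusion_generator r d (\<lambda>_. 1) \<zeta> \<le> - 0" for \<zeta> by (simp add: inclusion_generator_def)
  have "\<exists>h. (\<forall>\<zeta>\<in>configs N. 0 \<le> h \<zeta> \<and> h \<zeta> \<le> 1) \<and> (\<forall>\<zeta>\<in>configs N \<inter> cond N ` S0. h \<zeta> = of_bool (\<zeta> = cond N z)) \<and>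
      (\<forall>\<zeta>\<in>configs N - cond N ` S0. inclusion_generator r d h \<zeta> = - 0)"
    by (rule dirichlet_solution[where V = "\<lambda>_. 1"]) (use one in auto)
  then obtain h where h: "\<And>\<zeta>. \<zeta> \<in> configs N \<Longrightarrow> 0 \<le> h \<zeta> \<and> h \<zeta> \<le> 1"
    "\<And>\<zeta>. \<zeta> \<in> configs N \<inter> cond N ` S0 \<Longrightarrow> h \<zeta> = of_bool (\<zeta> = cond N z)"
    "\<And>\<zeta>. \<zeta> \<in> configs N - cond N ` S0 \<Longrightarrow> inclusion_generator r d h \<zeta> = - 0" by blast
  have "h (cond N u) = of_bool (cond N u = cond N z)" if "u \<in> S0" for u
    by (rule h(2)) (use that cond_configs in auto)
  then show ?thesis using h(1,3) by (intro exI[of _ h]) auto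
qed

text \<open>First step of a shortest path to \<open>z\<close>; irreducibility makes the distance
  \<open>D\<close> well defined.\<close>

lemma nearer_site:
  fixes z :: 's
  defines "D \<equiv> \<lambda>x. LEAST n. (x, z) \<in> {(u, v). 0 < r u v} ^^ n"
  assumes "x \<noteq> z"
  shows "\<exists>u. 0 < r x u \<and> D u < D x"
proof -
  let ?R = "{(u, v). 0 < r u v}"
  have ex: "\<exists>n. (u, z) \<in> ?R ^^ n" for u using irreducible[of u z] by (simp add: rtrancl_power)
  have Dx: "(x, z) \<in> ?R ^^ D x" unfolding D_def by (rule LeastI_ex[OF ex])
  then obtain k where k: "D x = Suc k" using assms(2) by (cases "D x") auto
  then have "(x, z) \<in> ?R ^^ Suc k" using Dx by (simp only:)
  then obtain u where u: "(x, u) \<in> ?R" "(u, z) \<in> ?R ^^ k" by (rule relpow_Suc_E2)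
  have "D u \<le> k" unfolding D_def by (rule Least_le[where P = "\<lambda>n. (u, z) \<in> ?R ^^ n", OF u(2)])
  then show ?thesis using u(1) k by auto
qed

text \<open>The height is the total distance of the particles to \<open>z\<close>.\<close>

lemma lyapunov_condensate:
  assumes d: "0 < d"
  shows "\<exists>w. (\<forall>\<zeta>\<in>configs N. 0 \<le> w \<zeta>) \<and> (\<forall>\<zeta>\<in>configs N - {cond N z}. inclusion_generator r d w \<zeta> \<le> - 1)"
proof -
  interpret jump_generator "configs N" UNIV "\<lambda>(x, y) \<zeta>. real (\<zeta> x) * (d + real (\<zeta> y)) * r x y"
    "\<lambda>(x, y). move x y" "inclusion_generator r d" by (rule jump_generator_inclusion[OF less_imp_le[OF d]])
  define D where "D x = (LEAST n. (x, z) \<in> {(u, v). 0 < r u v} ^^ n)" for x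
  define height where "height \<zeta> = (\<Sum>x\<in>UNIV. \<zeta> x * D x)" for \<zeta> :: "'s \<Rightarrow> nat"
  let ?X = "insert 1 ((\<lambda>(x, y). r x y) ` {(x, y). 0 < r x y})"
  define \<epsilon> where "\<epsilon> = Min ?X"
  have finX: "finite ?X" by simp
  have \<epsilon>: "0 < \<epsilon>" unfolding \<epsilon>_def using finX by (subst Min_gr_iff) auto
  have \<epsilon>_le: "\<epsilon> \<le> r x y" if "0 < r x y" for x y
    unfolding \<epsilon>_def by (rule Min_le[OF finX]) (use that in force)
  have height_move: "height (move x u \<zeta>) < height \<zeta>" if "0 < \<zeta> x" "x \<noteq> u" "D u < D x" for x u \<zeta>
  proof -
    have "int (move x u \<zeta> y) = int (\<zeta> y) + of_bool (y = u) - of_bool (y = x)" for y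
      using that by (auto simp: move_def)
    then have "int (height (move x u \<zeta>)) = (\<Sum>y\<in>UNIV. (int (\<zeta> y) + of_bool (y = u) - of_bool (y = x)) * int (D y))"
      unfolding height_def by simp
    also have "\<dots> = (\<Sum>y\<in>UNIV. int (\<zeta> y) * int (D y)) + (\<Sum>y\<in>UNIV. if y = u then int (D y) else 0) - (\<Sum>y\<in>UNIV. if y = x then int (D y) else 0)"
      unfolding sum.distrib[symmetric] sum_subtractf[symmetric]
      by (rule sum.cong[OF refl]) (auto simp: algebra_simps)
    also have "\<dots> = int (height \<zeta>) + int (D u) - int (D x)" unfolding height_def by (simp add: sum.delta)
    finally show ?thesis using that(3) by linarith
  qed
  show ?thesis
  proof (rule lyapunov_function[of "d * \<epsilon>" "{cond N z}" height "\<Sum>x\<in>UNIV. N * D x"])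
    show "0 < d * \<epsilon>" using d \<epsilon> by simp
    show "height \<zeta> \<le> (\<Sum>x\<in>UNIV. N * D x)" if "\<zeta> \<in> configs N" for \<zeta>
      unfolding height_def by (intro sum_mono mult_right_mono configs_le[OF that]) simp
    fix \<zeta> assume \<zeta>: "\<zeta> \<in> configs N - {cond N z}"
    have "\<exists>x. x \<noteq> z \<and> \<zeta> x \<noteq> 0"
    proof (rule ccontr)
      assume "\<nexists>x. x \<noteq> z \<and> \<zeta> x \<noteq> 0"
      then have "\<zeta> = cond N z" using \<zeta> by (intro configs_cond) auto
      then show False using \<zeta> by simp
    qed
    then obtain x where x: "x \<noteq> z" "0 < \<zeta> x" by auto
    obtain u where u: "0 < r x u" "D u < D x" using nearer_site[OF x(1)] unfolding D_def by blast
    \<comment> \<open>One particle at \<open>x\<close> and the summand \<open>d\<close> alone bound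
      the rate of a descending move from below, even when the target site is empty.\<close>
    have "1 * (d * \<epsilon>) \<le> real (\<zeta> x) * ((d + real (\<zeta> u)) * r x u)"
      by (intro mult_mono \<epsilon>_le u) (use x d \<epsilon> in auto)
    moreover have "x \<noteq> u" using u(2) by auto
    ultimately show "\<exists>i\<in>UNIV. d * \<epsilon> \<le> (case i of (x, y) \<Rightarrow> \<lambda>\<zeta>. real (\<zeta> x) * (d + real (\<zeta> y)) * r x y) \<zeta> \<and>
        height ((case i of (x, y) \<Rightarrow> move x y) \<zeta>) < height \<zeta>"
      using height_move[where x = x and u = u and \<zeta> = \<zeta>, OF x(2) _ u(2)] by (intro bexI[of _ "(x, u)"]) (auto simp: mult.assoc)
  qed
qed

text \<open>\<open>m\<close> is constant on \<open>S0\<close>, so the rates between sites of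
  \<open>S0\<close> are symmetric.\<close>

lemma limit_generator_symmetric:
  assumes "y \<in> S0" "z \<in> S0"
  shows "limit_generator r S0 (indicator {y}) z = limit_generator r S0 (indicator {z}) y"
proof -
  have "(\<Sum>u\<in>S0. r z u * (indicator {y} u - indicator {y} z)) = r z y - of_bool (z = y) * (\<Sum>u\<in>S0. r z u)" if "y \<in> S0" for y z
  proof -
    have "(\<Sum>u\<in>S0. r z u * (indicator {y} u - indicator {y} z)) = (\<Sum>u\<in>S0. (if u = y then r z u else 0) - of_bool (z = y) * r z u)"
      by (rule sum.cong) (auto simp: indicator_def)
    then show ?thesis using that by (simp add: sum_subtractf sum.delta sum_distrib_left)
  qed
  from this[OF assms(1), of z] this[OF assms(2), of y] show ?thesis
    unfolding limit_generator_def using r_sym[OF assms] by auto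
qed

lemma sum_configs_split:
  assumes "0 < N"
  shows "(\<Sum>\<zeta>\<in>configs N. f \<zeta>) = (\<Sum>u\<in>S0. f (cond N u)) + (\<Sum>\<zeta>\<in>configs N - cond N ` S0. f \<zeta> :: real)"
proof -
  have "(\<Sum>\<zeta>\<in>configs N. f \<zeta>) = (\<Sum>\<zeta>\<in>configs N - cond N ` S0. f \<zeta>) + (\<Sum>\<zeta>\<in>cond N ` S0. f \<zeta>)"
    by (rule sum.subset_diff) (auto simp: finite_configs cond_configs)
  also have "(\<Sum>\<zeta>\<in>cond N ` S0. f \<zeta>) = (\<Sum>u\<in>S0. f (cond N u))"
    by (rule sum.reindex[unfolded o_def]) (use assms in \<open>auto simp: inj_on_def cond_inj\<close>)
  finally show ?thesis by simp
qed

context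
  fixes d :: real and N :: nat and h :: "('s \<Rightarrow> nat) \<Rightarrow> real" and z :: 's
  assumes d: "0 < d" and N: "2 \<le> N" and z: "z \<in> S0"
    and h01: "\<And>\<zeta>. \<zeta> \<in> configs N \<Longrightarrow> 0 \<le> h \<zeta> \<and> h \<zeta> \<le> 1"
    and h_cond: "\<And>u. u \<in> S0 \<Longrightarrow> h (cond N u) = of_bool (u = z)"
    and h_harmonic: "\<And>\<zeta>. \<zeta> \<in> configs N - cond N ` S0 \<Longrightarrow> inclusion_generator r d h \<zeta> = 0"
begin

lemma ratio_cond: "u \<in> S0 \<Longrightarrow> ratio d N (cond N u) = 1"
  unfolding ratio_def using weight_cond[of u d N] wt_pos[OF d, of N] by simp

lemma ratio_nonneg: "0 \<le> ratio d N \<zeta>"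
  unfolding ratio_def using weight_nonneg[OF d] wt_pos[OF d] by (simp add: less_imp_le)

lemma ratio_symmetric:
  "(\<Sum>\<zeta>\<in>configs N. ratio d N \<zeta> * f \<zeta> * inclusion_generator r d g \<zeta>) =
   (\<Sum>\<zeta>\<in>configs N. ratio d N \<zeta> * g \<zeta> * inclusion_generator r d f \<zeta>)"
  using generator_symmetric[where d = d and N = N and f = f and g = g]
  by (simp add: ratio_def sum_divide_distrib[symmetric])

text \<open>The left-hand term is a jump rate of the trace process; test \<open>h\<close> against the share of particles.\<close>

lemma trace_rate:
  assumes y: "y \<in> S0"
  shows "\<bar>inclusion_generator r d h (cond N y) - d * limit_generator r S0 (indicator {z}) y\<bar> \<le>
    (\<Sum>\<zeta>\<in>configs N - cond N ` S0. ratio d N \<zeta> * \<bar>inclusion_generator r d (share y) \<zeta>\<bar>)"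
proof -
  let ?L = "inclusion_generator r d" and ?\<Delta> = "configs N - cond N ` S0"
  have N0: "0 < N" using N by simp
  have "(\<Sum>\<zeta>\<in>configs N. ratio d N \<zeta> * share y \<zeta> * ?L h \<zeta>) = (\<Sum>u\<in>S0. if u = y then ?L h (cond N u) else 0)"
    unfolding sum_configs_split[OF N0]
  proof -
    have "(\<Sum>\<zeta>\<in>?\<Delta>. ratio d N \<zeta> * share y \<zeta> * ?L h \<zeta>) = 0" using h_harmonic by (intro sum.neutral) auto
    moreover have "(\<Sum>u\<in>S0. ratio d N (cond N u) * share y (cond N u) * ?L h (cond N u)) = (\<Sum>u\<in>S0. if u = y then ?L h (cond N u) else 0)"
      by (rule sum.cong[OF refl]) (simp add: ratio_cond share_cond[OF _ N0])
    ultimately show "(\<Sum>u\<in>S0. ratio d N (cond N u) * share y (cond N u) * ?L h (cond N u)) +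
      (\<Sum>\<zeta>\<in>?\<Delta>. ratio d N \<zeta> * share y \<zeta> * ?L h \<zeta>) = (\<Sum>u\<in>S0. if u = y then ?L h (cond N u) else 0)" by simp
  qed
  also have "\<dots> = ?L h (cond N y)" using y by (simp add: sum.delta)
  finally have 1: "(\<Sum>\<zeta>\<in>configs N. ratio d N \<zeta> * share y \<zeta> * ?L h \<zeta>) = ?L h (cond N y)" .
  have "(\<Sum>u\<in>S0. ratio d N (cond N u) * h (cond N u) * ?L (share y) (cond N u)) =
      (\<Sum>u\<in>S0. if u = z then d * limit_generator r S0 (indicator {y}) u else 0)"
    by (rule sum.cong[OF refl]) (simp add: ratio_cond h_cond generator_share_cond[OF y _ N])
  also have "\<dots> = d * limit_generator r S0 (indicator {y}) z" using z by (simp add: sum.delta)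
  finally have "(\<Sum>\<zeta>\<in>configs N. ratio d N \<zeta> * h \<zeta> * ?L (share y) \<zeta>) =
      d * limit_generator r S0 (indicator {y}) z + (\<Sum>\<zeta>\<in>?\<Delta>. ratio d N \<zeta> * h \<zeta> * ?L (share y) \<zeta>)"
    unfolding sum_configs_split[OF N0] by simp
  then have "?L h (cond N y) - d * limit_generator r S0 (indicator {z}) y = (\<Sum>\<zeta>\<in>?\<Delta>. ratio d N \<zeta> * h \<zeta> * ?L (share y) \<zeta>)"
    using 1 ratio_symmetric[of "share y" h] limit_generator_symmetric[OF y z] by simp
  also have "\<bar>\<dots>\<bar> \<le> (\<Sum>\<zeta>\<in>?\<Delta>. \<bar>ratio d N \<zeta> * h \<zeta> * ?L (share y) \<zeta>\<bar>)" by (rule sum_abs)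
  also have "\<dots> \<le> (\<Sum>\<zeta>\<in>?\<Delta>. ratio d N \<zeta> * \<bar>?L (share y) \<zeta>\<bar>)"
  proof (rule sum_mono)
    fix \<zeta> assume "\<zeta> \<in> ?\<Delta>"
    then have "\<bar>h \<zeta>\<bar> * \<bar>?L (share y) \<zeta>\<bar> \<le> 1 * \<bar>?L (share y) \<zeta>\<bar>" using h01[of \<zeta>] by (intro mult_right_mono) auto
    then have "ratio d N \<zeta> * (\<bar>h \<zeta>\<bar> * \<bar>?L (share y) \<zeta>\<bar>) \<le> ratio d N \<zeta> * (1 * \<bar>?L (share y) \<zeta>\<bar>)"
      using ratio_nonneg by (rule mult_left_mono)
    then show "\<bar>ratio d N \<zeta> * h \<zeta> * ?L (share y) \<zeta>\<bar> \<le> ratio d N \<zeta> * \<bar>?L (share y) \<zeta>\<bar>"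
      using ratio_nonneg[of \<zeta>] by (simp add: abs_mult mult.assoc)
  qed
  finally show ?thesis .
qed

text \<open>Green's identity for \<open>V\<close> and \<open>h\<close>. On one side \<open>h\<close>
  is harmonic off the condensates and \<open>V\<close> vanishes on the target, so only the term at
  \<open>z\<close> is left. On the other side the generator of \<open>V\<close> is -1 at
  \<open>z\<close> and off the condensates, and \<open>h\<close> vanishes on the target.\<close>

lemma mean_hitting_time:
  assumes V: "\<And>u. u \<in> S0 - {z} \<Longrightarrow> V (cond N u) = 0"
    and LV: "\<And>\<zeta>. \<zeta> \<in> configs N - cond N ` (S0 - {z}) \<Longrightarrow> inclusion_generator r d V \<zeta> = - 1"
  shows "V (cond N z) * (- inclusion_generator r d h (cond N z)) =
    1 + (\<Sum>\<zeta>\<in>configs N - cond N ` S0. ratio d N \<zeta> * h \<zeta>)"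
proof -
  let ?L = "inclusion_generator r d" and ?\<Delta> = "configs N - cond N ` S0"
  have N0: "0 < N" using N by simp
  have "(\<Sum>u\<in>S0. ratio d N (cond N u) * V (cond N u) * ?L h (cond N u)) = (\<Sum>u\<in>S0. if u = z then V (cond N u) * ?L h (cond N u) else 0)"
    by (rule sum.cong[OF refl]) (use V in \<open>auto simp: ratio_cond\<close>)
  also have "\<dots> = V (cond N z) * ?L h (cond N z)" using z by (simp add: sum.delta)
  finally have 1: "(\<Sum>\<zeta>\<in>configs N. ratio d N \<zeta> * V \<zeta> * ?L h \<zeta>) = V (cond N z) * ?L h (cond N z)"
    unfolding sum_configs_split[OF N0] using h_harmonic by simp
  have "?L V (cond N z) = - 1"
    by (rule LV) (use N0 in \<open>auto simp: cond_configs cond_inj\<close>)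
  then have "(\<Sum>u\<in>S0. ratio d N (cond N u) * h (cond N u) * ?L V (cond N u)) = (\<Sum>u\<in>S0. if u = z then - 1 else 0)"
    by (intro sum.cong refl) (auto simp: ratio_cond h_cond)
  also have "\<dots> = - 1" using z by (simp add: sum.delta)
  finally have "(\<Sum>\<zeta>\<in>configs N. ratio d N \<zeta> * h \<zeta> * ?L V \<zeta>) = - 1 + (\<Sum>\<zeta>\<in>?\<Delta>. ratio d N \<zeta> * h \<zeta> * ?L V \<zeta>)"
    unfolding sum_configs_split[OF N0] by simp
  also have "(\<Sum>\<zeta>\<in>?\<Delta>. ratio d N \<zeta> * h \<zeta> * ?L V \<zeta>) = (\<Sum>\<zeta>\<in>?\<Delta>. - (ratio d N \<zeta> * h \<zeta>))"
  proof (rule sum.cong[OF refl])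
    fix \<zeta> assume "\<zeta> \<in> ?\<Delta>"
    then have "\<zeta> \<in> configs N - cond N ` (S0 - {z})" by blast
    then show "ratio d N \<zeta> * h \<zeta> * ?L V \<zeta> = - (ratio d N \<zeta> * h \<zeta>)" using LV by simp
  qed
  finally show ?thesis using 1 ratio_symmetric[of h V] by (simp add: sum_negf)
qed

end

section \<open>Asymptotics\<close>

context
  fixes d :: "nat \<Rightarrow> real"
  assumes d_pos: "\<And>N. 1 \<le> N \<Longrightarrow> 0 < d N" and d_log: "(\<lambda>N. d N * ln (real N)) \<longlonglongrightarrow> 0"
begin

private abbreviation \<Theta> where "\<Theta> N \<equiv> 2 * d N * (1 + ln (real N))"

lemma d_tendsto_0: "d \<longlonglongrightarrow> 0"
proof (rule tendsto_sandwich[OF _ _ tendsto_const d_log])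
  show "\<forall>\<^sub>F N in sequentially. 0 \<le> d N"
    using eventually_ge_at_top[of 1] by eventually_elim (use d_pos in \<open>auto intro: less_imp_le\<close>)
  show "\<forall>\<^sub>F N in sequentially. d N \<le> d N * ln (real N)"
    using eventually_ge_at_top[of 3]
  proof eventually_elim
    case (elim N)
    have "exp 1 \<le> real N" using exp_le elim by linarith
    then have "1 \<le> ln (real N)" by (subst ln_ge_iff) (use elim in auto)
    then show ?case using d_pos[of N] elim by simp
  qed
qed

lemma \<Theta>_tendsto_0: "\<Theta> \<longlonglongrightarrow> 0"
proof -
  have "(\<lambda>N. 2 * d N + 2 * (d N * ln (real N))) \<longlonglongrightarrow> 2 * 0 + 2 * 0"
    by (intro tendsto_intros d_tendsto_0 d_log)
  moreover have "(\<lambda>N. 2 * d N + 2 * (d N * ln (real N))) = \<Theta>" by (auto simp: algebra_simps)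
  ultimately show ?thesis by simp
qed

lemma eventually_admissible:
  "\<forall>\<^sub>F N in sequentially. 0 < d N \<and> 2 * CARD('s) \<le> N \<and> \<Theta> N \<le> 1 \<and> 1 \<le> N"
proof -
  have "\<forall>\<^sub>F N in sequentially. \<Theta> N < 1" by (rule order_tendstoD(2)[OF \<Theta>_tendsto_0]) simp
  then show ?thesis
    using eventually_ge_at_top[of "2 * CARD('s)"] eventually_ge_at_top[of 1]
    by eventually_elim (use d_pos in auto)
qed

lemma cube_Q: "(\<lambda>N. real N ^ 3 * q ^ (N div CARD('s))) \<longlonglongrightarrow> 0"
  by (rule cube_times_geometric) (use q_bounds in auto)

lemma power_Q: "j \<le> 3 \<Longrightarrow> (\<lambda>N. real N ^ j * q ^ (N div CARD('s))) \<longlonglongrightarrow> 0"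
proof (rule tendsto_sandwich[OF _ _ tendsto_const cube_Q])
  show "\<forall>\<^sub>F N in sequentially. 0 \<le> real N ^ j * q ^ (N div CARD('s))" using q_bounds by simp
  assume j: "j \<le> 3"
  show "\<forall>\<^sub>F N in sequentially. real N ^ j * q ^ (N div CARD('s)) \<le> real N ^ 3 * q ^ (N div CARD('s))"
    using eventually_ge_at_top[of 1]
    by eventually_elim (intro mult_right_mono power_increasing j; use q_bounds in simp)
qed

definition mass :: "nat \<Rightarrow> real" where
  "mass N = (\<Sum>\<zeta>\<in>configs N - cond N ` S0. ratio (d N) N \<zeta>)"

definition err :: "nat \<Rightarrow> 's \<Rightarrow> real" where
  "err N y = (\<Sum>\<zeta>\<in>configs N - cond N ` S0. ratio (d N) N \<zeta> * \<bar>inclusion_generator r (d N) (share y) \<zeta>\<bar>) / d N"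

lemma mass_tendsto_0: "mass \<longlonglongrightarrow> 0"
proof -
  let ?c = "real CARD('s)" and ?Q = "\<lambda>N. q ^ (N div CARD('s))"
  let ?b = "\<lambda>N. ?c * (?c * (2 * ?c * (\<Theta> N * 2 ^ CARD('s))) + 2 * ?c * ?Q N * 2 ^ CARD('s))"
  have "?b \<longlonglongrightarrow> ?c * (?c * (2 * ?c * (0 * 2 ^ CARD('s))) + 2 * ?c * 0 * 2 ^ CARD('s))"
    using power_Q[of 0] by (intro tendsto_add tendsto_mult tendsto_const \<Theta>_tendsto_0) simp_all
  then have b: "?b \<longlonglongrightarrow> 0" by simp
  show ?thesis
  proof (rule tendsto_sandwich[OF _ _ tendsto_const b])
    show "\<forall>\<^sub>F N in sequentially. 0 \<le> mass N" using eventually_admissible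
      by eventually_elim (auto simp: mass_def ratio_def wt_pos weight_nonneg less_imp_le intro!: sum_nonneg divide_nonneg_nonneg)
    show "\<forall>\<^sub>F N in sequentially. mass N \<le> ?b N" using eventually_admissible
      unfolding mass_def by eventually_elim (rule mass_outside_condensates[OF _ _ refl], auto)
  qed
qed

lemma err_tendsto_0: "y \<in> S0 \<Longrightarrow> (\<lambda>N. err N y) \<longlonglongrightarrow> 0"
proof -
  assume y: "y \<in> S0"
  let ?c = "real CARD('s)" and ?Q = "\<lambda>N. q ^ (N div CARD('s))" and ?p = "2 ^ CARD('s) :: real"
  let ?b = "\<lambda>T D Q1 Q3. ?c * (2 * rM * ?c\<^sup>2 * (?c * (2 * ?c * (T * ?p))) +
      3 * rM * ?c\<^sup>2 * (?c * (?c * (2 * ?c * (4 * D / (1 - q) * ?p)))) +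
      rM * ?c * (2 * ?c * ?p) * Q1 + 2 * rM * (?c * (2 * ?c * (4 * ?p))) * Q3)"
  have "(\<lambda>N. ?b (\<Theta> N) (d N) (real N * ?Q N) (real N ^ 3 * ?Q N)) \<longlonglongrightarrow> ?b 0 0 0 0"
    using power_Q[of 1] power_Q[of 3] q_bounds
    by (intro tendsto_add tendsto_mult tendsto_divide tendsto_const \<Theta>_tendsto_0 d_tendsto_0) simp_all
  then have b: "(\<lambda>N. ?b (\<Theta> N) (d N) (real N * ?Q N) (real N ^ 3 * ?Q N)) \<longlonglongrightarrow> 0" by simp
  show ?thesis
  proof (rule tendsto_sandwich[OF _ _ tendsto_const b])
    show "\<forall>\<^sub>F N in sequentially. 0 \<le> err N y" using eventually_admissible
      by eventually_elim (auto simp: err_def ratio_def wt_pos weight_nonneg less_imp_le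
          intro!: sum_nonneg divide_nonneg_nonneg mult_nonneg_nonneg)
    show "\<forall>\<^sub>F N in sequentially. err N y \<le> ?b (\<Theta> N) (d N) (real N * ?Q N) (real N ^ 3 * ?Q N)"
      using eventually_admissible
      unfolding err_def by eventually_elim (rule generator_outside_condensates[OF _ _ refl _ y], auto)
  qed
qed

end

end

section \<open>Change of the time scale\<close>

lemma occupation_time_scale:
  assumes "0 < d"
  shows "occupation_time A (\<lambda>s. w (s / d)) t = d * occupation_time A w (t / d)"
proof -
  let ?f = "\<lambda>s. indicator {0..t} s *\<^sub>R (indicator A (w (s / d)) :: real)"
  have "(LINT s|lborel. ?f s) = \<bar>d\<bar> *\<^sub>R (LINT s|lborel. ?f (0 + d * s))"
    by (rule lborel_integral_real_affine) (use assms in simp)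
  also have "(\<lambda>s. ?f (0 + d * s)) = (\<lambda>s. indicator {0..t / d} s *\<^sub>R indicator A (w s))"
    using assms by (auto simp: indicator_def field_simps zero_le_mult_iff)
  finally show ?thesis using assms unfolding occupation_time_def set_lebesgue_integral_def by simp
qed

text \<open>The local clock is rescaled together with the time, so accelerating the process and
  taking the trace commute. This requires infinite occupation time, where the supremum in the trace
  is meaningful.\<close>

lemma trace_path_scale:
  assumes d: "0 < d" and w: "cadlag E w" and w': "cadlag E (\<lambda>s. w (s / d))" and t: "0 \<le> t"
    and unb: "\<And>K. \<exists>s\<ge>0. K < occupation_time A (\<lambda>s. w (s / d)) s"
  shows "trace_path A (\<lambda>s. w (s / d)) t = trace_path A w (t / d)"
proof -
  let ?s = "Sup {s. 0 \<le> s \<and> occupation_time A (\<lambda>s. w (s / d)) s \<le> t}"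
  note s = inverse_occupation[OF w' unb t]
  have "d * occupation_time A w (?s / d) = t" using s(2) unfolding occupation_time_scale[OF d] .
  then have "occupation_time A w (?s / d) = t / d" using d by (simp add: field_simps)
  moreover have "trace_path A w (occupation_time A w (?s / d)) = w (?s / d)"
    by (rule trace_path_occupation[OF w]) (use s d in auto)
  ultimately show ?thesis unfolding trace_path_def[of A "\<lambda>s. w (s / d)"] by simp
qed

text \<open>Functions that agree almost everywhere are measurable for the completion together; if
  neither is measurable, both integrals are 0 by convention.\<close>

lemma integral_completion_cong_AE:
  fixes f g :: "'a \<Rightarrow> real"
  assumes eq: "AE x in M. f x = g x"
  shows "(\<integral>x. f x \<partial>completion M) = (\<integral>x. g x \<partial>completion M)"
proof -
  have m: "g \<in> borel_measurable (completion M)" if mf: "f \<in> borel_measurable (completion M)" and fg: "AE x in M. f x = g x" for f g :: "'a \<Rightarrow> real"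
  proof -
    obtain f' where f': "f' \<in> borel_measurable M" "AE x in M. f x = f' x"
      using completion_ex_borel_measurable_real[OF mf] by blast
    have "AE x in M. g x = f' x" using fg f'(2) by eventually_elim simp
    then show ?thesis by (rule measurable_completion_AE_eq[OF f'(1)])
  qed
  have eq': "AE x in M. g x = f x" using eq by eventually_elim simp
  show ?thesis
  proof (cases "f \<in> borel_measurable (completion M)")
    case True
    show ?thesis by (rule integral_cong_AE[OF True m[OF True eq] AE_completion[OF eq]])
  next
    case False
    then have "g \<notin> borel_measurable (completion M)" using m[OF _ eq'] by blast
    then have "\<not> integrable (completion M) f" "\<not> integrable (completion M) g"
      using False borel_measurable_integrable by blast+
    then show ?thesis by (simp add: not_integrable_integral_eq)
  qed
qed

lemma weakly_converges_cong_AE: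
  assumes conv: "weakly_converges T P Y Q Z"
    and eq: "\<forall>\<^sub>F n in sequentially. AE \<omega> in P n. Y n \<omega> = Y' n \<omega>"
  shows "weakly_converges T P Y' Q Z"
  unfolding weakly_converges_def
proof (intro conjI allI impI)
  have "\<forall>\<^sub>F n in sequentially. AE \<omega> in P n. Y n \<omega> \<in> topspace T" using conv by (simp add: weakly_converges_def)
  then show "\<forall>\<^sub>F n in sequentially. AE \<omega> in P n. Y' n \<omega> \<in> topspace T"
    using eq
  proof eventually_elim
    case (elim n)
    show ?case using elim by eventually_elim simp
  qed
  show "AE \<omega> in Q. Z \<omega> \<in> topspace T" using conv by (simp add: weakly_converges_def)
  fix f assume "continuous_map T euclideanreal f \<and> bounded (f ` topspace T)"
  then have lim: "(\<lambda>n. \<integral>\<omega>. f (Y n \<omega>) \<partial>completion (P n)) \<longlonglongrightarrow> (\<integral>\<omega>. f (Z \<omega>) \<partial>completion Q)"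
    using conv by (simp add: weakly_converges_def)
  have "\<forall>\<^sub>F n in sequentially. (\<integral>\<omega>. f (Y n \<omega>) \<partial>completion (P n)) = (\<integral>\<omega>. f (Y' n \<omega>) \<partial>completion (P n))"
    using eq
  proof eventually_elim
    case (elim n)
    have "AE \<omega> in P n. f (Y n \<omega>) = f (Y' n \<omega>)" using elim by eventually_elim simp
    then show ?case by (rule integral_completion_cong_AE)
  qed
  from Lim_transform_eventually[OF lim this]
  show "(\<lambda>n. \<integral>\<omega>. f (Y' n \<omega>) \<partial>completion (P n)) \<longlonglongrightarrow> (\<integral>\<omega>. f (Z \<omega>) \<partial>completion Q)" .
qed

lemma markov_two_times:
  assumes X: "markov_process E L P X" and st: "0 \<le> s" "s \<le> t" and ab: "a \<in> E" "b \<in> E"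
  shows "measure P {\<omega>\<in>space P. X s \<omega> = a \<and> X t \<omega> = b} =
    measure P {\<omega>\<in>space P. X s \<omega> = a} * semigroup_of L (t - s) (indicator {b}) a"
proof -
  have M: "\<forall>n t a. 0 \<le> t 0 \<and> mono_on {..Suc n} t \<and> (\<forall>k\<le>Suc n. a k \<in> E) \<longrightarrow>
        measure P {\<omega>\<in>space P. \<forall>k\<le>Suc n. X (t k) \<omega> = a k} =
        measure P {\<omega>\<in>space P. \<forall>k\<le>n. X (t k) \<omega> = a k} *
          semigroup_of L (t (Suc n) - t n) (indicator {a (Suc n)}) (a n)"
    using X unfolding markov_process_def by (elim conjE)
  have "mono_on {..Suc 0} (\<lambda>k. if k = 0 then s else t)" by (rule mono_onI) (use st in auto)
  then show ?thesis
    using M[rule_format, of "\<lambda>k. if k = 0 then s else t" 0 "\<lambda>k. if k = 0 then a else b"] st ab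
    by (simp add: le_Suc_eq all_conj_distrib conj_commute)
qed

section \<open>The three limits\<close>

locale inclusion_process = reversible_walk r m
  for r :: "'s::finite \<Rightarrow> 's \<Rightarrow> real" and m :: "'s pmf" +
  fixes d :: "nat \<Rightarrow> real" and P :: "nat \<Rightarrow> 'w measure" and \<eta> :: "nat \<Rightarrow> real \<Rightarrow> 'w \<Rightarrow> 's \<Rightarrow> nat" and x :: 's
  assumes d_pos: "1 \<le> N \<Longrightarrow> 0 < d N"
    and d_log: "(\<lambda>N. d N * ln (real N)) \<longlonglongrightarrow> 0"
    and process: "1 \<le> N \<Longrightarrow> markov_process (configs N) (inclusion_generator r (d N)) (P N) (\<eta> N)"
    and x_in: "x \<in> S0"
begin

abbreviation L where "L N \<equiv> inclusion_generator r (d N)"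

abbreviation outside where "outside N \<equiv> configs N - cond N ` S0"

lemma scaled_process:
  assumes N: "1 \<le> N" and s: "0 < s"
  shows "\<exists>C. jump_process (P N) (configs N) (\<lambda>t. \<eta> N (t / s))
    (\<lambda>m a b. semigroup_of (L N) (1 / (m * s)) (indicator {b}) a) (\<lambda>a b. L N (indicator {b}) a / s) C"
proof -
  interpret jump_generator "configs N" UNIV "\<lambda>(x, y) \<zeta>. real (\<zeta> x) * (d N + real (\<zeta> y)) * r x y"
    "\<lambda>(x, y). move x y" "L N" by (rule jump_generator_inclusion[OF less_imp_le[OF d_pos[OF N]]])
  show ?thesis using jump_process_of_markov_process[OF process[OF N] s] by blast
qed

lemma gen_scaled:
  assumes "jump_process (P N) (configs N) Y p (\<lambda>a b. L N (indicator {b}) a / s) C"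
    and N: "1 \<le> N" and a: "a \<in> configs N"
  shows "jump_process.gen (configs N) (\<lambda>a b. L N (indicator {b}) a / s) f a = L N f a / s"
proof -
  interpret jump_generator "configs N" UNIV "\<lambda>(x, y) \<zeta>. real (\<zeta> x) * (d N + real (\<zeta> y)) * r x y"
    "\<lambda>(x, y). move x y" "L N" by (rule jump_generator_inclusion[OF less_imp_le[OF d_pos[OF N]]])
  show ?thesis unfolding jump_process.gen_def[OF assms(1)] L_expand[OF a, of f]
    by (simp add: sum_divide_distrib)
qed

lemma start_cond:
  assumes "AE \<omega> in P N. \<eta> N 0 \<omega> \<in> condensate N x"
  shows "AE \<omega> in P N. \<eta> N 0 \<omega> = cond N x"
  using assms by (simp add: condensate_eq)

lemma mass_eq: "mass d N = (\<Sum>\<zeta>\<in>outside N. ratio (d N) N \<zeta>)"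
  by (rule mass_def[OF d_pos d_log])

lemma err_eq: "err d N y = (\<Sum>\<zeta>\<in>outside N. ratio (d N) N \<zeta> * \<bar>L N (share y) \<zeta>\<bar>) / d N"
  by (rule err_def[OF d_pos d_log])

lemma limit_rate_self: "limit_generator r S0 (indicator {x}) x = - (\<Sum>y\<in>S0 - {x}. r x y)"
proof -
  have "limit_generator r S0 (indicator {x}) x = (\<Sum>u\<in>S0. if u = x then 0 else - r x u)"
    unfolding limit_generator_def by (rule sum.cong) auto
  also have "\<dots> = (\<Sum>u\<in>S0 - {x}. if u = x then 0 else - r x u)"
    by (rule sum.mono_neutral_right) auto
  also have "\<dots> = (\<Sum>u\<in>S0 - {x}. - r x u)" by (rule sum.cong) auto
  finally show ?thesis by (simp add: sum_negf)
qed

lemma harmonic_cond: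
  assumes N: "1 \<le> N"
  shows "\<exists>h. (\<forall>\<zeta>\<in>configs N. 0 \<le> h \<zeta> \<and> h \<zeta> \<le> 1) \<and> (\<forall>u\<in>S0. h (cond N u) = of_bool (u = z)) \<and>
    (\<forall>\<zeta>\<in>outside N. L N h \<zeta> = 0)"
  using harmonic_exists[OF d_pos[OF N], of N z] N by (simp add: cond_inj)

text \<open>\<open>a\<close> is the rate at which the trace leaves \<open>x\<close>, divided by
  \<open>d N\<close>, and \<open>b\<close> is the weighted sum of the harmonic function, including
  its value 1 at \<open>x\<close>. Green's identity expresses the scaled mean hitting time as
  \<open>b / a\<close>.\<close>

lemma scaled_hitting_time:
  assumes start: "AE \<omega> in P N. \<eta> N 0 \<omega> \<in> condensate N x" and N: "2 \<le> N" and other: "S0 - {x} \<noteq> {}"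
  shows "\<exists>a b. 0 < a \<and> \<bar>a - (\<Sum>y\<in>S0 - {x}. r x y)\<bar> \<le> err d N x \<and> 1 \<le> b \<and> b \<le> 1 + mass d N \<and>
    ennreal (d N) * (\<integral>\<^sup>+\<omega>. hitting_time (condensates N (S0 - {x})) (\<lambda>t. \<eta> N t \<omega>) \<partial>P N) = ennreal (b / a)"
proof -
  have N1: "1 \<le> N" and N0: "0 < N" using N by auto
  note dN = d_pos[OF N1]
  interpret G: jump_generator "configs N" UNIV "\<lambda>(x, y) \<zeta>. real (\<zeta> x) * (d N + real (\<zeta> y)) * r x y"
    "\<lambda>(x, y). move x y" "L N" by (rule jump_generator_inclusion[OF less_imp_le[OF dN]])
  let ?B = "cond N ` (S0 - {x})"
  obtain y0 where y0: "y0 \<in> S0 - {x}" using other by blast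
  obtain w where w: "\<And>\<zeta>. \<zeta> \<in> configs N \<Longrightarrow> 0 \<le> w \<zeta>" "\<And>\<zeta>. \<zeta> \<in> configs N - {cond N y0} \<Longrightarrow> L N w \<zeta> \<le> - 1"
    using lyapunov_condensate[OF dN, of N y0] by blast
  \<comment> \<open>Any single condensate of the target will do: a Lyapunov function for reaching it
    is a supersolution for reaching the target.\<close>
  have w2: "L N w \<zeta> \<le> - 1" if "\<zeta> \<in> configs N - ?B" for \<zeta> by (rule w(2)) (use that y0 in blast)
  have "\<exists>U. (\<forall>a\<in>configs N. 0 \<le> U a \<and> U a \<le> w a) \<and> (\<forall>a\<in>configs N \<inter> ?B. U a = 0) \<and> (\<forall>a\<in>configs N - ?B. L N U a = - 1)"
    by (rule G.dirichlet_solution[where h = "\<lambda>_. 0"]) (use w(1) w2 in auto)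
  then obtain V where V: "\<And>\<zeta>. \<zeta> \<in> configs N \<Longrightarrow> 0 \<le> V \<zeta>" "\<And>\<zeta>. \<zeta> \<in> configs N \<Longrightarrow> \<zeta> \<in> ?B \<Longrightarrow> V \<zeta> = 0"
    "\<And>\<zeta>. \<zeta> \<in> configs N - ?B \<Longrightarrow> L N V \<zeta> = - 1" by blast
  obtain h where h: "\<And>\<zeta>. \<zeta> \<in> configs N \<Longrightarrow> 0 \<le> h \<zeta> \<and> h \<zeta> \<le> 1" "\<And>u. u \<in> S0 \<Longrightarrow> h (cond N u) = of_bool (u = x)"
    "\<And>\<zeta>. \<zeta> \<in> outside N \<Longrightarrow> L N h \<zeta> = 0" using harmonic_cond[OF N1, of x] by blast
  obtain C where proc: "jump_process (P N) (configs N) (\<lambda>t. \<eta> N (t / 1))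
      (\<lambda>m a b. semigroup_of (L N) (1 / (m * 1)) (indicator {b}) a) (\<lambda>a b. L N (indicator {b}) a / 1) C"
    using scaled_process[OF N1, of 1] by auto
  have E: "(\<integral>\<^sup>+\<omega>. hitting_time ?B (\<lambda>t. \<eta> N (t / 1) \<omega>) \<partial>P N) = ennreal (V (cond N x))"
  proof (rule jump_process.expected_hitting_time[OF proc])
    show "0 \<le> V a" if "a \<in> configs N" for a by (rule V(1)[OF that])
    show "V a = 0" if "a \<in> configs N" "a \<in> ?B" for a by (rule V(2)[OF that])
    show "jump_process.gen (configs N) (\<lambda>a b. L N (indicator {b}) a / 1) V a = - 1" if "a \<in> configs N - ?B" for a
      using gen_scaled[OF proc N1, of a V] V(3)[OF that] that by simp
    show "AE \<omega> in P N. \<eta> N (0 / 1) \<omega> = cond N x" using start_cond[OF start] by simp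
  qed
  define a where "a = - L N h (cond N x) / d N"
  define b where "b = 1 + (\<Sum>\<zeta>\<in>outside N. ratio (d N) N \<zeta> * h \<zeta>)"
  have Vb: "V (cond N x) * (- L N h (cond N x)) = b" unfolding b_def
    by (rule mean_hitting_time[OF dN N x_in h(1) h(2) h(3)]) (use V(2,3) cond_configs in auto)
  have b1: "1 \<le> b" unfolding b_def using ratio_nonneg[OF dN N x_in h(1) h(2) h(3)] h(1)
    by (auto intro!: sum_nonneg mult_nonneg_nonneg)
  have "(\<Sum>\<zeta>\<in>outside N. ratio (d N) N \<zeta> * h \<zeta>) \<le> (\<Sum>\<zeta>\<in>outside N. ratio (d N) N \<zeta> * 1)"
    using ratio_nonneg[OF dN N x_in h(1) h(2) h(3)] h(1) by (intro sum_mono mult_left_mono) auto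
  then have b2: "b \<le> 1 + mass d N" unfolding b_def mass_eq by simp
  have V0: "0 \<le> V (cond N x)" by (rule V(1)[OF cond_configs])
  \<comment> \<open>The exit rate is positive because its product with the mean hitting time is at
    least 1.\<close>
  have pos: "0 < V (cond N x) * (- L N h (cond N x))" using Vb b1 by simp
  then have V0': "0 < V (cond N x)" using V0 by (cases "V (cond N x) = 0") auto
  have Lh: "0 < - L N h (cond N x)" by (rule zero_less_mult_pos[OF pos V0'])
  then have a0: "0 < a" unfolding a_def using dN by (intro divide_pos_pos)
  have "\<bar>L N h (cond N x) - d N * limit_generator r S0 (indicator {x}) x\<bar> / d N \<le> err d N x"
    unfolding err_eq
    by (rule divide_right_mono[OF trace_rate[OF dN N x_in h(1) h(2) h(3) x_in]]) (use dN in simp_all)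
  also have "\<bar>L N h (cond N x) - d N * limit_generator r S0 (indicator {x}) x\<bar> / d N =
      \<bar>(L N h (cond N x) - d N * limit_generator r S0 (indicator {x}) x) / d N\<bar>" using dN by simp
  also have "(L N h (cond N x) - d N * limit_generator r S0 (indicator {x}) x) / d N = - (a - (\<Sum>y\<in>S0 - {x}. r x y))"
    unfolding limit_rate_self a_def using dN by (simp add: field_simps)
  finally have a_err: "\<bar>a - (\<Sum>y\<in>S0 - {x}. r x y)\<bar> \<le> err d N x" by (simp only: abs_minus_cancel)
  have "d N * V (cond N x) = b / a" unfolding Vb[symmetric] a_def using dN Lh by (simp add: field_simps)
  then have "ennreal (d N) * (\<integral>\<^sup>+\<omega>. hitting_time (condensates N (S0 - {x})) (\<lambda>t. \<eta> N t \<omega>) \<partial>P N) = ennreal (b / a)"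
    using E dN V0 by (simp add: condensates_eq ennreal_mult[symmetric])
  then show ?thesis using a0 a_err b1 b2 by blast
qed

theorem expected_hitting_time_limit:
  assumes start: "\<And>N. 1 \<le> N \<Longrightarrow> AE \<omega> in P N. \<eta> N 0 \<omega> \<in> condensate N x"
  shows "(\<lambda>N. ennreal (d N) * (\<integral>\<^sup>+\<omega>. hitting_time (condensates N (S0 - {x})) (\<lambda>t. \<eta> N t \<omega>) \<partial>P N))
    \<longlonglongrightarrow> 1 / ennreal (\<Sum>y\<in>S0 - {x}. r x y)" (is "?E \<longlonglongrightarrow> 1 / ennreal ?s")
proof (cases "S0 - {x} = {}")
  \<comment> \<open>The target is empty: the hitting time is an infimum over the empty set and the
    limit is \<open>1 / 0\<close>, both infinite.\<close>
  case True
  have "?E N = top" if N: "1 \<le> N" for N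
  proof -
    interpret prob_space "P N" using process[OF N] by (simp add: markov_process_def)
    show ?thesis unfolding True using d_pos[OF N]
      by (simp add: hitting_time_def condensates_def emeasure_space_1 ennreal_mult_top)
  qed
  then have "\<forall>\<^sub>F N in sequentially. ?E N = top" by (intro eventually_sequentiallyI[of 1])
  moreover have "1 / ennreal ?s = top" unfolding True by simp
  ultimately show ?thesis by (simp add: tendsto_eventually)
next
  case False
  have s0: "0 \<le> ?s" by (intro sum_nonneg rates_nonneg)
  have "\<forall>N. \<exists>a b. 2 \<le> N \<longrightarrow> 0 < a \<and> \<bar>a - ?s\<bar> \<le> err d N x \<and> 1 \<le> b \<and> b \<le> 1 + mass d N \<and> ?E N = ennreal (b / a)"
    using scaled_hitting_time[OF start _ False] by (meson le_trans one_le_numeral)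
  then obtain a b where ab: "\<And>N. 2 \<le> N \<Longrightarrow> 0 < a N \<and> \<bar>a N - ?s\<bar> \<le> err d N x \<and> 1 \<le> b N \<and> b N \<le> 1 + mass d N \<and> ?E N = ennreal (b N / a N)"
    by metis
  have ev: "\<forall>\<^sub>F N in sequentially. 0 < a N \<and> \<bar>a N - ?s\<bar> \<le> err d N x \<and> 1 \<le> b N \<and> b N \<le> 1 + mass d N \<and> ?E N = ennreal (b N / a N)"
    using eventually_ge_at_top[of 2] by eventually_elim (rule ab)
  have "(\<lambda>N. a N - ?s) \<longlonglongrightarrow> 0"
    by (rule Lim_null_comparison[OF _ err_tendsto_0[OF d_pos d_log x_in]]) (use ev in eventually_elim, auto)
  then have a: "a \<longlonglongrightarrow> ?s" by (rule LIM_zero_cancel)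
  have "(\<lambda>N. 1 + mass d N) \<longlonglongrightarrow> 1 + 0" by (intro tendsto_intros mass_tendsto_0[OF d_pos d_log])
  then have m: "(\<lambda>N. 1 + mass d N) \<longlonglongrightarrow> 1" by simp
  have b: "b \<longlonglongrightarrow> 1"
    by (rule tendsto_sandwich[OF _ _ tendsto_const m]) (use ev in eventually_elim, auto)+
  have "(\<lambda>N. ennreal (b N / a N)) \<longlonglongrightarrow> 1 / ennreal ?s"
  proof (cases "?s = 0")
    case True
    \<comment> \<open>Other sites of \<open>S0\<close> exist, but none is reached from
      \<open>x\<close> in one jump of the walk. The exit rate, still positive, is then of smaller
      order than \<open>d N\<close>, and the quotient diverges in accordance with
      \<open>1 / 0\<close>.\<close>
    have "filterlim (\<lambda>N. inverse (a N)) at_top sequentially"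
      by (rule filterlim_inverse_at_top) (use a True ev in \<open>auto elim: eventually_mono\<close>)
    from filterlim_tendsto_pos_mult_at_top[OF b _ this]
    have "filterlim (\<lambda>N. b N / a N) at_top sequentially" by (simp add: divide_inverse)
    then show ?thesis using True by (simp add: ennreal_tendsto_top_eq_at_top)
  next
    case False
    then have s: "0 < ?s" using s0 by simp
    have "(\<lambda>N. ennreal (b N / a N)) \<longlonglongrightarrow> ennreal (1 / ?s)"
      by (intro tendsto_ennrealI tendsto_divide a b) (use s in simp)
    then show ?thesis using divide_ennreal[of 1 ?s] s by simp
  qed
  moreover have "\<forall>\<^sub>F N in sequentially. ennreal (b N / a N) = ?E N" using ev by eventually_elim simp
  ultimately show ?thesis by (rule Lim_transform_eventually)
qed

end

section \<open>Time outside the condensates and weak convergence of the trace\<close>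

context inclusion_process
begin

text \<open>The process returns to the condensate with probability at most one, and detailed balance
  compares this with the way to \<open>\<zeta>\<close>.\<close>

lemma prob_config_le:
  assumes start: "AE \<omega> in P N. \<eta> N 0 \<omega> \<in> condensate N x" and N: "1 \<le> N" and t: "0 \<le> t" and \<zeta>: "\<zeta> \<in> configs N"
  shows "measure (P N) {\<omega>\<in>space (P N). \<eta> N t \<omega> = \<zeta>} \<le> ratio (d N) N \<zeta>"
proof -
  let ?sg = "semigroup_of (L N)" and ?c = "cond N x" and ?p = "measure (P N) {\<omega>\<in>space (P N). \<eta> N t \<omega> = \<zeta>}"
  note dN = d_pos[OF N]
  obtain C where "jump_process (P N) (configs N) (\<lambda>t. \<eta> N (t / 1))
      (\<lambda>m a b. semigroup_of (L N) (1 / (m * 1)) (indicator {b}) a) (\<lambda>a b. L N (indicator {b}) a / 1) C"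
    using scaled_process[OF N, of 1] by auto
  then interpret Y: jump_process "P N" "configs N" "\<lambda>t. \<eta> N (t / 1)"
      "\<lambda>m a b. semigroup_of (L N) (1 / (m * 1)) (indicator {b}) a" "\<lambda>a b. L N (indicator {b}) a / 1" C .
  have ev: "{\<omega>\<in>space (P N). \<eta> N t \<omega> = a} \<in> sets (P N)" if "0 \<le> t" for t a using Y.Y_event[OF that, of a] by simp
  have c: "?c \<in> configs N" by (rule cond_configs)
  have st: "AE \<omega> in P N. \<eta> N 0 \<omega> = ?c" by (rule start_cond[OF start])
  have "Y.prob {\<omega>\<in>space (P N). \<eta> N 0 \<omega> = ?c} = 1"
    using st ev[of 0 ?c] by (subst Y.prob_eq_1) auto
  then have "measure (P N) {\<omega>\<in>space (P N). \<eta> N 0 \<omega> = ?c \<and> \<eta> N t \<omega> = \<zeta>} = ?sg t (indicator {\<zeta>}) ?c"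
    using markov_two_times[OF process[OF N] order_refl t c \<zeta>] by simp
  moreover have "measure (P N) {\<omega>\<in>space (P N). \<eta> N 0 \<omega> = ?c \<and> \<eta> N t \<omega> = \<zeta>} = ?p"
  proof (rule Y.finite_measure_eq_AE)
    show "AE \<omega> in P N. (\<omega> \<in> {\<omega>\<in>space (P N). \<eta> N 0 \<omega> = ?c \<and> \<eta> N t \<omega> = \<zeta>}) = (\<omega> \<in> {\<omega>\<in>space (P N). \<eta> N t \<omega> = \<zeta>})"
      using st by eventually_elim auto
    have "{\<omega>\<in>space (P N). \<eta> N 0 \<omega> = ?c \<and> \<eta> N t \<omega> = \<zeta>} = {\<omega>\<in>space (P N). \<eta> N 0 \<omega> = ?c} \<inter> {\<omega>\<in>space (P N). \<eta> N t \<omega> = \<zeta>}" by auto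
    then show "{\<omega>\<in>space (P N). \<eta> N 0 \<omega> = ?c \<and> \<eta> N t \<omega> = \<zeta>} \<in> sets (P N)" using ev[of 0] ev[OF t] by auto
  qed (rule ev[OF t])
  ultimately have p: "?p = ?sg t (indicator {\<zeta>}) ?c" by simp
  show ?thesis
  proof (cases "?p = 0")
    case True
    then show ?thesis using weight_nonneg[OF dN] wt_pos[OF dN] by (simp add: ratio_def less_imp_le)
  next
    case False
    then have p0: "0 < ?p" by (simp add: less_le)
    \<comment> \<open>That the semigroup value on the way back is at most 1 is read off from the
      Markov property at the times \<open>t\<close> and \<open>2 * t\<close>. This needs
      \<open>?p\<close> positive; for \<open>?p = 0\<close> the claim is trivial.\<close>
    have "?p * ?sg t (indicator {?c}) \<zeta> = measure (P N) {\<omega>\<in>space (P N). \<eta> N t \<omega> = \<zeta> \<and> \<eta> N (2 * t) \<omega> = ?c}"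
      using markov_two_times[OF process[OF N] t, of "2 * t", OF _ \<zeta> c] t by simp
    also have "\<dots> \<le> ?p * 1" using ev[OF t] by (auto intro!: Y.finite_measure_mono)
    finally have "?sg t (indicator {?c}) \<zeta> \<le> 1" using p0 by simp
    then have "weight (d N) \<zeta> * ?sg t (indicator {?c}) \<zeta> \<le> weight (d N) \<zeta> * 1"
      by (rule mult_left_mono) (rule weight_nonneg[OF dN])
    moreover have "wt (d N) N * ?p = weight (d N) \<zeta> * ?sg t (indicator {?c}) \<zeta>"
      unfolding p weight_cond[OF x_in, of "d N" N, symmetric]
      by (rule semigroup_symmetric[OF less_imp_le[OF dN] t c \<zeta>])
    ultimately show ?thesis unfolding ratio_def using wt_pos[OF dN, of N] by (simp add: field_simps)
  qed
qed

lemma visits_nn_integral: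
  assumes "cadlag E w" "0 \<le> T"
  shows "(\<integral>\<^sup>+s. indicator {0..T} s * indicator A (w s) \<partial>lborel) = ennreal (occupation_time A w T)"
proof -
  have i: "integrable lborel (\<lambda>s. indicator {0..T} s *\<^sub>R (indicator A (w s) :: real))"
    using set_integrable_visits[OF assms(1), of 0 T A] by (simp add: set_integrable_def)
  have "(\<integral>\<^sup>+s. indicator {0..T} s * indicator A (w s) \<partial>lborel) =
      (\<integral>\<^sup>+s. ennreal (indicator {0..T} s *\<^sub>R (indicator A (w s) :: real)) \<partial>lborel)"
    by (rule nn_integral_cong) (auto simp: indicator_def)
  also have "\<dots> = ennreal (occupation_time A w T)"
    unfolding occupation_time_def set_lebesgue_integral_def by (rule nn_integral_eq_integral[OF i]) simp
  finally show ?thesis .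
qed

text \<open>The probability of being outside is at most \<open>mass d N\<close> at every time, so
  the acceleration by \<open>1 / d N\<close> does no harm. An integer \<open>M\<close> above
  \<open>T\<close> is used because the occupation time is estimated at integer times.\<close>

theorem time_outside_limit:
  assumes start: "\<And>N. 1 \<le> N \<Longrightarrow> AE \<omega> in P N. \<eta> N 0 \<omega> \<in> condensate N x" and T: "0 < T"
  shows "(\<lambda>N. \<integral>\<^sup>+\<omega>. (\<integral>\<^sup>+s. indicator {0..T} s *
      indicator (configs N - condensates N S0) (\<eta> N (s / d N) \<omega>) \<partial>lborel) \<partial>P N) \<longlonglongrightarrow> 0" (is "?I \<longlonglongrightarrow> 0")
proof -
  obtain M where M: "T \<le> real M" using real_arch_simple by blast
  have bound: "?I N \<le> ennreal (real M * mass d N)" if N: "1 \<le> N" for N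
  proof -
    obtain C where "jump_process (P N) (configs N) (\<lambda>t. \<eta> N (t / d N))
        (\<lambda>m a b. semigroup_of (L N) (1 / (m * d N)) (indicator {b}) a) (\<lambda>a b. L N (indicator {b}) a / d N) C"
      using scaled_process[OF N d_pos[OF N]] by blast
    then interpret Y: jump_process "P N" "configs N" "\<lambda>t. \<eta> N (t / d N)"
        "\<lambda>m a b. semigroup_of (L N) (1 / (m * d N)) (indicator {b}) a" "\<lambda>a b. L N (indicator {b}) a / d N" C .
    let ?o = "\<lambda>\<omega>. occupation_time (outside N) (\<lambda>s. \<eta> N (s / d N) \<omega>) (real M)"
    have o: "0 \<le> ?o \<omega>" "?o \<omega> \<le> real M" if "\<omega> \<in> space (P N)" for \<omega>
      using occupation_time_nonneg[OF Y.cadlag_Y[OF that], of "real M" "outside N"]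
        occupation_time_bounds(2)[OF Y.cadlag_Y[OF that], of 0 "real M" "outside N"]
      by (simp_all add: occupation_time_0[OF Y.cadlag_Y[OF that]])
    have int: "integrable (P N) ?o"
      by (rule Y.integrable_const_bound[where B = "real M"]) (use o in \<open>auto intro!: AE_I2 Y.occupation_time_measurable\<close>)
    have rare: "Y.prob {\<omega>\<in>space (P N). \<eta> N (t / d N) \<omega> \<in> outside N} \<le> mass d N" if t: "0 \<le> t" for t
    proof -
      have "{\<omega>\<in>space (P N). \<eta> N (t / d N) \<omega> \<in> outside N} = (\<Union>\<zeta>\<in>outside N. {\<omega>\<in>space (P N). \<eta> N (t / d N) \<omega> = \<zeta>})" by auto
      also have "Y.prob \<dots> \<le> (\<Sum>\<zeta>\<in>outside N. Y.prob {\<omega>\<in>space (P N). \<eta> N (t / d N) \<omega> = \<zeta>})"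
        by (rule Y.finite_measure_subadditive_finite) (use finite_configs Y.Y_event[OF t] in auto)
      also have "\<dots> \<le> mass d N" unfolding mass_eq
        by (rule sum_mono) (use prob_config_le[OF start[OF N] N, of "t / d N"] t d_pos[OF N] in auto)
      finally show ?thesis .
    qed
    have "?I N \<le> (\<integral>\<^sup>+\<omega>. ennreal (?o \<omega>) \<partial>P N)"
    proof (rule nn_integral_mono)
      fix \<omega> assume \<omega>: "\<omega> \<in> space (P N)"
      show "(\<integral>\<^sup>+s. indicator {0..T} s * indicator (configs N - condensates N S0) (\<eta> N (s / d N) \<omega>) \<partial>lborel) \<le> ennreal (?o \<omega>)"
        unfolding condensates_eq visits_nn_integral[OF Y.cadlag_Y[OF \<omega>] less_imp_le[OF T]]
        using occupation_time_bounds(1)[OF Y.cadlag_Y[OF \<omega>], of T "real M" "outside N"] T M by (simp add: ennreal_leI)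
    qed
    also have "\<dots> = ennreal (Y.expectation ?o)" by (rule nn_integral_eq_integral[OF int]) (use o in auto)
    also have "\<dots> \<le> ennreal (real M * mass d N)" by (intro ennreal_leI Y.expected_occupation_time_le rare)
    finally show ?thesis .
  qed
  have "(\<lambda>N. ennreal (real M * mass d N)) \<longlonglongrightarrow> ennreal (real M * 0)"
    by (intro tendsto_intros mass_tendsto_0[OF d_pos d_log])
  then have lim: "(\<lambda>N. ennreal (real M * mass d N)) \<longlonglongrightarrow> 0" by simp
  show ?thesis
    by (rule tendsto_sandwich[OF _ _ tendsto_const lim]) (auto intro!: eventually_sequentiallyI[of 1] bound)
qed

lemma condensate_site_cond: "0 < N \<Longrightarrow> y \<in> S0 \<Longrightarrow> condensate_site m N (cond N y) = y"
  unfolding condensate_site_def condensate_eq by (rule the_equality) (auto simp: cond_inj)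

theorem trace_limit:
  assumes start: "\<And>N. 1 \<le> N \<Longrightarrow> AE \<omega> in P N. condensate_path m N (\<lambda>t. \<eta> N t \<omega>) 0 = x"
    and limit_process: "markov_process S0 (limit_generator r S0) Q X" and limit_start: "AE \<omega> in Q. X 0 \<omega> = x"
  shows "weakly_converges (skorokhod_topology S0)
    P (\<lambda>N \<omega>. \<lambda>t\<in>{0..}. condensate_path m N (\<lambda>s. \<eta> N s \<omega>) (t / d N)) Q (\<lambda>\<omega>. \<lambda>t\<in>{0..}. X t \<omega>)"
proof -
  let ?A = "\<lambda>N. cond N ` S0" and ?q = "\<lambda>N a b. L N (indicator {b}) a / d N"
  let ?Y = "\<lambda>N t. \<eta> N (t / d N)" and ?\<sigma> = "condensate_site m"
  let ?\<Lambda> = "\<lambda>y z. limit_generator r S0 (indicator {z}) y"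
  have finS: "finite S0" by simp
  have "\<forall>N. \<exists>C. 1 \<le> N \<longrightarrow> jump_process (P N) (configs N) (?Y N)
      (\<lambda>m a b. semigroup_of (L N) (1 / (m * d N)) (indicator {b}) a) (?q N) C"
    using scaled_process d_pos by blast
  then obtain C where proc: "\<And>N. 1 \<le> N \<Longrightarrow> jump_process (P N) (configs N) (?Y N)
      (\<lambda>m a b. semigroup_of (L N) (1 / (m * d N)) (indicator {b}) a) (?q N) (C N)" by metis
  define H where "H N z = (SOME h. (\<forall>\<zeta>\<in>configs N. 0 \<le> h \<zeta> \<and> h \<zeta> \<le> 1) \<and> (\<forall>u\<in>S0. h (cond N u) = of_bool (u = z)) \<and>
    (\<forall>\<zeta>\<in>outside N. L N h \<zeta> = 0))" for N z
  have H: "0 \<le> H N z \<zeta> \<and> H N z \<zeta> \<le> 1" if "1 \<le> N" "\<zeta> \<in> configs N" for N z \<zeta>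
    using someI_ex[OF harmonic_cond[OF that(1), of z]] that(2) unfolding H_def by blast
  have H_cond: "H N z (cond N u) = of_bool (u = z)" if "1 \<le> N" "u \<in> S0" for N z u
    using someI_ex[OF harmonic_cond[OF that(1), of z]] that(2) unfolding H_def by blast
  have LH: "L N (H N z) \<zeta> = 0" if "1 \<le> N" "\<zeta> \<in> outside N" for N z \<zeta>
    using someI_ex[OF harmonic_cond[OF that(1), of z]] that(2) unfolding H_def by blast
  have A: "?A N \<subseteq> configs N" for N using cond_configs by blast
  have \<sigma>: "?\<sigma> N a \<in> S0" if "1 \<le> N" "a \<in> ?A N" for N a using that by (auto simp: condensate_site_cond)
  have H_bound: "\<bar>H N b a\<bar> \<le> 1" if "1 \<le> N" "a \<in> configs N" for N a b using H[OF that, of b] by auto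
  have H_A: "H N b a = of_bool (?\<sigma> N a = b)" if "1 \<le> N" "a \<in> ?A N" for N a b
    using that by (auto simp: condensate_site_cond H_cond)
  have harmonic: "jump_process.gen (configs N) (?q N) (H N b) a = 0" if "1 \<le> N" "a \<in> outside N" for N a b
    using gen_scaled[OF proc[OF that(1)] that(1), of a "H N b"] LH[OF that] that(2) by simp
  have near: "\<bar>jump_process.gen (configs N) (?q N) (H N b) a - ?\<Lambda> (?\<sigma> N a) b\<bar> \<le> (\<Sum>y\<in>S0. \<bar>err d N y\<bar>)"
    if N: "2 \<le> N" and a: "a \<in> ?A N" and b: "b \<in> S0" for N a b
  proof -
    have N1: "1 \<le> N" and N0: "0 < N" using N by auto
    obtain y where y: "y \<in> S0" "a = cond N y" using a by blast
    note dN = d_pos[OF N1]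
    have tr: "\<bar>L N (H N b) (cond N y) - d N * ?\<Lambda> y b\<bar> \<le>
        (\<Sum>\<zeta>\<in>outside N. ratio (d N) N \<zeta> * \<bar>L N (share y) \<zeta>\<bar>)"
      by (rule trace_rate[OF dN N b _ _ _ y(1)]) (use H[OF N1] H_cond[OF N1] LH[OF N1] in auto)
    have "L N (H N b) (cond N y) / d N - ?\<Lambda> y b = (L N (H N b) (cond N y) - d N * ?\<Lambda> y b) / d N"
      using dN by (simp add: field_simps)
    then have "\<bar>L N (H N b) (cond N y) / d N - ?\<Lambda> y b\<bar> = \<bar>L N (H N b) (cond N y) - d N * ?\<Lambda> y b\<bar> / d N"
      using dN by simp
    also have "\<dots> \<le> err d N y" unfolding err_eq by (rule divide_right_mono[OF tr]) (use dN in simp)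
    also have "\<dots> \<le> \<bar>err d N y\<bar>" by (rule abs_ge_self)
    also have "\<dots> \<le> (\<Sum>y\<in>S0. \<bar>err d N y\<bar>)" by (rule member_le_sum[OF y(1)]) auto
    finally show ?thesis
      using gen_scaled[OF proc[OF N1] N1 cond_configs, of "H N b" y] condensate_site_cond[OF N0 y(1)] y(2) by simp
  qed
  have \<epsilon>_lim: "(\<lambda>N. \<Sum>y\<in>S0. \<bar>err d N y\<bar>) \<longlonglongrightarrow> 0"
    by (rule tendsto_null_sum) (intro tendsto_rabs_zero err_tendsto_0[OF d_pos d_log])
  have lap: "\<exists>\<kappa>>0. \<exists>m0\<ge>1. \<forall>m\<ge>m0. \<forall>n.
      (\<integral>\<omega>. exp (- 2 * real (length (visits (?A N) (\<lambda>t. ?Y N t \<omega>) m n)) / m) \<partial>P N) \<le> 2 * exp (- \<kappa> * real n / m)"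
    if N: "1 \<le> N" for N
  proof -
    note dN = d_pos[OF N]
    obtain w where w: "\<And>\<zeta>. \<zeta> \<in> configs N \<Longrightarrow> 0 \<le> w \<zeta>" "\<And>\<zeta>. \<zeta> \<in> configs N - {cond N x} \<Longrightarrow> L N w \<zeta> \<le> - 1"
      using lyapunov_condensate[OF dN, of N x] by blast
    \<comment> \<open>The factor \<open>d N\<close> compensates for the accelerated process having
      generator \<open>L N / d N\<close>. A Lyapunov function for the single condensate at
      \<open>x\<close> serves, as \<open>x\<close> is in \<open>S0\<close>.\<close>
    show ?thesis
    proof (rule jump_process.visits_laplace[OF proc[OF N] A, where g = "\<lambda>\<zeta>. d N * w \<zeta>"])
      show "0 \<le> d N * w a" if "a \<in> configs N" for a using dN w(1)[OF that] by simp
      fix a assume a: "a \<in> outside N"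
      have "L N (\<lambda>\<zeta>. d N * w \<zeta>) a = d N * L N w a"
        unfolding inclusion_generator_def sum_distrib_left by (intro sum.cong refl) (simp add: algebra_simps)
      moreover have "L N w a \<le> - 1" by (rule w(2)) (use a x_in in blast)
      ultimately show "jump_process.gen (configs N) (?q N) (\<lambda>\<zeta>. d N * w \<zeta>) a \<le> - 1"
        using gen_scaled[OF proc[OF N] N, of a "\<lambda>\<zeta>. d N * w \<zeta>"] a dN by simp
    qed
  qed
  have scale: "AE \<omega> in P N. \<forall>t\<ge>0. trace_path (?A N) (\<lambda>s. ?Y N s \<omega>) t = trace_path (?A N) (\<lambda>s. \<eta> N s \<omega>) (t / d N)"
    if N: "1 \<le> N" for N
  proof -
    obtain \<kappa> m0 where \<kappa>: "0 < \<kappa>" "1 \<le> m0" "\<And>m n. m0 \<le> m \<Longrightarrow>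
        (\<integral>\<omega>. exp (- 2 * real (length (visits (?A N) (\<lambda>t. ?Y N t \<omega>) m n)) / m) \<partial>P N) \<le> 2 * exp (- \<kappa> * real n / m)"
      using lap[OF N] by blast
    have unb: "AE \<omega> in P N. \<forall>K. \<exists>s\<ge>0. K < occupation_time (?A N) (\<lambda>t. ?Y N t \<omega>) s"
      by (rule jump_process.AE_occupation_unbounded[OF proc[OF N] \<kappa>])
    have cad: "\<forall>\<omega>\<in>space (P N). cadlag (configs N) (\<lambda>t. \<eta> N t \<omega>)"
      using process[OF N] unfolding markov_process_def by (elim conjE)
    show ?thesis using unb AE_space
    proof eventually_elim
      case (elim \<omega>)
      have w: "cadlag (configs N) (\<lambda>t. \<eta> N t \<omega>)" using cad elim(2) by (rule bspec)
      have w': "cadlag (configs N) (\<lambda>t. ?Y N t \<omega>)" by (rule jump_process.cadlag_Y[OF proc[OF N] elim(2)])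
      show ?case
        using trace_path_scale[OF d_pos[OF N] w w' _ spec[OF elim(1)]] by blast
    qed
  qed
  \<comment> \<open>The initial law of the process is arbitrary here; only the first state of its
    trace is prescribed, which fixes the means of the harmonic functions.\<close>
  have start': "(\<integral>\<omega>. H N b (?Y N 0 \<omega>) \<partial>P N) = of_bool (b = x)" if N: "1 \<le> N" and b: "b \<in> S0" for N b
  proof -
    obtain \<kappa> m0 where \<kappa>: "0 < \<kappa>" "1 \<le> m0" "\<And>m n. m0 \<le> m \<Longrightarrow>
        (\<integral>\<omega>. exp (- 2 * real (length (visits (?A N) (\<lambda>t. ?Y N t \<omega>) m n)) / m) \<partial>P N) \<le> 2 * exp (- \<kappa> * real n / m)"
      using lap[OF N] by blast
    show ?thesis
    proof (rule jump_process.start_of_trace[OF proc[OF N] finS A, where \<sigma> = "?\<sigma> N" and H = "H N" and \<kappa> = \<kappa> and ?m0.0 = m0])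
      show "AE \<omega> in P N. ?\<sigma> N (trace_path (?A N) (\<lambda>s. ?Y N s \<omega>) 0) = x"
        using start[OF N] scale[OF N]
      proof eventually_elim
        case (elim \<omega>)
        then show ?case using elim(2)[rule_format, of 0] by (simp add: condensate_path_def condensates_eq)
      qed
    qed (use \<sigma>[OF N] H_bound[OF N] H_A[OF N] harmonic[OF N] \<kappa> x_in b in auto)
  qed
  interpret X: jump_generator S0 S0 "\<lambda>z y. r y z" "\<lambda>z y. z" "limit_generator r S0"
    by unfold_locales (auto simp: rates_nonneg limit_generator_def)
  note limit = X.jump_process_of_markov_process[OF limit_process zero_less_one]
  have \<Lambda>_nonneg: "0 \<le> ?\<Lambda> a b" if "a \<noteq> b" for a b
    unfolding limit_generator_def by (intro sum_nonneg) (use that rates_nonneg in \<open>auto simp: indicator_def\<close>)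
  have "weakly_converges (skorokhod_topology S0) P
      (\<lambda>N \<omega>. \<lambda>t\<in>{0..}. ?\<sigma> N (trace_path (?A N) (\<lambda>s. ?Y N s \<omega>) t)) Q (\<lambda>\<omega>. \<lambda>t\<in>{0..}. X (t / 1) \<omega>)"
  proof (rule trace_weakly_converges[where ?N0.0 = 2 and E = configs and Y = ?Y and q = ?q and C = C
        and p = "\<lambda>N m a b. semigroup_of (L N) (1 / (m * d N)) (indicator {b}) a" and A = ?A and \<sigma> = "?\<sigma>"
        and H = H and \<Lambda> = ?\<Lambda> and \<epsilon> = "\<lambda>N. \<Sum>y\<in>S0. \<bar>err d N y\<bar>" and x = x, OF finS x_in])
    show "jump_process Q S0 (\<lambda>t. X (t / 1)) (\<lambda>m a b. semigroup_of (limit_generator r S0) (1 / (m * 1)) (indicator {b}) a)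
        ?\<Lambda> (((2 * X.total)\<^sup>2 * exp (2 * X.total * (1 / 1))) / 1\<^sup>2)" using limit by simp
    show "AE \<omega> in Q. X (0 / 1) \<omega> = x" using limit_start by simp
    show "(\<Sum>b\<in>S0. ?\<Lambda> a b) = 0" if "a \<in> S0" for a by (rule X.L_row[OF that])
    show "\<bar>jump_process.gen (configs N) (?q N) (H N b) a - ?\<Lambda> (?\<sigma> N a) b\<bar> \<le> (\<Sum>y\<in>S0. \<bar>err d N y\<bar>)"
      if "2 \<le> N" "a \<in> ?A N" "b \<in> S0" for N a b by (rule near[OF that])
    show "jump_process (P N) (configs N) (?Y N) (\<lambda>m a b. semigroup_of (L N) (1 / (m * d N)) (indicator {b}) a) (?q N) (C N)"
      if "2 \<le> N" for N by (rule proc) (use that in simp)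
    show "?A N \<subseteq> configs N" for N by (rule A)
    show "?\<sigma> N a \<in> S0" if "2 \<le> N" "a \<in> ?A N" for N a by (rule \<sigma>) (use that in simp_all)
    show "\<bar>H N b a\<bar> \<le> 1" if "2 \<le> N" "a \<in> configs N" for N a b by (rule H_bound) (use that in simp_all)
    show "H N b a = of_bool (?\<sigma> N a = b)" if "2 \<le> N" "a \<in> ?A N" for N a b by (rule H_A) (use that in simp_all)
    show "jump_process.gen (configs N) (?q N) (H N b) a = 0" if "2 \<le> N" "a \<in> outside N" for N a b
      by (rule harmonic) (use that in simp_all)
    show "0 \<le> (\<Sum>y\<in>S0. \<bar>err d N y\<bar>)" for N by (intro sum_nonneg abs_ge_zero)
    show "(\<lambda>N. \<Sum>y\<in>S0. \<bar>err d N y\<bar>) \<longlonglongrightarrow> 0" by (rule \<epsilon>_lim)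
    show "0 \<le> ?\<Lambda> a b" if "a \<noteq> b" for a b by (rule \<Lambda>_nonneg[OF that])
    show "\<exists>\<kappa>>0. \<exists>m0\<ge>1. \<forall>m\<ge>m0. \<forall>n.
      (\<integral>\<omega>. exp (- 2 * real (length (visits (?A N) (\<lambda>t. ?Y N t \<omega>) m n)) / m) \<partial>P N) \<le> 2 * exp (- \<kappa> * real n / m)"
      if "2 \<le> N" for N by (rule lap) (use that in simp)
    show "(\<integral>\<omega>. H N b (?Y N 0 \<omega>) \<partial>P N) = of_bool (b = x)" if "2 \<le> N" "b \<in> S0" for N b
      by (rule start') (use that in simp_all)
  qed
  then have conv: "weakly_converges (skorokhod_topology S0) P
      (\<lambda>N \<omega>. \<lambda>t\<in>{0..}. ?\<sigma> N (trace_path (?A N) (\<lambda>s. ?Y N s \<omega>) t)) Q (\<lambda>\<omega>. \<lambda>t\<in>{0..}. X t \<omega>)" by simp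
  show ?thesis
  proof (rule weakly_converges_cong_AE[OF conv], rule eventually_sequentiallyI[of 1])
    fix N :: nat assume N: "1 \<le> N"
    show "AE \<omega> in P N. (\<lambda>t\<in>{0..}. ?\<sigma> N (trace_path (?A N) (\<lambda>s. ?Y N s \<omega>) t)) =
        (\<lambda>t\<in>{0..}. condensate_path m N (\<lambda>s. \<eta> N s \<omega>) (t / d N))"
      using scale[OF N]
    proof eventually_elim
      case (elim \<omega>)
      show ?case by (rule restrict_ext) (use elim in \<open>auto simp: condensate_path_def condensates_eq\<close>)
    qed
  qed
qed

end

theorem theorem2p3:
  fixes r :: "'s::finite \<Rightarrow> 's \<Rightarrow> real"
    and m :: "'s pmf"
    and d :: "nat \<Rightarrow> real"
    and P :: "nat \<Rightarrow> 'w measure"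
    and \<eta> :: "nat \<Rightarrow> real \<Rightarrow> 'w \<Rightarrow> 's \<Rightarrow> nat"
    and Q :: "'v measure"
    and X :: "real \<Rightarrow> 'v \<Rightarrow> 's"
    and x :: 's
  assumes rates_nonneg: "\<And>y z. 0 \<le> r y z"
    and rates_diag: "\<And>y. r y y = 0"
    and irreducible: "\<And>y z. (y, z) \<in> {(u, v). 0 < r u v}\<^sup>*"
    and reversible: "\<And>y z. pmf m y * r y z = pmf m z * r z y"
    and d_pos: "\<And>N. 1 \<le> N \<Longrightarrow> 0 < d N"
    and d_log: "(\<lambda>N. d N * ln (real N)) \<longlonglongrightarrow> 0"
    and inclusion_process:
      "\<And>N. 1 \<le> N \<Longrightarrow> markov_process (configs N) (inclusion_generator r (d N)) (P N) (\<eta> N)"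
    and limit_process: "markov_process (Sstar m) (limit_generator r (Sstar m)) Q X"
    and limit_start: "AE \<omega> in Q. X 0 \<omega> = x"
    and x_in: "x \<in> Sstar m"
  shows
    "((\<forall>N\<ge>1. AE \<omega> in P N. \<eta> N 0 \<omega> \<in> condensate N x) \<longrightarrow>
       (\<lambda>N. ennreal (d N) *
            (\<integral>\<^sup>+\<omega>. hitting_time (condensates N (Sstar m - {x})) (\<lambda>t. \<eta> N t \<omega>) \<partial>P N))
         \<longlonglongrightarrow> 1 / ennreal (\<Sum>y\<in>Sstar m - {x}. r x y))
     \<and>
     ((\<forall>N\<ge>1. AE \<omega> in P N. condensate_path m N (\<lambda>t. \<eta> N t \<omega>) 0 = x) \<longrightarrow>
       weakly_converges (skorokhod_topology (Sstar m))
         P (\<lambda>N \<omega>. \<lambda>t\<in>{0..}. condensate_path m N (\<lambda>s. \<eta> N s \<omega>) (t / d N))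
         Q (\<lambda>\<omega>. \<lambda>t\<in>{0..}. X t \<omega>))
     \<and>
     ((\<forall>N\<ge>1. AE \<omega> in P N. \<eta> N 0 \<omega> \<in> condensate N x) \<longrightarrow>
       (\<forall>T>0. (\<lambda>N. \<integral>\<^sup>+\<omega>. (\<integral>\<^sup>+s. indicator {0..T} s *
                 indicator (configs N - condensates N (Sstar m)) (\<eta> N (s / d N) \<omega>) \<partial>lborel) \<partial>P N)
         \<longlonglongrightarrow> 0))"
proof -
  interpret inclusion_process r m d P \<eta> x
    by unfold_locales (fact rates_nonneg rates_diag irreducible reversible d_pos d_log inclusion_process x_in)+
  show ?thesis
    using expected_hitting_time_limit time_outside_limit trace_limit[OF _ limit_process limit_start] by blast
qed

end
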